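(* Suppose that $d=2$ and that $x\nu_x\le 0$ throughout $\partial\Omega$. Let $I$ be an open interval and let $C_I$ be a positive constant. Let $\Gamma_F$ be part of the intersection of $\partial\Omega$ with $I\times\mathbb R$ on which \[ x\nu_x\le -C_I . \] Suppose that the intersection of $\Omega$ with $I\times\mathbb R$ consists of bounded open sets $\Omega_1,\dots,\Omega_K$ with mutually disjoint closures such that for each $k=1,\dots,K$, \[ (\partial\Omega\cap\partial\Omega_k)\setminus\Gamma_F\subset I\times\{a_k\} \] for some real $a_k$. Then for any $\delta>0$ there are positive constants $E_0$ and $C$ such that \[ \big\|(1+|x|)^{-\frac{3+\delta}{2}}(-\Delta-E-i\varepsilon)^{-1}(1+|x|)^{-\frac{3+\delta}{2}}\big\|_{L^2(\Omega)\to L^2(\Omega)}\le C E^{1/2} \] for all $E\ge E_0$ and $\varepsilon\in(0,1]$.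
   Context: $\Omega\subset\mathbb R^d$ (here $d=2$) is an open set of infinite volume. Coordinates on $\mathbb R^2$ are $(x,y)$, and $\nu=(\nu_x,\nu_y)$ is the outward pointing unit normal vector to $\partial\Omega$. Standing regularity assumption: $\partial\Omega$ is Lipschitz, and every $p\in\partial\Omega$ has a neighborhood $U_p$ such that either $U_p\cap\Omega$ is convex or $U_p\cap\partial\Omega$ is $C^{1,1}$ (so $\nu$ is defined almost everywhere on $\partial\Omega$, and conditions on $\nu$ are understood where it is defined). $\Delta$ is the Dirichlet Laplacian on $\Omega$ (the Friedrichs extension from $C_c^\infty(\Omega)$); the spectrum of $-\Delta$ is contained in $[0,\infty)$, and $(-\Delta-z)^{-1}:L^2(\Omega)\to L^2(\Omega)$ is its resolvent. Powers of $1+|x|$ act as multiplication operators. *)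

theory Defs
  imports "HOL-Analysis.Analysis"
begin

section \<open>Boundary regularity and the outward unit normal in the plane\<close>

text \<open>After the linear isometry \<open>T\<close>, the set \<open>\<Omega>\<close> is near \<open>p\<close> the open region above the
  graph of \<open>\<phi>\<close>. Translations of the coordinates are absorbed into \<open>\<phi>\<close>.\<close>

definition local_epigraph ::
  "(real \<times> real) set \<Rightarrow> real \<times> real \<Rightarrow> (real \<times> real \<Rightarrow> real \<times> real) \<Rightarrow> (real \<Rightarrow> real) \<Rightarrow> bool"
where
  "local_epigraph \<Omega> p T \<phi> \<longleftrightarrow>
     orthogonal_transformation T \<and>
     (\<exists>U. open U \<and> p \<in> U \<and> \<Omega> \<inter> U = {q \<in> U. \<phi> (fst (T q)) < snd (T q)})"

definition lipschitz_boundary :: "(real \<times> real) set \<Rightarrow> bool" where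
  "lipschitz_boundary \<Omega> \<longleftrightarrow>
     (\<forall>p\<in>frontier \<Omega>. \<exists>T \<phi> L. local_epigraph \<Omega> p T \<phi> \<and> L-lipschitz_on UNIV \<phi>)"

definition C11_boundary_in :: "(real \<times> real) set \<Rightarrow> (real \<times> real) set \<Rightarrow> bool" where
  "C11_boundary_in U \<Omega> \<longleftrightarrow>
     (\<forall>p \<in> U \<inter> frontier \<Omega>. \<exists>T \<phi> \<phi>' L. local_epigraph \<Omega> p T \<phi> \<and>
        (\<forall>t. (\<phi> has_real_derivative \<phi>' t) (at t)) \<and> L-lipschitz_on UNIV \<phi>')"

definition locally_convex_or_C11 :: "(real \<times> real) set \<Rightarrow> bool" where
  "locally_convex_or_C11 \<Omega> \<longleftrightarrow>
     (\<forall>p\<in>frontier \<Omega>. \<exists>U. open U \<and> p \<in> U \<and> (convex (U \<inter> \<Omega>) \<or> C11_boundary_in U \<Omega>))"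

text \<open>\<open>\<nu>\<close> is the outward unit normal at the boundary point \<open>p\<close>. It is a relation because the
  normal exists only at the points where the (Lipschitz) graph function is differentiable,
  which is almost everywhere on the boundary. As \<open>\<Omega>\<close> lies above the graph, outward means
  downward in the coordinates given by \<open>T\<close>.\<close>

definition outward_normal :: "(real \<times> real) set \<Rightarrow> real \<times> real \<Rightarrow> real \<times> real \<Rightarrow> bool" where
  "outward_normal \<Omega> p \<nu> \<longleftrightarrow> p \<in> frontier \<Omega> \<and>
     (\<exists>T \<phi> L m. local_epigraph \<Omega> p T \<phi> \<and> L-lipschitz_on UNIV \<phi> \<and>
        (\<phi> has_real_derivative m) (at (fst (T p))) \<and>
        T \<nu> = (1 / sqrt (1 + m\<^sup>2)) *\<^sub>R (m, -1))"


section \<open>Operators on \<open>L\<^sup>2\<close> as relations\<close>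

text \<open>Elements of \<open>L\<^sup>2(M)\<close> are represented by functions, and a (possibly unbounded, not
  everywhere defined) operator by its graph, a relation between such functions.\<close>

definition L2 :: "'a measure \<Rightarrow> ('a \<Rightarrow> complex) set" where
  "L2 M = {f \<in> borel_measurable M. integrable M (\<lambda>x. (cmod (f x))\<^sup>2)}"

definition L2_inner :: "'a measure \<Rightarrow> ('a \<Rightarrow> complex) \<Rightarrow> ('a \<Rightarrow> complex) \<Rightarrow> complex" where
  "L2_inner M f g = (\<integral>x. f x * cnj (g x) \<partial>M)"

definition L2_norm :: "'a measure \<Rightarrow> ('a \<Rightarrow> complex) \<Rightarrow> real" where
  "L2_norm M f = sqrt (\<integral>x. (cmod (f x))\<^sup>2 \<partial>M)"

type_synonym 'a operator = "(('a \<Rightarrow> complex) \<times> ('a \<Rightarrow> complex)) set"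

text \<open>The norm is \<open>\<infinity>\<close> if the operator is unbounded or not defined on all of \<open>L\<^sup>2(M)\<close>. For a
  linear relation it is also \<open>\<infinity>\<close> if values are not unique almost everywhere, since then
  \<open>0\<close> is related to functions of arbitrarily large norm.\<close>

definition L2_operator_norm :: "'a measure \<Rightarrow> 'a operator \<Rightarrow> ennreal" where
  "L2_operator_norm M A =
     (if \<forall>f\<in>L2 M. \<exists>g\<in>L2 M. (f, g) \<in> A
      then SUP (f, g) \<in> {(f, g) \<in> A. f \<in> L2 M \<and> L2_norm M f \<le> 1}. ennreal (L2_norm M g)
      else \<infinity>)"

definition multiplication_operator :: "'a measure \<Rightarrow> ('a \<Rightarrow> real) \<Rightarrow> 'a operator" where
  "multiplication_operator M w =
     {(f, g). f \<in> L2 M \<and> g \<in> L2 M \<and> g = (\<lambda>x. complex_of_real (w x) * f x)}"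

definition resolvent :: "'a operator \<Rightarrow> complex \<Rightarrow> 'a operator" where
  "resolvent A z = {(\<lambda>x. g x - z * u x, u) | u g. (u, g) \<in> A}"

text \<open>Friedrichs extension of a nonnegative symmetric operator \<open>S\<close>: the restriction of the
  adjoint of \<open>S\<close> to the form domain, the latter being the closure of the domain of \<open>S\<close> in the
  norm given by \<open>\<parallel>u\<parallel>\<^sup>2 + \<langle>S u, u\<rangle>\<close>.\<close>

definition form_domain :: "'a measure \<Rightarrow> 'a operator \<Rightarrow> ('a \<Rightarrow> complex) set" where
  "form_domain M S = {u \<in> L2 M. \<exists>\<phi> \<psi>. (\<forall>n::nat. (\<phi> n, \<psi> n) \<in> S) \<and>
     (\<lambda>n. L2_norm M (\<lambda>x. \<phi> n x - u x)) \<longlonglongrightarrow> 0 \<and>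
     (\<forall>e>0. \<exists>N. \<forall>m\<ge>N. \<forall>n\<ge>N.
        Re (L2_inner M (\<lambda>x. \<psi> m x - \<psi> n x) (\<lambda>x. \<phi> m x - \<phi> n x)) < e)}"

definition adjoint_operator :: "'a measure \<Rightarrow> 'a operator \<Rightarrow> 'a operator" where
  "adjoint_operator M S = {(u, f). u \<in> L2 M \<and> f \<in> L2 M \<and>
     (\<forall>(\<phi>, \<psi>) \<in> S. L2_inner M f \<phi> = L2_inner M u \<psi>)}"

definition friedrichs_extension :: "'a measure \<Rightarrow> 'a operator \<Rightarrow> 'a operator" where
  "friedrichs_extension M S = {(u, f) \<in> adjoint_operator M S. u \<in> form_domain M S}"


section \<open>The Dirichlet Laplacian\<close>

definition partial_deriv ::
  "'a \<Rightarrow> ('a::real_normed_vector \<Rightarrow> 'b::real_normed_vector) \<Rightarrow> 'a \<Rightarrow> 'b" where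
  "partial_deriv b f = (\<lambda>x. frechet_derivative f (at x) b)"

primrec C_k :: "nat \<Rightarrow> ('a::euclidean_space \<Rightarrow> 'b::real_normed_vector) \<Rightarrow> bool" where
  "C_k 0 f \<longleftrightarrow> continuous_on UNIV f"
| "C_k (Suc k) f \<longleftrightarrow>
     (\<forall>x. f differentiable at x) \<and> (\<forall>b\<in>Basis. C_k k (partial_deriv b f))"

definition test_functions :: "'a::euclidean_space set \<Rightarrow> ('a \<Rightarrow> complex) set" where
  "test_functions \<Omega> =
     {\<phi>. (\<forall>k. C_k k \<phi>) \<and> compact (closure {x. \<phi> x \<noteq> 0}) \<and> closure {x. \<phi> x \<noteq> 0} \<subseteq> \<Omega>}"

definition laplacian :: "('a::euclidean_space \<Rightarrow> complex) \<Rightarrow> 'a \<Rightarrow> complex" where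
  "laplacian f x = (\<Sum>b\<in>Basis. partial_deriv b (partial_deriv b f) x)"

definition minus_dirichlet_laplacian :: "'a::euclidean_space set \<Rightarrow> 'a operator" where
  "minus_dirichlet_laplacian \<Omega> =
     friedrichs_extension (lebesgue_on \<Omega>)
       {(\<phi>, \<lambda>x. - laplacian \<phi> x) | \<phi>. \<phi> \<in> test_functions \<Omega>}"

text \<open>The composition \<open>w (-\<Delta> - z)\<^sup>-\<^sup>1 w\<close> on \<open>L\<^sup>2(\<Omega>)\<close>.\<close>

definition weighted_resolvent ::
  "'a::euclidean_space set \<Rightarrow> ('a \<Rightarrow> real) \<Rightarrow> complex \<Rightarrow> 'a operator" where
  "weighted_resolvent \<Omega> w z =
     multiplication_operator (lebesgue_on \<Omega>) w O
     resolvent (minus_dirichlet_laplacian \<Omega>) z O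
     multiplication_operator (lebesgue_on \<Omega>) w"

end

theory Submission
  imports Defs
begin

text \<open>Let \<open>u\<close> solve \<open>-\<Delta>u = f + (E + \<i>\<epsilon>)u\<close>. The estimate is a Rellich type commutator argument with the vector
  field \<open>X = (w(x), b)\<close>, where \<open>w\<close> is bounded, \<open>w(0) = 0\<close> and \<open>w' = (c + (x - x\<^sub>0)\<^sup>2)\<^bsup>-(1+\<delta>)/2\<^esup>\<close> for a point
  \<open>x\<^sub>0 \<in> I\<close>, and \<open>b = \<eta> \<chi>(x) (y - a\<^sub>k)\<close> on \<open>\<Omega>\<^sub>k\<close> with a cutoff \<open>\<chi>\<close> near \<open>x\<^sub>0\<close>. The hypotheses on \<open>\<nu>\<close> give
  \<open>X \<cdot> \<nu> \<le> 0\<close> for small \<open>\<eta>\<close>, and then the boundary term in the Rellich identity has the good sign.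

  Boundary regularity of \<open>u\<close> is avoided: for a test function \<open>\<phi>\<close> the pullback \<open>v(p) = \<phi>(p - hX(p))\<close> still has
  compact support in \<open>\<Omega>\<close>, because steps along \<open>X\<close> cannot leave \<open>\<Omega>\<close>. Convexity of the
  Dirichlet integral bounds \<open>Re \<langle>\<nabla>u, \<nabla>(v - \<phi>)\<rangle>\<close> by half of the difference of the Dirichlet integrals of \<open>v\<close> and \<open>\<phi>\<close>,
  and the change of variables \<open>p \<mapsto> p - hX(p)\<close> together with \<open>h \<rightarrow> 0\<close> yields the Rellich inequality.

  Adding the identities for the multipliers \<open>w' u\<close> and \<open>(x - x\<^sub>0) (c + (x - x\<^sub>0)\<^sup>2)\<^bsup>-(3+\<delta>)/2\<^esup>\<close> gives a quadratic form that is
  bounded below by \<open>w' |u\<^sub>x|\<^sup>2 + b\<^sub>y |u\<^sub>y|\<^sup>2 + (c + (x - x\<^sub>0)\<^sup>2)\<^bsup>-(3+\<delta>)/2\<^esup> |u|\<^sup>2\<close>; near \<open>x\<^sub>0\<close> the term \<open>E b\<^sub>y |u|\<^sup>2\<close> absorbs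
  the error for large \<open>E\<close>. The remaining term containing \<open>\<epsilon>\<close> is at most a constant times \<open>E\<^bsup>1/2\<^esup> |\<langle>f, u\<rangle>|\<close>, whence the bound.\<close>

text \<open>The one-dimensional multipliers alone leave a potential that is negative near
  \<open>x0\<close>; the term \<open>E b_y |u|^2\<close> is the only one there that grows with
  \<open>E\<close>, and this is why \<open>X\<close> has a second component at all. That component
  competes with \<open>w\<close> at the boundary, which fixes the rest of the construction. Since
  \<open>w\<close> vanishes at \<open>0\<close> and increases, it has the sign of \<open>x\<close>,
  so \<open>w\<close> times the first component of the normal is never positive. The point
  \<open>x0\<close> is taken away from \<open>0\<close>, because \<open>|w|\<close> must stay above
  a positive constant on the support of the cutoff: on the steep part of the boundary
  \<open>w\<close> then outweighs \<open>b\<close> once \<open>\<eta>\<close> is small, while on the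
  flat parts \<open>b\<close> vanishes because \<open>y = a_k\<close>. The backward steps cover only
  a part of \<Omega>, so an inequality replaces the Rellich identity; it points in the useful
  direction. The final weight is the square root, up to constants, of the density that multiplies
  \<open>|u|^2\<close> in the lower bound of the quadratic form.\<close>

type_synonym plane = "real \<times> real"

section \<open>Square integrable functions\<close>

text \<open>For complex valued functions \<open>ip\<close> is the real part of the \<open>L\<^sup>2\<close> inner product.\<close>

definition sqint :: "'a measure \<Rightarrow> ('a \<Rightarrow> 'b::euclidean_space) \<Rightarrow> bool" where
  "sqint M F \<longleftrightarrow> F \<in> borel_measurable M \<and> integrable M (\<lambda>x. (norm (F x))\<^sup>2)"

definition ip :: "'a measure \<Rightarrow> ('a \<Rightarrow> 'b::euclidean_space) \<Rightarrow> ('a \<Rightarrow> 'b) \<Rightarrow> real" where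
  "ip M F G = (\<integral>x. F x \<bullet> G x \<partial>M)"

definition nrm :: "'a measure \<Rightarrow> ('a \<Rightarrow> 'b::euclidean_space) \<Rightarrow> real" where
  "nrm M F = sqrt (\<integral>x. (norm (F x))\<^sup>2 \<partial>M)"

lemma sqint_meas[measurable_dest]: "sqint M F \<Longrightarrow> F \<in> borel_measurable M"
  by (simp add: sqint_def)

lemma sqint_bound:
  fixes F :: "'a \<Rightarrow> 'b::euclidean_space" and G :: "'a \<Rightarrow> 'c::euclidean_space"
  assumes F: "sqint M F" and G[measurable]: "G \<in> borel_measurable M"
    and le: "\<And>x. x \<in> space M \<Longrightarrow> norm (G x) \<le> c * norm (F x)"
  shows "sqint M G"
proof -
  have "integrable M (\<lambda>x. (norm (G x))\<^sup>2)"
  proof (rule Bochner_Integration.integrable_bound[where f="\<lambda>x. c\<^sup>2 * (norm (F x))\<^sup>2"])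
    show "integrable M (\<lambda>x. c\<^sup>2 * (norm (F x))\<^sup>2)" using F by (simp add: sqint_def)
    show "AE x in M. norm ((norm (G x))\<^sup>2) \<le> norm (c\<^sup>2 * (norm (F x))\<^sup>2)"
      using power_mono[OF le, of _ 2] by (intro AE_I2) (auto simp: power_mult_distrib)
  qed measurable
  then show ?thesis by (simp add: sqint_def G)
qed

lemma sqint_add [intro]:
  assumes "sqint M F" "sqint M G"
  shows "sqint M (\<lambda>x. F x + G x)"
proof -
  have [measurable]: "F \<in> borel_measurable M" "G \<in> borel_measurable M"
    using assms by (auto simp: sqint_def)
  have "integrable M (\<lambda>x. (norm (F x + G x))\<^sup>2)"
  proof (rule Bochner_Integration.integrable_bound[where f="\<lambda>x. 2 * (norm (F x))\<^sup>2 + 2 * (norm (G x))\<^sup>2"])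
    show "integrable M (\<lambda>x. 2 * (norm (F x))\<^sup>2 + 2 * (norm (G x))\<^sup>2)" using assms by (simp add: sqint_def)
    have "(norm (F x + G x))\<^sup>2 \<le> 2 * (norm (F x))\<^sup>2 + 2 * (norm (G x))\<^sup>2" for x
    proof -
      have "(norm (F x + G x))\<^sup>2 \<le> (norm (F x) + norm (G x))\<^sup>2"
        by (intro power_mono norm_triangle_ineq) auto
      also have "\<dots> \<le> 2 * (norm (F x))\<^sup>2 + 2 * (norm (G x))\<^sup>2"
        using sum_squares_bound[of "norm (F x)" "norm (G x)"] by (simp add: power2_eq_square algebra_simps)
      finally show ?thesis .
    qed
    then show "AE x in M. norm ((norm (F x + G x))\<^sup>2) \<le> norm (2 * (norm (F x))\<^sup>2 + 2 * (norm (G x))\<^sup>2)"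
      by (intro AE_I2) simp
  qed measurable
  then show ?thesis by (simp add: sqint_def)
qed

lemma sqint_bounded_linear:
  assumes "bounded_linear A" "sqint M F"
  shows "sqint M (\<lambda>x. A (F x))"
proof -
  obtain K where K: "\<And>x. norm (A x) \<le> norm x * K" using bounded_linear.bounded[OF assms(1)] by blast
  show ?thesis
  proof (rule sqint_bound[OF assms(2)])
    show "(\<lambda>x. A (F x)) \<in> borel_measurable M"
      by (rule borel_measurable_continuous_on[OF linear_continuous_on[OF assms(1)] sqint_meas[OF assms(2)]])
    show "norm (A (F x)) \<le> K * norm (F x)" for x using K[of "F x"] by (simp add: mult.commute)
  qed
qed

lemma sqint_scale:
  fixes F :: "'a \<Rightarrow> 'b::euclidean_space"
  assumes "sqint M F" and [measurable]: "c \<in> borel_measurable M"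
    and "\<And>x. x \<in> space M \<Longrightarrow> \<bar>c x\<bar> \<le> B"
  shows "sqint M (\<lambda>x. c x *\<^sub>R F x)"
  using assms by (intro sqint_bound[OF assms(1), of _ B]) (auto simp: sqint_def intro!: mult_right_mono)

lemma sqint_scaleR [intro]: "sqint M F \<Longrightarrow> sqint M (\<lambda>x. c *\<^sub>R F x)"
  by (rule sqint_bounded_linear[OF bounded_linear_scaleR_right])

lemma sqint_diff [intro]:
  assumes "sqint M F" "sqint M G"
  shows "sqint M (\<lambda>x. F x - G x)"
  using sqint_add[OF assms(1) sqint_scaleR[OF assms(2), of "-1"]] by simp

lemma sqint_zero [intro, simp]: "sqint M (\<lambda>x. 0)"
  by (simp add: sqint_def)

lemma sqint_inner:
  assumes "sqint M F" "sqint M G"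
  shows "integrable M (\<lambda>x. F x \<bullet> G x)"
proof (rule Bochner_Integration.integrable_bound[where f="\<lambda>x. (norm (F x))\<^sup>2 + (norm (G x))\<^sup>2"])
  have [measurable]: "F \<in> borel_measurable M" "G \<in> borel_measurable M"
    using assms by (auto simp: sqint_def)
  show "(\<lambda>x. F x \<bullet> G x) \<in> borel_measurable M" by measurable
  show "integrable M (\<lambda>x. (norm (F x))\<^sup>2 + (norm (G x))\<^sup>2)" using assms by (simp add: sqint_def)
  have "\<bar>F x \<bullet> G x\<bar> \<le> (norm (F x))\<^sup>2 + (norm (G x))\<^sup>2" for x
  proof -
    have "\<bar>F x \<bullet> G x\<bar> \<le> norm (F x) * norm (G x)" by (rule Cauchy_Schwarz_ineq2)
    also have "\<dots> \<le> (norm (F x))\<^sup>2 + (norm (G x))\<^sup>2"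
      using sum_squares_bound[of "norm (F x)" "norm (G x)"] mult_nonneg_nonneg[OF norm_ge_zero norm_ge_zero, of "F x" "G x"]
      by linarith
    finally show ?thesis .
  qed
  then show "AE x in M. norm (F x \<bullet> G x) \<le> norm ((norm (F x))\<^sup>2 + (norm (G x))\<^sup>2)"
    by (intro AE_I2) simp
qed

lemma sqint_inner_bounded:
  assumes "sqint M F" "sqint M G" and [measurable]: "c \<in> borel_measurable M"
    and "\<And>x. x \<in> space M \<Longrightarrow> \<bar>c x\<bar> \<le> B"
  shows "integrable M (\<lambda>x. c x * (F x \<bullet> G x))"
  using sqint_inner[OF sqint_scale[OF assms(1,3,4)] assms(2)] by simp

lemma ip_add_left: "sqint M F \<Longrightarrow> sqint M G \<Longrightarrow> sqint M H \<Longrightarrow> ip M (\<lambda>x. F x + G x) H = ip M F H + ip M G H"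
  by (simp add: ip_def inner_add_left sqint_inner)

lemma ip_diff_left: "sqint M F \<Longrightarrow> sqint M G \<Longrightarrow> sqint M H \<Longrightarrow> ip M (\<lambda>x. F x - G x) H = ip M F H - ip M G H"
  by (simp add: ip_def inner_diff_left sqint_inner)

lemma ip_commute: "ip M F G = ip M G F"
  by (simp add: ip_def inner_commute)

lemma ip_scaleR_left: "ip M (\<lambda>x. c *\<^sub>R F x) G = c * ip M F G"
  by (simp add: ip_def)

lemma ip_scaleR_right: "ip M F (\<lambda>x. c *\<^sub>R G x) = c * ip M F G"
  by (simp add: ip_def)

lemma ip_add_right: "sqint M F \<Longrightarrow> sqint M G \<Longrightarrow> sqint M H \<Longrightarrow> ip M H (\<lambda>x. F x + G x) = ip M H F + ip M H G"
  by (simp add: ip_add_left ip_commute[of M H])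

lemma ip_diff_right: "sqint M F \<Longrightarrow> sqint M G \<Longrightarrow> sqint M H \<Longrightarrow> ip M H (\<lambda>x. F x - G x) = ip M H F - ip M H G"
  by (simp add: ip_diff_left ip_commute[of M H])

lemma nrm_nonneg [simp]: "0 \<le> nrm M F"
  by (simp add: nrm_def)

lemma nrm_sq: "(nrm M F)\<^sup>2 = (\<integral>x. (norm (F x))\<^sup>2 \<partial>M)"
  by (simp add: nrm_def)

lemma nrm_sq_ip: "(nrm M F)\<^sup>2 = ip M F F"
  by (simp add: nrm_sq ip_def power2_norm_eq_inner)

lemma nrm_add_sq:
  assumes "sqint M F" "sqint M G"
  shows "(nrm M (\<lambda>x. F x + G x))\<^sup>2 = (nrm M F)\<^sup>2 + 2 * ip M F G + (nrm M G)\<^sup>2"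
  using assms by (simp add: nrm_sq_ip ip_add_left ip_add_right sqint_add ip_commute)

lemma nrm_diff_sq:
  assumes "sqint M F" "sqint M G"
  shows "(nrm M (\<lambda>x. F x - G x))\<^sup>2 = (nrm M F)\<^sup>2 - 2 * ip M F G + (nrm M G)\<^sup>2"
  using assms by (simp add: nrm_sq_ip ip_diff_left ip_diff_right sqint_diff ip_commute)

lemma nrm_scaleR: "nrm M (\<lambda>x. c *\<^sub>R F x) = \<bar>c\<bar> * nrm M F"
  by (simp add: nrm_def power_mult_distrib real_sqrt_mult)

lemma nrm_minus_commute: "nrm M (\<lambda>x. F x - G x) = nrm M (\<lambda>x. G x - F x)"
  by (simp add: nrm_def norm_minus_commute)

text \<open>The discriminant of the nonnegative quadratic
  \<open>\<parallel>F - t G\<parallel>^2\<close> in \<open>t\<close>. If \<open>nrm M G = 0\<close>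
  it degenerates to an affine function, which can be nonnegative for all \<open>t\<close> only if
  the pairing vanishes.\<close>

lemma ip_bound:
  assumes F: "sqint M F" and G: "sqint M G"
  shows "\<bar>ip M F G\<bar> \<le> nrm M F * nrm M G"
proof -
  have "(ip M F G)\<^sup>2 \<le> (nrm M F)\<^sup>2 * (nrm M G)\<^sup>2"
  proof -
    have key: "0 \<le> (nrm M F)\<^sup>2 - 2 * t * ip M F G + t\<^sup>2 * (nrm M G)\<^sup>2" for t
      using nrm_diff_sq[OF F sqint_scaleR[OF G, of t]] zero_le_power2[of "nrm M (\<lambda>x. F x - t *\<^sub>R G x)"]
      by (simp add: ip_scaleR_right nrm_scaleR power_mult_distrib)
    show ?thesis
    proof (cases "nrm M G = 0")
      case True
      have "ip M F G = 0"
      proof (rule ccontr)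
        assume ne: "ip M F G \<noteq> 0"
        have "0 \<le> (nrm M F)\<^sup>2 - 2 * (((nrm M F)\<^sup>2 + 1) / (2 * ip M F G)) * ip M F G"
          using key[of "((nrm M F)\<^sup>2 + 1) / (2 * ip M F G)"] True by simp
        also have "\<dots> = - 1" using ne by (simp add: field_simps)
        finally show False by simp
      qed
      then show ?thesis by simp
    next
      case False
      then have p: "(nrm M G)\<^sup>2 > 0" by simp
      define t where "t = ip M F G / (nrm M G)\<^sup>2"
      have t: "t * (nrm M G)\<^sup>2 = ip M F G" using p by (simp add: t_def)
      have "0 \<le> ((nrm M F)\<^sup>2 - 2 * t * ip M F G + t\<^sup>2 * (nrm M G)\<^sup>2) * (nrm M G)\<^sup>2"
        using key[of t] p by (intro mult_nonneg_nonneg) auto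
      also have "\<dots> = (nrm M F)\<^sup>2 * (nrm M G)\<^sup>2 - 2 * (t * (nrm M G)\<^sup>2) * ip M F G + (t * (nrm M G)\<^sup>2)\<^sup>2"
        by (simp add: algebra_simps power2_eq_square)
      also have "\<dots> = (nrm M F)\<^sup>2 * (nrm M G)\<^sup>2 - (ip M F G)\<^sup>2"
        unfolding t by (simp add: power2_eq_square)
      finally show ?thesis by simp
    qed
  qed
  then have "(ip M F G)\<^sup>2 \<le> (nrm M F * nrm M G)\<^sup>2" by (simp add: power_mult_distrib)
  then show ?thesis by (rule power2_le_imp_le[of "\<bar>ip M F G\<bar>", simplified]) simp
qed

lemma nrm_triangle:
  assumes "sqint M F" "sqint M G"
  shows "nrm M (\<lambda>x. F x + G x) \<le> nrm M F + nrm M G"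
proof (rule power2_le_imp_le)
  have "(nrm M (\<lambda>x. F x + G x))\<^sup>2 \<le> (nrm M F)\<^sup>2 + 2 * (nrm M F * nrm M G) + (nrm M G)\<^sup>2"
    using nrm_add_sq[OF assms] ip_bound[OF assms] by linarith
  then show "(nrm M (\<lambda>x. F x + G x))\<^sup>2 \<le> (nrm M F + nrm M G)\<^sup>2"
    by (simp add: power2_eq_square algebra_simps)
qed simp

lemma nrm_triangle_diff:
  assumes "sqint M F" "sqint M G" "sqint M H"
  shows "nrm M (\<lambda>x. F x - H x) \<le> nrm M (\<lambda>x. F x - G x) + nrm M (\<lambda>x. G x - H x)"
  using nrm_triangle[OF sqint_diff[OF assms(1,2)] sqint_diff[OF assms(2,3)]] by simp

lemma nrm_le_add_diff:
  assumes "sqint M F" "sqint M G"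
  shows "nrm M F \<le> nrm M G + nrm M (\<lambda>x. F x - G x)"
  using nrm_triangle[OF assms(2) sqint_diff[OF assms(1,2)]] by simp

lemma nrm_mono:
  assumes "sqint M F" "G \<in> borel_measurable M" "0 \<le> c"
    and "\<And>x. x \<in> space M \<Longrightarrow> norm (G x) \<le> c * norm (F x)"
  shows "nrm M G \<le> c * nrm M F"
proof -
  have G: "sqint M G" by (rule sqint_bound[OF assms(1,2,4)])
  have "(nrm M G)\<^sup>2 \<le> (\<integral>x. c\<^sup>2 * (norm (F x))\<^sup>2 \<partial>M)"
    unfolding nrm_sq
    using assms G power_mono[OF assms(4), of _ 2] by (intro integral_mono) (auto simp: sqint_def power_mult_distrib)
  also have "\<dots> = (c * nrm M F)\<^sup>2" by (simp add: nrm_sq power_mult_distrib)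
  finally show ?thesis by (rule power2_le_imp_le) (simp add: assms(3))
qed

text \<open>The integrability clauses carry weight: the Bochner integral of a non-integrable
  function is \<open>0\<close>, so \<open>nrm\<close> tending to \<open>0\<close> would by itself
  say nothing.\<close>

definition L2lim :: "'a measure \<Rightarrow> (nat \<Rightarrow> 'a \<Rightarrow> 'b::euclidean_space) \<Rightarrow> ('a \<Rightarrow> 'b) \<Rightarrow> bool" where
  "L2lim M F G \<longleftrightarrow> (\<forall>n. sqint M (F n)) \<and> sqint M G \<and> (\<lambda>n. nrm M (\<lambda>x. F n x - G x)) \<longlonglongrightarrow> 0"

lemma L2lim_dominated:
  fixes F' :: "nat \<Rightarrow> 'a \<Rightarrow> 'c::euclidean_space"
  assumes "L2lim M F G" "\<And>n. F' n \<in> borel_measurable M" "sqint M G'"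
    and le: "\<And>n x. x \<in> space M \<Longrightarrow> norm (F' n x - G' x) \<le> c * norm (F n x - G x)"
    and c: "0 \<le> c"
  shows "L2lim M F' G'"
proof -
  have [measurable]: "F' n \<in> borel_measurable M" "G' \<in> borel_measurable M" for n
    using assms by (auto simp: sqint_def)
  have FG: "sqint M (\<lambda>x. F n x - G x)" for n using assms(1) by (auto simp: L2lim_def)
  have *: "sqint M (\<lambda>x. F' n x - G' x)" for n
    by (rule sqint_bound[OF FG _ le]) auto
  have "sqint M (F' n)" for n using sqint_add[OF *[of n] assms(3)] by simp
  moreover have "(\<lambda>n. nrm M (\<lambda>x. F' n x - G' x)) \<longlonglongrightarrow> 0"
  proof (rule tendsto_sandwich[OF _ _ tendsto_const])
    show "\<forall>\<^sub>F n in sequentially. nrm M (\<lambda>x. F' n x - G' x) \<le> c * nrm M (\<lambda>x. F n x - G x)"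
      using nrm_mono[OF FG _ c le] by (intro always_eventually allI) auto
    show "(\<lambda>n. c * nrm M (\<lambda>x. F n x - G x)) \<longlonglongrightarrow> 0"
      using tendsto_mult_right_zero assms(1) by (auto simp: L2lim_def)
  qed auto
  ultimately show ?thesis using assms(3) by (simp add: L2lim_def)
qed

lemma L2lim_bounded_linear:
  assumes A: "bounded_linear A" and "L2lim M F G"
  shows "L2lim M (\<lambda>n x. A (F n x)) (\<lambda>x. A (G x))"
proof -
  obtain K where K: "\<And>x. norm (A x) \<le> norm x * K" "0 < K" using bounded_linear.pos_bounded[OF A] by blast
  have "sqint M (\<lambda>x. A (F n x))" "sqint M (\<lambda>x. A (G x))" for n
    using assms by (auto simp: L2lim_def intro!: sqint_bounded_linear[OF A])
  then show ?thesis
    using K by (intro L2lim_dominated[OF assms(2), of _ _ K])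
      (auto simp: sqint_def mult.commute simp flip: linear_diff[OF bounded_linear.linear[OF A]])
qed

lemma L2lim_add:
  assumes "L2lim M F G" "L2lim M F' G'"
  shows "L2lim M (\<lambda>n x. F n x + F' n x) (\<lambda>x. G x + G' x)"
proof -
  have "(\<lambda>n. nrm M (\<lambda>x. F n x + F' n x - (G x + G' x))) \<longlonglongrightarrow> 0"
  proof (rule tendsto_sandwich[OF _ _ tendsto_const])
    have "nrm M (\<lambda>x. F n x + F' n x - (G x + G' x)) \<le> nrm M (\<lambda>x. F n x - G x) + nrm M (\<lambda>x. F' n x - G' x)" for n
      using nrm_triangle[of M "\<lambda>x. F n x - G x" "\<lambda>x. F' n x - G' x"] assms
      by (auto simp: L2lim_def algebra_simps)
    then show "\<forall>\<^sub>F n in sequentially. nrm M (\<lambda>x. F n x + F' n x - (G x + G' x)) \<le> nrm M (\<lambda>x. F n x - G x) + nrm M (\<lambda>x. F' n x - G' x)"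
      by auto
    show "(\<lambda>n. nrm M (\<lambda>x. F n x - G x) + nrm M (\<lambda>x. F' n x - G' x)) \<longlonglongrightarrow> 0"
      using tendsto_add[of _ 0 sequentially _ 0] assms by (auto simp: L2lim_def)
  qed auto
  then show ?thesis using assms by (auto simp: L2lim_def)
qed

lemma L2lim_scale:
  assumes "L2lim M F G" and [measurable]: "c \<in> borel_measurable M"
    and "\<And>x. x \<in> space M \<Longrightarrow> \<bar>c x\<bar> \<le> B" "0 \<le> B"
  shows "L2lim M (\<lambda>n x. c x *\<^sub>R F n x) (\<lambda>x. c x *\<^sub>R G x)"
proof (rule L2lim_dominated[OF assms(1) _ _ _ assms(4)])
  have [measurable]: "F n \<in> borel_measurable M" for n using assms(1) by (auto simp: L2lim_def sqint_def)
  show "(\<lambda>x. c x *\<^sub>R F n x) \<in> borel_measurable M" for n by measurable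
  show "sqint M (\<lambda>x. c x *\<^sub>R G x)" using assms by (intro sqint_scale) (auto simp: L2lim_def)
qed (use assms in \<open>auto simp flip: scaleR_diff_right intro!: mult_right_mono\<close>)

lemma L2lim_const: "sqint M F \<Longrightarrow> L2lim M (\<lambda>n. F) F"
  by (auto simp: L2lim_def nrm_def)

lemma L2lim_ip:
  assumes "L2lim M F G" "L2lim M F' G'"
  shows "(\<lambda>n. ip M (F n) (F' n)) \<longlonglongrightarrow> ip M G G'"
proof -
  have s: "sqint M (F n)" "sqint M G" "sqint M (F' n)" "sqint M G'" for n using assms by (auto simp: L2lim_def)
  have z: "(\<lambda>n. nrm M (\<lambda>x. F n x - G x)) \<longlonglongrightarrow> 0" "(\<lambda>n. nrm M (\<lambda>x. F' n x - G' x)) \<longlonglongrightarrow> 0"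
    using assms by (auto simp: L2lim_def)
  have "(\<lambda>n. ip M (F n) (F' n) - ip M G G') \<longlonglongrightarrow> 0"
  proof (rule Lim_null_comparison)
    show "(\<lambda>n. nrm M (\<lambda>x. F n x - G x) * (nrm M G' + nrm M (\<lambda>x. F' n x - G' x)) + nrm M G * nrm M (\<lambda>x. F' n x - G' x)) \<longlonglongrightarrow> 0"
      using tendsto_add[OF tendsto_mult[OF z(1) tendsto_add[OF tendsto_const z(2)]] tendsto_mult[OF tendsto_const z(2)]] by simp
    have "norm (ip M (F n) (F' n) - ip M G G') \<le> nrm M (\<lambda>x. F n x - G x) * (nrm M G' + nrm M (\<lambda>x. F' n x - G' x)) + nrm M G * nrm M (\<lambda>x. F' n x - G' x)" for n
    proof -
      have "ip M (F n) (F' n) - ip M G G' = ip M (\<lambda>x. F n x - G x) (F' n) + ip M G (\<lambda>x. F' n x - G' x)"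
        using s by (simp add: ip_diff_left ip_diff_right)
      moreover have "\<bar>ip M (\<lambda>x. F n x - G x) (F' n)\<bar> \<le> nrm M (\<lambda>x. F n x - G x) * nrm M (F' n)"
        using s by (intro ip_bound sqint_diff)
      moreover have "nrm M (\<lambda>x. F n x - G x) * nrm M (F' n) \<le> nrm M (\<lambda>x. F n x - G x) * (nrm M G' + nrm M (\<lambda>x. F' n x - G' x))"
        using nrm_le_add_diff[of M "F' n" G'] s by (intro mult_left_mono) auto
      moreover have "\<bar>ip M G (\<lambda>x. F' n x - G' x)\<bar> \<le> nrm M G * nrm M (\<lambda>x. F' n x - G' x)"
        using s by (intro ip_bound sqint_diff)
      ultimately show ?thesis by simp
    qed
    then show "\<forall>\<^sub>F n in sequentially. norm (ip M (F n) (F' n) - ip M G G') \<le> nrm M (\<lambda>x. F n x - G x) * (nrm M G' + nrm M (\<lambda>x. F' n x - G' x)) + nrm M G * nrm M (\<lambda>x. F' n x - G' x)"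
      by auto
  qed
  then show ?thesis by (simp add: LIM_zero_iff)
qed

text \<open>After weighting with \<open>2^k\<close> the squared increments still have a convergent
  series of integrals. Where the weighted series is finite, the increments at that point decay
  geometrically, so their sum converges.\<close>

lemma sqint_lim_subseq:
  fixes F :: "nat \<Rightarrow> 'a \<Rightarrow> 'b::euclidean_space"
  assumes F: "\<And>n. sqint M (F n)"
    and small: "\<And>k. (nrm M (\<lambda>x. F (Suc k) x - F k x))\<^sup>2 \<le> (1/4)^k"
  shows "AE x in M. convergent (\<lambda>k. F k x)"
proof -
  have [measurable]: "F n \<in> borel_measurable M" for n using F by (simp add: sqint_def)
  have d: "sqint M (\<lambda>x. F (Suc k) x - F k x)" for k using F by auto
  have "(\<integral>\<^sup>+x. (\<Sum>k. ennreal (2^k * (norm (F (Suc k) x - F k x))\<^sup>2)) \<partial>M) = (\<Sum>k. (\<integral>\<^sup>+x. ennreal (2^k * (norm (F (Suc k) x - F k x))\<^sup>2) \<partial>M))"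
    by (rule nn_integral_suminf) measurable
  also have "\<dots> \<le> (\<Sum>k. ennreal ((1/2)^k))"
  proof (intro suminf_le summableI)
    fix k
    have "(\<integral>\<^sup>+x. ennreal (2^k * (norm (F (Suc k) x - F k x))\<^sup>2) \<partial>M) = ennreal (\<integral>x. 2^k * (norm (F (Suc k) x - F k x))\<^sup>2 \<partial>M)"
      using d[of k] by (intro nn_integral_eq_integral) (auto simp: sqint_def)
    also have "(\<integral>x. 2^k * (norm (F (Suc k) x - F k x))\<^sup>2 \<partial>M) \<le> 2^k * (1/4)^k"
      using small[of k] by (simp add: nrm_sq)
    also have "2^k * (1/4)^k = (1/2::real)^k" by (simp flip: power_mult_distrib)
    finally show "(\<integral>\<^sup>+x. ennreal (2^k * (norm (F (Suc k) x - F k x))\<^sup>2) \<partial>M) \<le> ennreal ((1/2)^k)"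
      by (simp add: ennreal_leI)
  qed
  also have "\<dots> < \<infinity>"
  proof -
    have "(\<Sum>k. ennreal ((1/2)^k)) = ennreal (\<Sum>k. (1/2)^k)"
      by (intro suminf_ennreal2) (auto simp: summable_geometric)
    then show ?thesis by simp
  qed
  finally have "AE x in M. (\<Sum>k. ennreal (2^k * (norm (F (Suc k) x - F k x))\<^sup>2)) \<noteq> \<infinity>"
    by (intro nn_integral_PInf_AE) auto
  then show ?thesis
  proof (rule AE_mp, intro AE_I2 impI)
    fix x assume fin: "(\<Sum>k. ennreal (2^k * (norm (F (Suc k) x - F k x))\<^sup>2)) \<noteq> \<infinity>"
    have sm: "summable (\<lambda>k. 2^k * (norm (F (Suc k) x - F k x))\<^sup>2)"
      using fin by (intro summable_suminf_not_top) auto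
    define B where "B = (\<Sum>k. 2^k * (norm (F (Suc k) x - F k x))\<^sup>2)"
    have B: "2^k * (norm (F (Suc k) x - F k x))\<^sup>2 \<le> B" for k
      using sum_le_suminf[OF sm, of "{k}"] by (simp add: B_def)
    have bnd: "norm (F (Suc k) x - F k x) \<le> sqrt B * sqrt (1/2)^k" for k
    proof -
      have "(norm (F (Suc k) x - F k x))\<^sup>2 \<le> B * (1/2)^k"
        using B[of k] by (simp add: field_simps)
      then have "norm (F (Suc k) x - F k x) \<le> sqrt (B * (1/2)^k)"
        by (rule real_le_rsqrt)
      then show ?thesis by (simp add: real_sqrt_mult real_sqrt_power)
    qed
    have "summable (\<lambda>k. F (Suc k) x - F k x)"
    proof (rule summable_comparison_test)
      show "summable (\<lambda>k. sqrt B * sqrt (1/2)^k)"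
        by (intro summable_mult summable_geometric) (simp add: real_sqrt_divide)
      show "\<exists>N. \<forall>n\<ge>N. norm (F (Suc n) x - F n x) \<le> sqrt B * sqrt (1/2)^n" using bnd by auto
    qed
    then have "convergent (\<lambda>k. (\<Sum>i<k. F (Suc i) x - F i x) + F 0 x)"
      by (intro convergent_add convergent_const) (simp add: summable_iff_convergent)
    then show "convergent (\<lambda>k. F k x)" by (simp only: sum_lessThan_telescope[of "\<lambda>i. F i x"] diff_add_cancel)
  qed
qed

text \<open>Riesz-Fischer. A rapidly converging subsequence has a pointwise limit; Fatou's lemma
  along it carries the Cauchy bound to the limit, which yields both its square integrability and the
  convergence of the whole sequence.\<close>

lemma sqint_complete:
  fixes F :: "nat \<Rightarrow> 'a \<Rightarrow> 'b::euclidean_space"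
  assumes F: "\<And>n. sqint M (F n)"
    and cauchy: "\<And>e. 0 < e \<Longrightarrow> \<exists>N. \<forall>m\<ge>N. \<forall>n\<ge>N. nrm M (\<lambda>x. F m x - F n x) < e"
  shows "\<exists>G. L2lim M F G"
proof -
  have [measurable]: "F n \<in> borel_measurable M" for n using F by (simp add: sqint_def)
  obtain N where N: "\<And>k m n. m \<ge> N k \<Longrightarrow> n \<ge> N k \<Longrightarrow> nrm M (\<lambda>x. F m x - F n x) < (1/2)^k"
  proof -
    have "\<forall>k. \<exists>N. \<forall>m\<ge>N. \<forall>n\<ge>N. nrm M (\<lambda>x. F m x - F n x) < (1/2)^k"
      using cauchy by simp
    then show ?thesis using that by metis
  qed
  \<comment> \<open>Summing over \<open>i \<le> k\<close> makes \<open>s\<close> monotone and at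
    least \<open>N k\<close>; the extra \<open>k\<close> makes it unbounded.\<close>
  define s where "s k = (\<Sum>i\<le>k. N i) + k" for k
  have sN: "N k \<le> s k" for k
    unfolding s_def using member_le_sum[of k "{..k}" N] by auto
  have smono: "s k \<le> s (Suc k)" and sge: "k \<le> s k" for k by (auto simp: s_def)
  have AE: "AE x in M. convergent (\<lambda>k. F (s k) x)"
  proof (rule sqint_lim_subseq)
    fix k
    have "nrm M (\<lambda>x. F (s (Suc k)) x - F (s k) x) < (1/2)^k"
      using sN[of k] smono[of k] by (intro N) auto
    then have "(nrm M (\<lambda>x. F (s (Suc k)) x - F (s k) x))\<^sup>2 \<le> ((1/2)^k)\<^sup>2"
      by (intro power_mono) auto
    then show "(nrm M (\<lambda>x. F (s (Suc k)) x - F (s k) x))\<^sup>2 \<le> (1/4)^k"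
      by (simp add: power_mult[symmetric] mult.commute[of k 2]) (simp add: power_mult power2_eq_square)
  qed (rule F)
  define G where "G x = lim (\<lambda>k. F (s k) x)" for x
  have [measurable]: "G \<in> borel_measurable M" unfolding G_def by measurable
  have conv: "AE x in M. (\<lambda>k. F (s k) x) \<longlonglongrightarrow> G x"
    using AE by eventually_elim (simp add: G_def convergent_LIMSEQ_iff)
  have fatou: "(\<integral>\<^sup>+x. ennreal ((norm (F n x - G x))\<^sup>2) \<partial>M) \<le> ennreal (e\<^sup>2)"
    if e: "\<And>m. m \<ge> N0 \<Longrightarrow> nrm M (\<lambda>x. F n x - F m x) \<le> e" and "0 \<le> e" for n N0 e
  proof -
    have "(\<integral>\<^sup>+x. ennreal ((norm (F n x - G x))\<^sup>2) \<partial>M) = (\<integral>\<^sup>+x. liminf (\<lambda>k. ennreal ((norm (F n x - F (s k) x))\<^sup>2)) \<partial>M)"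
    proof (rule nn_integral_cong_AE)
      show "AE x in M. ennreal ((norm (F n x - G x))\<^sup>2) = liminf (\<lambda>k. ennreal ((norm (F n x - F (s k) x))\<^sup>2))"
        using conv
      proof eventually_elim
        case (elim x)
        then have "(\<lambda>k. ennreal ((norm (F n x - F (s k) x))\<^sup>2)) \<longlonglongrightarrow> ennreal ((norm (F n x - G x))\<^sup>2)"
          by (intro tendsto_intros) auto
        then show ?case using lim_imp_Liminf[OF sequentially_bot] by metis
      qed
    qed
    also have "\<dots> \<le> liminf (\<lambda>k. \<integral>\<^sup>+x. ennreal ((norm (F n x - F (s k) x))\<^sup>2) \<partial>M)"
      by (rule nn_integral_liminf) measurable
    also have "\<dots> \<le> ennreal (e\<^sup>2)"
    proof -
      have "\<forall>\<^sub>F k in sequentially. (\<integral>\<^sup>+x. ennreal ((norm (F n x - F (s k) x))\<^sup>2) \<partial>M) \<le> ennreal (e\<^sup>2)"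
      proof (rule eventually_sequentiallyI[of N0])
        fix k assume "N0 \<le> k"
        then have "nrm M (\<lambda>x. F n x - F (s k) x) \<le> e" using sge[of k] by (intro e) auto
        then have "(nrm M (\<lambda>x. F n x - F (s k) x))\<^sup>2 \<le> e\<^sup>2" by (intro power_mono) auto
        moreover have "(\<integral>\<^sup>+x. ennreal ((norm (F n x - F (s k) x))\<^sup>2) \<partial>M) = ennreal ((nrm M (\<lambda>x. F n x - F (s k) x))\<^sup>2)"
          unfolding nrm_sq using F sqint_diff[of M "F n" "F (s k)"]
          by (intro nn_integral_eq_integral) (auto simp: sqint_def)
        ultimately show "(\<integral>\<^sup>+x. ennreal ((norm (F n x - F (s k) x))\<^sup>2) \<partial>M) \<le> ennreal (e\<^sup>2)"
          by (simp add: ennreal_leI)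
      qed
      then have "liminf (\<lambda>k. \<integral>\<^sup>+x. ennreal ((norm (F n x - F (s k) x))\<^sup>2) \<partial>M) \<le> liminf (\<lambda>k. ennreal (e\<^sup>2))"
        by (rule Liminf_mono)
      then show ?thesis by (simp add: Liminf_const)
    qed
    finally show ?thesis .
  qed
  have fin: "sqint M (\<lambda>x. F n x - G x)" if "\<And>m. m \<ge> N0 \<Longrightarrow> nrm M (\<lambda>x. F n x - F m x) \<le> e" "0 \<le> e" for n N0 e
    unfolding sqint_def
  proof (intro conjI integrableI_bounded)
    show "(\<integral>\<^sup>+x. ennreal (norm ((norm (F n x - G x))\<^sup>2)) \<partial>M) < \<infinity>"
      using le_less_trans[OF fatou[OF that] ennreal_less_top] by simp
  qed measurable
  have fin2: "nrm M (\<lambda>x. F n x - G x) \<le> e" if "\<And>m. m \<ge> N0 \<Longrightarrow> nrm M (\<lambda>x. F n x - F m x) \<le> e" "0 \<le> e" for n N0 e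
  proof (rule power2_le_imp_le[OF _ that(2)])
    have "ennreal ((nrm M (\<lambda>x. F n x - G x))\<^sup>2) = (\<integral>\<^sup>+x. ennreal ((norm (F n x - G x))\<^sup>2) \<partial>M)"
      unfolding nrm_sq using fin[OF that] by (intro nn_integral_eq_integral[symmetric]) (auto simp: sqint_def)
    also have "\<dots> \<le> ennreal (e\<^sup>2)" using that by (rule fatou)
    finally show "(nrm M (\<lambda>x. F n x - G x))\<^sup>2 \<le> e\<^sup>2" by simp
  qed
  have "sqint M (\<lambda>x. F (N 0) x - G x)"
    by (rule fin[of "N 0" _ 1]) (use N[of 0 "N 0"] in \<open>auto simp: less_imp_le\<close>)
  from sqint_diff[OF F[of "N 0"] this] have G: "sqint M G" by simp
  moreover have "(\<lambda>n. nrm M (\<lambda>x. F n x - G x)) \<longlonglongrightarrow> 0"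
  proof (rule LIMSEQ_I)
    fix e :: real assume "0 < e"
    then obtain N0 where N0: "\<And>m n. m \<ge> N0 \<Longrightarrow> n \<ge> N0 \<Longrightarrow> nrm M (\<lambda>x. F m x - F n x) < e/2"
      using cauchy[of "e/2"] by auto
    show "\<exists>no. \<forall>n\<ge>no. norm (nrm M (\<lambda>x. F n x - G x) - 0) < e"
    proof (intro exI allI impI)
      fix n assume "N0 \<le> n"
      then have "nrm M (\<lambda>x. F n x - G x) \<le> e/2"
        using N0 \<open>0 < e\<close> by (intro fin2[of N0]) (auto simp: less_imp_le)
      then show "norm (nrm M (\<lambda>x. F n x - G x) - 0) < e" using \<open>0 < e\<close> by simp
    qed
  qed
  ultimately show ?thesis using F by (auto simp: L2lim_def)
qed

lemma LIMSEQ_squeeze_zero: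
  fixes f g :: "nat \<Rightarrow> real"
  assumes "\<And>n. 0 \<le> f n" "\<And>n. f n \<le> g n" "g \<longlonglongrightarrow> 0"
  shows "f \<longlonglongrightarrow> 0"
  by (rule tendsto_sandwich[OF _ _ tendsto_const assms(3)]) (use assms in auto)

lemma mult_right_cancel_le:
  fixes a b c :: real
  assumes "a * b \<le> c * b" "0 \<le> b" "b = 0 \<Longrightarrow> a \<le> c"
  shows "a \<le> c"
  using assms by (cases "b = 0") (auto simp: less_le)

text \<open>The first order condition at a minimum. Replacing \<open>b\<close> by
  \<open>\<bar>b\<bar> + 1\<close> gives a positive denominator for the test value of
  \<open>t\<close> even if \<open>b\<close> is zero or negative.\<close>

lemma quadratic_nonneg_imp_zero:
  fixes a b :: real
  assumes key: "\<And>t. 0 \<le> - 2 * t * a + t\<^sup>2 * b"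
  shows "a = 0"
proof (rule ccontr)
  assume ne: "a \<noteq> 0"
  define c where "c = \<bar>b\<bar> + 1"
  have c: "c > 0" "b \<le> c" by (simp_all add: c_def)
  have "0 \<le> - 2 * (a / c) * a + (a / c)\<^sup>2 * b" by (rule key)
  also have "\<dots> \<le> - 2 * (a / c) * a + (a / c)\<^sup>2 * c"
    using c by (intro add_left_mono mult_left_mono) auto
  also have "\<dots> = - (a\<^sup>2 / c)" using c by (simp add: power2_eq_square field_simps)
  also have "\<dots> < 0" using ne c by simp
  finally show False by simp
qed

section \<open>Closed subspaces, orthogonal projection and coercive forms\<close>

definition closed_subspace :: "'a measure \<Rightarrow> ('a \<Rightarrow> 'b::euclidean_space) set \<Rightarrow> bool" where
  "closed_subspace M W \<longleftrightarrow> (\<forall>U\<in>W. sqint M U) \<and> (\<lambda>x. 0) \<in> W \<and>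
     (\<forall>U\<in>W. \<forall>V\<in>W. (\<lambda>x. U x + V x) \<in> W) \<and> (\<forall>c. \<forall>U\<in>W. (\<lambda>x. c *\<^sub>R U x) \<in> W) \<and>
     (\<forall>F G. (\<forall>n. F n \<in> W) \<longrightarrow> L2lim M F G \<longrightarrow> G \<in> W)"

context
  fixes M :: "'a measure" and W :: "('a \<Rightarrow> 'b::euclidean_space) set"
  assumes W: "closed_subspace M W"
begin

lemma csD: "U \<in> W \<Longrightarrow> sqint M U" "(\<lambda>x. 0) \<in> W" "U \<in> W \<Longrightarrow> V \<in> W \<Longrightarrow> (\<lambda>x. U x + V x) \<in> W"
  "U \<in> W \<Longrightarrow> (\<lambda>x. c *\<^sub>R U x) \<in> W" "(\<And>n. F n \<in> W) \<Longrightarrow> L2lim M F G \<Longrightarrow> G \<in> W"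
  using W unfolding closed_subspace_def by blast+

lemma cs_diff: "U \<in> W \<Longrightarrow> V \<in> W \<Longrightarrow> (\<lambda>x. U x - V x) \<in> W"
  using csD(3)[OF _ csD(4)[of V "-1"], of U] by simp

text \<open>A minimising sequence for the distance is Cauchy by the parallelogram identity, because
  midpoints stay in \<open>W\<close> and cannot beat the infimum. Orthogonality is the vanishing
  first variation at the minimiser.\<close>

lemma projection_exists:
  assumes F: "sqint M F"
  shows "\<exists>P\<in>W. \<forall>V\<in>W. ip M (\<lambda>x. F x - P x) V = 0"
proof -
  define D where "D = (\<lambda>V. (nrm M (\<lambda>x. F x - V x))\<^sup>2)"
  define d where "d = Inf (D ` W)"
  have dle: "d \<le> D V" if "V \<in> W" for V
    unfolding d_def using that by (intro cInf_lower) (auto intro!: bdd_belowI[of _ 0] simp: D_def)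
  have "\<exists>V\<in>W. D V < d + 1 / (real n + 1)" for n
  proof -
    have "Inf (D ` W) < d + 1 / (real n + 1)" by (simp add: d_def)
    then show ?thesis using cInf_lessD[of "D ` W"] csD(2) by blast
  qed
  then obtain V where V: "\<And>n. V n \<in> W" "\<And>n::nat. D (V n) < d + 1 / (real n + 1)" by metis
  have s: "sqint M (V n)" "sqint M (\<lambda>x. F x - V n x)" for n using V(1) csD(1) F by auto
  have par: "(nrm M (\<lambda>x. V m x - V n x))\<^sup>2 \<le> 2 / (real m + 1) + 2 / (real n + 1)" for m n
  proof -
    let ?a = "\<lambda>x. F x - V m x" and ?b = "\<lambda>x. F x - V n x"
    have "(nrm M (\<lambda>x. ?a x + ?b x))\<^sup>2 + (nrm M (\<lambda>x. ?a x - ?b x))\<^sup>2 = 2 * D (V m) + 2 * D (V n)"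
      using nrm_add_sq[OF s(2) s(2), of m n] nrm_diff_sq[OF s(2) s(2), of m n] by (simp add: D_def)
    moreover have "(nrm M (\<lambda>x. ?a x - ?b x))\<^sup>2 = (nrm M (\<lambda>x. V m x - V n x))\<^sup>2"
      using nrm_minus_commute[of M "V m" "V n"] by (simp add: algebra_simps)
    moreover have "(nrm M (\<lambda>x. ?a x + ?b x))\<^sup>2 = 4 * D (\<lambda>x. (1/2) *\<^sub>R (V m x + V n x))"
    proof -
      have "nrm M (\<lambda>x. ?a x + ?b x) = nrm M (\<lambda>x. 2 *\<^sub>R (F x - (1/2) *\<^sub>R (V m x + V n x)))"
        by (rule arg_cong[of _ _ "nrm M"]) (auto simp: fun_eq_iff scaleR_2 algebra_simps)
      then show ?thesis by (simp add: nrm_scaleR D_def power_mult_distrib)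
    qed
    moreover have "d \<le> D (\<lambda>x. (1/2) *\<^sub>R (V m x + V n x))"
      by (intro dle csD(3,4) V(1))
    moreover have "2 / (real m + 1) = 2 * (1 / (real m + 1))" "2 / (real n + 1) = 2 * (1 / (real n + 1))"
      by simp_all
    ultimately show ?thesis using V(2)[of m] V(2)[of n] by linarith
  qed
  have "\<exists>P. L2lim M V P"
  proof (rule sqint_complete[OF s(1)])
    fix e :: real assume e: "0 < e"
    obtain N where N: "4 / e\<^sup>2 < real N" using reals_Archimedean2 by blast
    show "\<exists>N. \<forall>m\<ge>N. \<forall>n\<ge>N. nrm M (\<lambda>x. V m x - V n x) < e"
    proof (intro exI allI impI)
      fix m n assume mn: "N \<le> m" "N \<le> n"
      have N0: "0 < real N" by (rule less_trans[OF _ N]) (use e in simp)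
      have "2 / (real m + 1) + 2 / (real n + 1) \<le> 2 / real N + 2 / real N"
        using mn N0 by (intro add_mono divide_left_mono) auto
      also have "\<dots> = 4 / real N" by simp
      also have "\<dots> < e\<^sup>2" using N N0 e by (simp add: pos_divide_less_eq mult.commute)
      finally have "(nrm M (\<lambda>x. V m x - V n x))\<^sup>2 < e\<^sup>2" using par[of m n] by simp
      then show "nrm M (\<lambda>x. V m x - V n x) < e" by (rule power2_less_imp_less) (use e in simp)
    qed
  qed
  then obtain P where P: "L2lim M V P" by blast
  have PW: "P \<in> W" using csD(5)[OF V(1) P] .
  have sP: "sqint M P" "sqint M (\<lambda>x. F x - P x)" using csD(1)[OF PW] F by auto
  have "L2lim M (\<lambda>n x. F x - V n x) (\<lambda>x. F x - P x)"
    using L2lim_add[OF L2lim_const[OF F] L2lim_bounded_linear[OF bounded_linear_minus[OF bounded_linear_ident] P]] by simp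
  from L2lim_ip[OF this this] have lim: "(\<lambda>n. D (V n)) \<longlonglongrightarrow> D P" by (simp add: D_def nrm_sq_ip)
  have "D P \<le> d + 0"
  proof (rule LIMSEQ_le[OF lim])
    show "(\<lambda>n. d + 1 / (real n + 1)) \<longlonglongrightarrow> d + 0"
      using LIMSEQ_inverse_real_of_nat by (intro tendsto_add tendsto_const) (simp add: inverse_eq_divide add.commute)
  qed (use V(2) less_imp_le in blast)
  then have DP: "D P \<le> d" by simp
  have "ip M (\<lambda>x. F x - P x) U = 0" if U: "U \<in> W" for U
  proof -
    have sU: "sqint M U" using csD(1)[OF U] .
    have key: "0 \<le> - 2 * t * ip M (\<lambda>x. F x - P x) U + t\<^sup>2 * (nrm M U)\<^sup>2" for t
    proof -
      have "D P \<le> D (\<lambda>x. P x + t *\<^sub>R U x)" using DP dle[OF csD(3)[OF PW csD(4)[OF U]]] by (rule order_trans)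
      also have "D (\<lambda>x. P x + t *\<^sub>R U x) = (nrm M (\<lambda>x. (F x - P x) - t *\<^sub>R U x))\<^sup>2"
        by (simp add: D_def algebra_simps)
      also have "\<dots> = D P - 2 * t * ip M (\<lambda>x. F x - P x) U + t\<^sup>2 * (nrm M U)\<^sup>2"
        using nrm_diff_sq[OF sP(2) sqint_scaleR[OF sU, of t]] by (simp add: D_def ip_scaleR_right nrm_scaleR power_mult_distrib)
      finally show ?thesis by simp
    qed
    show ?thesis by (rule quadratic_nonneg_imp_zero[OF key])
  qed
  then show ?thesis using PW by blast
qed

end

text \<open>The Riesz representatives \<open>E\<close> of the functionals \<open>V \<mapsto> \<langle>A P, V\<rangle>\<close> with \<open>P \<in> W\<close> form a subspace
  of \<open>W\<close>; coercivity makes it closed and its orthogonal complement in \<open>W\<close> trivial.\<close>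

lemma lax_milgram:
  fixes W :: "('a \<Rightarrow> 'b::euclidean_space) set"
  assumes W: "closed_subspace M W" and A: "bounded_linear A" and c: "0 < c" and coer: "\<And>b. c * (norm b)\<^sup>2 \<le> A b \<bullet> b"
    and F: "sqint M F"
  shows "\<exists>P\<in>W. \<forall>V\<in>W. ip M (\<lambda>x. A (P x)) V = ip M F V"
proof -
  interpret A: bounded_linear A by (rule A)
  note cs = csD[OF W]
  have sA: "sqint M (\<lambda>x. A (U x))" if "U \<in> W" for U using sqint_bounded_linear[OF A cs(1)[OF that]] .
  have coerM: "c * (nrm M U)\<^sup>2 \<le> ip M (\<lambda>x. A (U x)) U" if U: "U \<in> W" for U
  proof -
    have "c * (nrm M U)\<^sup>2 = (\<integral>x. c * (norm (U x))\<^sup>2 \<partial>M)" by (simp add: nrm_sq)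
    also have "\<dots> \<le> ip M (\<lambda>x. A (U x)) U"
      unfolding ip_def using sqint_inner[OF sA[OF U] cs(1)[OF U]] cs(1)[OF U] coer by (intro integral_mono) (auto simp: sqint_def)
    finally show ?thesis .
  qed
  have riesz: "\<exists>E\<in>W. \<forall>V\<in>W. ip M E V = ip M G V" if G: "sqint M G" for G
  proof -
    obtain E where E: "E \<in> W" "\<forall>V\<in>W. ip M (\<lambda>x. G x - E x) V = 0" using projection_exists[OF W G] by blast
    then have "ip M E V = ip M G V" if "V \<in> W" for V using ip_diff_left[OF G cs(1)[OF E(1)] cs(1)[OF that]] that by simp
    then show ?thesis using E(1) by blast
  qed
  define rep where "rep E P \<longleftrightarrow> P \<in> W \<and> E \<in> W \<and> (\<forall>V\<in>W. ip M E V = ip M (\<lambda>x. A (P x)) V)" for E P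
  have rep_add: "rep (\<lambda>x. E x + E' x) (\<lambda>x. P x + P' x)" if "rep E P" "rep E' P'" for E P E' P'
    using that cs(1,3) sA by (simp add: rep_def A.add ip_add_left)
  have rep_scale: "rep (\<lambda>x. r *\<^sub>R E x) (\<lambda>x. r *\<^sub>R P x)" if "rep E P" for E P r
    using that cs(4) by (simp add: rep_def A.scaleR ip_scaleR_left)
  have rep_bound: "c * nrm M P \<le> nrm M E" if "rep E P" for E P
  proof -
    have P: "P \<in> W" "E \<in> W" and eq: "ip M E P = ip M (\<lambda>x. A (P x)) P" using that by (auto simp: rep_def)
    have "(c * nrm M P) * nrm M P \<le> nrm M E * nrm M P"
      using coerM[OF P(1)] ip_bound[OF cs(1)[OF P(2)] cs(1)[OF P(1)]] eq by (simp add: power2_eq_square mult.assoc)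
    then show ?thesis by (rule mult_right_cancel_le) auto
  qed
  define R where "R = {E. \<exists>P. rep E P}"
  have R: "closed_subspace M R"
    unfolding closed_subspace_def
  proof (intro conjI ballI allI impI)
    show "sqint M U" if "U \<in> R" for U using that cs(1) by (auto simp: R_def rep_def)
    have "rep (\<lambda>x. 0) (\<lambda>x. 0)" using cs(2) by (simp add: rep_def A.zero ip_def)
    then show "(\<lambda>x. 0) \<in> R" by (auto simp: R_def)
    show "(\<lambda>x. U x + V x) \<in> R" if UV: "U \<in> R" "V \<in> R" for U V
    proof -
      from UV obtain P P' where "rep U P" "rep V P'" by (auto simp: R_def)
      from rep_add[OF this] show ?thesis by (auto simp: R_def)
    qed
    show "(\<lambda>x. r *\<^sub>R U x) \<in> R" if U: "U \<in> R" for U r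
    proof -
      from U obtain P where "rep U P" by (auto simp: R_def)
      from rep_scale[OF this] show ?thesis by (auto simp: R_def)
    qed
    fix E G assume "\<forall>n. E n \<in> R" and lim: "L2lim M E G"
    then have "\<forall>n. \<exists>P. rep (E n) P" by (auto simp: R_def)
    then obtain P where P: "\<And>n. rep (E n) (P n)" using choice[of "\<lambda>n. rep (E n)"] by auto
    then have PW: "P n \<in> W" "E n \<in> W" and eq: "V \<in> W \<Longrightarrow> ip M (E n) V = ip M (\<lambda>x. A (P n x)) V" for n V by (auto simp: rep_def)
    have sG: "sqint M G" and l0: "(\<lambda>n. nrm M (\<lambda>x. E n x - G x)) \<longlonglongrightarrow> 0" using lim by (auto simp: L2lim_def)
    have "\<exists>Q. L2lim M P Q"
    proof (rule sqint_complete)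
      show "sqint M (P n)" for n by (rule cs(1)[OF PW(1)])
      fix r :: real assume "0 < r"
      then have "0 < c * r / 2" using c by simp
      then obtain N where N: "\<And>n. n \<ge> N \<Longrightarrow> nrm M (\<lambda>x. E n x - G x) < c * r / 2"
        using LIMSEQ_D[OF l0] by (metis abs_of_nonneg diff_zero nrm_nonneg real_norm_def)
      show "\<exists>N. \<forall>m\<ge>N. \<forall>n\<ge>N. nrm M (\<lambda>x. P m x - P n x) < r"
      proof (intro exI allI impI)
        fix m n assume mn: "N \<le> m" "N \<le> n"
        have "c * nrm M (\<lambda>x. P m x - P n x) \<le> nrm M (\<lambda>x. E m x - E n x)"
          using rep_bound[OF rep_add[OF P rep_scale[OF P, of "-1"]], of m n] by simp
        also have "\<dots> \<le> nrm M (\<lambda>x. E m x - G x) + nrm M (\<lambda>x. E n x - G x)"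
          using nrm_triangle_diff[OF cs(1)[OF PW(2)] sG cs(1)[OF PW(2)], of m n] by (simp add: nrm_minus_commute[of M G])
        also have "\<dots> < c * r" using N[OF mn(1)] N[OF mn(2)] by simp
        finally show "nrm M (\<lambda>x. P m x - P n x) < r" using c by simp
      qed
    qed
    then obtain Q where Q: "L2lim M P Q" by blast
    have "ip M G V = ip M (\<lambda>x. A (Q x)) V" if V: "V \<in> W" for V
      using L2lim_ip[OF lim L2lim_const[OF cs(1)[OF V]]] L2lim_ip[OF L2lim_bounded_linear[OF A Q] L2lim_const[OF cs(1)[OF V]]]
      unfolding eq[OF V] by (rule LIMSEQ_unique)
    then have "rep G Q" unfolding rep_def using cs(5)[OF PW(1) Q] cs(5)[OF PW(2) lim] by blast
    then show "G \<in> R" by (auto simp: R_def)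
  qed
  obtain F' where F': "F' \<in> W" "\<And>V. V \<in> W \<Longrightarrow> ip M F' V = ip M F V" using riesz[OF F] by blast
  obtain E where E: "E \<in> R" "\<And>V. V \<in> R \<Longrightarrow> ip M (\<lambda>x. F' x - E x) V = 0" using projection_exists[OF R cs(1)[OF F'(1)]] by blast
  from E(1) obtain P where P: "rep E P" by (auto simp: R_def)
  then have EW: "E \<in> W" by (simp add: rep_def)
  let ?D = "\<lambda>x. F' x - E x"
  have D: "?D \<in> W" by (rule cs_diff[OF W F'(1) EW])
  \<comment> \<open>\<open>T\<close> represents the functional generated by \<open>?D\<close>
    itself, hence lies in \<open>R\<close>, to which \<open>?D\<close> is orthogonal; coercivity
    then forces \<open>?D\<close> to have norm \<open>0\<close>.\<close>
  obtain T where T: "rep T ?D" using riesz[OF sA[OF D]] D unfolding rep_def by blast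
  then have "T \<in> R" "T \<in> W" by (auto simp: R_def rep_def)
  have "c * (nrm M ?D)\<^sup>2 \<le> ip M T ?D" using coerM[OF D] T D by (simp add: rep_def)
  also have "\<dots> = 0" using E(2)[OF \<open>T \<in> R\<close>] by (simp add: ip_commute)
  finally have D0: "nrm M ?D = 0" using c by (simp add: mult_le_0_iff)
  have "ip M (\<lambda>x. A (P x)) V = ip M F V" if V: "V \<in> W" for V
  proof -
    have "ip M ?D V = 0" using ip_bound[OF cs(1)[OF D] cs(1)[OF V]] D0 by simp
    then show ?thesis using ip_diff_left[OF cs(1)[OF F'(1)] cs(1)[OF EW] cs(1)[OF V]] F'(2)[OF V] P V by (simp add: rep_def)
  qed
  then show ?thesis using P by (auto simp: rep_def)
qed

section \<open>Smooth functions of compact support\<close>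

lemma partial_derivI:
  "(f has_derivative D) (at x) \<Longrightarrow> partial_deriv b f x = D b"
  by (simp add: partial_deriv_def flip: frechet_derivative_at)

abbreviation dx :: "(plane \<Rightarrow> 'b::real_normed_vector) \<Rightarrow> plane \<Rightarrow> 'b" where "dx \<equiv> partial_deriv (1, 0)"
abbreviation dy :: "(plane \<Rightarrow> 'b::real_normed_vector) \<Rightarrow> plane \<Rightarrow> 'b" where "dy \<equiv> partial_deriv (0, 1)"

lemma C_k_Suc_imp: "C_k (Suc k) f \<Longrightarrow> C_k k f"
proof (induction k arbitrary: f)
  case 0
  then show ?case unfolding C_k.simps continuous_on_eq_continuous_at[OF open_UNIV]
    using differentiable_imp_continuous_within by blast
next
  case (Suc k)
  then show ?case by (metis C_k.simps(2))
qed

lemma C_k_0_imp: "C_k k f \<Longrightarrow> C_k 0 f"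
  by (induction k) (blast dest: C_k_Suc_imp)+

lemma C_k_const: "C_k k (\<lambda>x. c)"
proof (induction k arbitrary: c)
  case (Suc k)
  have "partial_deriv b (\<lambda>x. c) = (\<lambda>x. 0)" for b :: 'a
    by (auto simp: fun_eq_iff intro!: partial_derivI[where D="\<lambda>_. 0", simplified])
  then show ?case using Suc by simp
qed simp

lemma C_k_add: "C_k k f \<Longrightarrow> C_k k g \<Longrightarrow> C_k k (\<lambda>x. f x + g x)"
proof (induction k arbitrary: f g)
  case (Suc k)
  have "partial_deriv b (\<lambda>x. f x + g x) = (\<lambda>x. partial_deriv b f x + partial_deriv b g x)" for b
  proof
    fix x
    have "f differentiable at x" "g differentiable at x" using Suc.prems by auto
    from has_derivative_add[OF this[unfolded frechet_derivative_works]]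
    show "partial_deriv b (\<lambda>x. f x + g x) x = partial_deriv b f x + partial_deriv b g x"
      by (rule partial_derivI[THEN trans]) (simp add: partial_deriv_def)
  qed
  then show ?case using Suc by auto
qed (auto intro: continuous_intros)

lemma C_k_mult:
  fixes f g :: "'a::euclidean_space \<Rightarrow> 'b::real_normed_algebra"
  shows "C_k k f \<Longrightarrow> C_k k g \<Longrightarrow> C_k k (\<lambda>x. f x * g x)"
proof (induction k arbitrary: f g)
  case (Suc k)
  have "partial_deriv b (\<lambda>x. f x * g x) = (\<lambda>x. f x * partial_deriv b g x + partial_deriv b f x * g x)" for b
  proof
    fix x
    have "f differentiable at x" "g differentiable at x" using Suc.prems by auto
    from has_derivative_mult[OF this[unfolded frechet_derivative_works]]
    show "partial_deriv b (\<lambda>x. f x * g x) x = f x * partial_deriv b g x + partial_deriv b f x * g x"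
      by (rule partial_derivI[THEN trans]) (simp add: partial_deriv_def)
  qed
  moreover have "C_k k f" "C_k k g" using Suc.prems C_k_Suc_imp by blast+
  ultimately show ?case using Suc by (auto intro!: C_k_add)
qed (auto intro: continuous_intros)

section \<open>Smooth functions of compact support\<close>

text \<open>Carrying a polynomial in \<open>1/t\<close> makes the family closed under
  differentiation, so smoothness follows by a single induction over all polynomials at once.\<close>

definition flat_exp :: "real poly \<Rightarrow> real \<Rightarrow> real" where
  "flat_exp P t = (if t > 0 then poly P (1/t) * exp (- (1/t)) else 0)"

lemma poly_div_exp_tendsto: "((\<lambda>s. s^k * poly P s * exp (-s)) \<longlongrightarrow> 0) at_top"
  for P :: "real poly"
proof (induction P arbitrary: k)
  case (pCons a P)
  have "((\<lambda>s. a * (s ^ k / exp s) + s ^ Suc k * poly P s * exp (-s)) \<longlongrightarrow> a * 0 + 0) at_top"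
    by (intro tendsto_intros pCons.IH tendsto_power_div_exp_0)
  then show ?case by (simp add: algebra_simps exp_minus divide_inverse)
qed simp

text \<open>With \<open>s = 1/t\<close> the chain rule turns \<open>P(s) exp(-s)\<close> into
  \<open>s^2 (P - P')(s) exp(-s)\<close>, whence the factor \<open>[:0,0,1:]\<close>. At
  \<open>t = 0\<close> the difference quotient is \<open>s P(s) exp(-s)\<close> on the right and
  \<open>0\<close> on the left.\<close>

lemma flat_exp_deriv:
  "(flat_exp P has_real_derivative flat_exp ([:0,0,1:] * (P - pderiv P)) t) (at t)"
proof -
  consider "t > 0" | "t < 0" | "t = 0" by linarith
  then show ?thesis
  proof cases
    case 1
    have "((\<lambda>t. poly P (1/t) * exp (- (1/t))) has_real_derivative
       poly P (1/t) * (exp (- (1/t)) * (1/t^2)) + poly (pderiv P) (1/t) * (- 1/t^2) * exp (- (1/t))) (at t)"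
      using 1 by (auto intro!: derivative_eq_intros DERIV_chain2[OF poly_DERIV] simp: power2_eq_square field_simps)
    moreover have "poly P (1/t) * (exp (- (1/t)) * (1/t^2)) + poly (pderiv P) (1/t) * (- 1/t^2) * exp (- (1/t))
      = flat_exp ([:0,0,1:] * (P - pderiv P)) t"
      using 1 by (simp add: flat_exp_def power2_eq_square field_simps)
    ultimately have "((\<lambda>t. poly P (1/t) * exp (- (1/t))) has_real_derivative flat_exp ([:0,0,1:] * (P - pderiv P)) t) (at t)"
      by simp
    then show ?thesis
      by (rule has_field_derivative_transform_within_open[where S="{0<..}"]) (use 1 in \<open>auto simp: flat_exp_def\<close>)
  next
    case 2
    have "((\<lambda>t. 0) has_real_derivative flat_exp ([:0,0,1:] * (P - pderiv P)) t) (at t)"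
      using 2 by (simp add: flat_exp_def)
    then show ?thesis
      by (rule has_field_derivative_transform_within_open[where S="{..<0}"]) (use 2 in \<open>auto simp: flat_exp_def\<close>)
  next
    case 3
    have right: "((\<lambda>h. flat_exp P h / h) \<longlongrightarrow> 0) (at_right 0)"
    proof -
      have "((\<lambda>h. (inverse h)^1 * poly P (inverse h) * exp (- inverse h)) \<longlongrightarrow> 0) (at_right (0::real))"
        by (rule filterlim_compose[OF poly_div_exp_tendsto filterlim_inverse_at_top_right])
      then show ?thesis
        by (rule Lim_transform_eventually)
          (auto simp: eventually_at_filter flat_exp_def divide_inverse mult_ac)
    qed
    have left: "((\<lambda>h. flat_exp P h / h) \<longlongrightarrow> 0) (at_left 0)"
      by (rule tendsto_eventually) (auto simp: eventually_at_filter flat_exp_def)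
    have "((\<lambda>h. flat_exp P h / h) \<longlongrightarrow> 0) (at 0)"
      using left right by (simp add: filterlim_at_split)
    then have "(flat_exp P has_real_derivative 0) (at 0)"
      unfolding has_field_derivative_iff by (simp add: flat_exp_def)
    then show ?thesis using 3 by (simp add: flat_exp_def)
  qed
qed

lemma C_k_flat_exp_affine:
  fixes \<beta> :: "'a::euclidean_space"
  shows "C_k k (\<lambda>p. complex_of_real (flat_exp P (\<alpha> + \<beta> \<bullet> p)))"
proof (induction k arbitrary: P)
  let ?P' = "\<lambda>P. [:0,0,1:] * (P - pderiv P)"
  have der: "((\<lambda>p. complex_of_real (flat_exp P (\<alpha> + \<beta> \<bullet> p))) has_derivative
      (\<lambda>h. complex_of_real (\<beta> \<bullet> h) * complex_of_real (flat_exp (?P' P) (\<alpha> + \<beta> \<bullet> p)))) (at p)" for P p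
  proof -
    have "((\<lambda>p. flat_exp P (\<alpha> + \<beta> \<bullet> p)) has_derivative (\<lambda>h. (\<beta> \<bullet> h) * flat_exp (?P' P) (\<alpha> + \<beta> \<bullet> p))) (at p)"
    proof -
      have "((\<lambda>p. \<alpha> + \<beta> \<bullet> p) has_derivative (\<lambda>h. \<beta> \<bullet> h)) (at p)"
        by (auto intro!: derivative_eq_intros)
      from has_derivative_compose[OF this has_field_derivative_imp_has_derivative[OF flat_exp_deriv]]
      show ?thesis by (simp only: mult.commute)
    qed
    from bounded_linear.has_derivative[OF bounded_linear_of_real this] show ?thesis by simp
  qed
  {
    case 0
    show ?case unfolding C_k.simps continuous_on_eq_continuous_at[OF open_UNIV]
      using has_derivative_continuous[OF der] by blast
  next
    case (Suc k)
    have "partial_deriv b (\<lambda>p. complex_of_real (flat_exp P (\<alpha> + \<beta> \<bullet> p)))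
       = (\<lambda>p. complex_of_real (\<beta> \<bullet> b) * complex_of_real (flat_exp (?P' P) (\<alpha> + \<beta> \<bullet> p)))" for b
      using partial_derivI[OF der] by (auto simp: fun_eq_iff)
    moreover have "(\<lambda>p. complex_of_real (flat_exp P (\<alpha> + \<beta> \<bullet> p))) differentiable at p" for p
      using der by (auto simp: differentiable_def)
    ultimately show ?case by (auto intro!: C_k_mult C_k_const Suc.IH)
  }
qed

text \<open>Four one-sided cutoffs with affine arguments, so that smoothness needs nothing beyond
  \<open>flat_exp\<close> and products. For \<open>0 < r\<close> the support is the square of half
  side \<open>1/r\<close>; the normalisation is left to \<open>mollify\<close>.\<close>

definition bump :: "real \<Rightarrow> plane \<Rightarrow> real" where
  "bump r p = flat_exp 1 (1 - r * fst p) * flat_exp 1 (1 + r * fst p) *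
    (flat_exp 1 (1 - r * snd p) * flat_exp 1 (1 + r * snd p))"

lemma C_k_bump: "C_k k (\<lambda>p. complex_of_real (bump r p))"
proof -
  have "C_k k (\<lambda>p. complex_of_real (flat_exp 1 (1 + (-r, 0) \<bullet> p)) * complex_of_real (flat_exp 1 (1 + (r, 0) \<bullet> p)) *
    (complex_of_real (flat_exp 1 (1 + (0, -r) \<bullet> p)) * complex_of_real (flat_exp 1 (1 + (0, r) \<bullet> p))))"
    by (intro C_k_mult C_k_flat_exp_affine)
  then show ?thesis by (simp add: bump_def inner_prod_def)
qed

lemma flat_exp_1_nonneg: "0 \<le> flat_exp 1 t" by (simp add: flat_exp_def)

lemma bump_nonneg: "0 \<le> bump r p"
  by (simp add: bump_def flat_exp_1_nonneg)

lemma bump_zero: "0 < bump r 0"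
  by (simp add: bump_def flat_exp_def)

lemma bump_support: 
  assumes "bump r p \<noteq> 0" "0 < r"
  shows "\<bar>fst p\<bar> < 1 / r" "\<bar>snd p\<bar> < 1 / r"
  using assms by (auto simp: bump_def flat_exp_def field_simps abs_if split: if_splits)

section \<open>Continuously differentiable functions with their partial derivatives as data\<close>

definition C1 :: "(plane \<Rightarrow> 'b::euclidean_space) \<Rightarrow> (plane \<Rightarrow> 'b) \<Rightarrow> (plane \<Rightarrow> 'b) \<Rightarrow> bool" where
  "C1 f fx fy \<longleftrightarrow> (\<forall>p. (f has_derivative (\<lambda>h. fst h *\<^sub>R fx p + snd h *\<^sub>R fy p)) (at p)) \<and>
     continuous_on UNIV fx \<and> continuous_on UNIV fy"

text \<open>The partial derivatives are arguments, so that the formulas for products, pullbacks and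
  convolutions travel with the function. The compact set is existential because it changes under
  these operations.\<close>

definition C1c :: "plane set \<Rightarrow> (plane \<Rightarrow> 'b::euclidean_space) \<Rightarrow> (plane \<Rightarrow> 'b) \<Rightarrow> (plane \<Rightarrow> 'b) \<Rightarrow> bool" where
  "C1c \<Omega> f fx fy \<longleftrightarrow> C1 f fx fy \<and>
     (\<exists>K. compact K \<and> K \<subseteq> \<Omega> \<and> (\<forall>p. p \<notin> K \<longrightarrow> f p = 0 \<and> fx p = 0 \<and> fy p = 0))"

lemma C1_continuous: "C1 f fx fy \<Longrightarrow> continuous_on UNIV f"
  unfolding C1_def continuous_on_eq_continuous_at[OF open_UNIV] by (blast intro: has_derivative_continuous)

lemma C1_partial:
  assumes "C1 f fx fy"
  shows "partial_deriv (1, 0) f = fx" "partial_deriv (0, 1) f = fy"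
  using assms by (auto simp: C1_def fun_eq_iff dest!: spec intro!: partial_derivI[THEN trans])

lemma Basis_real2: "Basis = {(1::real, 0::real), (0, 1)}"
  by (auto simp: Basis_prod_def)

lemma C_k_C1:
  fixes f :: "plane \<Rightarrow> complex"
  assumes "C_k (Suc k) f"
  shows "C1 f (dx f) (dy f)"
proof -
  have "C_k 0 (partial_deriv b f)" if "b \<in> Basis" for b
  proof -
    have "C_k k (partial_deriv b f)" using assms that by simp
    then show ?thesis by (rule C_k_0_imp)
  qed
  moreover have "(f has_derivative (\<lambda>h. fst h *\<^sub>R dx f p + snd h *\<^sub>R dy f p)) (at p)" for p
  proof -
    have d: "(f has_derivative frechet_derivative f (at p)) (at p)"
      unfolding frechet_derivative_works[symmetric] using assms by (cases p) auto
    interpret linear "frechet_derivative f (at p)" using d by (rule has_derivative_linear)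
    have "frechet_derivative f (at p) h = fst h *\<^sub>R dx f p + snd h *\<^sub>R dy f p" for h
    proof -
      have "h = fst h *\<^sub>R (1,0) + snd h *\<^sub>R (0,1)" by (simp add: prod_eq_iff)
      then have "frechet_derivative f (at p) h = frechet_derivative f (at p) (fst h *\<^sub>R (1,0) + snd h *\<^sub>R (0,1))" by simp
      then show ?thesis by (simp only: add scale partial_deriv_def)
    qed
    then have "frechet_derivative f (at p) = (\<lambda>h. fst h *\<^sub>R dx f p + snd h *\<^sub>R dy f p)"
      by (rule ext)
    then show ?thesis using d by simp
  qed
  ultimately show ?thesis by (auto simp: C1_def Basis_real2)
qed

lemma C1_C_k:
  fixes f :: "plane \<Rightarrow> complex"
  assumes "C1 f fx fy" "C_k k fx" "C_k k fy"
  shows "C_k (Suc k) f"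
  using assms C1_partial[OF assms(1)] by (auto simp: Basis_real2 C1_def differentiable_def)

lemma partial_deriv_support:
  assumes "\<And>p. p \<notin> K \<Longrightarrow> f p = 0" "closed K" "p \<notin> K"
  shows "partial_deriv b f p = 0"
proof -
  have "(f has_derivative (\<lambda>_. 0)) (at p)"
    using assms by (intro has_derivative_transform_within_open[of "\<lambda>_. 0" "\<lambda>_. 0" p UNIV "- K" f]) auto
  then show ?thesis by (rule partial_derivI)
qed

lemma test_functions_C1c:
  assumes "\<phi> \<in> test_functions \<Omega>"
  shows "C1c \<Omega> \<phi> (dx \<phi>) (dy \<phi>)"
proof -
  let ?K = "closure {x. \<phi> x \<noteq> 0}"
  have "C1 \<phi> (dx \<phi>) (dy \<phi>)"
    using assms by (intro C_k_C1[of 0]) (auto simp: test_functions_def)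
  moreover have z: "\<phi> p = 0" if "p \<notin> ?K" for p using that closure_subset[of "{x. \<phi> x \<noteq> 0}"] by auto
  moreover have "partial_deriv b \<phi> p = 0" if "p \<notin> ?K" for p b
    by (rule partial_deriv_support[OF z _ that]) auto
  moreover have "compact ?K" "?K \<subseteq> \<Omega>" using assms by (simp_all add: test_functions_def)
  ultimately show ?thesis unfolding C1c_def by blast
qed

lemma test_functions_partial:
  fixes \<Omega> :: "plane set"
  assumes "\<phi> \<in> test_functions \<Omega>" "b \<in> Basis"
  shows "partial_deriv b \<phi> \<in> test_functions \<Omega>"
proof -
  let ?K = "closure {x. \<phi> x \<noteq> 0}"
  have K: "compact ?K" "?K \<subseteq> \<Omega>" using assms by (auto simp: test_functions_def)
  have z: "\<phi> p = 0" if "p \<notin> ?K" for p using that closure_subset[of "{x. \<phi> x \<noteq> 0}"] by auto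
  have "partial_deriv b \<phi> p = 0" if "p \<notin> ?K" for p
    by (rule partial_deriv_support[OF z _ that]) auto
  then have "{x. partial_deriv b \<phi> x \<noteq> 0} \<subseteq> ?K" by auto
  then have sub: "closure {x. partial_deriv b \<phi> x \<noteq> 0} \<subseteq> ?K" by (rule closure_minimal) simp
  have "compact (closure {x. partial_deriv b \<phi> x \<noteq> 0})"
    using closed_Int_compact[OF closed_closure K(1)] sub by (metis Int_absorb2)
  moreover have "C_k k (partial_deriv b \<phi>)" for k
    using assms C_k.simps(2)[of k \<phi>] by (auto simp: test_functions_def)
  ultimately show ?thesis using sub K by (auto simp: test_functions_def)
qed

lemma test_functionsI:
  fixes \<phi> :: "plane \<Rightarrow> complex"
  assumes "\<And>k. C_k k \<phi>" "compact K" "K \<subseteq> \<Omega>" "\<And>p. p \<notin> K \<Longrightarrow> \<phi> p = 0"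
  shows "\<phi> \<in> test_functions \<Omega>"
proof -
  have "closure {x. \<phi> x \<noteq> 0} \<subseteq> K"
    using assms(2,4) by (intro closure_minimal) (auto simp: compact_imp_closed)
  moreover from this have "compact (closure {x. \<phi> x \<noteq> 0})"
    using closed_Int_compact[OF closed_closure assms(2)] by (metis Int_absorb2)
  ultimately show ?thesis using assms by (auto simp: test_functions_def)
qed

lemma C1_deriv: "C1 f fx fy \<Longrightarrow> (f has_derivative (\<lambda>h. fst h *\<^sub>R fx p + snd h *\<^sub>R fy p)) (at p)"
  and C1_contx: "C1 f fx fy \<Longrightarrow> continuous_on UNIV fx"
  and C1_conty: "C1 f fx fy \<Longrightarrow> continuous_on UNIV fy"
  unfolding C1_def by blast+

lemma C1I:
  assumes "\<And>p. (f has_derivative (\<lambda>h. fst h *\<^sub>R fx p + snd h *\<^sub>R fy p)) (at p)"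
    "continuous_on UNIV fx" "continuous_on UNIV fy"
  shows "C1 f fx fy"
  unfolding C1_def using assms by blast

lemma C1cE:
  assumes "C1c \<Omega> f fx fy"
  obtains K where "compact K" "K \<subseteq> \<Omega>" "\<And>p. p \<notin> K \<Longrightarrow> f p = 0" "\<And>p. p \<notin> K \<Longrightarrow> fx p = 0" "\<And>p. p \<notin> K \<Longrightarrow> fy p = 0"
  using assms unfolding C1c_def by blast

lemma C1c_C1: "C1c \<Omega> f fx fy \<Longrightarrow> C1 f fx fy"
  by (simp add: C1c_def)

section \<open>Integration of continuous functions of compact support\<close>

lemma supp_integrable:
  fixes f :: "'a::euclidean_space \<Rightarrow> 'b::{banach, second_countable_topology}"
  assumes "continuous_on UNIV f" "compact K" "\<And>p. p \<notin> K \<Longrightarrow> f p = 0"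
  shows "integrable lborel f"
proof -
  have "integrable lborel (\<lambda>x. indicator K x *\<^sub>R f x)"
    using assms(2) continuous_on_subset[OF assms(1)] by (intro borel_integrable_compact) auto
  moreover have "(\<lambda>x. indicator K x *\<^sub>R f x) = f" using assms(3) by (auto simp: fun_eq_iff indicator_def)
  ultimately show ?thesis by simp
qed

lemma continuous_measurable_lebesgue_on:
  fixes f :: "'a::euclidean_space \<Rightarrow> 'b::euclidean_space"
  assumes "continuous_on UNIV f"
  shows "f \<in> borel_measurable (lebesgue_on \<Omega>)"
  using measurable_restrict_space1[OF measurable_completion[OF borel_measurable_continuous_onI[OF assms, unfolded measurable_lborel2[symmetric]]]]
  by simp

lemma supp_integrable_on:
  fixes f :: "'a::euclidean_space \<Rightarrow> 'b::euclidean_space"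
  assumes "continuous_on UNIV f" "compact K" "\<And>p. p \<notin> K \<Longrightarrow> f p = 0" "\<Omega> \<in> sets lebesgue"
  shows "integrable (lebesgue_on \<Omega>) f"
proof -
  have m: "f \<in> borel_measurable lborel" using assms(1) by (simp add: borel_measurable_continuous_onI)
  have "integrable lebesgue f"
    using supp_integrable[OF assms(1-3)] integrable_completion[OF m] by simp
  then show ?thesis using assms(4) by (simp add: integrable_restrict_space integrable_mult_indicator)
qed

lemma supp_integral_on:
  fixes f :: "'a::euclidean_space \<Rightarrow> 'b::euclidean_space"
  assumes "continuous_on UNIV f" "\<And>p. p \<notin> \<Omega> \<Longrightarrow> f p = 0" "\<Omega> \<in> sets lebesgue"
  shows "integral\<^sup>L (lebesgue_on \<Omega>) f = integral\<^sup>L lborel f"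
proof -
  have m: "f \<in> borel_measurable lborel" using assms(1) by (simp add: borel_measurable_continuous_onI)
  have "integral\<^sup>L (lebesgue_on \<Omega>) f = integral\<^sup>L lebesgue (\<lambda>x. indicator \<Omega> x *\<^sub>R f x)"
    using assms(3) by (intro integral_restrict_space) simp
  also have "(\<lambda>x. indicator \<Omega> x *\<^sub>R f x) = f" using assms(2) by (auto simp: fun_eq_iff indicator_def)
  finally show ?thesis using integral_completion[OF m] by simp
qed

lemma supp_bounded:
  fixes f :: "'a::euclidean_space \<Rightarrow> 'b::real_normed_vector"
  assumes "continuous_on UNIV f" "compact K" "\<And>p. p \<notin> K \<Longrightarrow> f p = 0"
  obtains B where "0 \<le> B" "\<And>p. norm (f p) \<le> B"
proof -
  have "bounded (f ` K)"
    using compact_continuous_image[OF continuous_on_subset[OF assms(1)] assms(2)] by (auto intro: compact_imp_bounded)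
  then obtain B where "\<And>p. p \<in> K \<Longrightarrow> norm (f p) \<le> B" by (auto simp: bounded_iff)
  then have "norm (f p) \<le> max B 0" for p using assms(3)[of p] by (cases "p \<in> K") (auto simp: le_max_iff_disj)
  then show ?thesis using that[of "max B 0"] by auto
qed

lemma supp_sqint:
  fixes f :: "'a::euclidean_space \<Rightarrow> 'b::euclidean_space"
  assumes "continuous_on UNIV f" "compact K" "\<And>p. p \<notin> K \<Longrightarrow> f p = 0" "\<Omega> \<in> sets lebesgue"
  shows "sqint (lebesgue_on \<Omega>) f"
  unfolding sqint_def
proof
  show "f \<in> borel_measurable (lebesgue_on \<Omega>)" by (rule continuous_measurable_lebesgue_on[OF assms(1)])
  show "integrable (lebesgue_on \<Omega>) (\<lambda>x. (norm (f x))\<^sup>2)"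
    using assms by (intro supp_integrable_on[of _ K] continuous_intros) auto
qed

text \<open>A pair of close points either lies in a ball slightly larger than one that contains
  \<open>K\<close>, where compactness applies, or misses \<open>K\<close> altogether.\<close>

lemma supp_uniform:
  fixes f :: "'a::euclidean_space \<Rightarrow> 'b::real_normed_vector"
  assumes f: "continuous_on UNIV f" and K: "compact K" "\<And>p. p \<notin> K \<Longrightarrow> f p = 0" and e: "0 < e"
  obtains d where "0 < d" "\<And>p q. dist p q < d \<Longrightarrow> dist (f p) (f q) < e"
proof -
  obtain R where R: "\<And>p. p \<in> K \<Longrightarrow> norm p \<le> R" using compact_imp_bounded[OF K(1)] by (auto simp: bounded_iff)
  have "uniformly_continuous_on (cball 0 (R+1)) f"
    using continuous_on_subset[OF f] by (intro compact_uniformly_continuous) auto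
  then obtain d where d: "0 < d" "\<And>p q. p \<in> cball 0 (R+1) \<Longrightarrow> q \<in> cball 0 (R+1) \<Longrightarrow> dist q p < d \<Longrightarrow> dist (f q) (f p) < e"
    using e unfolding uniformly_continuous_on_def by meson
  have "dist (f p) (f q) < e" if "dist p q < min d 1" for p q
  proof (cases "p \<in> cball 0 (R+1) \<and> q \<in> cball 0 (R+1)")
    case True
    then show ?thesis using d(2) that by auto
  next
    case False
    have "norm q \<le> norm p + dist p q" "norm p \<le> norm q + dist p q"
      by (metis add.commute dist_commute dist_norm norm_triangle_sub)+
    then have "p \<notin> K" "q \<notin> K" using False that R[of p] R[of q] by auto
    then show ?thesis using K(2) e by simp
  qed
  then show ?thesis using that[of "min d 1"] d(1) by auto
qed

lemma lborel_integral_translate: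
  fixes f :: "'a::euclidean_space \<Rightarrow> 'b::{banach, second_countable_topology}"
  assumes "f \<in> borel_measurable borel"
  shows "(\<integral>x. f (c + x) \<partial>lborel) = (\<integral>x. f x \<partial>lborel)"
proof -
  have "(\<integral>x. f x \<partial>lborel) = (\<integral>x. f x \<partial>(distr lborel borel ((+) c)))" by (simp add: lborel_distr_plus)
  also have "\<dots> = (\<integral>x. f (c + x) \<partial>lborel)" using assms by (intro integral_distr) auto
  finally show ?thesis by simp
qed

lemma lborel_integral_reflect:
  fixes f :: "'a::euclidean_space \<Rightarrow> 'b::{banach, second_countable_topology}"
  assumes "f \<in> borel_measurable borel"
  shows "(\<integral>x. f (c - x) \<partial>lborel) = (\<integral>x. f x \<partial>lborel)"
proof -
  have "distr lborel borel (\<lambda>x::'a. c + (-1) *\<^sub>R x) = lborel"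
    by (subst (2) lborel_affine[of "-1" c]) (auto simp: density_1)
  then have "(\<integral>x. f x \<partial>lborel) = (\<integral>x. f x \<partial>(distr lborel borel (\<lambda>x. c + (-1) *\<^sub>R x)))" by simp
  also have "\<dots> = (\<integral>x. f (c + (-1) *\<^sub>R x) \<partial>lborel)" using assms by (intro integral_distr) auto
  finally show ?thesis by simp
qed

lemma C1_diff_quotient:
  fixes f :: "plane \<Rightarrow> 'b::euclidean_space"
  assumes "C1 f fx fy"
  shows "((\<lambda>t. (f (p + t *\<^sub>R b) - f p) /\<^sub>R t) \<longlongrightarrow> fst b *\<^sub>R fx p + snd b *\<^sub>R fy p) (at 0)"
proof -
  let ?D = "fst b *\<^sub>R fx p + snd b *\<^sub>R fy p"
  have "((\<lambda>t. p + t *\<^sub>R b) has_derivative (\<lambda>t. t *\<^sub>R b)) (at 0)" by (auto intro!: derivative_eq_intros)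
  moreover have "(f has_derivative (\<lambda>h. fst h *\<^sub>R fx p + snd h *\<^sub>R fy p)) (at (p + 0 *\<^sub>R b))" using C1_deriv[OF assms] by simp
  ultimately have "((\<lambda>t. f (p + t *\<^sub>R b)) has_vector_derivative ?D) (at 0)"
    unfolding has_vector_derivative_def
    by (rule has_derivative_compose[THEN has_derivative_eq_rhs]) (simp add: fun_eq_iff scaleR_add_right)
  then have "((\<lambda>t. norm (f (p + t *\<^sub>R b) - f p - t *\<^sub>R ?D) / norm t) \<longlongrightarrow> 0) (at 0)"
    unfolding has_vector_derivative_def has_derivative_at by simp
  then have "((\<lambda>t. norm ((f (p + t *\<^sub>R b) - f p) /\<^sub>R t - ?D)) \<longlongrightarrow> 0) (at 0)"
  proof (rule Lim_transform_eventually)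
    have "norm (f (p + t *\<^sub>R b) - f p - t *\<^sub>R ?D) / norm t = norm ((f (p + t *\<^sub>R b) - f p) /\<^sub>R t - ?D)" if "t \<noteq> 0" for t
    proof -
      have "(f (p + t *\<^sub>R b) - f p) /\<^sub>R t - ?D = (f (p + t *\<^sub>R b) - f p - t *\<^sub>R ?D) /\<^sub>R t"
        using that by (simp add: scaleR_diff_right)
      then show ?thesis by (simp add: divide_inverse mult.commute)
    qed
    then show "\<forall>\<^sub>F t in at 0. norm (f (p + t *\<^sub>R b) - f p - t *\<^sub>R ?D) / norm t = norm ((f (p + t *\<^sub>R b) - f p) /\<^sub>R t - ?D)"
      by (simp add: eventually_at_filter)
  qed
  then show ?thesis by (simp add: tendsto_norm_zero_iff LIM_zero_iff)
qed

lemma C1c_lipschitz: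
  fixes f :: "plane \<Rightarrow> 'b::euclidean_space"
  assumes "C1c \<Omega> f fx fy"
  obtains B where "0 \<le> B" "\<And>p q. norm (f p - f q) \<le> B * norm (p - q)"
proof -
  have C1: "C1 f fx fy" using assms by (rule C1c_C1)
  from C1cE[OF assms] obtain K where K: "compact K" "\<And>p. p \<notin> K \<Longrightarrow> f p = 0" "\<And>p. p \<notin> K \<Longrightarrow> fx p = 0" "\<And>p. p \<notin> K \<Longrightarrow> fy p = 0"
    by metis
  note d = C1_deriv[OF C1] and c = C1_contx[OF C1] C1_conty[OF C1]
  obtain B1 where B1: "0 \<le> B1" "\<And>p. norm (fx p) \<le> B1" using supp_bounded[OF c(1) K(1,3)] by blast
  obtain B2 where B2: "0 \<le> B2" "\<And>p. norm (fy p) \<le> B2" using supp_bounded[OF c(2) K(1,4)] by blast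
  define B where "B = B1 + B2"
  have B0: "0 \<le> B" using B1 B2 by (simp add: B_def)
  have on: "onorm (\<lambda>h. fst h *\<^sub>R fx p + snd h *\<^sub>R fy p) \<le> B" for p
  proof (rule onorm_bound[OF B0])
    fix h :: "plane"
    have "norm (fst h *\<^sub>R fx p + snd h *\<^sub>R fy p) \<le> \<bar>fst h\<bar> * norm (fx p) + \<bar>snd h\<bar> * norm (fy p)"
      using norm_triangle_ineq[of "fst h *\<^sub>R fx p" "snd h *\<^sub>R fy p"] by simp
    also have "\<dots> \<le> norm h * B1 + norm h * B2"
      using B1 B2 norm_fst_le[of "fst h" "snd h"] norm_snd_le[of "snd h" "fst h"] by (intro add_mono mult_mono) auto
    finally show "norm (fst h *\<^sub>R fx p + snd h *\<^sub>R fy p) \<le> B * norm h" by (simp add: B_def algebra_simps)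
  qed
  have lip: "norm (f p - f q) \<le> B * norm (p - q)" for p q
    using differentiable_bound[of UNIV f "\<lambda>p h. fst h *\<^sub>R fx p + snd h *\<^sub>R fy p" B p q] d on by simp
  then show ?thesis using that B0 by blast
qed

text \<open>Translation invariance of Lebesgue measure makes the integral of every difference
  quotient vanish. The quotients are bounded by the Lipschitz constant; as \<open>b\<close> has norm
  at most \<open>1\<close> and the steps are at most \<open>1\<close>, they all live in one ball, so
  dominated convergence applies.\<close>

lemma C1c_integral_deriv:
  fixes f :: "plane \<Rightarrow> 'b::euclidean_space"
  assumes "C1c UNIV f fx fy" "norm b \<le> 1"
  shows "(\<integral>p. fst b *\<^sub>R fx p + snd b *\<^sub>R fy p \<partial>lborel) = 0"
proof -
  have C1: "C1 f fx fy" using assms(1) by (rule C1c_C1)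
  from C1cE[OF assms(1)] obtain K where K: "compact K" "\<And>p. p \<notin> K \<Longrightarrow> f p = 0" "\<And>p. p \<notin> K \<Longrightarrow> fx p = 0" "\<And>p. p \<notin> K \<Longrightarrow> fy p = 0"
    by metis
  note d = C1_deriv[OF C1] and c = C1_contx[OF C1] C1_conty[OF C1] and cf = C1_continuous[OF C1]
  obtain B where B0: "0 \<le> B" and lip: "\<And>p q. norm (f p - f q) \<le> B * norm (p - q)"
    using C1c_lipschitz[OF assms(1)] by blast
  obtain R where R: "\<And>p. p \<in> K \<Longrightarrow> norm p \<le> R" using compact_imp_bounded[OF K(1)] by (auto simp: bounded_iff)
  define s where "s n p = real (Suc n) *\<^sub>R (f (inverse (real (Suc n)) *\<^sub>R b + p) - f p)" for n p
  have m[measurable]: "f \<in> borel_measurable borel" "fx \<in> borel_measurable borel" "fy \<in> borel_measurable borel"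
    using c cf by (auto intro: borel_measurable_continuous_onI)
  have if1: "integrable lborel (\<lambda>p. f (c + p))" for c
  proof (rule supp_integrable[where K="(\<lambda>p. p - c) ` K"])
    show "continuous_on UNIV (\<lambda>p. f (c + p))"
      by (intro continuous_on_compose2[OF cf] continuous_intros) auto
    show "compact ((\<lambda>p. p - c) ` K)" by (intro compact_continuous_image K continuous_intros)
    show "f (c + p) = 0" if "p \<notin> (\<lambda>p. p - c) ` K" for p
      using that by (intro K(2)) (auto simp: image_iff algebra_simps)
  qed
  have "(\<integral>p. s n p \<partial>lborel) = 0" for n
  proof -
    have "(\<integral>p. s n p \<partial>lborel) = real (Suc n) *\<^sub>R (\<integral>p. f (inverse (real (Suc n)) *\<^sub>R b + p) - f p \<partial>lborel)"
      unfolding s_def by simp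
    also have "(\<integral>p. f (inverse (real (Suc n)) *\<^sub>R b + p) - f p \<partial>lborel) = 0"
      using if1 if1[of 0] lborel_integral_translate[OF m(1)] by (subst Bochner_Integration.integral_diff) simp_all
    finally show ?thesis by simp
  qed
  moreover have "(\<lambda>n. \<integral>p. s n p \<partial>lborel) \<longlonglongrightarrow> (\<integral>p. fst b *\<^sub>R fx p + snd b *\<^sub>R fy p \<partial>lborel)"
  proof (rule integral_dominated_convergence[where w="\<lambda>p. indicator (cball 0 (R+1)) p *\<^sub>R B"])
    show "integrable lborel (\<lambda>p::plane. indicator (cball 0 (R+1)) p *\<^sub>R B)"
      by (rule borel_integrable_compact) (auto intro: continuous_intros)
    show "s n \<in> borel_measurable lborel" for n unfolding s_def by measurable
    show "AE p in lborel. norm (s n p) \<le> indicator (cball 0 (R+1)) p *\<^sub>R B" for n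
    proof (intro AE_I2)
      fix p :: "plane"
      let ?t = "inverse (real (Suc n))"
      have t: "0 < ?t" "?t \<le> 1" by (auto simp: inverse_le_1_iff)
      have nb: "norm (?t *\<^sub>R b) \<le> ?t" using assms(2) t by (simp add: mult_left_le)
      show "norm (s n p) \<le> indicator (cball 0 (R+1)) p *\<^sub>R B"
      proof (cases "p \<in> cball 0 (R+1)")
        case True
        have "norm (s n p) \<le> real (Suc n) * (B * norm (?t *\<^sub>R b))"
        proof -
          have "norm (s n p) = real (Suc n) * norm (f (?t *\<^sub>R b + p) - f p)"
            unfolding s_def norm_scaleR by (simp only: abs_of_nat)
          also have "\<dots> \<le> real (Suc n) * (B * norm (?t *\<^sub>R b))"
            using lip[of "?t *\<^sub>R b + p" p] by (intro mult_left_mono) (simp_all only: add_diff_cancel_right' of_nat_0_le_iff)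
          finally show ?thesis .
        qed
        also have "\<dots> \<le> real (Suc n) * (B * ?t)"
          using nb B0 by (intro mult_left_mono) auto
        also have "\<dots> = B" by simp
        finally show ?thesis using True by simp
      next
        case False
        then have "R + 1 < norm p" by simp
        moreover have "norm p \<le> norm (?t *\<^sub>R b + p) + norm (?t *\<^sub>R b)"
          using norm_triangle_ineq4[of "?t *\<^sub>R b + p" "?t *\<^sub>R b"] by simp
        ultimately have "p \<notin> K" "?t *\<^sub>R b + p \<notin> K" using R[of p] R[of "?t *\<^sub>R b + p"] nb t by linarith+
        then show ?thesis using K(2) B0 by (simp add: s_def)
      qed
    qed
    show "AE p in lborel. (\<lambda>n. s n p) \<longlonglongrightarrow> fst b *\<^sub>R fx p + snd b *\<^sub>R fy p"
    proof (intro AE_I2)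
      fix p
      note C1_diff_quotient[OF C1, of p b]
      moreover have "filterlim (\<lambda>n. inverse (real (Suc n))) (at 0) sequentially"
        using LIMSEQ_inverse_real_of_nat by (auto simp: filterlim_at)
      ultimately have "((\<lambda>n. (f (p + inverse (real (Suc n)) *\<^sub>R b) - f p) /\<^sub>R inverse (real (Suc n))) \<longlongrightarrow> fst b *\<^sub>R fx p + snd b *\<^sub>R fy p) sequentially"
        by (rule filterlim_compose)
      then show "(\<lambda>n. s n p) \<longlonglongrightarrow> fst b *\<^sub>R fx p + snd b *\<^sub>R fy p"
        by (simp add: s_def add.commute)
    qed
  qed measurable
  ultimately show ?thesis by (simp add: LIMSEQ_const_iff)
qed

section \<open>Products and convolutions\<close>

lemma C1_bounded_bilinear:
  assumes bb: "bounded_bilinear prd" and f: "C1 f fx fy" and g: "C1 g gx gy"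
  shows "C1 (\<lambda>p. prd (f p) (g p)) (\<lambda>p. prd (f p) (gx p) + prd (fx p) (g p)) (\<lambda>p. prd (f p) (gy p) + prd (fy p) (g p))"
proof -
  interpret bounded_bilinear prd by (rule bb)
  have c: "continuous_on UNIV f" "continuous_on UNIV g" using f g by (auto intro: C1_continuous)
  have "((\<lambda>p. prd (f p) (g p)) has_derivative (\<lambda>h. fst h *\<^sub>R (prd (f p) (gx p) + prd (fx p) (g p)) + snd h *\<^sub>R (prd (f p) (gy p) + prd (fy p) (g p)))) (at p)" for p
  proof -
    have "(f has_derivative (\<lambda>h. fst h *\<^sub>R fx p + snd h *\<^sub>R fy p)) (at p)" "(g has_derivative (\<lambda>h. fst h *\<^sub>R gx p + snd h *\<^sub>R gy p)) (at p)"
      using f g by (auto intro: C1_deriv)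
    from FDERIV[OF this] show ?thesis
      by (rule has_derivative_eq_rhs) (simp add: fun_eq_iff add_left add_right scaleR_left scaleR_right algebra_simps)
  qed
  then show ?thesis
    using f g c by (intro C1I continuous_intros continuous_on) (auto dest: C1_contx C1_conty)
qed

lemma C1_bounded_linear:
  assumes "bounded_linear A" "C1 f fx fy"
  shows "C1 (\<lambda>p. A (f p)) (\<lambda>p. A (fx p)) (\<lambda>p. A (fy p))"
proof -
  interpret bounded_linear A by fact
  show ?thesis
  proof (rule C1I)
    fix p
    have "(f has_derivative (\<lambda>h. fst h *\<^sub>R fx p + snd h *\<^sub>R fy p)) (at p)" using assms by (auto intro: C1_deriv)
    from has_derivative[OF this] show "((\<lambda>p. A (f p)) has_derivative (\<lambda>h. fst h *\<^sub>R A (fx p) + snd h *\<^sub>R A (fy p))) (at p)"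
      by (simp add: add scaleR)
  qed (use assms in \<open>auto intro!: continuous_on dest: C1_contx C1_conty\<close>)
qed

text \<open>Over a compact box the integrand is jointly continuous together with its derivative in
  \<open>p\<close>, so differentiation under the integral sign requires no domination
  argument.\<close>

lemma conv_C1:
  fixes R :: "plane \<Rightarrow> complex" and v :: "plane \<Rightarrow> complex"
  assumes R: "C1 R Rx Ry" and v: "continuous_on UNIV v"
  shows "C1 (\<lambda>p. integral (cbox A B) (\<lambda>q. R (p - q) * v q)) (\<lambda>p. integral (cbox A B) (\<lambda>q. Rx (p - q) * v q))
     (\<lambda>p. integral (cbox A B) (\<lambda>q. Ry (p - q) * v q))"
proof -
  have cR: "continuous_on UNIV R" "continuous_on UNIV Rx" "continuous_on UNIV Ry"
    using R C1_continuous[OF R] by (auto simp: C1_def)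
  have c: "continuous_on S (\<lambda>z. S' (fst z - snd z) * v (snd z))" if "continuous_on UNIV S'" for S' S
    by (intro continuous_intros continuous_on_compose2[OF that] continuous_on_compose2[OF v]) auto
  have int: "(\<lambda>q. S' (p - q) * v q) integrable_on cbox A B" if "continuous_on UNIV S'" for S' p
    by (intro integrable_continuous continuous_intros continuous_on_compose2[OF that] continuous_on_compose2[OF v]) auto
  let ?fx = "\<lambda>p q. (blinfun_scaleR_left (Rx (p - q) * v q) o\<^sub>L fst_blinfun) + (blinfun_scaleR_left (Ry (p - q) * v q) o\<^sub>L snd_blinfun)"
  have cfx: "continuous_on S (\<lambda>(p,q). ?fx p q)" for S
    unfolding split_def
    by (intro continuous_intros c cR bounded_linear.continuous_on[OF bounded_linear_blinfun_scaleR_left])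
  have "((\<lambda>p. integral (cbox A B) (\<lambda>q. R (p - q) * v q)) has_derivative integral (cbox A B) (?fx p)) (at p within UNIV)" for p
  proof (rule leibniz_rule[where fx="?fx"])
    show "((\<lambda>p. R (p - q) * v q) has_derivative blinfun_apply (?fx p q)) (at p within UNIV)" for p q
    proof -
      have "((\<lambda>p. p - q) has_derivative (\<lambda>h. h)) (at p)" by (auto intro!: derivative_eq_intros)
      moreover have "(R has_derivative (\<lambda>h. fst h *\<^sub>R Rx (p - q) + snd h *\<^sub>R Ry (p - q))) (at (p - q))"
        using R by (rule C1_deriv)
      ultimately have "((\<lambda>p. R (p - q)) has_derivative (\<lambda>h. fst h *\<^sub>R Rx (p - q) + snd h *\<^sub>R Ry (p - q))) (at p)"
        by (rule has_derivative_compose)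
      from has_derivative_mult_left[OF this, of "v q"] show ?thesis
        by (rule has_derivative_eq_rhs) (simp add: fun_eq_iff blinfun.add_left algebra_simps)
    qed
  qed (use int[OF cR(1)] cfx in auto)
  moreover have "blinfun_apply (integral (cbox A B) (?fx p)) = (\<lambda>h. fst h *\<^sub>R integral (cbox A B) (\<lambda>q. Rx (p - q) * v q) + snd h *\<^sub>R integral (cbox A B) (\<lambda>q. Ry (p - q) * v q))" for p
  proof
    fix h
    have "?fx p integrable_on cbox A B"
    proof (rule integrable_continuous)
      show "continuous_on (cbox A B) (?fx p)"
        by (intro continuous_intros bounded_linear.continuous_on[OF bounded_linear_blinfun_scaleR_left]
            continuous_on_compose2[OF cR(2)] continuous_on_compose2[OF cR(3)] continuous_on_compose2[OF v]) auto
    qed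
    then have "blinfun_apply (integral (cbox A B) (?fx p)) h = integral (cbox A B) (\<lambda>q. blinfun_apply (?fx p q) h)"
      by (rule blinfun_apply_integral)
    also have "\<dots> = integral (cbox A B) (\<lambda>q. fst h *\<^sub>R (Rx (p - q) * v q) + snd h *\<^sub>R (Ry (p - q) * v q))"
      by (simp add: blinfun.add_left)
    also have "\<dots> = fst h *\<^sub>R integral (cbox A B) (\<lambda>q. Rx (p - q) * v q) + snd h *\<^sub>R integral (cbox A B) (\<lambda>q. Ry (p - q) * v q)"
      by (subst Henstock_Kurzweil_Integration.integral_add) (auto intro!: integrable_cmul int cR)
    finally show "blinfun_apply (integral (cbox A B) (?fx p)) h = fst h *\<^sub>R integral (cbox A B) (\<lambda>q. Rx (p - q) * v q) + snd h *\<^sub>R integral (cbox A B) (\<lambda>q. Ry (p - q) * v q)" .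
  qed
  moreover have "continuous_on UNIV (\<lambda>p. integral (cbox A B) (\<lambda>q. S (p - q) * v q))" if "continuous_on UNIV S" for S
    using c[OF that] by (intro integral_continuous_on_param) (simp add: split_def)
  ultimately show ?thesis using cR by (intro C1I) simp_all
qed

lemma conv_C_k:
  fixes R :: "plane \<Rightarrow> complex" and v :: "plane \<Rightarrow> complex"
  assumes v: "continuous_on UNIV v" and R: "C_k k R"
  shows "C_k k (\<lambda>p. integral (cbox A B) (\<lambda>q. R (p - q) * v q))"
  using R
proof (induction k arbitrary: R)
  case 0
  have "continuous_on UNIV (\<lambda>z. R (fst z - snd z) * v (snd z))"
    by (intro continuous_intros continuous_on_compose2[OF v] continuous_on_compose2[OF 0[simplified]]) auto
  then have "continuous_on (UNIV \<times> cbox A B) (\<lambda>(p, q). R (p - q) * v q)"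
    unfolding split_def by (rule continuous_on_subset) simp
  then show ?case by (simp add: integral_continuous_on_param)
next
  case (Suc k)
  show ?case
    by (rule C1_C_k[OF conv_C1[OF C_k_C1[OF Suc.prems] v]]) (use Suc in \<open>auto simp: Basis_real2\<close>)
qed

section \<open>The Sobolev space\<close>

text \<open>An element of the Sobolev space is a triple \<open>(u, u\<^sub>x, u\<^sub>y)\<close>: the weak derivatives are carried along as
  data, and the closure of the test functions is taken in \<open>L\<^sup>2\<close> of such triples.\<close>

definition jet :: "('a \<Rightarrow> complex) \<Rightarrow> ('a \<Rightarrow> complex) \<Rightarrow> ('a \<Rightarrow> complex) \<Rightarrow> 'a \<Rightarrow> complex \<times> complex \<times> complex" where
  "jet u p q = (\<lambda>x. (u x, p x, q x))"

definition H10 :: "plane set \<Rightarrow> (plane \<Rightarrow> complex \<times> complex \<times> complex) set" where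
  "H10 \<Omega> = {U. \<exists>\<phi>. (\<forall>n. \<phi> n \<in> test_functions \<Omega>) \<and>
     L2lim (lebesgue_on \<Omega>) (\<lambda>n. jet (\<phi> n) (dx (\<phi> n)) (dy (\<phi> n))) U}"

lemma uniform_L2lim:
  fixes F :: "nat \<Rightarrow> plane \<Rightarrow> 'b::euclidean_space"
  assumes "\<And>n. continuous_on UNIV (F n)" "continuous_on UNIV G" "compact K"
    and "\<And>n p. p \<notin> K \<Longrightarrow> F n p = 0" "\<And>p. p \<notin> K \<Longrightarrow> G p = 0"
    and u: "uniform_limit UNIV F G sequentially" and \<Omega>: "\<Omega> \<in> sets lebesgue"
  shows "L2lim (lebesgue_on \<Omega>) F G"
proof -
  let ?M = "lebesgue_on \<Omega>"
  have s: "sqint ?M (F n)" "sqint ?M G" for n using assms by (auto intro!: supp_sqint[where K=K])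
  define c where "c = (\<integral>p. indicator K p \<partial>?M :: real)"
  have c0: "0 \<le> c" unfolding c_def by (intro Bochner_Integration.integral_nonneg) auto
  have K1: "integrable ?M (\<lambda>p. indicator K p :: real)"
  proof -
    have "integrable lborel (\<lambda>p::plane. indicator K p *\<^sub>R (1::real))"
      by (rule borel_integrable_compact) (auto intro: assms)
    then have "integrable lebesgue (\<lambda>p::plane. indicator K p :: real)"
      using assms(3) by (subst integrable_completion) (auto simp: borel_compact)
    then show ?thesis using \<Omega> integrable_mult_indicator[of \<Omega> lebesgue "indicator K :: _ \<Rightarrow> real"]
      by (simp add: integrable_restrict_space)
  qed
  have "(\<lambda>n. nrm ?M (\<lambda>x. F n x - G x)) \<longlonglongrightarrow> 0"
  proof (rule LIMSEQ_I)
    fix e :: real assume e: "0 < e"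
    \<comment> \<open>A sup bound \<open>d\<close> gives the norm bound \<open>d * sqrt c\<close>,
      as \<open>c\<close> is the measure of the part of the common support in \<Omega>; the
      \<open>+ 1\<close> covers \<open>c = 0\<close>.\<close>
    define d where "d = e / (2 * sqrt (c + 1))"
    have d: "0 < d" using e c0 by (simp add: d_def)
    obtain N where N: "\<And>n p. n \<ge> N \<Longrightarrow> dist (F n p) (G p) < d"
      using uniform_limitD[OF u d] by (auto simp: eventually_sequentially)
    show "\<exists>no. \<forall>n\<ge>no. norm (nrm ?M (\<lambda>x. F n x - G x) - 0) < e"
    proof (intro exI allI impI)
      fix n assume n: "N \<le> n"
      have "(nrm ?M (\<lambda>x. F n x - G x))\<^sup>2 \<le> (\<integral>p. d\<^sup>2 * indicator K p \<partial>?M)"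
        unfolding nrm_sq
      proof (rule integral_mono)
        show "integrable ?M (\<lambda>x. (norm (F n x - G x))\<^sup>2)" using sqint_diff[OF s] by (simp add: sqint_def)
        show "(norm (F n p - G p))\<^sup>2 \<le> d\<^sup>2 * indicator K p" for p
          using N[OF n, of p] assms(4,5)[of p] by (cases "p \<in> K") (auto simp: dist_norm intro!: power_mono)
      qed (use K1 in simp)
      also have "\<dots> = d\<^sup>2 * c" by (simp add: c_def)
      also have "\<dots> \<le> (d * sqrt (c + 1))\<^sup>2" using c0 by (simp add: power_mult_distrib mult_left_mono)
      also have "d * sqrt (c + 1) = e / 2" using c0 by (simp add: d_def)
      finally have "nrm ?M (\<lambda>x. F n x - G x) \<le> e / 2"
        by (rule power2_le_imp_le) (use e in simp)
      then show "norm (nrm ?M (\<lambda>x. F n x - G x) - 0) < e" using e by simp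
    qed
  qed
  then show ?thesis using s by (simp add: L2lim_def)
qed

lemma uniform_limit_Pair:
  assumes "uniform_limit S f l F" "uniform_limit S g m F"
  shows "uniform_limit S (\<lambda>n x. (f n x, g n x)) (\<lambda>x. (l x, m x)) F"
proof (rule uniform_limitI)
  fix e :: real assume e: "0 < e"
  have "\<forall>\<^sub>F n in F. \<forall>x\<in>S. dist (f n x) (l x) < e/2" "\<forall>\<^sub>F n in F. \<forall>x\<in>S. dist (g n x) (m x) < e/2"
    using uniform_limitD[OF assms(1), of "e/2"] uniform_limitD[OF assms(2), of "e/2"] e by simp_all
  then show "\<forall>\<^sub>F n in F. \<forall>x\<in>S. dist (f n x, g n x) (l x, m x) < e"
  proof eventually_elim
    case (elim n)
    show ?case
    proof
      fix x assume "x \<in> S"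
      then have "dist (f n x) (l x) + dist (g n x) (m x) < e" using elim by (smt (verit) field_sum_of_halves)
      moreover have "dist (f n x, g n x) (l x, m x) \<le> dist (f n x) (l x) + dist (g n x) (m x)"
        unfolding dist_Pair_Pair by (rule sqrt_sum_squares_le_sum) auto
      ultimately show "dist (f n x, g n x) (l x, m x) < e" by linarith
    qed
  qed
qed

section \<open>Mollification at scale \<open>1/r\<close>\<close>

definition mollify :: "real \<Rightarrow> (plane \<Rightarrow> complex) \<Rightarrow> plane \<Rightarrow> complex" where
  "mollify r v p = (\<integral>q. complex_of_real (bump r (p - q)) * v q \<partial>lborel) / complex_of_real (\<integral>q. bump r q \<partial>lborel)"

lemma bump_continuous: "continuous_on UNIV (bump r)"
proof -
  have "continuous_on UNIV (\<lambda>p. Re (complex_of_real (bump r p)))"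
    using C_k_bump[of 0 r] by (intro continuous_intros) simp
  then show ?thesis by simp
qed

lemma bump_outside: "0 < r \<Longrightarrow> p \<notin> cball 0 (2/r) \<Longrightarrow> bump r p = 0"
proof (rule ccontr)
  assume "0 < r" "p \<notin> cball 0 (2/r)" "bump r p \<noteq> 0"
  then have "\<bar>fst p\<bar> < 1/r" "\<bar>snd p\<bar> < 1/r" "2/r < norm p" using bump_support by auto
  moreover have "norm p \<le> \<bar>fst p\<bar> + \<bar>snd p\<bar>" using norm_Pair_le[of "fst p" "snd p"] by simp
  ultimately show False by simp
qed

lemma bump_integrable: "0 < r \<Longrightarrow> integrable lborel (bump r)"
  by (rule supp_integrable[OF bump_continuous, where K="cball 0 (2/r)"]) (auto simp del: mem_cball intro: bump_outside)

lemma bump_integral_pos: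
  assumes r: "0 < r"
  shows "0 < (\<integral>q. bump r q \<partial>lborel)"
proof -
  have "open {p. bump r p > bump r 0 / 2}"
    using bump_continuous by (intro open_Collect_less continuous_intros) auto
  moreover have "0 \<in> {p. bump r p > bump r 0 / 2}" using bump_zero[of r] by simp
  ultimately obtain e where e: "0 < e" "ball 0 e \<subseteq> {p. bump r p > bump r 0 / 2}"
    using open_contains_ball by blast
  have "0 < bump r 0 / 2 * measure lborel (ball (0::plane) e)"
    using bump_zero[of r] e(1) by (intro mult_pos_pos content_ball_pos) auto
  also have "\<dots> = (\<integral>q. indicator (ball (0::plane) e) q *\<^sub>R (bump r 0 / 2) \<partial>lborel)"
    by simp
  also have "\<dots> \<le> (\<integral>q. bump r q \<partial>lborel)"
  proof (rule integral_mono)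
    show "integrable lborel (\<lambda>q::plane. indicator (ball 0 e) q *\<^sub>R (bump r 0 / 2))"
      by (intro integrable_indicator_iff[THEN iffD2] integrable_scaleR_left) (use emeasure_bounded_finite[OF bounded_ball, of "0 :: plane" e] in simp_all)
    show "integrable lborel (bump r)" by (rule bump_integrable[OF r])
    show "indicator (ball 0 e) q *\<^sub>R (bump r 0 / 2) \<le> bump r q" for q
    proof (cases "q \<in> ball 0 e")
      case True
      then have "bump r q > bump r 0 / 2" using e(2) by blast
      then show ?thesis using True by simp
    qed (use bump_nonneg[of r q] in simp)
  qed
  finally show ?thesis .
qed

lemma mollify_integrable:
  assumes v: "continuous_on UNIV v" "compact K" "\<And>p. p \<notin> K \<Longrightarrow> v p = (0::complex)"
    and S: "continuous_on UNIV (S :: plane \<Rightarrow> complex)"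
  shows "integrable lborel (\<lambda>q. S (p - q) * v q)"
  by (rule supp_integrable[OF _ v(2)]) (auto intro!: continuous_intros continuous_on_compose2[OF S] v simp: v)

lemma mollify_conv:
  assumes v: "continuous_on UNIV v" "compact K" "\<And>p. p \<notin> K \<Longrightarrow> v p = (0::complex)"
    and S: "continuous_on UNIV (S :: plane \<Rightarrow> complex)" and A: "K \<subseteq> cbox A B"
  shows "(\<integral>q. S (p - q) * v q \<partial>lborel) = integral (cbox A B) (\<lambda>q. S (p - q) * v q)"
proof -
  have "(\<integral>q. S (p - q) * v q \<partial>lborel) = integral UNIV (\<lambda>q. S (p - q) * v q)"
    by (rule integral_lborel[symmetric]) (rule mollify_integrable[OF assms(1-4)])
  also have "\<dots> = integral UNIV (\<lambda>q. if q \<in> cbox A B then S (p - q) * v q else 0)"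
    using A v(3) by (intro arg_cong[of _ _ "integral UNIV"]) (auto simp: fun_eq_iff)
  also have "\<dots> = integral (cbox A B) (\<lambda>q. S (p - q) * v q)" by (rule integral_restrict_UNIV)
  finally show ?thesis .
qed

lemma mollify_C_k:
  assumes v: "continuous_on UNIV v" "compact K" "\<And>p. p \<notin> K \<Longrightarrow> v p = (0::complex)"
  shows "C_k k (mollify r v)"
proof -
  obtain A where A: "K \<subseteq> cbox (-A) A" using bounded_subset_cbox_symmetric[OF compact_imp_bounded[OF v(2)]] by blast
  have "C_k k (\<lambda>p. integral (cbox (-A) A) (\<lambda>q. complex_of_real (bump r (p - q)) * v q) * (1 / complex_of_real (\<integral>q. bump r q \<partial>lborel)))"
    by (intro C_k_mult C_k_const conv_C_k v(1) C_k_bump)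
  moreover have "mollify r v = (\<lambda>p. integral (cbox (-A) A) (\<lambda>q. complex_of_real (bump r (p - q)) * v q) * (1 / complex_of_real (\<integral>q. bump r q \<partial>lborel)))"
    using mollify_conv[OF v, of "\<lambda>p. complex_of_real (bump r p)" "-A" A] bump_continuous A
    by (auto simp: fun_eq_iff mollify_def intro!: continuous_intros)
  ultimately show ?thesis by simp
qed

text \<open>\<open>conv_C1\<close> puts the derivative on the kernel. Integrating the derivative of
  \<open>q\<close>-dependent product of kernel and \<open>v\<close>, which is zero, moves it over to
  \<open>v\<close>; the sign comes from the reflection in \<open>p - q\<close>.\<close>

lemma mollify_C1:
  assumes "C1c \<Omega> v vx vy"
  shows "C1 (mollify r v) (mollify r vx) (mollify r vy)"
proof -
  note C1 = C1c_C1[OF assms]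
  from C1cE[OF assms] obtain K where K: "compact K" "\<And>p. p \<notin> K \<Longrightarrow> v p = 0" "\<And>p. p \<notin> K \<Longrightarrow> vx p = 0" "\<And>p. p \<notin> K \<Longrightarrow> vy p = 0"
    by metis
  note c = C1_continuous[OF C1] C1_contx[OF C1] C1_conty[OF C1]
  obtain A where A: "K \<subseteq> cbox (-A) A" using bounded_subset_cbox_symmetric[OF compact_imp_bounded[OF K(1)]] by blast
  let ?R = "\<lambda>p. complex_of_real (bump r p)"
  let ?c = "complex_of_real (\<integral>q. bump r q \<partial>lborel)"
  define Rx where "Rx = dx ?R"
  define Ry where "Ry = dy ?R"
  have R: "C1 ?R Rx Ry" unfolding Rx_def Ry_def by (rule C_k_C1[OF C_k_bump])
  note cR = C1_continuous[OF R] C1_contx[OF R] C1_conty[OF R]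
  have refl: "C1 (\<lambda>q. ?R (p - q)) (\<lambda>q. - Rx (p - q)) (\<lambda>q. - Ry (p - q))" for p
  proof (rule C1I)
    fix q
    have "((\<lambda>q. p - q) has_derivative (\<lambda>h. - h)) (at q)" by (auto intro!: derivative_eq_intros)
    from has_derivative_compose[OF this C1_deriv[OF R]]
    show "((\<lambda>q. ?R (p - q)) has_derivative (\<lambda>h. fst h *\<^sub>R - Rx (p - q) + snd h *\<^sub>R - Ry (p - q))) (at q)"
      by (rule has_derivative_eq_rhs) (simp add: fun_eq_iff)
  qed (auto intro!: continuous_intros continuous_on_compose2[OF cR(2)] continuous_on_compose2[OF cR(3)])
  have prod: "C1c UNIV (\<lambda>q. ?R (p - q) * v q) (\<lambda>q. ?R (p - q) * vx q + - Rx (p - q) * v q) (\<lambda>q. ?R (p - q) * vy q + - Ry (p - q) * v q)" for p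
    unfolding C1c_def using C1_bounded_bilinear[OF bounded_bilinear_mult refl C1] K by (auto intro!: exI[of _ K])
  note mi = mollify_integrable[OF _ K(1)]
  have x: "(\<integral>q. Rx (p - q) * v q \<partial>lborel) = (\<integral>q. ?R (p - q) * vx q \<partial>lborel)" for p
  proof -
    have "0 = (\<integral>q. ?R (p - q) * vx q - Rx (p - q) * v q \<partial>lborel)"
      using C1c_integral_deriv[OF prod, of "(1,0)"] by simp
    also have "\<dots> = (\<integral>q. ?R (p - q) * vx q \<partial>lborel) - (\<integral>q. Rx (p - q) * v q \<partial>lborel)"
      by (intro Bochner_Integration.integral_diff mi c K cR)
    finally show ?thesis by simp
  qed
  have y: "(\<integral>q. Ry (p - q) * v q \<partial>lborel) = (\<integral>q. ?R (p - q) * vy q \<partial>lborel)" for p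
  proof -
    have "0 = (\<integral>q. ?R (p - q) * vy q - Ry (p - q) * v q \<partial>lborel)"
      using C1c_integral_deriv[OF prod, of "(0,1)"] by simp
    also have "\<dots> = (\<integral>q. ?R (p - q) * vy q \<partial>lborel) - (\<integral>q. Ry (p - q) * v q \<partial>lborel)"
      by (intro Bochner_Integration.integral_diff mi c K cR)
    finally show ?thesis by simp
  qed
  note mc = mollify_conv[OF _ K(1) _ _ A]
  have bl: "bounded_linear (\<lambda>z::complex. z / ?c)" by (rule bounded_linear_divide)
  have "C1 (\<lambda>p. \<integral>q. ?R (p - q) * v q \<partial>lborel) (\<lambda>p. \<integral>q. Rx (p - q) * v q \<partial>lborel) (\<lambda>p. \<integral>q. Ry (p - q) * v q \<partial>lborel)"
    using conv_C1[OF R c(1), of "-A" A] mc[OF c(1) K(2) cR(1)] mc[OF c(1) K(2) cR(2)] mc[OF c(1) K(2) cR(3)] by simp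
  from C1_bounded_linear[OF bl this] show ?thesis unfolding mollify_def x y .
qed

text \<open>The normalised kernel is a probability density living at distance at most
  \<open>2/r\<close>, so the error is an average of oscillations of \<open>v\<close> at that
  scale.\<close>

lemma mollify_close:
  assumes v: "continuous_on UNIV v" "compact K" "\<And>p. p \<notin> K \<Longrightarrow> v p = (0::complex)"
    and r: "0 < r" and d: "\<And>p q. dist p q \<le> 2/r \<Longrightarrow> norm (v p - v q) \<le> e" and e: "0 \<le> e"
  shows "norm (mollify r v p - v p) \<le> e"
proof -
  let ?c = "\<integral>q. bump r q \<partial>lborel"
  have c: "0 < ?c" by (rule bump_integral_pos[OF r])
  have m: "bump r \<in> borel_measurable borel" by (rule borel_measurable_continuous_onI[OF bump_continuous])
  have ic: "(\<integral>q. bump r (p - q) \<partial>lborel) = ?c" by (rule lborel_integral_reflect[OF m])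
  then have i1: "integrable lborel (\<lambda>q. bump r (p - q))"
    using c not_integrable_integral_eq by fastforce
  have i2: "integrable lborel (\<lambda>q. complex_of_real (bump r (p - q)) * v q)"
    using mollify_integrable[OF v, of "\<lambda>p. complex_of_real (bump r p)"] bump_continuous by (auto intro: continuous_intros)
  have i3: "integrable lborel (\<lambda>q. complex_of_real (bump r (p - q)) * v p)"
    using i1 by (intro integrable_mult_left integrable_of_real)
  have "norm ((mollify r v p - v p) * ?c) = norm ((\<integral>q. complex_of_real (bump r (p - q)) * v q \<partial>lborel) - (\<integral>q. complex_of_real (bump r (p - q)) * v p \<partial>lborel))"
    using c i1 by (simp add: mollify_def ic algebra_simps)
  also have "(\<integral>q. complex_of_real (bump r (p - q)) * v q \<partial>lborel) - (\<integral>q. complex_of_real (bump r (p - q)) * v p \<partial>lborel)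
     = (\<integral>q. complex_of_real (bump r (p - q)) * (v q - v p) \<partial>lborel)"
    using i2 i3 by (subst Bochner_Integration.integral_diff[symmetric]) (simp_all add: algebra_simps)
  also have "norm \<dots> \<le> (\<integral>q. norm (complex_of_real (bump r (p - q)) * (v q - v p)) \<partial>lborel)"
    by (rule integral_norm_bound)
  also have "\<dots> \<le> (\<integral>q. bump r (p - q) * e \<partial>lborel)"
  proof (rule integral_mono)
    have "integrable lborel (\<lambda>q. complex_of_real (bump r (p - q)) * (v q - v p))"
      using Bochner_Integration.integrable_diff[OF i2 i3] by (simp add: algebra_simps)
    then show "integrable lborel (\<lambda>q. norm (complex_of_real (bump r (p - q)) * (v q - v p)))" by (rule integrable_norm)
    show "norm (complex_of_real (bump r (p - q)) * (v q - v p)) \<le> bump r (p - q) * e" for q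
    proof (cases "p - q \<in> cball 0 (2/r)")
      case True
      then have "norm (v q - v p) \<le> e" by (intro d) (auto simp: dist_norm norm_minus_commute)
      then show ?thesis using bump_nonneg[of r "p - q"] by (simp add: norm_mult mult_left_mono)
    next
      case False
      then show ?thesis using bump_outside[OF r] by simp
    qed
  qed (use i1 in simp)
  also have "\<dots> = e * ?c" using ic by simp
  finally have "norm (mollify r v p - v p) * ?c \<le> e * ?c" using c by (simp add: norm_mult)
  then show ?thesis using c by simp
qed

lemma mollify_outside:
  assumes "\<And>p. p \<notin> K \<Longrightarrow> v p = (0::complex)" "0 < r" "2/r \<le> e" "p \<notin> (\<Union>x\<in>K. \<Union>y\<in>cball 0 e. {x + y})"
  shows "mollify r v p = 0"
proof -
  have "complex_of_real (bump r (p - q)) * v q = 0" for q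
  proof (cases "q \<in> K")
    case True
    have "p - q \<notin> cball 0 e"
    proof
      assume "p - q \<in> cball 0 e"
      then have "q + (p - q) \<in> (\<Union>x\<in>K. \<Union>y\<in>cball 0 e. {x + y})" using True by blast
      then show False using assms(4) by simp
    qed
    then have "p - q \<notin> cball 0 (2/r)" using assms(3) by auto
    then show ?thesis using bump_outside[OF assms(2)] by simp
  qed (use assms(1) in simp)
  then show ?thesis unfolding mollify_def by (simp only: Bochner_Integration.integral_zero div_0)
qed

lemma mollify_uniform:
  assumes v: "continuous_on UNIV v" "compact K" "\<And>p. p \<notin> K \<Longrightarrow> v p = (0::complex)"
    and r: "\<And>n::nat. real n < r n"
  shows "uniform_limit UNIV (\<lambda>n. mollify (r n) v) v sequentially"
proof (rule uniform_limitI)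
  fix e :: real assume e: "0 < e"
  obtain d where d: "0 < d" "\<And>p q. dist p q < d \<Longrightarrow> dist (v p) (v q) < e/2"
    using supp_uniform[OF v, of "e/2"] e by auto
  obtain N where N: "2 / d < real N" using reals_Archimedean2 by blast
  have N0: "0 < real N" by (rule less_trans[OF _ N]) (use d in simp)
  have "dist (mollify (r n) v p) (v p) < e" if n: "N \<le> n" for n p
  proof -
    have rN: "real N < r n" using r[of n] n by linarith
    have r0: "0 < r n" using rN N0 by linarith
    have "2 / d < r n" using N rN by linarith
    then have "2 / r n < d" using d r0 by (simp add: pos_divide_less_eq mult.commute)
    then have "norm (mollify (r n) v p - v p) \<le> e/2"
      using d(2) e r0 by (intro mollify_close[OF v r0]) (auto simp: dist_norm intro: less_imp_le)
    then show ?thesis using e by (simp add: dist_norm)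
  qed
  then show "\<forall>\<^sub>F n in sequentially. \<forall>p\<in>UNIV. dist (mollify (r n) v p) (v p) < e"
    by (auto simp: eventually_sequentially)
qed

text \<open>Mollifications converge uniformly together with their first derivatives, and their
  supports stay in one compact neighbourhood \<open>K'\<close> of the support inside \<Omega>. The
  result is needed because the pullback of a test function along the vector field is only of class
  C^1.\<close>

lemma C1c_in_H10:
  assumes \<Omega>: "open \<Omega>" and v: "C1c \<Omega> v vx vy"
  shows "jet v vx vy \<in> H10 \<Omega>"
proof -
  note C1 = C1c_C1[OF v]
  from C1cE[OF v] obtain K where K: "compact K" "\<And>p. p \<notin> K \<Longrightarrow> v p = 0" "\<And>p. p \<notin> K \<Longrightarrow> vx p = 0" "\<And>p. p \<notin> K \<Longrightarrow> vy p = 0" "K \<subseteq> \<Omega>"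
    by metis
  note c = C1_continuous[OF C1] C1_contx[OF C1] C1_conty[OF C1]
  obtain e where e: "0 < e" "(\<Union>x\<in>K. cball x e) \<subseteq> \<Omega>"
    using compact_subset_open_imp_cball_epsilon_subset[OF K(1) \<Omega> K(5)] by blast
  define K' where "K' = (\<Union>x\<in>K. \<Union>y\<in>cball 0 e. {x + y})"
  have K': "compact K'" unfolding K'_def by (rule compact_sums'[OF K(1) compact_cball])
  have K'\<Omega>: "K' \<subseteq> \<Omega>"
  proof -
    have "K' \<subseteq> (\<Union>x\<in>K. cball x e)" unfolding K'_def by (auto simp: dist_norm)
    then show ?thesis using e(2) by blast
  qed
  have KK': "K \<subseteq> K'" unfolding K'_def using e(1) by force
  \<comment> \<open>The summand \<open>2 / e\<close> makes the kernel radius \<open>2 / r n\<close>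
    at most \<open>e\<close>, which keeps the supports in \<open>K'\<close>; \<open>real n\<close>
    sends the scale to zero.\<close>
  define r where "r n = 2 / e + real n + 1" for n :: nat
  have r: "0 < r n" "2 / r n \<le> e" "real n < r n" for n
  proof -
    show 1: "0 < r n" using e by (simp add: r_def add_pos_nonneg)
    have "2 / e \<le> r n" by (simp add: r_def)
    then show "2 / r n \<le> e" using e 1 by (simp add: pos_divide_le_eq mult.commute)
    show "real n < r n" using e by (simp add: r_def add_pos_nonneg)
  qed
  let ?\<phi> = "\<lambda>n. mollify (r n) v"
  have test: "?\<phi> n \<in> test_functions \<Omega>" for n
    by (rule test_functionsI[OF mollify_C_k[OF c(1) K(1,2)] K' K'\<Omega> mollify_outside[OF K(2) r(1,2)]]) (auto simp: K'_def)
  have jet: "jet (?\<phi> n) (dx (?\<phi> n)) (dy (?\<phi> n)) = jet (?\<phi> n) (mollify (r n) vx) (mollify (r n) vy)" for n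
    using C1_partial[OF mollify_C1[OF v]] by simp
  have out: "mollify (r n) w p = 0" if "\<And>p. p \<notin> K \<Longrightarrow> w p = 0" "p \<notin> K'" for n w p
    by (rule mollify_outside[OF that(1) r(1,2)]) (use that in \<open>auto simp: K'_def\<close>)
  have cm: "continuous_on UNIV (mollify (r n) w)" if "continuous_on UNIV w" "\<And>p. p \<notin> K \<Longrightarrow> w p = 0" for n w
    using mollify_C_k[OF that(1) K(1) that(2), of 0] by simp
  have "L2lim (lebesgue_on \<Omega>) (\<lambda>n. jet (?\<phi> n) (mollify (r n) vx) (mollify (r n) vy)) (jet v vx vy)"
  proof (rule uniform_L2lim[OF _ _ K'])
    show "continuous_on UNIV (jet (?\<phi> n) (mollify (r n) vx) (mollify (r n) vy))" for n
      unfolding jet_def by (intro continuous_intros cm c K)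
    show "continuous_on UNIV (jet v vx vy)" unfolding jet_def by (intro continuous_intros c)
    show "jet (?\<phi> n) (mollify (r n) vx) (mollify (r n) vy) p = 0" if "p \<notin> K'" for n p
      using out[OF K(2) that] out[OF K(3) that] out[OF K(4) that] by (simp add: jet_def zero_prod_def)
    show "jet v vx vy p = 0" if "p \<notin> K'" for p
      using K(2-4)[of p] that KK' by (auto simp: jet_def zero_prod_def)
    have u: "uniform_limit UNIV (\<lambda>n. mollify (r n) w) w sequentially" if "continuous_on UNIV w" "\<And>p. p \<notin> K \<Longrightarrow> w p = 0" for w
      by (rule mollify_uniform[OF that(1) K(1) that(2) r(3)])
    show "uniform_limit UNIV (\<lambda>n. jet (?\<phi> n) (mollify (r n) vx) (mollify (r n) vy)) (jet v vx vy) sequentially"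
      unfolding jet_def by (intro uniform_limit_Pair u c K)
    show "\<Omega> \<in> sets lebesgue" using \<Omega> by auto
  qed
  then show ?thesis unfolding H10_def using test jet by (intro CollectI exI[of _ ?\<phi>]) simp
qed

lemma C1cI:
  assumes "C1 f fx fy" "compact K" "K \<subseteq> \<Omega>" "\<And>p. p \<notin> K \<Longrightarrow> f p = 0" "\<And>p. p \<notin> K \<Longrightarrow> fx p = 0" "\<And>p. p \<notin> K \<Longrightarrow> fy p = 0"
  shows "C1c \<Omega> f fx fy"
  unfolding C1c_def using assms by blast

lemma jet_simps [simp]: "fst (jet u p q x) = u x" "fst (snd (jet u p q x)) = p x" "snd (snd (jet u p q x)) = q x"
  by (simp_all add: jet_def)

lemma sqint_jet_iff: "sqint M (jet u p q) \<longleftrightarrow> sqint M u \<and> sqint M p \<and> sqint M q"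
proof
  assume "sqint M (jet u p q)"
  from sqint_bounded_linear[OF _ this, of fst] sqint_bounded_linear[OF _ this, of "\<lambda>x. fst (snd x)"]
    sqint_bounded_linear[OF _ this, of "\<lambda>x. snd (snd x)"]
  show "sqint M u \<and> sqint M p \<and> sqint M q"
    by (simp add: bounded_linear_fst bounded_linear_snd bounded_linear_fst_comp bounded_linear_snd_comp)
next
  assume a: "sqint M u \<and> sqint M p \<and> sqint M q"
  then have [measurable]: "u \<in> borel_measurable M" "p \<in> borel_measurable M" "q \<in> borel_measurable M"
    by (auto simp: sqint_def)
  have "integrable M (\<lambda>x. (norm (u x))\<^sup>2 + ((norm (p x))\<^sup>2 + (norm (q x))\<^sup>2))"
    using a by (simp add: sqint_def)
  then show "sqint M (jet u p q)"
    unfolding sqint_def jet_def by (simp add: norm_Pair)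
qed

lemma norm_jet_sq: "(norm (jet u p q x))\<^sup>2 = (norm (u x))\<^sup>2 + (norm (p x))\<^sup>2 + (norm (q x))\<^sup>2"
  by (simp add: jet_def norm_Pair)

lemma L2lim_fst: "L2lim M F G \<Longrightarrow> L2lim M (\<lambda>n x. fst (F n x)) (\<lambda>x. fst (G x))"
  for F :: "nat \<Rightarrow> 'a \<Rightarrow> 'b::euclidean_space \<times> 'c::euclidean_space"
  by (rule L2lim_bounded_linear[OF bounded_linear_fst])

lemma L2lim_snd: "L2lim M F G \<Longrightarrow> L2lim M (\<lambda>n x. snd (F n x)) (\<lambda>x. snd (G x))"
  for F :: "nat \<Rightarrow> 'a \<Rightarrow> 'b::euclidean_space \<times> 'c::euclidean_space"
  by (rule L2lim_bounded_linear[OF bounded_linear_snd])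

lemma L2lim_jet:
  assumes "L2lim M (\<lambda>n. jet (u n) (p n) (q n)) (jet u' p' q')"
  shows "L2lim M u u'" "L2lim M p p'" "L2lim M q q'"
  using L2lim_fst[OF assms] L2lim_fst[OF L2lim_snd[OF assms]] L2lim_snd[OF L2lim_snd[OF assms]] by simp_all

lemma L2lim_jetI:
  assumes "L2lim M u u'" "L2lim M p p'" "L2lim M q q'"
  shows "L2lim M (\<lambda>n. jet (u n) (p n) (q n)) (jet u' p' q')"
proof -
  have s: "sqint M (u n)" "sqint M u'" "sqint M (p n)" "sqint M p'" "sqint M (q n)" "sqint M q'" for n
    using assms by (auto simp: L2lim_def)
  let ?g = "\<lambda>n. (nrm M (\<lambda>x. u n x - u' x))\<^sup>2 + (nrm M (\<lambda>x. p n x - p' x))\<^sup>2 + (nrm M (\<lambda>x. q n x - q' x))\<^sup>2"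
  have eq: "(nrm M (\<lambda>x. jet (u n) (p n) (q n) x - jet u' p' q' x))\<^sup>2 = ?g n" for n
  proof -
    have "jet (u n) (p n) (q n) x - jet u' p' q' x = jet (\<lambda>x. u n x - u' x) (\<lambda>x. p n x - p' x) (\<lambda>x. q n x - q' x) x" for x
      by (simp add: jet_def)
    moreover have "integrable M (\<lambda>x. (norm (u n x - u' x))\<^sup>2)" "integrable M (\<lambda>x. (norm (p n x - p' x))\<^sup>2)" "integrable M (\<lambda>x. (norm (q n x - q' x))\<^sup>2)"
      using sqint_diff[OF s(1,2)] sqint_diff[OF s(3,4)] sqint_diff[OF s(5,6)] by (auto simp: sqint_def)
    ultimately show ?thesis by (simp add: nrm_sq norm_jet_sq)
  qed
  have "?g \<longlonglongrightarrow> 0\<^sup>2 + 0\<^sup>2 + 0\<^sup>2"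
    using assms by (intro tendsto_intros) (auto simp: L2lim_def)
  then have "(\<lambda>n. (nrm M (\<lambda>x. jet (u n) (p n) (q n) x - jet u' p' q' x))\<^sup>2) \<longlonglongrightarrow> 0" by (simp add: eq)
  from tendsto_real_sqrt[OF this] show ?thesis using s by (simp add: L2lim_def sqint_jet_iff)
qed

section \<open>Algebra of the Sobolev space and integration by parts\<close>

lemma C1_add:
  assumes "C1 f fx fy" "C1 g gx gy"
  shows "C1 (\<lambda>p. f p + g p) (\<lambda>p. fx p + gx p) (\<lambda>p. fy p + gy p)"
proof (rule C1I)
  show "((\<lambda>p. f p + g p) has_derivative (\<lambda>h. fst h *\<^sub>R (fx p + gx p) + snd h *\<^sub>R (fy p + gy p))) (at p)" for p
    using has_derivative_add[OF C1_deriv[OF assms(1)] C1_deriv[OF assms(2)]]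
    by (rule has_derivative_eq_rhs) (simp add: fun_eq_iff algebra_simps)
qed (use assms in \<open>auto intro!: continuous_intros dest: C1_contx C1_conty\<close>)

lemma C1c_add:
  assumes "C1c \<Omega> f fx fy" "C1c \<Omega> g gx gy"
  shows "C1c \<Omega> (\<lambda>p. f p + g p) (\<lambda>p. fx p + gx p) (\<lambda>p. fy p + gy p)"
proof -
  from C1cE[OF assms(1)] obtain K1 where K1: "compact K1" "\<And>p. p \<notin> K1 \<Longrightarrow> f p = 0" "\<And>p. p \<notin> K1 \<Longrightarrow> fx p = 0" "\<And>p. p \<notin> K1 \<Longrightarrow> fy p = 0" "K1 \<subseteq> \<Omega>"
    by metis
  from C1cE[OF assms(2)] obtain K2 where K2: "compact K2" "\<And>p. p \<notin> K2 \<Longrightarrow> g p = 0" "\<And>p. p \<notin> K2 \<Longrightarrow> gx p = 0" "\<And>p. p \<notin> K2 \<Longrightarrow> gy p = 0" "K2 \<subseteq> \<Omega>"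
    by metis
  have "\<forall>p. p \<notin> K1 \<union> K2 \<longrightarrow> f p + g p = 0 \<and> fx p + gx p = 0 \<and> fy p + gy p = 0"
    using K1(2-4) K2(2-4) by simp
  moreover have "compact (K1 \<union> K2)" "K1 \<union> K2 \<subseteq> \<Omega>" using K1 K2 by auto
  ultimately show ?thesis
    unfolding C1c_def using C1_add[OF C1c_C1[OF assms(1)] C1c_C1[OF assms(2)]] by blast
qed

lemma C1c_bounded_linear:
  assumes "bounded_linear A" "C1c \<Omega> f fx fy"
  shows "C1c \<Omega> (\<lambda>p. A (f p)) (\<lambda>p. A (fx p)) (\<lambda>p. A (fy p))"
proof -
  from C1cE[OF assms(2)] obtain K where K: "compact K" "\<And>p. p \<notin> K \<Longrightarrow> f p = 0" "\<And>p. p \<notin> K \<Longrightarrow> fx p = 0" "\<And>p. p \<notin> K \<Longrightarrow> fy p = 0" "K \<subseteq> \<Omega>"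
    by metis
  interpret bounded_linear A by fact
  show ?thesis
    unfolding C1c_def using C1_bounded_linear[OF assms(1) C1c_C1[OF assms(2)]] K by (auto intro!: exI[of _ K] simp: zero)
qed

text \<open>Nothing is asked outside \<Omega>, since the coefficient \<open>b\<close> used later
  involves a locally constant function that is controlled only inside. \<open>by'\<close> is the
  partial derivative in the second variable.\<close>

definition C1_on :: "plane set \<Rightarrow> (plane \<Rightarrow> real) \<Rightarrow> (plane \<Rightarrow> real) \<Rightarrow> (plane \<Rightarrow> real) \<Rightarrow> bool" where
  "C1_on \<Omega> b bx by' \<longleftrightarrow> (\<forall>p\<in>\<Omega>. (b has_derivative (\<lambda>h. fst h * bx p + snd h * by' p)) (at p)) \<and>
     continuous_on \<Omega> bx \<and> continuous_on \<Omega> by'"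

lemma C1_on_continuous: "C1_on \<Omega> b bx by' \<Longrightarrow> continuous_on \<Omega> b"
  unfolding C1_on_def by (meson continuous_at_imp_continuous_on has_derivative_continuous)

lemma continuous_on_extend_zero:
  fixes f :: "'a::t2_space \<Rightarrow> 'b::{t2_space, zero}"
  assumes "continuous_on \<Omega> f" "open \<Omega>" "compact K" "K \<subseteq> \<Omega>" "\<And>p. p \<notin> K \<Longrightarrow> f p = 0"
  shows "continuous_on UNIV f"
proof -
  have "continuous_on (- K) f"
    by (rule continuous_on_cong[THEN iffD1, OF refl _ continuous_on_const[of _ 0]]) (simp add: assms(5))
  moreover have "open (- K)" using compact_imp_closed[OF assms(3)] by auto
  moreover have "\<Omega> \<union> - K = UNIV" using assms(4) by auto
  ultimately show ?thesis using continuous_on_open_Un[of \<Omega> "- K" f] assms(1,2) by simp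
qed

text \<open>Only the values of \<open>b\<close> near the compact support of \<open>f\<close> matter;
  elsewhere the product and its derivatives are extended by zero.\<close>

lemma C1c_mult_local:
  fixes f :: "plane \<Rightarrow> 'b::euclidean_space"
  assumes b: "C1_on \<Omega> b bx by'" and f: "C1c \<Omega> f fx fy" and \<Omega>: "open \<Omega>"
  shows "C1c \<Omega> (\<lambda>p. b p *\<^sub>R f p) (\<lambda>p. b p *\<^sub>R fx p + bx p *\<^sub>R f p) (\<lambda>p. b p *\<^sub>R fy p + by' p *\<^sub>R f p)"
proof -
  from C1cE[OF f] obtain K where K: "compact K" "\<And>p. p \<notin> K \<Longrightarrow> f p = 0" "\<And>p. p \<notin> K \<Longrightarrow> fx p = 0" "\<And>p. p \<notin> K \<Longrightarrow> fy p = 0" "K \<subseteq> \<Omega>"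
    by metis
  note C1 = C1c_C1[OF f]
  have cf: "continuous_on S f" "continuous_on S fx" "continuous_on S fy" for S
    using C1_continuous[OF C1] C1_contx[OF C1] C1_conty[OF C1] continuous_on_subset by blast+
  have cb: "continuous_on \<Omega> b" "continuous_on \<Omega> bx" "continuous_on \<Omega> by'"
    using C1_on_continuous[OF b] b by (auto simp: C1_on_def)
  have "C1 (\<lambda>p. b p *\<^sub>R f p) (\<lambda>p. b p *\<^sub>R fx p + bx p *\<^sub>R f p) (\<lambda>p. b p *\<^sub>R fy p + by' p *\<^sub>R f p)"
  proof (rule C1I)
    show "((\<lambda>p. b p *\<^sub>R f p) has_derivative (\<lambda>h. fst h *\<^sub>R (b p *\<^sub>R fx p + bx p *\<^sub>R f p) + snd h *\<^sub>R (b p *\<^sub>R fy p + by' p *\<^sub>R f p))) (at p)" for p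
    proof (cases "p \<in> \<Omega>")
      case True
      then have "(b has_derivative (\<lambda>h. fst h * bx p + snd h * by' p)) (at p)" using b unfolding C1_on_def by blast
      from has_derivative_scaleR[OF this C1_deriv[OF C1]] show ?thesis
        by (rule has_derivative_eq_rhs) (simp add: fun_eq_iff algebra_simps)
    next
      case False
      then have p: "p \<in> - K" using K by auto
      have "((\<lambda>p. b p *\<^sub>R f p) has_derivative (\<lambda>h. 0)) (at p)"
        by (rule has_derivative_transform_within_open[OF has_derivative_const _ p])
          (use K compact_imp_closed[OF K(1)] in auto)
      then show ?thesis using p K by simp
    qed
    show "continuous_on UNIV (\<lambda>p. b p *\<^sub>R fx p + bx p *\<^sub>R f p)"
      by (rule continuous_on_extend_zero[OF _ \<Omega> K(1,5)]) (use K cf cb in \<open>auto intro!: continuous_intros\<close>)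
    show "continuous_on UNIV (\<lambda>p. b p *\<^sub>R fy p + by' p *\<^sub>R f p)"
      by (rule continuous_on_extend_zero[OF _ \<Omega> K(1,5)]) (use K cf cb in \<open>auto intro!: continuous_intros\<close>)
  qed
  then show ?thesis by (rule C1cI[OF _ K(1,5)]) (use K in auto)
qed

lemma test_C1c_add:
  fixes \<phi> \<psi> :: "plane \<Rightarrow> complex"
  assumes "\<phi> \<in> test_functions \<Omega>" "\<psi> \<in> test_functions \<Omega>"
  shows "(\<lambda>x. \<phi> x + c * \<psi> x) \<in> test_functions \<Omega>"
    and "dx (\<lambda>x. \<phi> x + c * \<psi> x) = (\<lambda>x. dx \<phi> x + c * dx \<psi> x)"
    and "dy (\<lambda>x. \<phi> x + c * \<psi> x) = (\<lambda>x. dy \<phi> x + c * dy \<psi> x)"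
proof -
  note c = C1c_add[OF test_functions_C1c[OF assms(1)] C1c_bounded_linear[OF bounded_linear_mult_right[of c] test_functions_C1c[OF assms(2)]]]
  show "dx (\<lambda>x. \<phi> x + c * \<psi> x) = (\<lambda>x. dx \<phi> x + c * dx \<psi> x)"
    "dy (\<lambda>x. \<phi> x + c * \<psi> x) = (\<lambda>x. dy \<phi> x + c * dy \<psi> x)"
    using C1_partial[OF C1c_C1[OF c]] by auto
  from C1cE[OF c] obtain K where K: "compact K" "K \<subseteq> \<Omega>" "\<And>p. p \<notin> K \<Longrightarrow> \<phi> p + c * \<psi> p = 0" by metis
  show "(\<lambda>x. \<phi> x + c * \<psi> x) \<in> test_functions \<Omega>"
    by (rule test_functionsI[OF _ K(1,2)]) (use K(3) assms in \<open>auto simp: test_functions_def intro!: C_k_add C_k_mult C_k_const\<close>)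
qed

lemma test_zero: "(\<lambda>x. 0) \<in> test_functions \<Omega>"
  by (auto simp: test_functions_def intro: C_k_const)

abbreviation tjet :: "(plane \<Rightarrow> complex) \<Rightarrow> plane \<Rightarrow> complex \<times> complex \<times> complex" where
  "tjet \<phi> \<equiv> jet \<phi> (dx \<phi>) (dy \<phi>)"

lemma H10_sqint: "U \<in> H10 \<Omega> \<Longrightarrow> sqint (lebesgue_on \<Omega>) U"
  by (auto simp: H10_def L2lim_def)

text \<open>Complex, not only real, multiples are allowed: testing an equation with \<i> u, and
  recovering imaginary parts of pairings, depend on this.\<close>

lemma H10_add_cmult:
  assumes "U \<in> H10 \<Omega>" "V \<in> H10 \<Omega>"
  shows "(\<lambda>x. U x + (c * fst (V x), c * fst (snd (V x)), c * snd (snd (V x)))) \<in> H10 \<Omega>"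
proof -
  let ?A = "\<lambda>v. (c * fst v, c * fst (snd v), c * snd (snd v))"
  have A: "bounded_linear ?A"
    by (intro bounded_linear_Pair bounded_linear_mult_right[THEN bounded_linear_compose] bounded_linear_fst bounded_linear_snd bounded_linear_fst_comp bounded_linear_snd_comp)
  obtain \<phi> \<psi> where t: "\<And>n. \<phi> n \<in> test_functions \<Omega>" "\<And>n. \<psi> n \<in> test_functions \<Omega>"
    and l: "L2lim (lebesgue_on \<Omega>) (\<lambda>n. tjet (\<phi> n)) U" "L2lim (lebesgue_on \<Omega>) (\<lambda>n. tjet (\<psi> n)) V"
    using assms unfolding H10_def by blast
  have "L2lim (lebesgue_on \<Omega>) (\<lambda>n x. tjet (\<phi> n) x + ?A (tjet (\<psi> n) x)) (\<lambda>x. U x + ?A (V x))"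
    by (intro L2lim_add l L2lim_bounded_linear[OF A])
  moreover have "(\<lambda>x. tjet (\<phi> n) x + ?A (tjet (\<psi> n) x)) = tjet (\<lambda>x. \<phi> n x + c * \<psi> n x)" for n
    using test_C1c_add(2,3)[OF t(1) t(2), where c=c] by (simp add: jet_def)
  ultimately show ?thesis unfolding H10_def using test_C1c_add(1)[OF t(1) t(2), where c=c]
    by (intro CollectI exI[of _ "\<lambda>n x. \<phi> n x + c * \<psi> n x"]) simp
qed

lemma H10_zero: "(\<lambda>x. 0) \<in> H10 \<Omega>"
proof -
  have "partial_deriv b (\<lambda>x. 0::complex) = (\<lambda>x. 0)" for b :: "plane"
    by (auto simp: fun_eq_iff intro!: partial_derivI[where D="\<lambda>_. 0", simplified])
  then have "tjet (\<lambda>x. 0) = (\<lambda>x. 0)" by (simp add: jet_def zero_prod_def)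
  moreover have "L2lim (lebesgue_on \<Omega>) (\<lambda>n x. 0 :: complex \<times> complex \<times> complex) (\<lambda>x. 0)"
    by (rule L2lim_const[OF sqint_zero])
  moreover have "(\<lambda>x. 0 :: complex) \<in> test_functions \<Omega>" by (rule test_zero)
  ultimately show ?thesis unfolding H10_def
    by (intro CollectI exI[of _ "\<lambda>n x. 0"]) simp
qed

text \<open>A diagonal argument: the \<open>n\<close>-th member is replaced by a test function at
  distance below \<open>1/(n+1)\<close>.\<close>

lemma H10_closed:
  assumes F: "\<And>n. F n \<in> H10 \<Omega>" and l: "L2lim (lebesgue_on \<Omega>) F G"
  shows "G \<in> H10 \<Omega>"
proof -
  let ?M = "lebesgue_on \<Omega>"
  have "\<exists>\<phi>\<in>test_functions \<Omega>. sqint ?M (tjet \<phi>) \<and> nrm ?M (\<lambda>x. tjet \<phi> x - F n x) < inverse (real (Suc n))" for n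
  proof -
    obtain \<phi> where t: "\<And>k. \<phi> k \<in> test_functions \<Omega>" and k: "L2lim ?M (\<lambda>k. tjet (\<phi> k)) (F n)"
      using F[of n] unfolding H10_def by blast
    have "\<forall>\<^sub>F k in sequentially. nrm ?M (\<lambda>x. tjet (\<phi> k) x - F n x) < inverse (real (Suc n))"
      using k unfolding L2lim_def by (intro order_tendstoD(2)[of _ 0]) auto
    then obtain k where "nrm ?M (\<lambda>x. tjet (\<phi> k) x - F n x) < inverse (real (Suc n))"
      by (auto simp: eventually_sequentially)
    then show ?thesis using t k by (auto simp: L2lim_def)
  qed
  then have "\<forall>n. \<exists>\<phi>. \<phi> \<in> test_functions \<Omega> \<and> sqint ?M (tjet \<phi>) \<and> nrm ?M (\<lambda>x. tjet \<phi> x - F n x) < inverse (real (Suc n))"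
    by blast
  from choice[OF this] obtain \<phi> where \<phi>: "\<And>n. \<phi> n \<in> test_functions \<Omega>" "\<And>n. sqint ?M (tjet (\<phi> n))"
    "\<And>n. nrm ?M (\<lambda>x. tjet (\<phi> n) x - F n x) < inverse (real (Suc n))" by blast
  have s: "sqint ?M (F n)" "sqint ?M G" for n using l by (auto simp: L2lim_def)
  have "(\<lambda>n. nrm ?M (\<lambda>x. tjet (\<phi> n) x - G x)) \<longlonglongrightarrow> 0"
  proof (rule LIMSEQ_squeeze_zero)
    show "nrm ?M (\<lambda>x. tjet (\<phi> n) x - G x) \<le> inverse (real (Suc n)) + nrm ?M (\<lambda>x. F n x - G x)" for n
      using nrm_triangle_diff[OF \<phi>(2) s(1) s(2), of n n] \<phi>(3)[of n] by linarith
    show "(\<lambda>n. inverse (real (Suc n)) + nrm ?M (\<lambda>x. F n x - G x)) \<longlonglongrightarrow> 0"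
      using tendsto_add[OF LIMSEQ_inverse_real_of_nat] l by (auto simp: L2lim_def)
  qed simp
  then have "L2lim ?M (\<lambda>n. tjet (\<phi> n)) G" using \<phi>(2) s by (simp add: L2lim_def)
  then show ?thesis using \<phi>(1) unfolding H10_def by blast
qed

lemma H10_closed_subspace: "closed_subspace (lebesgue_on \<Omega>) (H10 \<Omega>)"
proof -
  have "(\<lambda>x. U x + V x) \<in> H10 \<Omega>" if "U \<in> H10 \<Omega>" "V \<in> H10 \<Omega>" for U V
    using H10_add_cmult[OF that, of 1] by simp
  moreover have "(\<lambda>x. c *\<^sub>R U x) \<in> H10 \<Omega>" if "U \<in> H10 \<Omega>" for U c
  proof -
    have "(\<lambda>x. 0 + (complex_of_real c * fst (U x), complex_of_real c * fst (snd (U x)), complex_of_real c * snd (snd (U x)))) = (\<lambda>x. c *\<^sub>R U x)"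
      by (simp add: fun_eq_iff scaleR_prod_def scaleR_conv_of_real)
    then show ?thesis using H10_add_cmult[OF H10_zero that, of "complex_of_real c"] by simp
  qed
  ultimately show ?thesis
    unfolding closed_subspace_def using H10_sqint H10_zero H10_closed by blast
qed

lemma H10_cmult:
  assumes "jet u p q \<in> H10 \<Omega>"
  shows "jet (\<lambda>x. c * u x) (\<lambda>x. c * p x) (\<lambda>x. c * q x) \<in> H10 \<Omega>"
  using H10_add_cmult[OF H10_zero assms, of c] by (simp add: jet_def)

lemma C1c_integral_on:
  fixes f :: "plane \<Rightarrow> 'b::euclidean_space"
  assumes f: "C1c \<Omega> f fx fy" and \<Omega>: "open \<Omega>"
  shows "(\<integral>p. fx p \<partial>(lebesgue_on \<Omega>)) = 0" "(\<integral>p. fy p \<partial>(lebesgue_on \<Omega>)) = 0"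
proof -
  note C1 = C1c_C1[OF f]
  from C1cE[OF f] obtain K where K: "compact K" "K \<subseteq> \<Omega>" "\<And>p. p \<notin> K \<Longrightarrow> f p = 0" "\<And>p. p \<notin> K \<Longrightarrow> fx p = 0" "\<And>p. p \<notin> K \<Longrightarrow> fy p = 0"
    by metis
  have u: "C1c UNIV f fx fy" by (rule C1cI[OF C1 K(1)]) (use K in auto)
  have s: "\<Omega> \<in> sets lebesgue" using \<Omega> by auto
  have x: "(\<integral>p. fx p \<partial>(lebesgue_on \<Omega>)) = (\<integral>p. fx p \<partial>lborel)"
    by (rule supp_integral_on[OF C1_contx[OF C1] _ s]) (use K in blast)
  have y: "(\<integral>p. fy p \<partial>(lebesgue_on \<Omega>)) = (\<integral>p. fy p \<partial>lborel)"
    by (rule supp_integral_on[OF C1_conty[OF C1] _ s]) (use K in blast)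
  show "(\<integral>p. fx p \<partial>(lebesgue_on \<Omega>)) = 0" unfolding x using C1c_integral_deriv[OF u, of "(1,0)"] by simp
  show "(\<integral>p. fy p \<partial>(lebesgue_on \<Omega>)) = 0" unfolding y using C1c_integral_deriv[OF u, of "(0,1)"] by simp
qed

lemma C1_on_measurable:
  assumes "C1_on \<Omega> b bx by'" "open \<Omega>"
  shows "b \<in> borel_measurable (lebesgue_on \<Omega>)" "bx \<in> borel_measurable (lebesgue_on \<Omega>)" "by' \<in> borel_measurable (lebesgue_on \<Omega>)"
  using assms C1_on_continuous[OF assms(1)]
  by (auto simp: C1_on_def intro!: continuous_imp_measurable_on_sets_lebesgue)

lemma tjet_C1c: "\<phi> \<in> test_functions \<Omega> \<Longrightarrow> C1c \<Omega> \<phi> (dx \<phi>) (dy \<phi>)"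
  by (rule test_functions_C1c)

lemma tjet_H10: "open \<Omega> \<Longrightarrow> \<phi> \<in> test_functions \<Omega> \<Longrightarrow> tjet \<phi> \<in> H10 \<Omega>"
  by (rule C1c_in_H10[OF _ tjet_C1c])

lemma H10E:
  assumes "jet u p q \<in> H10 \<Omega>"
  obtains \<phi> where "\<And>n. \<phi> n \<in> test_functions \<Omega>" "L2lim (lebesgue_on \<Omega>) \<phi> u"
    "L2lim (lebesgue_on \<Omega>) (\<lambda>n. dx (\<phi> n)) p" "L2lim (lebesgue_on \<Omega>) (\<lambda>n. dy (\<phi> n)) q"
proof -
  from assms obtain \<phi> where "\<And>n. \<phi> n \<in> test_functions \<Omega>" and l: "L2lim (lebesgue_on \<Omega>) (\<lambda>n. tjet (\<phi> n)) (jet u p q)"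
    unfolding H10_def by blast
  then show ?thesis using that L2lim_jet[OF l] by blast
qed

lemma H10_jet_sqint:
  assumes "jet u p q \<in> H10 \<Omega>"
  shows "sqint (lebesgue_on \<Omega>) u" "sqint (lebesgue_on \<Omega>) p" "sqint (lebesgue_on \<Omega>) q"
  using H10_sqint[OF assms] by (auto simp: sqint_jet_iff)

text \<open>For test functions the weighted product has compact support in \<Omega>, so its
  derivatives integrate to zero and no boundary term arises. Boundedness of the weight and its
  derivatives lets the identity pass to the limit.\<close>

lemma H10_ibp:
  assumes U: "jet u p q \<in> H10 \<Omega>" and V: "jet v vx vy \<in> H10 \<Omega>" and \<Omega>: "open \<Omega>"
    and b: "C1_on \<Omega> b bx by'" and B: "\<And>x. x \<in> \<Omega> \<Longrightarrow> \<bar>b x\<bar> \<le> B" "\<And>x. x \<in> \<Omega> \<Longrightarrow> \<bar>bx x\<bar> \<le> B" "\<And>x. x \<in> \<Omega> \<Longrightarrow> \<bar>by' x\<bar> \<le> B"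
    and B0: "0 \<le> B"
  shows "(\<integral>x. b x * (p x \<bullet> v x) \<partial>(lebesgue_on \<Omega>)) + (\<integral>x. b x * (u x \<bullet> vx x) \<partial>(lebesgue_on \<Omega>)) = - (\<integral>x. bx x * (u x \<bullet> v x) \<partial>(lebesgue_on \<Omega>))"
    and "(\<integral>x. b x * (q x \<bullet> v x) \<partial>(lebesgue_on \<Omega>)) + (\<integral>x. b x * (u x \<bullet> vy x) \<partial>(lebesgue_on \<Omega>)) = - (\<integral>x. by' x * (u x \<bullet> v x) \<partial>(lebesgue_on \<Omega>))"
proof -
  let ?M = "lebesgue_on \<Omega>"
  note m = C1_on_measurable[OF b \<Omega>]
  from H10E[OF U] obtain \<phi> where \<phi>: "\<And>n. \<phi> n \<in> test_functions \<Omega>" and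
    u: "L2lim ?M \<phi> u" "L2lim ?M (\<lambda>n. dx (\<phi> n)) p" "L2lim ?M (\<lambda>n. dy (\<phi> n)) q" by blast
  from H10E[OF V] obtain \<psi> where \<psi>: "\<And>n. \<psi> n \<in> test_functions \<Omega>" and
    v: "L2lim ?M \<psi> v" "L2lim ?M (\<lambda>n. dx (\<psi> n)) vx" "L2lim ?M (\<lambda>n. dy (\<psi> n)) vy" by blast
  have lim: "(\<lambda>n. \<integral>x. c x * (F n x \<bullet> F' n x) \<partial>?M) \<longlonglongrightarrow> (\<integral>x. c x * (G x \<bullet> G' x) \<partial>?M)"
    if "L2lim ?M F G" "L2lim ?M F' G'" "c \<in> borel_measurable ?M" "\<And>x. x \<in> \<Omega> \<Longrightarrow> \<bar>c x\<bar> \<le> B" for F F' :: "nat \<Rightarrow> plane \<Rightarrow> complex" and G G' c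
  proof -
    have "L2lim ?M (\<lambda>n x. c x *\<^sub>R F n x) (\<lambda>x. c x *\<^sub>R G x)"
      using L2lim_scale[OF that(1,3) _ B0] that(4) by simp
    from L2lim_ip[OF this that(2)] show ?thesis by (simp add: ip_def)
  qed
  have ib: "integrable ?M (\<lambda>x. c x * (F x \<bullet> F' x))"
    if "sqint ?M F" "sqint ?M F'" "c \<in> borel_measurable ?M" "\<And>x. x \<in> \<Omega> \<Longrightarrow> \<bar>c x\<bar> \<le> B" for F F' :: "plane \<Rightarrow> complex" and c
    using that by (intro sqint_inner_bounded[of _ _ _ _ B]) auto
  have key: "(\<integral>x. b x * (dx (\<phi> n) x \<bullet> \<psi> n x) \<partial>?M) + (\<integral>x. b x * (\<phi> n x \<bullet> dx (\<psi> n) x) \<partial>?M) = - (\<integral>x. bx x * (\<phi> n x \<bullet> \<psi> n x) \<partial>?M)"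
    "(\<integral>x. b x * (dy (\<phi> n) x \<bullet> \<psi> n x) \<partial>?M) + (\<integral>x. b x * (\<phi> n x \<bullet> dy (\<psi> n) x) \<partial>?M) = - (\<integral>x. by' x * (\<phi> n x \<bullet> \<psi> n x) \<partial>?M)" for n
  proof -
    note f = tjet_C1c[OF \<phi>, of n] and g = tjet_C1c[OF \<psi>, of n]
    from C1cE[OF f] obtain K where K: "compact K" "K \<subseteq> \<Omega>" "\<And>p. p \<notin> K \<Longrightarrow> \<phi> n p = 0" "\<And>p. p \<notin> K \<Longrightarrow> dx (\<phi> n) p = 0" "\<And>p. p \<notin> K \<Longrightarrow> dy (\<phi> n) p = 0"
      by metis
    have s: "sqint ?M (\<phi> n)" "sqint ?M (\<psi> n)" "sqint ?M (dx (\<phi> n))" "sqint ?M (dy (\<phi> n))" "sqint ?M (dx (\<psi> n))" "sqint ?M (dy (\<psi> n))"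
      using H10_jet_sqint[OF tjet_H10[OF \<Omega> \<phi>]] H10_jet_sqint[OF tjet_H10[OF \<Omega> \<psi>]] by auto
    have "C1c \<Omega> (\<lambda>p. \<phi> n p \<bullet> \<psi> n p) (\<lambda>p. \<phi> n p \<bullet> dx (\<psi> n) p + dx (\<phi> n) p \<bullet> \<psi> n p)
      (\<lambda>p. \<phi> n p \<bullet> dy (\<psi> n) p + dy (\<phi> n) p \<bullet> \<psi> n p)"
      by (rule C1cI[OF C1_bounded_bilinear[OF bounded_bilinear_inner C1c_C1[OF f] C1c_C1[OF g]] K(1,2)]) (use K in auto)
    note C1c_integral_on[OF C1c_mult_local[OF b this \<Omega>] \<Omega>]
    then have z: "(\<integral>x. b x * (\<phi> n x \<bullet> dx (\<psi> n) x) + b x * (dx (\<phi> n) x \<bullet> \<psi> n x) + bx x * (\<phi> n x \<bullet> \<psi> n x) \<partial>?M) = 0"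
      "(\<integral>x. b x * (\<phi> n x \<bullet> dy (\<psi> n) x) + b x * (dy (\<phi> n) x \<bullet> \<psi> n x) + by' x * (\<phi> n x \<bullet> \<psi> n x) \<partial>?M) = 0"
      by (simp_all add: distrib_left)
    note i = ib[OF s(1,5) m(1) B(1)] ib[OF s(3,2) m(1) B(1)] ib[OF s(1,2) m(2) B(2)]
       ib[OF s(1,6) m(1) B(1)] ib[OF s(4,2) m(1) B(1)] ib[OF s(1,2) m(3) B(3)]
    show "(\<integral>x. b x * (dx (\<phi> n) x \<bullet> \<psi> n x) \<partial>?M) + (\<integral>x. b x * (\<phi> n x \<bullet> dx (\<psi> n) x) \<partial>?M) = - (\<integral>x. bx x * (\<phi> n x \<bullet> \<psi> n x) \<partial>?M)"
      using z(1) i by simp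
    show "(\<integral>x. b x * (dy (\<phi> n) x \<bullet> \<psi> n x) \<partial>?M) + (\<integral>x. b x * (\<phi> n x \<bullet> dy (\<psi> n) x) \<partial>?M) = - (\<integral>x. by' x * (\<phi> n x \<bullet> \<psi> n x) \<partial>?M)"
      using z(2) i by simp
  qed
  show "(\<integral>x. b x * (p x \<bullet> v x) \<partial>?M) + (\<integral>x. b x * (u x \<bullet> vx x) \<partial>?M) = - (\<integral>x. bx x * (u x \<bullet> v x) \<partial>?M)"
    by (rule LIMSEQ_unique[OF tendsto_add[OF lim[OF u(2) v(1) m(1) B(1)] lim[OF u(1) v(2) m(1) B(1)]]])
      (auto simp: key(1) intro!: tendsto_minus[OF lim[OF u(1) v(1) m(2) B(2)]])
  show "(\<integral>x. b x * (q x \<bullet> v x) \<partial>?M) + (\<integral>x. b x * (u x \<bullet> vy x) \<partial>?M) = - (\<integral>x. by' x * (u x \<bullet> v x) \<partial>?M)"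
    by (rule LIMSEQ_unique[OF tendsto_add[OF lim[OF u(3) v(1) m(1) B(1)] lim[OF u(1) v(3) m(1) B(1)]]])
      (auto simp: key(2) intro!: tendsto_minus[OF lim[OF u(1) v(1) m(3) B(3)]])
qed

lemma C1_on_const: "C1_on \<Omega> (\<lambda>_. c) (\<lambda>_. 0) (\<lambda>_. 0)"
  by (auto simp: C1_on_def)

lemma H10_mult:
  assumes U: "jet u p q \<in> H10 \<Omega>" and \<Omega>: "open \<Omega>"
    and b: "C1_on \<Omega> b bx by'" and B: "\<And>x. x \<in> \<Omega> \<Longrightarrow> \<bar>b x\<bar> \<le> B" "\<And>x. x \<in> \<Omega> \<Longrightarrow> \<bar>bx x\<bar> \<le> B" "\<And>x. x \<in> \<Omega> \<Longrightarrow> \<bar>by' x\<bar> \<le> B"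
    and B0: "0 \<le> B"
  shows "jet (\<lambda>x. b x *\<^sub>R u x) (\<lambda>x. b x *\<^sub>R p x + bx x *\<^sub>R u x) (\<lambda>x. b x *\<^sub>R q x + by' x *\<^sub>R u x) \<in> H10 \<Omega>"
proof -
  let ?M = "lebesgue_on \<Omega>"
  note m = C1_on_measurable[OF b \<Omega>]
  from H10E[OF U] obtain \<phi> where \<phi>: "\<And>n. \<phi> n \<in> test_functions \<Omega>" and
    u: "L2lim ?M \<phi> u" "L2lim ?M (\<lambda>n. dx (\<phi> n)) p" "L2lim ?M (\<lambda>n. dy (\<phi> n)) q" by blast
  have lim: "L2lim ?M (\<lambda>n x. c x *\<^sub>R F n x) (\<lambda>x. c x *\<^sub>R G x)"
    if "L2lim ?M F G" "c \<in> borel_measurable ?M" "\<And>x. x \<in> \<Omega> \<Longrightarrow> \<bar>c x\<bar> \<le> B" for F :: "nat \<Rightarrow> plane \<Rightarrow> complex" and G c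
    using L2lim_scale[OF that(1,2) _ B0] that(3) by simp
  show ?thesis
  proof (rule H10_closed)
    show "jet (\<lambda>x. b x *\<^sub>R \<phi> n x) (\<lambda>x. b x *\<^sub>R dx (\<phi> n) x + bx x *\<^sub>R \<phi> n x) (\<lambda>x. b x *\<^sub>R dy (\<phi> n) x + by' x *\<^sub>R \<phi> n x) \<in> H10 \<Omega>" for n
      by (rule C1c_in_H10[OF \<Omega> C1c_mult_local[OF b tjet_C1c[OF \<phi>] \<Omega>]])
    show "L2lim ?M (\<lambda>n. jet (\<lambda>x. b x *\<^sub>R \<phi> n x) (\<lambda>x. b x *\<^sub>R dx (\<phi> n) x + bx x *\<^sub>R \<phi> n x) (\<lambda>x. b x *\<^sub>R dy (\<phi> n) x + by' x *\<^sub>R \<phi> n x))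
      (jet (\<lambda>x. b x *\<^sub>R u x) (\<lambda>x. b x *\<^sub>R p x + bx x *\<^sub>R u x) (\<lambda>x. b x *\<^sub>R q x + by' x *\<^sub>R u x))"
      by (intro L2lim_jetI L2lim_add lim u m B)
  qed
qed

section \<open>The Friedrichs extension in terms of weak derivatives\<close>

lemma L2_sqint: "f \<in> L2 M \<longleftrightarrow> sqint M f"
  by (simp add: L2_def sqint_def)

lemma L2_norm_nrm: "L2_norm M f = nrm M f"
  by (simp add: L2_norm_def nrm_def)

lemma sqint_cnj_integrable:
  assumes "sqint M f" "sqint M g"
  shows "integrable M (\<lambda>x. f x * cnj (g x))"
proof (rule Bochner_Integration.integrable_bound[where f="\<lambda>x. (norm (f x))\<^sup>2 + (norm (g x))\<^sup>2"])
  have [measurable]: "f \<in> borel_measurable M" "g \<in> borel_measurable M"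
    using assms by (auto simp: sqint_def)
  show "integrable M (\<lambda>x. (norm (f x))\<^sup>2 + (norm (g x))\<^sup>2)" using assms by (simp add: sqint_def)
  have "cnj \<in> borel_measurable borel" by (intro borel_measurable_continuous_onI continuous_intros)
  then show "(\<lambda>x. f x * cnj (g x)) \<in> borel_measurable M" by measurable
  have "norm (f x) * norm (g x) \<le> (norm (f x))\<^sup>2 + (norm (g x))\<^sup>2" for x
    using sum_squares_bound[of "norm (f x)" "norm (g x)"] mult_nonneg_nonneg[OF norm_ge_zero norm_ge_zero, of "f x" "g x"]
    by linarith
  then show "AE x in M. norm (f x * cnj (g x)) \<le> norm ((norm (f x))\<^sup>2 + (norm (g x))\<^sup>2)"
    by (intro AE_I2) (simp add: norm_mult)
qed

lemma Re_L2_inner: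
  assumes "sqint M f" "sqint M g"
  shows "Re (L2_inner M f g) = ip M f g"
  unfolding L2_inner_def ip_def
  using integral_Re[OF sqint_cnj_integrable[OF assms]] by (simp add: inner_complex_def)

lemma sqint_cmult: "sqint M f \<Longrightarrow> sqint M (\<lambda>x. c * f x)" for f :: "'a \<Rightarrow> complex"
  by (rule sqint_bounded_linear[OF bounded_linear_mult_right])

text \<open>The imaginary part is the real pairing against the rotated function, so the whole
  complex pairing is accessible through \<open>ip\<close>.\<close>

lemma Im_L2_inner:
  assumes "sqint M f" "sqint M g"
  shows "Im (L2_inner M f g) = ip M f (\<lambda>x. \<i> * g x)"
proof -
  have "L2_inner M f (\<lambda>x. \<i> * g x) = - \<i> * L2_inner M f g"
    unfolding L2_inner_def by (simp flip: integral_mult_right_zero add: mult_ac)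
  then show ?thesis using Re_L2_inner[OF assms(1) sqint_cmult[OF assms(2), of \<i>]] by simp
qed

lemma laplacian_eq: "laplacian f p = dx (dx f) p + dy (dy f) p"
  for f :: "plane \<Rightarrow> complex"
  by (simp add: laplacian_def Basis_real2)

lemma test_partials:
  fixes \<Omega> :: "plane set"
  assumes "\<phi> \<in> test_functions \<Omega>"
  shows "dx \<phi> \<in> test_functions \<Omega>" "dy \<phi> \<in> test_functions \<Omega>"
  using test_functions_partial[OF assms] by (auto simp: Basis_real2)

lemma test_sqint:
  assumes "\<phi> \<in> test_functions \<Omega>" "open \<Omega>"
  shows "sqint (lebesgue_on \<Omega>) (\<phi> :: plane \<Rightarrow> complex)"
  using H10_jet_sqint[OF tjet_H10[OF assms(2,1)]] by blast

lemma laplacian_sqint: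
  assumes "\<phi> \<in> test_functions \<Omega>" "open \<Omega>"
  shows "sqint (lebesgue_on \<Omega>) (\<lambda>x::plane. - laplacian \<phi> x)"
  unfolding laplacian_eq
  using sqint_scaleR[OF sqint_add[OF test_sqint[OF test_partials(1)[OF test_partials(1)[OF assms(1)]] assms(2)] test_sqint[OF test_partials(2)[OF test_partials(2)[OF assms(1)]] assms(2)]], of "-1"]
  by simp

lemma laplacian_add_cmult:
  fixes \<phi> \<psi> :: "plane \<Rightarrow> complex"
  assumes "\<phi> \<in> test_functions \<Omega>" "\<psi> \<in> test_functions \<Omega>"
  shows "laplacian (\<lambda>x. \<phi> x + c * \<psi> x) p = laplacian \<phi> p + c * laplacian \<psi> p"
  by (simp add: laplacian_eq test_C1c_add(2,3)[OF assms] test_C1c_add(2)[OF test_partials(1)[OF assms(1)] test_partials(1)[OF assms(2)]]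
    test_C1c_add(3)[OF test_partials(2)[OF assms(1)] test_partials(2)[OF assms(2)]] algebra_simps)

text \<open>First derivatives of test functions are again test functions, so \<open>H10_ibp\<close>
  with constant weight applies to \<open>u\<close> against each of them.\<close>

lemma green:
  assumes U: "jet u p q \<in> H10 \<Omega>" and \<phi>: "\<phi> \<in> test_functions \<Omega>" and \<Omega>: "open \<Omega>"
  shows "ip (lebesgue_on \<Omega>) u (\<lambda>x. - laplacian \<phi> x) =
    ip (lebesgue_on \<Omega>) p (dx \<phi>) + ip (lebesgue_on \<Omega>) q (dy \<phi>)"
proof -
  let ?M = "lebesgue_on \<Omega>"
  note s = H10_jet_sqint[OF U]
  note xx = test_partials(1)[OF test_partials(1)[OF \<phi>]] and yy = test_partials(2)[OF test_partials(2)[OF \<phi>]]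
  have "ip ?M p (dx \<phi>) + ip ?M u (dx (dx \<phi>)) = 0"
    using H10_ibp(1)[OF U tjet_H10[OF \<Omega> test_partials(1)[OF \<phi>]] \<Omega> C1_on_const[of \<Omega> 1], of 1] by (simp add: ip_def)
  moreover have "ip ?M q (dy \<phi>) + ip ?M u (dy (dy \<phi>)) = 0"
    using H10_ibp(2)[OF U tjet_H10[OF \<Omega> test_partials(2)[OF \<phi>]] \<Omega> C1_on_const[of \<Omega> 1], of 1] by (simp add: ip_def)
  moreover have "ip ?M u (\<lambda>x. - laplacian \<phi> x) = - (ip ?M u (dx (dx \<phi>)) + ip ?M u (dy (dy \<phi>)))"
    unfolding laplacian_eq ip_add_right[OF test_sqint[OF xx \<Omega>] test_sqint[OF yy \<Omega>] s(1), symmetric]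
    unfolding ip_def by (simp flip: inner_minus_right Bochner_Integration.integral_minus)
  ultimately show ?thesis by linarith
qed

lemma test_energy:
  fixes \<Omega> :: "plane set"
  assumes \<phi>: "\<phi> \<in> test_functions \<Omega>" and \<Omega>: "open \<Omega>"
  shows "Re (L2_inner (lebesgue_on \<Omega>) (\<lambda>x. - laplacian \<phi> x) \<phi>) =
    (nrm (lebesgue_on \<Omega>) (dx \<phi>))\<^sup>2 + (nrm (lebesgue_on \<Omega>) (dy \<phi>))\<^sup>2"
  using green[OF tjet_H10[OF \<Omega> \<phi>] \<phi> \<Omega>] Re_L2_inner[OF laplacian_sqint[OF \<phi> \<Omega>] test_sqint[OF \<phi> \<Omega>]]
  by (simp add: nrm_sq_ip ip_commute[of _ \<phi>])

abbreviation test_laplacian :: "plane set \<Rightarrow> plane operator" where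
  "test_laplacian \<Omega> \<equiv> {(\<phi>, \<lambda>x. - laplacian \<phi> x) | \<phi>. \<phi> \<in> test_functions \<Omega>}"

lemma test_energy_diff:
  fixes \<Omega> :: "plane set"
  assumes \<phi>: "\<phi> \<in> test_functions \<Omega>" and \<psi>: "\<psi> \<in> test_functions \<Omega>" and \<Omega>: "open \<Omega>"
  shows "Re (L2_inner (lebesgue_on \<Omega>) (\<lambda>x. - laplacian \<phi> x - - laplacian \<psi> x) (\<lambda>x. \<phi> x - \<psi> x)) =
    (nrm (lebesgue_on \<Omega>) (\<lambda>x. dx \<phi> x - dx \<psi> x))\<^sup>2 +
    (nrm (lebesgue_on \<Omega>) (\<lambda>x. dy \<phi> x - dy \<psi> x))\<^sup>2"
  using test_energy[OF test_C1c_add(1)[OF \<phi> \<psi>, of "-1"] \<Omega>] laplacian_add_cmult[OF \<phi> \<psi>, of "-1"]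
    test_C1c_add(2,3)[OF \<phi> \<psi>, of "-1"] by simp

text \<open>By \<open>test_energy_diff\<close> the form evaluated at differences is the squared norm
  of the gradient differences. The Cauchy condition for the form is therefore the Cauchy condition
  for both partial derivatives, and completeness supplies the weak derivatives \<open>p\<close> and
  \<open>q\<close>.\<close>

lemma form_domain_H10:
  assumes \<Omega>: "open \<Omega>"
  shows "u \<in> form_domain (lebesgue_on \<Omega>) (test_laplacian \<Omega>) \<longleftrightarrow> (\<exists>p q. jet u p q \<in> H10 \<Omega>)"
proof
  let ?M = "lebesgue_on \<Omega>"
  assume "u \<in> form_domain ?M (test_laplacian \<Omega>)"
  then obtain \<phi> \<psi> where u: "sqint ?M u" and S: "\<And>n::nat. (\<phi> n, \<psi> n) \<in> test_laplacian \<Omega>"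
    and conv: "(\<lambda>n. nrm ?M (\<lambda>x. \<phi> n x - u x)) \<longlonglongrightarrow> 0"
    and cau: "\<And>e. e > 0 \<Longrightarrow> \<exists>N. \<forall>m\<ge>N. \<forall>n\<ge>N. Re (L2_inner ?M (\<lambda>x. \<psi> m x - \<psi> n x) (\<lambda>x. \<phi> m x - \<phi> n x)) < e"
    unfolding form_domain_def L2_sqint L2_norm_nrm by blast
  have t: "\<phi> n \<in> test_functions \<Omega>" and \<psi>: "\<psi> n = (\<lambda>x. - laplacian (\<phi> n) x)" for n using S[of n] by auto
  have s: "sqint ?M (dx (\<phi> n))" "sqint ?M (dy (\<phi> n))" "sqint ?M (\<phi> n)" for n
    using test_sqint[OF test_partials(1)[OF t] \<Omega>] test_sqint[OF test_partials(2)[OF t] \<Omega>] test_sqint[OF t \<Omega>] by auto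
  let ?d = "\<lambda>b m n. nrm ?M (\<lambda>x. partial_deriv b (\<phi> m) x - partial_deriv b (\<phi> n) x)"
  have c: "\<exists>N. \<forall>m\<ge>N. \<forall>n\<ge>N. ?d (1,0) m n < e \<and> ?d (0,1) m n < e" if e: "0 < e" for e
  proof -
    have "\<exists>N. \<forall>m\<ge>N. \<forall>n\<ge>N. (?d (1,0) m n)\<^sup>2 + (?d (0,1) m n)\<^sup>2 < e\<^sup>2"
      using cau[of "e\<^sup>2"] e unfolding \<psi> test_energy_diff[OF t t \<Omega>] by simp
    then obtain N where N: "\<And>m n. m \<ge> N \<Longrightarrow> n \<ge> N \<Longrightarrow> (?d (1,0) m n)\<^sup>2 + (?d (0,1) m n)\<^sup>2 < e\<^sup>2"
      by blast
    have "?d (1,0) m n < e \<and> ?d (0,1) m n < e" if "m \<ge> N" "n \<ge> N" for m n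
    proof -
      have "(?d (1,0) m n)\<^sup>2 < e\<^sup>2" "(?d (0,1) m n)\<^sup>2 < e\<^sup>2"
        using N[OF that] zero_le_power2[of "?d (0,1) m n"] zero_le_power2[of "?d (1,0) m n"] by linarith+
      then show ?thesis using power2_less_imp_less[OF _ less_imp_le[OF e]] by blast
    qed
    then show ?thesis by blast
  qed
  obtain p where p: "L2lim ?M (\<lambda>n. dx (\<phi> n)) p"
  proof -
    have "\<exists>p. L2lim ?M (\<lambda>n. dx (\<phi> n)) p"
    proof (rule sqint_complete[OF s(1)])
      show "\<exists>N. \<forall>m\<ge>N. \<forall>n\<ge>N. ?d (1,0) m n < e" if "0 < e" for e using c[OF that] by blast
    qed
    then show ?thesis using that by blast
  qed
  obtain q where q: "L2lim ?M (\<lambda>n. dy (\<phi> n)) q"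
  proof -
    have "\<exists>p. L2lim ?M (\<lambda>n. dy (\<phi> n)) p"
    proof (rule sqint_complete[OF s(2)])
      show "\<exists>N. \<forall>m\<ge>N. \<forall>n\<ge>N. ?d (0,1) m n < e" if "0 < e" for e using c[OF that] by blast
    qed
    then show ?thesis using that by blast
  qed
  have "L2lim ?M \<phi> u" using s u conv by (simp add: L2lim_def)
  from L2lim_jetI[OF this p q] have "jet u p q \<in> H10 \<Omega>" using t unfolding H10_def by blast
  then show "\<exists>p q. jet u p q \<in> H10 \<Omega>" by blast
next
  let ?M = "lebesgue_on \<Omega>"
  assume "\<exists>p q. jet u p q \<in> H10 \<Omega>"
  then obtain p q where U: "jet u p q \<in> H10 \<Omega>" by blast
  from H10E[OF U] obtain \<phi> where \<phi>: "\<And>n. \<phi> n \<in> test_functions \<Omega>" and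
    u: "L2lim ?M \<phi> u" "L2lim ?M (\<lambda>n. dx (\<phi> n)) p" "L2lim ?M (\<lambda>n. dy (\<phi> n)) q" by blast
  have cauchy: "\<exists>N. \<forall>m\<ge>N. \<forall>n\<ge>N. (nrm ?M (\<lambda>x. F m x - F n x))\<^sup>2 < e"
    if F: "L2lim ?M F G" and e: "0 < e" for F :: "nat \<Rightarrow> plane \<Rightarrow> complex" and G e
  proof -
    have s: "sqint ?M (F n)" "sqint ?M G" for n using F by (auto simp: L2lim_def)
    have "\<forall>\<^sub>F n in sequentially. nrm ?M (\<lambda>x. F n x - G x) < sqrt e / 2"
      using F e unfolding L2lim_def by (intro order_tendstoD(2)[of _ 0]) auto
    then obtain N where N: "\<And>n. n \<ge> N \<Longrightarrow> nrm ?M (\<lambda>x. F n x - G x) < sqrt e / 2"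
      by (auto simp: eventually_sequentially)
    have "(nrm ?M (\<lambda>x. F m x - F n x))\<^sup>2 < e" if "m \<ge> N" "n \<ge> N" for m n
    proof -
      have "nrm ?M (\<lambda>x. F m x - F n x) < sqrt e"
        using nrm_triangle_diff[OF s(1) s(2) s(1), of m n] N[OF that(1)] N[OF that(2)] nrm_minus_commute[of ?M G "F n"] by linarith
      then have "(nrm ?M (\<lambda>x. F m x - F n x))\<^sup>2 < (sqrt e)\<^sup>2" by (intro power_strict_mono) auto
      then show ?thesis using e by simp
    qed
    then show ?thesis by blast
  qed
  have "\<exists>N. \<forall>m\<ge>N. \<forall>n\<ge>N. Re (L2_inner ?M (\<lambda>x. - laplacian (\<phi> m) x - - laplacian (\<phi> n) x) (\<lambda>x. \<phi> m x - \<phi> n x)) < e" if e: "0 < e" for e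
  proof -
    obtain N1 where N1: "\<forall>m\<ge>N1. \<forall>n\<ge>N1. (nrm ?M (\<lambda>x. dx (\<phi> m) x - dx (\<phi> n) x))\<^sup>2 < e/2"
      using cauchy[OF u(2), of "e/2"] e by auto
    obtain N2 where N2: "\<forall>m\<ge>N2. \<forall>n\<ge>N2. (nrm ?M (\<lambda>x. dy (\<phi> m) x - dy (\<phi> n) x))\<^sup>2 < e/2"
      using cauchy[OF u(3), of "e/2"] e by auto
    show ?thesis
    proof (intro exI[of _ "max N1 N2"] allI impI)
      fix m n assume mn: "max N1 N2 \<le> m" "max N1 N2 \<le> n"
      have "(nrm ?M (\<lambda>x. dx (\<phi> m) x - dx (\<phi> n) x))\<^sup>2 < e/2"
        "(nrm ?M (\<lambda>x. dy (\<phi> m) x - dy (\<phi> n) x))\<^sup>2 < e/2"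
        using N1 N2 mn by simp_all
      then show "Re (L2_inner ?M (\<lambda>x. - laplacian (\<phi> m) x - - laplacian (\<phi> n) x) (\<lambda>x. \<phi> m x - \<phi> n x)) < e"
        unfolding test_energy_diff[OF \<phi> \<phi> \<Omega>] by linarith
    qed
  qed
  then show "u \<in> form_domain ?M (test_laplacian \<Omega>)"
    unfolding form_domain_def L2_sqint L2_norm_nrm using u(1) \<phi>
    by (intro CollectI conjI exI[of _ \<phi>] exI[of _ "\<lambda>n x. - laplacian (\<phi> n) x"]) (auto simp: L2lim_def)
qed

section \<open>Weak solutions of the Helmholtz equation\<close>

text \<open>Testing with the real pairing alone loses nothing, since \<open>H10\<close> is invariant
  under multiplication by \<i>.\<close>

definition weak_solution :: "plane set \<Rightarrow> (plane \<Rightarrow> complex) \<Rightarrow> (plane \<Rightarrow> complex) \<Rightarrow> (plane \<Rightarrow> complex) \<Rightarrow> (plane \<Rightarrow> complex) \<Rightarrow> bool" where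
  "weak_solution \<Omega> u p q g \<longleftrightarrow> jet u p q \<in> H10 \<Omega> \<and> sqint (lebesgue_on \<Omega>) g \<and>
     (\<forall>v vx vy. jet v vx vy \<in> H10 \<Omega> \<longrightarrow>
       ip (lebesgue_on \<Omega>) p vx + ip (lebesgue_on \<Omega>) q vy = ip (lebesgue_on \<Omega>) g v)"

text \<open>The adjoint relation is an equation against test functions; Green's identity shifts one
  derivative to \<open>u\<close>, after which only first derivatives of the test function occur and
  density extends it to all of \<open>H10\<close>.\<close>

lemma dirichlet_laplacian_weak:
  assumes \<Omega>: "open \<Omega>" and A: "(u, g) \<in> minus_dirichlet_laplacian \<Omega>"
  shows "\<exists>p q. weak_solution \<Omega> u p q g"
proof -
  let ?M = "lebesgue_on \<Omega>"
  have fd: "u \<in> form_domain ?M (test_laplacian \<Omega>)" and ad: "(u, g) \<in> adjoint_operator ?M (test_laplacian \<Omega>)"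
    using A by (auto simp: minus_dirichlet_laplacian_def friedrichs_extension_def)
  have s: "sqint ?M u" "sqint ?M g" and adj: "\<And>\<phi>. \<phi> \<in> test_functions \<Omega> \<Longrightarrow> L2_inner ?M g \<phi> = L2_inner ?M u (\<lambda>x. - laplacian \<phi> x)"
    using ad by (auto simp: adjoint_operator_def L2_sqint)
  obtain p q where U: "jet u p q \<in> H10 \<Omega>" using fd form_domain_H10[OF \<Omega>] by blast
  note sU = H10_jet_sqint[OF U]
  have test: "ip ?M p (dx \<phi>) + ip ?M q (dy \<phi>) = ip ?M g \<phi>" if \<phi>: "\<phi> \<in> test_functions \<Omega>" for \<phi>
    using arg_cong[OF adj[OF \<phi>], of Re] Re_L2_inner[OF s(2) test_sqint[OF \<phi> \<Omega>]] Re_L2_inner[OF s(1) laplacian_sqint[OF \<phi> \<Omega>]]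
      green[OF U \<phi> \<Omega>] by simp
  have "ip ?M p vx + ip ?M q vy = ip ?M g v" if V: "jet v vx vy \<in> H10 \<Omega>" for v vx vy
  proof -
    from H10E[OF V] obtain \<psi> where \<psi>: "\<And>n. \<psi> n \<in> test_functions \<Omega>" and
      v: "L2lim ?M \<psi> v" "L2lim ?M (\<lambda>n. dx (\<psi> n)) vx" "L2lim ?M (\<lambda>n. dy (\<psi> n)) vy" by blast
    have "(\<lambda>n. ip ?M p (dx (\<psi> n)) + ip ?M q (dy (\<psi> n))) \<longlonglongrightarrow> ip ?M p vx + ip ?M q vy"
      by (intro tendsto_add L2lim_ip[OF L2lim_const] sU v)
    moreover have "(\<lambda>n. ip ?M g (\<psi> n)) \<longlonglongrightarrow> ip ?M g v" by (rule L2lim_ip[OF L2lim_const[OF s(2)] v(1)])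
    ultimately show ?thesis unfolding test[OF \<psi>] by (rule LIMSEQ_unique)
  qed
  then show ?thesis using U s unfolding weak_solution_def by blast
qed

lemma weak_dirichlet_laplacian:
  assumes \<Omega>: "open \<Omega>" and w: "weak_solution \<Omega> u p q g"
  shows "(u, g) \<in> minus_dirichlet_laplacian \<Omega>"
proof -
  let ?M = "lebesgue_on \<Omega>"
  have U: "jet u p q \<in> H10 \<Omega>" and sg: "sqint ?M g" using w by (auto simp: weak_solution_def)
  note sU = H10_jet_sqint[OF U]
  have r: "ip ?M g \<phi> = ip ?M u (\<lambda>x. - laplacian \<phi> x)" if \<phi>: "\<phi> \<in> test_functions \<Omega>" for \<phi>
    using w tjet_H10[OF \<Omega> \<phi>] green[OF U \<phi> \<Omega>] unfolding weak_solution_def by metis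
  have "L2_inner ?M g \<phi> = L2_inner ?M u (\<lambda>x. - laplacian \<phi> x)" if \<phi>: "\<phi> \<in> test_functions \<Omega>" for \<phi>
  proof (rule complex_eqI)
    note t = test_sqint[OF \<phi> \<Omega>] and l = laplacian_sqint[OF \<phi> \<Omega>]
    show "Re (L2_inner ?M g \<phi>) = Re (L2_inner ?M u (\<lambda>x. - laplacian \<phi> x))"
      by (simp add: Re_L2_inner sg t sU l r[OF \<phi>])
    \<comment> \<open>The rotated test function yields the equality of the imaginary parts; the
      leading \<open>0\<close> matches the form of \<open>test_C1c_add\<close>.\<close>
    have i: "(\<lambda>x. 0 + \<i> * \<phi> x) \<in> test_functions \<Omega>" by (rule test_C1c_add(1)[OF test_zero \<phi>])
    have "laplacian (\<lambda>x. 0 + \<i> * \<phi> x) x = \<i> * laplacian \<phi> x" for x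
    proof -
      have "laplacian (\<lambda>x. 0 + \<i> * \<phi> x) x = laplacian (\<lambda>x. 0) x + \<i> * laplacian \<phi> x"
        by (rule laplacian_add_cmult[OF test_zero \<phi>])
      also have "laplacian (\<lambda>x. 0::complex) x = 0"
        using laplacian_add_cmult[OF test_zero test_zero, where c=1 and p=x] by simp
      finally show ?thesis by simp
    qed
    then show "Im (L2_inner ?M g \<phi>) = Im (L2_inner ?M u (\<lambda>x. - laplacian \<phi> x))"
      using r[OF i] by (simp add: Im_L2_inner sg t sU l)
  qed
  then have "(u, g) \<in> adjoint_operator ?M (test_laplacian \<Omega>)"
    using sg sU by (auto simp: adjoint_operator_def L2_sqint)
  moreover have "u \<in> form_domain ?M (test_laplacian \<Omega>)" using U form_domain_H10[OF \<Omega>] by blast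
  ultimately show ?thesis by (simp add: minus_dirichlet_laplacian_def friedrichs_extension_def)
qed

text \<open>Multiplying the form \<open>\<parallel>\<nabla>u\<parallel>\<^sup>2 - z \<parallel>u\<parallel>\<^sup>2\<close> by \<open>\<kappa> + \<i>\<close> with \<open>\<kappa> = \<epsilon> / (2 E)\<close> makes its
  real part coercive.\<close>

lemma helmholtz_solvable:
  assumes \<Omega>: "open \<Omega>" and E: "0 < E" and \<epsilon>: "0 < \<epsilon>" and f: "sqint (lebesgue_on \<Omega>) f"
  shows "\<exists>u p q. weak_solution \<Omega> u p q (\<lambda>x. f x + Complex E \<epsilon> * u x)"
proof -
  let ?M = "lebesgue_on \<Omega>"
  define \<kappa> where "\<kappa> = \<epsilon> / (2 * E)"
  define k where "k = Complex \<kappa> 1"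
  have \<kappa>: "0 < \<kappa>" using E \<epsilon> by (simp add: \<kappa>_def)
  define z where "z = Complex E \<epsilon>"
  define A where "A v = (- (k * z) * fst v, k * fst (snd v), k * snd (snd v))" for v :: "complex \<times> complex \<times> complex"
  have A: "bounded_linear A"
    unfolding A_def
    by (intro bounded_linear_Pair bounded_linear_mult_right[THEN bounded_linear_compose] bounded_linear_fst bounded_linear_snd bounded_linear_fst_comp bounded_linear_snd_comp)
  define c where "c = min \<kappa> (\<epsilon> / 2)"
  have c: "0 < c" using \<kappa> \<epsilon> by (simp add: c_def)
  have cz: "(w * a) \<bullet> a = Re w * (norm a)\<^sup>2" for w a :: complex
    unfolding cmod_power2 by (simp add: inner_complex_def power2_eq_square algebra_simps)
  have coer: "c * (norm v)\<^sup>2 \<le> A v \<bullet> v" for v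
  proof -
    obtain a b d where v: "v = (a, b, d)" by (cases v) auto
    have "\<kappa> * E = \<epsilon> / 2" using E by (simp add: \<kappa>_def)
    then have "Re (- (k * z)) = \<epsilon> / 2" by (simp add: k_def z_def)
    then have "A v \<bullet> v = \<epsilon> / 2 * (norm a)\<^sup>2 + \<kappa> * (norm b)\<^sup>2 + \<kappa> * (norm d)\<^sup>2"
      unfolding A_def v by (simp only: inner_Pair fst_conv snd_conv cz) (simp add: k_def)
    moreover have "c * (norm v)\<^sup>2 = c * (norm a)\<^sup>2 + c * (norm b)\<^sup>2 + c * (norm d)\<^sup>2"
      by (simp add: v norm_Pair algebra_simps)
    moreover have "c * (norm a)\<^sup>2 \<le> \<epsilon> / 2 * (norm a)\<^sup>2" "c * (norm b)\<^sup>2 \<le> \<kappa> * (norm b)\<^sup>2" "c * (norm d)\<^sup>2 \<le> \<kappa> * (norm d)\<^sup>2"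
      by (rule mult_right_mono, simp add: c_def, simp)+
    ultimately show ?thesis by linarith
  qed
  have F: "sqint ?M (jet (\<lambda>x. k * f x) (\<lambda>x. 0) (\<lambda>x. 0))" by (simp add: sqint_jet_iff sqint_cmult f)
  from lax_milgram[OF H10_closed_subspace A c coer F] obtain P where P: "P \<in> H10 \<Omega>"
    and eq: "\<And>V. V \<in> H10 \<Omega> \<Longrightarrow> ip ?M (\<lambda>x. A (P x)) V = ip ?M (jet (\<lambda>x. k * f x) (\<lambda>x. 0) (\<lambda>x. 0)) V" by blast
  define u where "u x = fst (P x)" for x
  define p where "p x = fst (snd (P x))" for x
  define q where "q x = snd (snd (P x))" for x
  have PU: "P = jet u p q" by (simp add: jet_def u_def p_def q_def)
  note U = P[unfolded PU]
  note s = H10_jet_sqint[OF U]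
  have k0: "k \<noteq> 0" by (simp add: k_def complex_eq_iff)
  \<comment> \<open>Testing with \<open>v\<close> divided by \<open>cnj k\<close> undoes the factor
    \<open>k\<close> that made the form coercive and returns the original equation.\<close>
  have ck: "(k * a) \<bullet> (inverse (cnj k) * b) = a \<bullet> b" for a b
  proof -
    have "(w * a) \<bullet> b = a \<bullet> (cnj w * b)" for w a b :: complex
      by (simp add: inner_complex_def algebra_simps)
    then show ?thesis using k0 by (simp add: mult.assoc[symmetric])
  qed
  have "ip ?M p vx + ip ?M q vy = ip ?M (\<lambda>x. f x + z * u x) v" if V: "jet v vx vy \<in> H10 \<Omega>" for v vx vy
  proof -
    note sV = H10_jet_sqint[OF V]
    have 1: "A (P x) = (k * (- (z * u x)), k * p x, k * q x)" for x
      by (simp add: A_def u_def p_def q_def)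
    have 2: "jet (\<lambda>x. k * f x) (\<lambda>x. 0) (\<lambda>x. 0) x = (k * f x, k * 0, k * 0)" for x by (simp add: jet_def)
    have 3: "jet (\<lambda>x. inverse (cnj k) * v x) (\<lambda>x. inverse (cnj k) * vx x) (\<lambda>x. inverse (cnj k) * vy x) x
      = (inverse (cnj k) * v x, inverse (cnj k) * vx x, inverse (cnj k) * vy x)" for x by (simp add: jet_def)
    from eq[OF H10_cmult[OF V, of "inverse (cnj k)"]]
    have "ip ?M (jet (\<lambda>x. - (z * u x)) p q) (jet v vx vy) = ip ?M (jet f (\<lambda>x. 0) (\<lambda>x. 0)) (jet v vx vy)"
      unfolding ip_def 1 2 3 inner_Pair ck by (simp only: jet_def inner_Pair)
    moreover have "ip ?M (jet (\<lambda>x. - (z * u x)) p q) (jet v vx vy) = - ip ?M (\<lambda>x. z * u x) v + ip ?M p vx + ip ?M q vy"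
      unfolding ip_def jet_def
      using sqint_inner[OF sqint_cmult[OF s(1), of z] sV(1)] sqint_inner[OF s(2) sV(2)] sqint_inner[OF s(3) sV(3)] by simp
    moreover have "ip ?M (jet f (\<lambda>x. 0) (\<lambda>x. 0)) (jet v vx vy) = ip ?M f v" by (simp add: ip_def jet_def)
    moreover have "ip ?M (\<lambda>x. f x + z * u x) v = ip ?M f v + ip ?M (\<lambda>x. z * u x) v"
      by (rule ip_add_left[OF f sqint_cmult[OF s(1)] sV(1)])
    ultimately show ?thesis by linarith
  qed
  then have "weak_solution \<Omega> u p q (\<lambda>x. f x + z * u x)"
    unfolding weak_solution_def using U sqint_add[OF f sqint_cmult[OF s(1)]] by blast
  then show ?thesis unfolding z_def by blast
qed

section \<open>Segments that reach the boundary\<close>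

text \<open>A parabola touching a convex function from above forces differentiability at the
  touching point, and steep parabolas touch near their vertex.\<close>

lemma convex_differentiable_dense:
  fixes f :: "real \<Rightarrow> real"
  assumes f: "convex_on {a<..<b} f" and ab: "a \<le> c" "c < d" "d \<le> b"
  shows "\<exists>s D. c < s \<and> s < d \<and> (f has_real_derivative D) (at s)"
proof -
  define m where "m = (c + d) / 2"
  define e where "e = (d - c) / 4"
  have e: "0 < e" "c < m - e" "m + e < d" using ab by (auto simp: e_def m_def field_simps)
  have cont: "continuous_on {a<..<b} f" using convex_on_continuous[OF open_greaterThanLessThan f] .
  have sub: "{m-e..m+e} \<subseteq> {a<..<b}" using e ab by auto
  \<comment> \<open>Large enough for \<open>g\<close> to be smaller at both ends than at the centre,
    so that its maximum is attained in the interior.\<close>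
  define N where "N = (\<bar>f (m+e)\<bar> + \<bar>f (m-e)\<bar> + \<bar>f m\<bar> + 1) / e\<^sup>2"
  have N0: "0 \<le> N" by (simp add: N_def)
  have Ne: "N * e\<^sup>2 = \<bar>f (m+e)\<bar> + \<bar>f (m-e)\<bar> + \<bar>f m\<bar> + 1" using e by (simp add: N_def)
  define g where "g s = f s - N * (s - m)\<^sup>2" for s
  have "continuous_on {m-e..m+e} g"
    unfolding g_def by (intro continuous_intros continuous_on_subset[OF cont sub])
  then obtain s0 where s0: "s0 \<in> {m-e..m+e}" "\<And>s. s \<in> {m-e..m+e} \<Longrightarrow> g s \<le> g s0"
    using continuous_attains_sup[of "{m-e..m+e}" g] e by auto
  have gm: "f m \<le> g s0" using s0(2)[of m] e by (simp add: g_def)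
  have "s0 \<noteq> m + e" using gm Ne by (auto simp: g_def)
  moreover have "s0 \<noteq> m - e" using gm Ne by (auto simp: g_def)
  ultimately have s0': "m - e < s0" "s0 < m + e" using s0(1) by auto
  define r where "r = min (s0 - (m - e)) (m + e - s0)"
  have r: "0 < r" using s0' by (simp add: r_def)
  define D where "D = 2 * N * (s0 - m)"
  have up: "f (s0 + h) - f s0 - D * h \<le> N * h\<^sup>2" if "\<bar>h\<bar> < r" for h
  proof -
    have "g (s0 + h) \<le> g s0" using that by (intro s0(2)) (auto simp: r_def)
    then have "f (s0 + h) - f s0 \<le> N * ((s0 + h - m)\<^sup>2 - (s0 - m)\<^sup>2)" by (simp add: g_def algebra_simps)
    also have "\<dots> = D * h + N * h\<^sup>2" by (simp add: D_def power2_eq_square algebra_simps)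
    finally show ?thesis by simp
  qed
  \<comment> \<open>Midpoint convexity reflects the upper bound at \<open>-h\<close> into a lower
    bound at \<open>h\<close>; both together leave an error of second order.\<close>
  have low: "- (N * h\<^sup>2) \<le> f (s0 + h) - f s0 - D * h" if h: "\<bar>h\<bar> < r" for h
  proof -
    have "a < m - e" "m + e < b" using e ab by linarith+
    then have "s0 + h \<in> {a<..<b}" "s0 - h \<in> {a<..<b}" using h by (auto simp: r_def)
    from convex_onD[OF f, of "1/2", OF _ _ this] have *: "f (1/2 * (s0 + h) + 1/2 * (s0 - h)) \<le> f (s0 + h) / 2 + f (s0 - h) / 2" by (simp add: algebra_simps)
    have "1/2 * (s0 + h) + 1/2 * (s0 - h) = s0" by (simp add: field_simps)
    with * have "f s0 \<le> f (s0 + h) / 2 + f (s0 - h) / 2" by (simp only:)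
    moreover have "f (s0 + -h) - f s0 - D * -h \<le> N * (-h)\<^sup>2" using h by (intro up) simp
    ultimately show ?thesis by simp
  qed
  have "(f has_real_derivative D) (at s0)"
    unfolding DERIV_def
  proof (rule LIM_I)
    fix \<eta> :: real assume \<eta>: "0 < \<eta>"
    define \<delta> where "\<delta> = min r (\<eta> / (N + 1))"
    have "norm ((f (s0 + h) - f s0) / h - D) < \<eta>" if h: "h \<noteq> 0" "norm (h - 0) < \<delta>" for h
    proof -
      have hr: "\<bar>h\<bar> < r" "\<bar>h\<bar> < \<eta> / (N + 1)" using h by (auto simp: \<delta>_def)
      have "\<bar>f (s0 + h) - f s0 - D * h\<bar> \<le> N * h\<^sup>2" using up[OF hr(1)] low[OF hr(1)] by linarith
      then have "\<bar>(f (s0 + h) - f s0 - D * h) / h\<bar> \<le> N * h\<^sup>2 / \<bar>h\<bar>" by (simp add: abs_divide divide_right_mono)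
      also have "N * h\<^sup>2 / \<bar>h\<bar> = N * \<bar>h\<bar>" using h(1) by (simp add: power2_eq_square field_simps abs_if)
      also have "\<dots> \<le> (N + 1) * \<bar>h\<bar>" by (simp add: algebra_simps)
      also have "\<dots> < \<eta>" using hr(2) N0 by (simp add: pos_less_divide_eq mult.commute)
      finally show ?thesis using h(1) by (simp add: diff_divide_distrib)
    qed
    moreover have "0 < \<delta>" using r \<eta> N0 by (simp add: \<delta>_def)
    ultimately show "\<exists>s>0. \<forall>x. x \<noteq> 0 \<and> norm (x - 0) < s \<longrightarrow> norm ((f (s0 + x) - f s0) / x - D) < \<eta>" by blast
  qed
  then show ?thesis using s0' e by (intro exI[of _ s0] exI[of _ D]) auto
qed

text \<open>The path runs strictly above the graph and arrives on it at time \<open>0\<close>, while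
  \<open>slope\<close> says that it rises at least as fast as every nearby tangent. If
  \<open>\<phi>\<close> is differentiable, \<open>\<phi> (s + t * \<alpha>) - t * \<beta>\<close> is
  nonincreasing in \<open>t\<close>, against the strict inequality at earlier times. If
  \<open>\<phi>\<close> is only convex, a tangent at a differentiability point close to
  \<open>s\<close> gives the same contradiction up to a small error.\<close>

lemma no_exit_graph:
  fixes \<phi> :: "real \<Rightarrow> real"
  assumes t1: "0 < t1" and path: "\<And>t. - t1 \<le> t \<Longrightarrow> t < 0 \<Longrightarrow> \<phi> (s + t * \<alpha>) < \<phi> s + t * \<beta>"
    and e: "0 < e" and slope: "\<And>x m. \<bar>x - s\<bar> < e \<Longrightarrow> (\<phi> has_real_derivative m) (at x) \<Longrightarrow> \<alpha> * m \<le> \<beta>"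
    and cont: "isCont \<phi> s"
    and reg: "(\<forall>x. \<bar>x - s\<bar> < e \<longrightarrow> (\<exists>m. (\<phi> has_real_derivative m) (at x))) \<or> convex_on {s-e<..<s+e} \<phi>"
  shows False
proof -
  define u where "u = min t1 (e / (2 * (\<bar>\<alpha>\<bar> + 1)))"
  have u: "0 < u" "u \<le> t1" using t1 e by (auto simp: u_def)
  have ua: "u * \<bar>\<alpha>\<bar> < e"
  proof -
    have "u \<le> e / (2 * (\<bar>\<alpha>\<bar> + 1))" by (simp add: u_def)
    then have "u * (2 * (\<bar>\<alpha>\<bar> + 1)) \<le> e" by (simp add: pos_le_divide_eq)
    moreover have "u * \<bar>\<alpha>\<bar> \<ge> 0" using u by simp
    moreover have "u * (2 * (\<bar>\<alpha>\<bar> + 1)) = 2 * (u * \<bar>\<alpha>\<bar>) + 2 * u" by (simp add: algebra_simps)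
    ultimately show ?thesis using u by linarith
  qed
  have small: "\<bar>t * \<alpha>\<bar> < e" if "\<bar>t\<bar> \<le> u" for t
  proof -
    have "\<bar>t * \<alpha>\<bar> \<le> u * \<bar>\<alpha>\<bar>" using that by (simp add: abs_mult mult_right_mono)
    then show ?thesis using ua by linarith
  qed
  have p: "\<phi> (s - u * \<alpha>) < \<phi> s - u * \<beta>" using path[of "-u"] u by simp
  show False
  proof (cases "\<forall>x. \<bar>x - s\<bar> < e \<longrightarrow> (\<exists>m. (\<phi> has_real_derivative m) (at x))")
    case True
    define g where "g t = \<phi> (s + t * \<alpha>) - t * \<beta>" for t
    have "g 0 \<le> g (-u)"
    proof (rule DERIV_nonpos_imp_nonincreasing[where f=g and a="-u" and b=0])
      fix t assume t: "- u \<le> t" "t \<le> 0"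
      then have "\<bar>s + t * \<alpha> - s\<bar> < e" using small[of t] by simp
      then obtain m where m: "(\<phi> has_real_derivative m) (at (s + t * \<alpha>))" "\<alpha> * m \<le> \<beta>"
        using True slope by blast
      have "(g has_real_derivative (m * \<alpha> - \<beta>)) (at t)"
      proof -
        have c: "((\<lambda>t. s + t * \<alpha>) has_real_derivative \<alpha>) (at t)" by (auto intro!: derivative_eq_intros)
        have "((\<lambda>t. t * \<beta>) has_real_derivative \<beta>) (at t)" by (auto intro!: derivative_eq_intros)
        from DERIV_diff[OF DERIV_chain2[where g="\<lambda>t. s + t * \<alpha>", OF m(1) c] this] show ?thesis
          unfolding g_def .
      qed
      then show "\<exists>y. (g has_real_derivative y) (at t) \<and> y \<le> 0" using m(2) by (auto simp: mult.commute)
    qed (use u in simp)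
    then show False using p by (simp add: g_def)
  next
    case False
    then have conv: "convex_on {s-e<..<s+e} \<phi>" using reg by blast
    show False
    proof (cases "\<alpha> = 0")
      case True
      \<comment> \<open>For a vertical path any single tangent decides the sign of
        \<open>\<beta>\<close>.\<close>
      obtain x m where "s - e < x" "x < s + e" "(\<phi> has_real_derivative m) (at x)"
        using convex_differentiable_dense[OF conv, of "s-e" "s+e"] e by auto
      then have "0 \<le> \<beta>" using slope[of x m] True by (simp add: abs_less_iff)
      then have "0 \<le> u * \<beta>" using u by simp
      then show False using p True by simp
    next
      case False
      define \<delta> where "\<delta> = \<phi> s - u * \<beta> - \<phi> (s - u * \<alpha>)"
      have \<delta>: "0 < \<delta>" using p by (simp add: \<delta>_def)
      obtain k where k: "0 < k" "\<And>x. \<bar>x - s\<bar> < k \<Longrightarrow> \<bar>\<phi> x - \<phi> s\<bar> < \<delta> / 2"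
        using cont \<delta> unfolding continuous_at_eps_delta by (metis half_gt_zero dist_real_def)
      \<comment> \<open>On the last piece of the path, of duration \<open>\<eta>\<close>, both the
        variation of \<open>\<phi>\<close> and the rise \<open>t * \<bar>\<beta>\<bar>\<close> stay
        within half of the gap \<open>\<delta>\<close>.\<close>
      define \<eta> where "\<eta> = min u (min (k / \<bar>\<alpha>\<bar>) (\<delta> / (2 * (\<bar>\<beta>\<bar> + 1))))"
      have \<eta>: "0 < \<eta>" "\<eta> \<le> u" using u k \<delta> False by (auto simp: \<eta>_def)
      have "\<eta> \<le> k / \<bar>\<alpha>\<bar>" "\<eta> \<le> \<delta> / (2 * (\<bar>\<beta>\<bar> + 1))" by (simp_all add: \<eta>_def)
      then have \<eta>k: "\<eta> * \<bar>\<alpha>\<bar> \<le> k" and \<eta>b: "\<eta> * (2 * (\<bar>\<beta>\<bar> + 1)) \<le> \<delta>"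
        using False by (auto simp: pos_le_divide_eq)
      define lo where "lo = min s (s - \<eta> * \<alpha>)"
      define hi where "hi = max s (s - \<eta> * \<alpha>)"
      have sg: "0 < \<alpha> \<and> 0 < \<eta> * \<alpha> \<or> \<alpha> < 0 \<and> \<eta> * \<alpha> < 0"
        using False \<eta>(1) by (cases "0 < \<alpha>") (auto simp: mult_pos_neg)
      have lohi: "lo < hi" "s - e \<le> lo" "hi \<le> s + e"
        using sg small[of \<eta>] \<eta> by (auto simp: lo_def hi_def min_def max_def abs_less_iff)
      obtain x m where x: "lo < x" "x < hi" "(\<phi> has_real_derivative m) (at x)"
        using convex_differentiable_dense[OF conv lohi(2) lohi(1) lohi(3)] by auto
      define t where "t = (s - x) / \<alpha>"
      have xt: "x = s - t * \<alpha>" using False by (simp add: t_def)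
      have t: "0 < t" "t < \<eta>"
      proof -
        have "0 < \<alpha> \<and> 0 < t * \<alpha> \<and> t * \<alpha> < \<eta> * \<alpha> \<or> \<alpha> < 0 \<and> t * \<alpha> < 0 \<and> \<eta> * \<alpha> < t * \<alpha>"
          using x(1,2) sg unfolding xt lo_def hi_def by (auto simp: min_def max_def split: if_splits)
        then show "0 < t" "t < \<eta>"
          by (auto simp: zero_less_mult_iff mult_less_0_iff)
      qed
      have xe: "\<bar>x - s\<bar> < e" using small[of t] t \<eta> by (simp add: xt)
      have am: "\<alpha> * m \<le> \<beta>" by (rule slope[OF xe x(3)])
      \<comment> \<open>The supporting line at the differentiability point \<open>x\<close> is
        compared with the graph at the earlier point of the path.\<close>
      have tan: "m * ((s - u * \<alpha>) - x) \<le> \<phi> (s - u * \<alpha>) - \<phi> x"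
      proof (rule convex_on_imp_above_tangent[OF conv])
        show "x \<in> interior {s-e<..<s+e}" using xe by (simp add: abs_less_iff)
        show "s - u * \<alpha> \<in> {s-e<..<s+e}" using small[of u] u by (simp add: abs_less_iff)
      qed (use x(3) has_field_derivative_at_within in auto)
      have eq: "m * ((s - u * \<alpha>) - x) = - ((u - t) * (\<alpha> * m))" by (simp add: xt algebra_simps)
      have le: "(u - t) * (\<alpha> * m) \<le> (u - t) * \<beta>" using am t \<eta> by (intro mult_left_mono) auto
      have "\<phi> x \<le> \<phi> (s - u * \<alpha>) + (u - t) * \<beta>" using tan le unfolding eq by linarith
      then have up: "\<phi> x \<le> \<phi> (s - u * \<alpha>) + u * \<beta> - t * \<beta>" by (simp add: left_diff_distrib)
      have "- (t * \<beta>) \<le> t * \<bar>\<beta>\<bar>" using t by (cases "0 \<le> \<beta>") (auto simp: mult_nonneg_nonneg)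
      also have "\<dots> \<le> \<eta> * (\<bar>\<beta>\<bar> + 1)" using t by (intro mult_mono) auto
      finally have tb: "- (t * \<beta>) \<le> \<delta> / 2" using \<eta>b by (simp add: algebra_simps)
      have "\<bar>x - s\<bar> = t * \<bar>\<alpha>\<bar>" using t by (simp add: xt abs_mult)
      also have "\<dots> < \<eta> * \<bar>\<alpha>\<bar>" using t False by simp
      finally have "\<bar>\<phi> x - \<phi> s\<bar> < \<delta> / 2" using \<eta>k by (intro k(2)) linarith
      then have "\<phi> s - \<phi> x < \<delta> / 2" by linarith
      then have "\<phi> s - (\<phi> (s - u * \<alpha>) + u * \<beta>) < \<delta>" using up tb by linarith
      then show False by (simp add: \<delta>_def)
    qed
  qed
qed

text \<open>A C^{1,1} graph function need not be globally Lipschitz, as its slope may grow, whereas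
  \<open>outward_normal\<close> asks for a Lipschitz graph. Freezing the argument outside a unit
  neighbourhood repairs this without changing the boundary near the point.\<close>

lemma lipschitz_clamp:
  fixes \<phi> \<phi>' :: "real \<Rightarrow> real"
  assumes d: "\<And>t. (\<phi> has_real_derivative \<phi>' t) (at t)" and L: "L-lipschitz_on UNIV \<phi>'"
  shows "\<exists>B. B-lipschitz_on UNIV (\<lambda>t. \<phi> (max (s - 1) (min (s + 1) t)))"
proof -
  let ?c = "\<lambda>t. max (s - 1) (min (s + 1) t)"
  define B where "B = \<bar>\<phi>' s\<bar> + L"
  have L0: "0 \<le> L" by (rule lipschitz_on_nonneg[OF L])
  have B0: "0 \<le> B" using L0 by (simp add: B_def)
  have bnd: "norm (\<phi>' t) \<le> B" if "t \<in> {s-1..s+1}" for t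
  proof -
    have "\<bar>\<phi>' t - \<phi>' s\<bar> \<le> L * \<bar>t - s\<bar>" using lipschitz_onD[OF L, of t s] by (simp add: dist_real_def)
    also have "\<dots> \<le> L * 1" using that L0 by (intro mult_left_mono) (auto simp: abs_le_iff)
    finally show ?thesis by (simp add: B_def)
  qed
  have "B-lipschitz_on {s-1..s+1} \<phi>"
  proof (rule lipschitz_onI[OF _ B0])
    fix x y assume xy: "x \<in> {s-1..s+1}" "y \<in> {s-1..s+1}"
    have "norm (\<phi> x - \<phi> y) \<le> B * norm (x - y)"
      by (rule field_differentiable_bound[OF _ has_field_derivative_at_within[OF d] bnd xy]) auto
    then show "dist (\<phi> x) (\<phi> y) \<le> B * dist x y" by (simp add: dist_norm)
  qed
  then have *: "dist (\<phi> x) (\<phi> y) \<le> B * dist x y" if "x \<in> {s-1..s+1}" "y \<in> {s-1..s+1}" for x y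
    using lipschitz_onD that by blast
  have "B-lipschitz_on UNIV (\<lambda>t. \<phi> (?c t))"
  proof (rule lipschitz_onI[OF _ B0])
    fix x y :: real
    have "dist (\<phi> (?c x)) (\<phi> (?c y)) \<le> B * dist (?c x) (?c y)" by (rule *) auto
    also have "\<dots> \<le> B * dist x y" using B0 by (intro mult_left_mono) (auto simp: dist_real_def)
    finally show "dist (\<phi> (?c x)) (\<phi> (?c y)) \<le> B * dist x y" .
  qed
  then show ?thesis by blast
qed

lemma orthogonal_transformation_inverse:
  assumes T: "orthogonal_transformation (T :: 'a::euclidean_space \<Rightarrow> 'a)"
  obtains S where "orthogonal_transformation S" "\<And>x. T (S x) = x" "\<And>x. S (T x) = x"
proof
  show "orthogonal_transformation (inv T)" using T by (rule orthogonal_transformation_inv)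
  show "T (inv T x) = x" "inv T (T x) = x" for x
    using orthogonal_transformation_bij[OF T] by (auto simp: bij_is_surj surj_f_inv_f bij_is_inj inv_f_f)
qed

text \<open>Both alternatives of the regularity assumption are brought to Lipschitz graphs: a
  C^{1,1} chart is clamped, and in the convex case the Lipschitz chart inherits convexity from
  \<Omega>. That \<open>p\<close> lies on the graph enters as a proviso, which
  \<open>no_exit\<close> verifies.\<close>

lemma regular_chart:
  assumes lip: "lipschitz_boundary \<Omega>" and reg: "locally_convex_or_C11 \<Omega>" and p: "p \<in> frontier \<Omega>" and \<Omega>: "open \<Omega>"
  shows "\<exists>T \<phi> L e. local_epigraph \<Omega> p T \<phi> \<and> L-lipschitz_on UNIV \<phi> \<and> 0 < e \<and>
    ((\<forall>x. \<bar>x - fst (T p)\<bar> < e \<longrightarrow> (\<exists>m. (\<phi> has_real_derivative m) (at x))) \<or>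
     (\<phi> (fst (T p)) = snd (T p) \<longrightarrow> convex_on {fst (T p) - e<..<fst (T p) + e} \<phi>))"
proof -
  obtain V where V: "open V" "p \<in> V" "convex (V \<inter> \<Omega>) \<or> C11_boundary_in V \<Omega>"
    using reg p unfolding locally_convex_or_C11_def by blast
  show ?thesis
  proof (cases "C11_boundary_in V \<Omega>")
    case True
    then obtain T \<phi> \<phi>' L where c: "local_epigraph \<Omega> p T \<phi>" "\<And>t. (\<phi> has_real_derivative \<phi>' t) (at t)" "L-lipschitz_on UNIV \<phi>'"
      using V(2) p unfolding C11_boundary_in_def by blast
    define s where "s = fst (T p)"
    define \<psi> where "\<psi> = (\<lambda>t. \<phi> (max (s - 1) (min (s + 1) t)))"
    obtain B where B: "B-lipschitz_on UNIV \<psi>" using lipschitz_clamp[OF c(2,3), of s] unfolding \<psi>_def by blast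
    have eq: "\<psi> x = \<phi> x" if "\<bar>x - s\<bar> < 1" for x using that by (simp add: \<psi>_def abs_less_iff max_def min_def)
    obtain U where U: "open U" "p \<in> U" "\<Omega> \<inter> U = {q \<in> U. \<phi> (fst (T q)) < snd (T q)}" and T: "orthogonal_transformation T"
      using c(1) unfolding local_epigraph_def by blast
    have cT: "continuous_on UNIV T" using orthogonal_transformation_linear[OF T] by (simp add: linear_continuous_on linear_linear)
    have "local_epigraph \<Omega> p T \<psi>"
      unfolding local_epigraph_def
    proof (intro conjI T exI[of _ "U \<inter> {q. \<bar>fst (T q) - s\<bar> < 1}"])
      have "open {q. \<bar>fst (T q) - s\<bar> < 1}"
        by (intro open_Collect_less continuous_intros cT)
      then show "open (U \<inter> {q. \<bar>fst (T q) - s\<bar> < 1})" using U(1) by blast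
      show "p \<in> U \<inter> {q. \<bar>fst (T q) - s\<bar> < 1}" using U(2) by (simp add: s_def)
      show "\<Omega> \<inter> (U \<inter> {q. \<bar>fst (T q) - s\<bar> < 1}) = {q \<in> U \<inter> {q. \<bar>fst (T q) - s\<bar> < 1}. \<psi> (fst (T q)) < snd (T q)}"
        using U(3) eq by auto
    qed
    moreover have "\<exists>m. (\<psi> has_real_derivative m) (at x)" if x: "\<bar>x - s\<bar> < 1" for x
    proof -
      have "(\<psi> has_real_derivative \<phi>' x) (at x)"
        by (rule has_field_derivative_transform_within_open[OF c(2), where S="{s-1<..<s+1}"])
          (use x eq in \<open>auto simp: abs_less_iff\<close>)
      then show ?thesis by blast
    qed
    ultimately show ?thesis using B unfolding s_def by (intro exI[of _ T] exI[of _ \<psi>] exI[of _ B] exI[of _ 1]) auto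
  next
    case False
    then have conv: "convex (V \<inter> \<Omega>)" using V(3) by blast
    obtain T \<phi> L where c: "local_epigraph \<Omega> p T \<phi>" and L: "L-lipschitz_on UNIV \<phi>"
      using lip p unfolding lipschitz_boundary_def by blast
    obtain U where U: "open U" "p \<in> U" "\<Omega> \<inter> U = {q \<in> U. \<phi> (fst (T q)) < snd (T q)}" and T: "orthogonal_transformation T"
      using c unfolding local_epigraph_def by blast
    define s where "s = fst (T p)"
    obtain S where S: "orthogonal_transformation S" "\<And>x. T (S x) = x" "\<And>x. S (T x) = x"
      using orthogonal_transformation_inverse[OF T] by blast
    note lS = orthogonal_transformation_linear[OF S(1)]
    obtain r where r: "0 < r" "ball p r \<subseteq> U \<inter> V" using U V open_contains_ball[of "U \<inter> V"] by blast
    have L0: "0 \<le> L" by (rule lipschitz_on_nonneg[OF L])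
    \<comment> \<open>Points over the interval, raised above the graph by less than
      \<open>e\<close>, are within \<open>(L + 2) * e < r\<close> of \<open>p\<close>.\<close>
    define e where "e = r / (L + 3)"
    have e: "0 < e" using r L0 by (simp add: e_def)
    have er: "(L + 2) * e < r" using r L0 by (simp add: e_def field_simps)
    have "convex_on {s - e<..<s + e} \<phi>" if ps: "\<phi> s = snd (T p)"
    proof (rule convex_onI)
      fix t x y :: real assume t: "0 < t" "t < 1" and x: "x \<in> {s - e<..<s + e}" and y: "y \<in> {s - e<..<s + e}"
      have inb: "S (x, \<phi> x + k) \<in> ball p r" if x: "\<bar>x - s\<bar> < e" and k: "0 < k" "k < e" for x k
      proof -
        have "dist p (S (x, \<phi> x + k)) = dist (S (T p)) (S (x, \<phi> x + k))" by (simp add: S)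
        also have "\<dots> = norm (S (T p - (x, \<phi> x + k)))" by (simp add: dist_norm linear_diff[OF lS])
        also have "\<dots> = norm (T p - (x, \<phi> x + k))" by (rule orthogonal_transformation_norm[OF S(1)])
        also have "T p - (x, \<phi> x + k) = (s - x, \<phi> s - \<phi> x - k)" by (simp add: s_def ps[unfolded s_def] prod_eq_iff)
        also have "norm \<dots> \<le> \<bar>s - x\<bar> + \<bar>\<phi> s - \<phi> x - k\<bar>" using norm_Pair_le[of "s - x" "\<phi> s - \<phi> x - k"] by simp
        also have "\<bar>\<phi> s - \<phi> x - k\<bar> \<le> \<bar>\<phi> x - \<phi> s\<bar> + k" using k by linarith
        also have "\<bar>\<phi> x - \<phi> s\<bar> \<le> L * \<bar>x - s\<bar>" using lipschitz_onD[OF L, of x s] by (simp add: dist_real_def)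
        also have "L * \<bar>x - s\<bar> \<le> L * e" using x L0 by (intro mult_left_mono) auto
        finally have "dist p (S (x, \<phi> x + k)) < (L + 2) * e" using x k by (simp add: algebra_simps)
        then show ?thesis using er by simp
      qed
      have cb: "convex (ball p r \<inter> \<Omega>)"
      proof -
        have "ball p r \<inter> \<Omega> = ball p r \<inter> (V \<inter> \<Omega>)" using r(2) by auto
        then show ?thesis using convex_Int[OF convex_ball conv] by simp
      qed
      \<comment> \<open>Graph points are not in \<Omega>, so they are lifted by \<open>k\<close>
        before the convexity of \<Omega> near \<open>p\<close> is used; \<open>k\<close> tends to
        zero afterwards.\<close>
      have lt: "\<phi> ((1 - t) * x + t * y) < (1 - t) * \<phi> x + t * \<phi> y + k" if k: "0 < k" "k < e" for k
      proof -
        have 1: "S (z, \<phi> z + k) \<in> ball p r \<inter> \<Omega>" if "\<bar>z - s\<bar> < e" for z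
        proof -
          have "S (z, \<phi> z + k) \<in> ball p r" by (rule inb[OF that k])
          moreover from this have "S (z, \<phi> z + k) \<in> \<Omega> \<inter> U" unfolding U(3) using r(2) k by (auto simp: S)
          ultimately show ?thesis by blast
        qed
        have "S (x, \<phi> x + k) \<in> ball p r \<inter> \<Omega>" "S (y, \<phi> y + k) \<in> ball p r \<inter> \<Omega>"
          using x y by (auto intro!: 1 simp: abs_less_iff simp del: Int_iff)
        then have "(1 - t) *\<^sub>R S (x, \<phi> x + k) + t *\<^sub>R S (y, \<phi> y + k) \<in> ball p r \<inter> \<Omega>"
          using cb t unfolding convex_alt by auto
        then have "(1 - t) *\<^sub>R S (x, \<phi> x + k) + t *\<^sub>R S (y, \<phi> y + k) \<in> \<Omega> \<inter> U" using r(2) by blast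
        then have *: "\<phi> (fst (T ((1 - t) *\<^sub>R S (x, \<phi> x + k) + t *\<^sub>R S (y, \<phi> y + k)))) < snd (T ((1 - t) *\<^sub>R S (x, \<phi> x + k) + t *\<^sub>R S (y, \<phi> y + k)))"
          unfolding U(3) by blast
        have "T ((1 - t) *\<^sub>R S (x, \<phi> x + k) + t *\<^sub>R S (y, \<phi> y + k)) = (1 - t) *\<^sub>R (x, \<phi> x + k) + t *\<^sub>R (y, \<phi> y + k)"
          using orthogonal_transformation_linear[OF T] by (simp add: linear_add linear_scale S)
        with * show ?thesis by (simp add: algebra_simps)
      qed
      show "\<phi> ((1 - t) *\<^sub>R x + t *\<^sub>R y) \<le> (1 - t) * \<phi> x + t * \<phi> y"
      proof (rule field_le_epsilon)
        fix k :: real assume k: "0 < k"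
        have "0 < min k (e/2)" "min k (e/2) < e" "min k (e/2) \<le> k" using k e by auto
        then show "\<phi> ((1 - t) *\<^sub>R x + t *\<^sub>R y) \<le> (1 - t) * \<phi> x + t * \<phi> y + k"
          using lt[of "min k (e/2)"] unfolding real_scaleR_def by linarith
      qed
    qed (simp add: convex_real_interval)
    then show ?thesis using c L e unfolding s_def by (intro exI[of _ T] exI[of _ \<phi>] exI[of _ L] exI[of _ e]) auto
  qed
qed

text \<open>In the coordinates of the chart the direction \<open>d\<close> is
  \<open>(\<alpha>, \<beta>)\<close> and the normal is a positive multiple of
  \<open>(m, -1)\<close>, so the sign condition reads \<open>\<alpha> * m \<le> \<beta>\<close>.
  Requiring it on a neighbourhood \<open>V\<close> is essential, since \<open>p\<close> itself may
  have no normal.\<close>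

lemma no_exit:
  assumes \<Omega>: "open \<Omega>" "lipschitz_boundary \<Omega>" "locally_convex_or_C11 \<Omega>"
    and p: "p \<notin> \<Omega>" and t1: "0 < t1" and path: "\<And>t. - t1 \<le> t \<Longrightarrow> t < 0 \<Longrightarrow> p + t *\<^sub>R d \<in> \<Omega>"
    and V: "open V" "p \<in> V" "\<And>q \<nu>. q \<in> V \<Longrightarrow> outward_normal \<Omega> q \<nu> \<Longrightarrow> d \<bullet> \<nu> \<le> 0"
  shows False
proof -
  have lim: "((\<lambda>t. p + t *\<^sub>R d) \<longlongrightarrow> p) (at_left 0)"
    by (rule tendsto_eq_intros | simp)+
  have ev: "\<forall>\<^sub>F t in at_left 0. - t1 \<le> t \<and> t < 0"
    using t1 unfolding eventually_at_left_field by (intro exI[of _ "-t1"]) auto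
  have pf: "p \<in> frontier \<Omega>"
  proof -
    have "p \<in> closure \<Omega>"
    proof (rule Lim_in_closed_set[OF closed_closure _ _ lim])
      show "\<forall>\<^sub>F t in at_left 0. p + t *\<^sub>R d \<in> closure \<Omega>"
        using ev by eventually_elim (use path closure_subset in blast)
    qed simp
    then show ?thesis using p \<Omega>(1) by (simp add: frontier_def interior_open)
  qed
  obtain T \<phi> L e where c: "local_epigraph \<Omega> p T \<phi>" and L: "L-lipschitz_on UNIV \<phi>" and e: "0 < e"
    and reg: "(\<forall>x. \<bar>x - fst (T p)\<bar> < e \<longrightarrow> (\<exists>m. (\<phi> has_real_derivative m) (at x))) \<or>
     (\<phi> (fst (T p)) = snd (T p) \<longrightarrow> convex_on {fst (T p) - e<..<fst (T p) + e} \<phi>)"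
    using regular_chart[OF \<Omega>(2,3) pf \<Omega>(1)] by blast
  obtain U where U: "open U" "p \<in> U" "\<Omega> \<inter> U = {q \<in> U. \<phi> (fst (T q)) < snd (T q)}" and T: "orthogonal_transformation T"
    using c unfolding local_epigraph_def by blast
  note lT = orthogonal_transformation_linear[OF T]
  obtain S where S: "orthogonal_transformation S" "\<And>x. T (S x) = x" "\<And>x. S (T x) = x"
    using orthogonal_transformation_inverse[OF T] by blast
  note lS = orthogonal_transformation_linear[OF S(1)]
  have cS: "continuous_on UNIV S" using lS by (simp add: linear_continuous_on linear_linear)
  have c\<phi>: "continuous_on UNIV \<phi>" using L by (rule lipschitz_on_continuous_on)
  then have c\<phi>': "isCont \<phi> x" for x by (simp add: continuous_on_eq_continuous_at)
  define s where "s = fst (T p)"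
  define \<alpha> where "\<alpha> = fst (T d)"
  define \<beta> where "\<beta> = snd (T d)"
  have Tpath: "T (p + t *\<^sub>R d) = (s + t * \<alpha>, snd (T p) + t * \<beta>)" for t
    by (simp add: linear_add[OF lT] linear_scale[OF lT] s_def \<alpha>_def \<beta>_def prod_eq_iff)
  have evU: "\<forall>\<^sub>F t in at_left 0. p + t *\<^sub>R d \<in> U"
    by (rule topological_tendstoD[OF lim U(1,2)])
  have below: "\<phi> (s + t * \<alpha>) < snd (T p) + t * \<beta>" if "p + t *\<^sub>R d \<in> U" "p + t *\<^sub>R d \<in> \<Omega>" for t
  proof -
    have "p + t *\<^sub>R d \<in> \<Omega> \<inter> U" using that by blast
    then show ?thesis unfolding U(3) by (simp add: Tpath)
  qed
  \<comment> \<open>\<open>p\<close> is not strictly above the graph because it is outside \<Omega>,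
    and not below it because it is a limit of points above.\<close>
  have ps: "\<phi> s = snd (T p)"
  proof (rule antisym)
    have "p \<notin> \<Omega> \<inter> U" using p by blast
    then show "snd (T p) \<le> \<phi> s" unfolding U(3) using U(2) by (simp add: s_def)
    have "((\<lambda>t. \<phi> (s + t * \<alpha>)) \<longlongrightarrow> \<phi> s) (at_left 0)"
      by (rule isCont_tendsto_compose[OF c\<phi>']) (rule tendsto_eq_intros | simp)+
    moreover have "((\<lambda>t. snd (T p) + t * \<beta>) \<longlongrightarrow> snd (T p)) (at_left 0)"
      by (rule tendsto_eq_intros | simp)+
    moreover have "\<forall>\<^sub>F t in at_left 0. \<phi> (s + t * \<alpha>) \<le> snd (T p) + t * \<beta>"
      using ev evU by eventually_elim (use below path less_imp_le in blast)
    ultimately show "\<phi> s \<le> snd (T p)" by (intro tendsto_le[OF _ _ _]) auto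
  qed
  obtain t2 where t2: "0 < t2" "\<And>t. - t2 \<le> t \<Longrightarrow> t < 0 \<Longrightarrow> \<phi> (s + t * \<alpha>) < \<phi> s + t * \<beta>"
  proof -
    obtain b where b: "b < 0" "\<And>t. b < t \<Longrightarrow> t < 0 \<Longrightarrow> p + t *\<^sub>R d \<in> U"
      using evU unfolding eventually_at_left_field by blast
    show ?thesis
    proof (rule that[of "min t1 (- b / 2)"])
      show "0 < min t1 (- b / 2)" using b t1 by simp
      fix t assume "- min t1 (- b / 2) \<le> t" "t < 0"
      then have "p + t *\<^sub>R d \<in> U" "p + t *\<^sub>R d \<in> \<Omega>" using b by (auto intro!: b(2) path simp: min_def split: if_splits)
      then show "\<phi> (s + t * \<alpha>) < \<phi> s + t * \<beta>" using below ps by simp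
    qed
  qed
  have Ss: "S (s, \<phi> s) = p"
  proof -
    have "(s, \<phi> s) = T p" unfolding ps by (simp add: s_def)
    then show ?thesis using S(3) by simp
  qed
  have "open ((\<lambda>x. S (x, \<phi> x)) -` (U \<inter> V))"
    by (intro open_vimage open_Int U V continuous_on_compose2[OF cS] continuous_intros c\<phi>) auto
  moreover have "s \<in> (\<lambda>x. S (x, \<phi> x)) -` (U \<inter> V)" using U V by (simp add: Ss)
  ultimately obtain e2 where e2: "0 < e2" "ball s e2 \<subseteq> (\<lambda>x. S (x, \<phi> x)) -` (U \<inter> V)"
    using open_contains_ball by blast
  define e3 where "e3 = min e e2"
  have slope: "\<alpha> * m \<le> \<beta>" if x: "\<bar>x - s\<bar> < e3" and m: "(\<phi> has_real_derivative m) (at x)" for x m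
  proof -
    define q where "q = S (x, \<phi> x)"
    have q: "q \<in> U" "q \<in> V" using subsetD[OF e2(2), of x] x by (auto simp: e3_def q_def dist_real_def)
    have Tq: "T q = (x, \<phi> x)" by (simp add: q_def S)
    have "q \<notin> \<Omega> \<inter> U" unfolding U(3) by (simp add: Tq)
    then have qn: "q \<notin> \<Omega>" using q by blast
    \<comment> \<open>Points slightly above the graph, in the vertical direction of the chart, lie
      in \<Omega> and tend to \<open>q\<close>.\<close>
    have "q \<in> closure \<Omega>"
    proof (rule Lim_in_closed_set[OF closed_closure, of "\<lambda>k. q + k *\<^sub>R S (0, 1)" _ "at_right 0"])
      have l: "((\<lambda>k. q + k *\<^sub>R S (0, 1)) \<longlongrightarrow> q) (at_right (0::real))"
        by (rule tendsto_eq_intros | simp)+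
      then show "((\<lambda>k. q + k *\<^sub>R S (0, 1)) \<longlongrightarrow> q) (at_right (0::real))" .
      have "\<forall>\<^sub>F k in at_right 0. q + k *\<^sub>R S (0, 1) \<in> U" by (rule topological_tendstoD[OF l U(1) q(1)])
      moreover have "\<forall>\<^sub>F k in at_right 0. 0 < (k::real)" by (simp add: eventually_at_filter)
      ultimately show "\<forall>\<^sub>F k in at_right 0. q + k *\<^sub>R S (0, 1) \<in> closure \<Omega>"
      proof eventually_elim
        case (elim k)
        have "T (q + k *\<^sub>R S (0, 1)) = (x, \<phi> x + k)" by (simp add: linear_add[OF lT] linear_scale[OF lT] S Tq)
        then have "q + k *\<^sub>R S (0, 1) \<in> \<Omega> \<inter> U" unfolding U(3) using elim by simp
        then show ?case using closure_subset by blast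
      qed
    qed simp
    then have qf: "q \<in> frontier \<Omega>" using qn \<Omega>(1) by (simp add: frontier_def interior_open)
    define \<nu> where "\<nu> = S ((1 / sqrt (1 + m\<^sup>2)) *\<^sub>R (m, -1))"
    have "local_epigraph \<Omega> q T \<phi>" unfolding local_epigraph_def using T U q by blast
    then have "outward_normal \<Omega> q \<nu>"
      unfolding outward_normal_def using qf L m by (intro conjI exI[of _ T] exI[of _ \<phi>] exI[of _ L] exI[of _ m]) (auto simp: Tq \<nu>_def S)
    then have "d \<bullet> \<nu> \<le> 0" by (rule V(3)[OF q(2)])
    also have "d \<bullet> \<nu> = T d \<bullet> T \<nu>" using T unfolding orthogonal_transformation_def by metis
    also have "\<dots> = (1 / sqrt (1 + m\<^sup>2)) * (\<alpha> * m - \<beta>)"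
      by (cases "T d") (simp add: \<nu>_def S \<alpha>_def \<beta>_def inner_prod_def algebra_simps diff_divide_distrib)
    finally have "(1 / sqrt (1 + m\<^sup>2)) * (\<alpha> * m - \<beta>) \<le> 0" .
    moreover have "0 < 1 / sqrt (1 + m\<^sup>2)" by (simp add: add_pos_nonneg)
    ultimately have "\<alpha> * m - \<beta> \<le> 0" using mult_pos_pos[of "1 / sqrt (1 + m\<^sup>2)" "\<alpha> * m - \<beta>"] by linarith
    then show ?thesis by simp
  qed
  show False
  proof (rule no_exit_graph[OF t2, of e3])
    show "0 < e3" using e e2 by (simp add: e3_def)
    show "(\<forall>x. \<bar>x - s\<bar> < e3 \<longrightarrow> (\<exists>m. (\<phi> has_real_derivative m) (at x))) \<or> convex_on {s - e3<..<s + e3} \<phi>"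
    proof (cases "convex_on {s - e<..<s + e} \<phi>")
      case True
      then have "convex_on {s - e3<..<s + e3} \<phi>" by (rule convex_on_subset) (auto simp: e3_def convex_real_interval)
      then show ?thesis by blast
    next
      case False
      then show ?thesis using reg ps by (auto simp: s_def e3_def)
    qed
  qed (use slope c\<phi>' in auto)
qed

section \<open>Change of variables in the plane\<close>

text \<open>The change of variables formula is stated for vectors in \<open>real^2\<close>;
  integrals over the plane are transported along this linear isometry.\<close>

definition to_vec2 :: "plane \<Rightarrow> real^2" where "to_vec2 p = vector [fst p, snd p]"
definition of_vec2 :: "real^2 \<Rightarrow> plane" where "of_vec2 z = (z $ 1, z $ 2)"

lemma vec2_inverse [simp]: "of_vec2 (to_vec2 p) = p" "to_vec2 (of_vec2 z) = z"
  by (simp_all add: to_vec2_def of_vec2_def vec_eq_iff forall_2)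

lemma to_vec2_nth [simp]: "to_vec2 p $ 1 = fst p" "to_vec2 p $ 2 = snd p"
  by (simp_all add: to_vec2_def)

lemma mem_to_vec2_image: "z \<in> to_vec2 ` S \<longleftrightarrow> of_vec2 z \<in> S"
proof
  assume "of_vec2 z \<in> S"
  then have "to_vec2 (of_vec2 z) \<in> to_vec2 ` S" by (rule imageI)
  then show "z \<in> to_vec2 ` S" by simp
qed auto

lemma linear_to_vec2: "linear to_vec2"
  by (rule linearI) (simp_all add: vec_eq_iff forall_2)

lemma linear_of_vec2: "linear of_vec2"
  by (rule linearI) (simp_all add: of_vec2_def)

lemma to_vec2_cbox: "to_vec2 ` cbox u v = cbox (to_vec2 u) (to_vec2 v)"
proof -
  have "x \<in> to_vec2 ` cbox u v \<longleftrightarrow> x \<in> cbox (to_vec2 u) (to_vec2 v)" for x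
  proof -
    have "x \<in> to_vec2 ` cbox u v \<longleftrightarrow> of_vec2 x \<in> cbox u v" by (rule mem_to_vec2_image)
    also have "\<dots> \<longleftrightarrow> x \<in> cbox (to_vec2 u) (to_vec2 v)"
      by (cases u; cases v) (auto simp: of_vec2_def cbox_Pair_eq mem_box_cart forall_2)
    finally show ?thesis .
  qed
  then show ?thesis by blast
qed

lemma of_vec2_cbox: "of_vec2 ` cbox u v = cbox (of_vec2 u) (of_vec2 v)"
proof -
  have "of_vec2 ` cbox u v = of_vec2 ` (to_vec2 ` cbox (of_vec2 u) (of_vec2 v))" by (simp add: to_vec2_cbox)
  then show ?thesis by (simp add: image_image)
qed

lemma content_of_vec2: "measure lborel (of_vec2 ` cbox u v) = measure lborel (cbox u v)"
proof -
  have "measure lborel (cbox (of_vec2 u) (of_vec2 v)) = measure lborel (cbox (u$1) (v$1)) * measure lborel (cbox (u$2) (v$2))"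
    by (simp add: of_vec2_def content_Pair)
  also have "\<dots> = measure lborel (cbox u v)"
  proof (cases "cbox u v = {}")
    case True
    then have "v$1 < u$1 \<or> v$2 < u$2"
      unfolding interval_eq_empty_cart by (metis (full_types) exhaust_2)
    then show ?thesis using True by (auto simp: content_real_if)
  next
    case False
    then have "u$1 \<le> v$1" "u$2 \<le> v$2" unfolding interval_eq_empty_cart by (auto simp: not_less)
    then show ?thesis using content_cbox_cart[OF False] by (simp add: UNIV_2)
  qed
  finally show ?thesis by (simp add: of_vec2_cbox)
qed

lemma content_to_vec2: "measure lborel (to_vec2 ` cbox u v) = measure lborel (cbox u v)"
  using content_of_vec2[of "to_vec2 u" "to_vec2 v"] by (simp add: to_vec2_cbox of_vec2_cbox)

lemma norm_to_vec2: "norm (to_vec2 p) = norm p"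
  by (cases p) (simp add: norm_vec_def L2_set_def UNIV_2 norm_Pair)

lemma continuous_to_vec2: "continuous (at x) to_vec2"
  using linear_to_vec2 by (simp add: linear_continuous_at linear_linear)

lemma continuous_of_vec2: "continuous (at x) of_vec2"
  using linear_of_vec2 by (simp add: linear_continuous_at linear_linear)

lemma has_integral_of_vec2_cbox:
  fixes f :: "plane \<Rightarrow> 'a::real_normed_vector"
  assumes "(f has_integral i) (cbox a b)"
  shows "((\<lambda>z. f (of_vec2 z)) has_integral i) (cbox (to_vec2 a) (to_vec2 b))"
proof -
  have "((\<lambda>z. f (of_vec2 z)) has_integral (1 / 1) *\<^sub>R i) (to_vec2 ` cbox a b)"
  proof (rule has_integral_twiddle[OF _ _ _ _ _ _ _ assms])
    show "\<exists>w z. of_vec2 ` cbox u v = cbox w z" for u v using of_vec2_cbox by blast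
    show "\<exists>w z. to_vec2 ` cbox u v = cbox w z" for u v using to_vec2_cbox by blast
  qed (simp_all add: content_of_vec2 content_to_vec2 continuous_of_vec2 continuous_to_vec2)
  then show ?thesis by (simp add: to_vec2_cbox)
qed

lemma has_integral_to_vec2_cbox:
  fixes f :: "real^2 \<Rightarrow> 'a::real_normed_vector"
  assumes "(f has_integral i) (cbox a b)"
  shows "((\<lambda>p. f (to_vec2 p)) has_integral i) (cbox (of_vec2 a) (of_vec2 b))"
proof -
  have "((\<lambda>p. f (to_vec2 p)) has_integral (1 / 1) *\<^sub>R i) (of_vec2 ` cbox a b)"
  proof (rule has_integral_twiddle[OF _ _ _ _ _ _ _ assms])
    show "\<exists>w z. of_vec2 ` cbox u v = cbox w z" for u v using of_vec2_cbox by blast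
    show "\<exists>w z. to_vec2 ` cbox u v = cbox w z" for u v using to_vec2_cbox by blast
  qed (simp_all add: content_of_vec2 content_to_vec2 continuous_of_vec2 continuous_to_vec2)
  then show ?thesis by (simp add: of_vec2_cbox)
qed

text \<open>A gauge integral over an arbitrary set is a limit over boxes that contain large balls,
  and the isometry sends boxes to boxes of the same content and centred balls to centred
  balls.\<close>

lemma has_integral_vec2:
  fixes f :: "plane \<Rightarrow> 'a::banach"
  shows "((\<lambda>z. f (of_vec2 z)) has_integral i) (to_vec2 ` S) \<longleftrightarrow> (f has_integral i) S"
proof -
  note mem = mem_to_vec2_image[of _ S]
  have ball1: "ball 0 B \<subseteq> cbox a b \<longleftrightarrow> ball 0 B \<subseteq> cbox (of_vec2 a) (of_vec2 b)" for B a b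
  proof -
    have "of_vec2 ` ball 0 B = ball 0 B"
    proof -
      have "x \<in> of_vec2 ` ball 0 B \<longleftrightarrow> x \<in> ball 0 B" for x
        using norm_to_vec2[of x] by (metis image_iff mem_ball_0 vec2_inverse)
      then show ?thesis by blast
    qed
    moreover have "ball 0 B \<subseteq> cbox a b \<longleftrightarrow> of_vec2 ` ball 0 B \<subseteq> of_vec2 ` cbox a b"
      by (rule inj_image_subset_iff[symmetric]) (metis injI vec2_inverse(2))
    ultimately show ?thesis by (simp add: of_vec2_cbox)
  qed
  have box: "((\<lambda>z. if z \<in> to_vec2 ` S then f (of_vec2 z) else 0) has_integral y) (cbox a b) \<longleftrightarrow>
     ((\<lambda>p. if p \<in> S then f p else 0) has_integral y) (cbox (of_vec2 a) (of_vec2 b))" for a b y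
    using has_integral_of_vec2_cbox[of "\<lambda>p. if p \<in> S then f p else 0" y "of_vec2 a" "of_vec2 b"]
      has_integral_to_vec2_cbox[of "\<lambda>z. if z \<in> to_vec2 ` S then f (of_vec2 z) else 0" y a b]
    by (auto simp: mem cong: if_cong)
  have all: "(\<forall>a b. Q (of_vec2 a) (of_vec2 b)) \<longleftrightarrow> (\<forall>a b. Q a b)" for Q :: "plane \<Rightarrow> plane \<Rightarrow> bool"
  proof
    assume *: "\<forall>a b. Q (of_vec2 a) (of_vec2 b)"
    show "\<forall>a b. Q a b"
    proof (intro allI)
      fix a b show "Q a b" using *[rule_format, of "to_vec2 a" "to_vec2 b"] by simp
    qed
  qed blast
  show ?thesis
    unfolding has_integral'[of _ _ "to_vec2 ` S"] has_integral'[of f _ S] box ball1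
    using all[of "\<lambda>a b. ball 0 B \<subseteq> cbox a b \<longrightarrow> (\<exists>z. ((\<lambda>p. if p \<in> S then f p else 0) has_integral z) (cbox a b) \<and> norm (z - i) < e)" for B e]
    by (simp only:)
qed

lemma absolutely_integrable_vec2:
  fixes f :: "plane \<Rightarrow> real"
  shows "(\<lambda>z. f (of_vec2 z)) absolutely_integrable_on (to_vec2 ` S) \<longleftrightarrow> f absolutely_integrable_on S"
  unfolding absolutely_integrable_on_def integrable_on_def
  using has_integral_vec2[of f _ S] has_integral_vec2[of "\<lambda>x. norm (f x)" _ S] by simp

lemma integral_vec2:
  fixes f :: "plane \<Rightarrow> real"
  shows "integral (to_vec2 ` S) (\<lambda>z. f (of_vec2 z)) = integral S f"
  unfolding integral_def integrable_on_def has_integral_vec2 ..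

text \<open>After transport to \<open>real^2\<close> the quantity \<open>J\<close> is the absolute
  determinant of the derivative. The integrand is wrapped into \<open>real^1\<close> because the
  formula applied is one for vector-valued functions.\<close>

lemma change_of_variables_pair:
  fixes f :: "plane \<Rightarrow> real" and g :: "plane \<Rightarrow> plane"
  assumes S: "open S" and der: "\<And>p. p \<in> S \<Longrightarrow> (g has_derivative g' p) (at p)" and inj: "inj_on g S"
    and f: "f absolutely_integrable_on g ` S"
  defines "J \<equiv> \<lambda>p. \<bar>fst (g' p (1,0)) * snd (g' p (0,1)) - fst (g' p (0,1)) * snd (g' p (1,0))\<bar>"
  shows "(\<lambda>p. J p * f (g p)) absolutely_integrable_on S" "integral S (\<lambda>p. J p * f (g p)) = integral (g ` S) f"
proof -
  define G where "G z = to_vec2 (g (of_vec2 z))" for z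
  define G' where "G' z = (\<lambda>h. to_vec2 (g' (of_vec2 z) (of_vec2 h)))" for z
  define F where "F z = (vec (f (of_vec2 z)) :: real^1)" for z
  define S' where "S' = to_vec2 ` S"
  have mem: "z \<in> S' \<longleftrightarrow> of_vec2 z \<in> S" for z unfolding S'_def by (rule mem_to_vec2_image)
  have bl: "bounded_linear to_vec2" "bounded_linear of_vec2"
    using linear_to_vec2 linear_of_vec2 unfolding linear_linear by this+
  have eq: "S' = of_vec2 -` S" by (rule set_eqI) (simp only: mem vimage_eq)
  have "open S'" unfolding eq by (rule open_vimage[OF S linear_continuous_on[OF bl(2)]])
  then have S'l: "S' \<in> sets lebesgue" by auto
  have der': "(G has_derivative G' z) (at z within S')" if z: "z \<in> S'" for z
  proof -
    have "(of_vec2 has_derivative of_vec2) (at z within S')" by (rule bounded_linear_imp_has_derivative[OF bl(2)])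
    moreover have "(g has_derivative g' (of_vec2 z)) (at (of_vec2 z))" using der z mem by blast
    ultimately have "((\<lambda>z. g (of_vec2 z)) has_derivative (\<lambda>h. g' (of_vec2 z) (of_vec2 h))) (at z within S')"
      by (rule has_derivative_compose)
    from bounded_linear.has_derivative[OF bl(1) this] show ?thesis unfolding G_def G'_def .
  qed
  have inj': "inj_on G S'"
  proof (rule inj_onI)
    fix x y assume "x \<in> S'" "y \<in> S'" "G x = G y"
    then have "of_vec2 (G x) = of_vec2 (G y)" "of_vec2 x \<in> S" "of_vec2 y \<in> S" using mem by simp_all
    then have "of_vec2 x = of_vec2 y" using inj_onD[OF inj] by (simp add: G_def)
    then have "to_vec2 (of_vec2 x) = to_vec2 (of_vec2 y)" by (rule arg_cong)
    then show "x = y" by simp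
  qed
  have img: "G ` S' = to_vec2 ` (g ` S)" unfolding S'_def G_def by (simp add: image_image)
  have det: "\<bar>det (matrix (G' z))\<bar> = J (of_vec2 z)" for z
  proof -
    have "of_vec2 (axis 1 1) = (1,0)" "of_vec2 (axis 2 1) = (0,1)" by (simp_all add: of_vec2_def axis_def)
    then show ?thesis by (simp add: J_def det_2 matrix_def G'_def)
  qed
  have 1: "F absolutely_integrable_on G ` S'"
    unfolding img absolutely_integrable_on_1_iff F_def using f absolutely_integrable_vec2[where f=f and S="g ` S"] by simp
  have 2: "(\<lambda>z. \<bar>det (matrix (G' z))\<bar> *\<^sub>R F (G z)) absolutely_integrable_on S'"
    and 3: "integral S' (\<lambda>z. \<bar>det (matrix (G' z))\<bar> *\<^sub>R F (G z)) = integral (G ` S') F"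
    using has_absolute_integral_change_of_variables[OF S'l der' inj', of F "integral (G ` S') F"] 1 by blast+
  have comp: "(\<bar>det (matrix (G' z))\<bar> *\<^sub>R F (G z)) $ 1 = J (of_vec2 z) * f (g (of_vec2 z))" for z
    by (simp add: det F_def G_def)
  have "(\<lambda>z. J (of_vec2 z) * f (g (of_vec2 z))) absolutely_integrable_on S'"
    using 2 unfolding absolutely_integrable_on_1_iff comp .
  then show "(\<lambda>p. J p * f (g p)) absolutely_integrable_on S"
    unfolding S'_def using absolutely_integrable_vec2[where f="\<lambda>p. J p * f (g p)" and S=S] by simp
  have "integral S' (\<lambda>z. J (of_vec2 z) * f (g (of_vec2 z))) = integral (G ` S') (\<lambda>z. f (of_vec2 z))"
    using arg_cong[OF 3, of "\<lambda>v. v $ 1"] 1 2 unfolding integral_on_1_eq comp by (simp add: F_def)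
  then show "integral S (\<lambda>p. J p * f (g p)) = integral (g ` S) f"
    unfolding S'_def img[unfolded S'_def] using integral_vec2[where f="\<lambda>p. J p * f (g p)" and S=S] integral_vec2[where f=f and S="g ` S"] by simp
qed

text \<open>The image of \<open>S\<close> may miss a part of \<Omega>; for a nonnegative
  \<open>F\<close> the missing part has a favourable sign. Extending by \<open>0\<close> outside
  \<open>S\<close> keeps all integrals over the same measure space.\<close>

lemma change_of_variables_le:
  fixes F :: "plane \<Rightarrow> real" and g :: "plane \<Rightarrow> plane"
  assumes \<Omega>: "open \<Omega>" and S: "open S" "S \<subseteq> \<Omega>" and der: "\<And>p. p \<in> S \<Longrightarrow> (g has_derivative g' p) (at p)"
    and inj: "inj_on g S" and img: "\<And>p. p \<in> S \<Longrightarrow> g p \<in> \<Omega>"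
    and F: "integrable (lebesgue_on \<Omega>) F" "\<And>p. p \<in> \<Omega> \<Longrightarrow> 0 \<le> F p"
    and J: "\<And>p. p \<in> S \<Longrightarrow> J p = \<bar>fst (g' p (1,0)) * snd (g' p (0,1)) - fst (g' p (0,1)) * snd (g' p (1,0))\<bar>"
  shows "integrable (lebesgue_on \<Omega>) (\<lambda>p. if p \<in> S then J p * F (g p) else 0)"
    "(\<integral>p. (if p \<in> S then J p * F (g p) else 0) \<partial>(lebesgue_on \<Omega>)) \<le> (\<integral>p. F p \<partial>(lebesgue_on \<Omega>))"
proof -
  have l: "\<Omega> \<in> sets lebesgue" "S \<in> sets lebesgue" using \<Omega> S by auto
  have "continuous_on S g" by (meson der continuous_at_imp_continuous_on has_derivative_continuous)
  then have og: "open (g ` S)" by (rule invariance_of_domain[OF _ S(1) inj])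
  then have lg: "g ` S \<in> sets lebesgue" by auto
  have gs: "g ` S \<subseteq> \<Omega>" using img by blast
  have F\<Omega>: "F absolutely_integrable_on \<Omega>"
    using F(1) l by (simp add: set_integrable_def integrable_restrict_space)
  then have Fg: "F absolutely_integrable_on g ` S" by (rule set_integrable_subset[OF _ lg gs])
  note cv = change_of_variables_pair[OF S(1) der inj Fg]
  have "(\<lambda>p. J p * F (g p)) absolutely_integrable_on S"
  proof (rule absolutely_integrable_spike[OF cv(1) negligible_empty])
    show "J p * F (g p) = \<bar>fst (g' p (1,0)) * snd (g' p (0,1)) - fst (g' p (0,1)) * snd (g' p (1,0))\<bar> * F (g p)" if "p \<in> S - {}" for p
      using J[of p] that by simp
  qed
  then have i: "integrable lebesgue (\<lambda>p. indicator S p *\<^sub>R (J p * F (g p)))" by (simp add: set_integrable_def)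
  have eq: "(\<lambda>p. indicator \<Omega> p *\<^sub>R (if p \<in> S then J p * F (g p) else 0)) = (\<lambda>p. indicator S p *\<^sub>R (J p * F (g p)))"
    using S(2) by (auto simp: fun_eq_iff indicator_def)
  show "integrable (lebesgue_on \<Omega>) (\<lambda>p. if p \<in> S then J p * F (g p) else 0)"
    using i l by (simp add: integrable_restrict_space eq del: real_scaleR_def)
  have "(\<integral>p. (if p \<in> S then J p * F (g p) else 0) \<partial>(lebesgue_on \<Omega>)) = (\<integral>p. indicator S p *\<^sub>R (J p * F (g p)) \<partial>lebesgue)"
    using l by (simp add: integral_restrict_space eq del: real_scaleR_def)
  also have "\<dots> = (\<integral>p. J p * F (g p) \<partial>(lebesgue_on S))"
    using l by (simp add: integral_restrict_space)
  also have "\<dots> = integral S (\<lambda>p. J p * F (g p))"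
    using i l by (intro lebesgue_integral_eq_integral) (simp_all add: integrable_restrict_space)
  also have "\<dots> = integral S (\<lambda>p. \<bar>fst (g' p (1,0)) * snd (g' p (0,1)) - fst (g' p (0,1)) * snd (g' p (1,0))\<bar> * F (g p))"
    by (rule Henstock_Kurzweil_Integration.integral_cong) (use J in simp)
  also have "\<dots> = integral (g ` S) F" by (rule cv(2))
  also have "\<dots> \<le> integral \<Omega> F"
  proof (rule integral_subset_le[OF gs])
    show "F integrable_on g ` S" "F integrable_on \<Omega>" using Fg F\<Omega> by (simp_all add: absolutely_integrable_on_def)
  qed (use F(2) in blast)
  also have "\<dots> = (\<integral>p. F p \<partial>(lebesgue_on \<Omega>))"
    using F(1) l by (intro lebesgue_integral_eq_integral[symmetric]) auto
  finally show "(\<integral>p. (if p \<in> S then J p * F (g p) else 0) \<partial>(lebesgue_on \<Omega>)) \<le> (\<integral>p. F p \<partial>(lebesgue_on \<Omega>))" .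
qed

section \<open>The Rellich inequality\<close>

text \<open>For \<open>v(p) = \<phi>(p - hX(p))\<close> and \<open>(a, c) = \<nabla>\<phi>(p - hX(p))\<close> the left-hand side is \<open>|\<nabla>v(p)|\<^sup>2\<close>. Primed letters are
  the derivatives of \<open>X\<close> at \<open>p - hX(p)\<close>, unprimed ones those at \<open>p\<close>; the first factor on the right is the
  Jacobian of \<open>p \<mapsto> p - hX(p)\<close>.\<close>

lemma rellich_pointwise:
  fixes a c :: complex and h B :: real
  assumes h: "0 < h" "8 * B * h \<le> 1" and B: "0 \<le> B"
    and bd: "\<bar>\<omega>\<bar> \<le> B" "\<bar>\<beta>\<bar> \<le> B" "\<bar>\<gamma>\<bar> \<le> B" "\<bar>\<omega>'\<bar> \<le> B" "\<bar>\<beta>'\<bar> \<le> B" "\<bar>\<gamma>'\<bar> \<le> B"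
    and lip: "\<bar>\<omega> - \<omega>'\<bar> \<le> B * h" "\<bar>\<beta> - \<beta>'\<bar> \<le> B * h" "\<bar>\<gamma> - \<gamma>'\<bar> \<le> B * h"
  shows "(norm ((1 - h * \<omega>) *\<^sub>R a - (h * \<gamma>) *\<^sub>R c))\<^sup>2 + (norm ((1 - h * \<beta>) *\<^sub>R c))\<^sup>2 \<le>
    ((1 - h * \<omega>) * (1 - h * \<beta>)) * ((norm a)\<^sup>2 + (norm c)\<^sup>2 +
      h * ((\<beta>' - \<omega>') * ((norm a)\<^sup>2 - (norm c)\<^sup>2) - 2 * \<gamma>' * (a \<bullet> c)) + 20 * (B + B\<^sup>2) * h\<^sup>2 * ((norm a)\<^sup>2 + (norm c)\<^sup>2))"
proof -
  define X where "X = (norm a)\<^sup>2"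
  define Y where "Y = (norm c)\<^sup>2"
  define Z where "Z = a \<bullet> c"
  define A where "A = 1 - h * \<omega>"
  define D where "D = 1 - h * \<beta>"
  define b where "b = B + B\<^sup>2"
  have XY: "0 \<le> X" "0 \<le> Y" by (simp_all add: X_def Y_def)
  have b0: "0 \<le> b" using B by (simp add: b_def)
  have h0: "0 \<le> h" "0 \<le> h\<^sup>2" using h by simp_all
  have Z: "\<bar>Z\<bar> \<le> (X + Y) / 2"
  proof -
    have "\<bar>Z\<bar> \<le> norm a * norm c" unfolding Z_def by (rule Cauchy_Schwarz_ineq2)
    also have "\<dots> \<le> (X + Y) / 2" using sum_squares_bound[of "norm a" "norm c"] by (simp add: X_def Y_def)
    finally show ?thesis .
  qed
  have hb: "\<bar>h * x\<bar> \<le> 1/8" if "\<bar>x\<bar> \<le> B" for x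
  proof -
    have "\<bar>h * x\<bar> \<le> h * B" using that h0 by (simp add: abs_mult mult_left_mono)
    moreover have "8 * (h * B) \<le> 1" using h(2) by (simp add: mult_ac)
    ultimately show ?thesis by linarith
  qed
  have AD: "7/8 \<le> A" "A \<le> 9/8" "7/8 \<le> D" "D \<le> 9/8"
    using hb[OF bd(1)] hb[OF bd(2)] by (auto simp: A_def D_def abs_le_iff)
  have m: "\<bar>x * y\<bar> \<le> B * B" if "\<bar>x\<bar> \<le> B" "\<bar>y\<bar> \<le> B" for x y
    using that by (simp add: abs_mult mult_mono)
  have hm: "\<bar>h * x\<bar> \<le> B * h\<^sup>2" if "\<bar>x\<bar> \<le> B * h" for x
    using mult_left_mono[OF that h0(1)] h0 by (simp add: abs_mult power2_eq_square mult_ac)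
  have hm2: "\<bar>h\<^sup>2 * x\<bar> \<le> h\<^sup>2 * (B * B)" if "\<bar>x\<bar> \<le> B * B" for x
    using mult_left_mono[OF that h0(2)] by (simp add: abs_mult)
  \<comment> \<open>To first order in \<open>h\<close> the two sides agree; exchanging primed and
    unprimed derivatives costs only \<open>B * h\<close> each, hence order \<open>h^2\<close> in
    total.\<close>
  have e1: "D * (1 + h * (\<beta>' - \<omega>')) - A \<ge> - (2 * b * h\<^sup>2)"
  proof -
    have "D * (1 + h * (\<beta>' - \<omega>')) - A = - (h * (\<beta> - \<beta>')) + h * (\<omega> - \<omega>') - h\<^sup>2 * (\<beta> * \<beta>') + h\<^sup>2 * (\<beta> * \<omega>')"
      by (simp add: D_def A_def power2_eq_square algebra_simps)
    moreover have "2 * b * h\<^sup>2 = B * h\<^sup>2 + B * h\<^sup>2 + h\<^sup>2 * (B * B) + h\<^sup>2 * (B * B)"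
      by (simp add: b_def power2_eq_square algebra_simps)
    ultimately show ?thesis
      using hm[OF lip(2)] hm[OF lip(1)] hm2[OF m[OF bd(2) bd(5)]] hm2[OF m[OF bd(2) bd(4)]] unfolding abs_le_iff by linarith
  qed
  have e2: "A * (1 - h * (\<beta>' - \<omega>')) - D \<ge> - (2 * b * h\<^sup>2)"
  proof -
    have "A * (1 - h * (\<beta>' - \<omega>')) - D = h * (\<beta> - \<beta>') - h * (\<omega> - \<omega>') + h\<^sup>2 * (\<omega> * \<beta>') - h\<^sup>2 * (\<omega> * \<omega>')"
      by (simp add: D_def A_def power2_eq_square algebra_simps)
    moreover have "2 * b * h\<^sup>2 = B * h\<^sup>2 + B * h\<^sup>2 + h\<^sup>2 * (B * B) + h\<^sup>2 * (B * B)"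
      by (simp add: b_def power2_eq_square algebra_simps)
    ultimately show ?thesis
      using hm[OF lip(2)] hm[OF lip(1)] hm2[OF m[OF bd(1) bd(5)]] hm2[OF m[OF bd(1) bd(4)]] unfolding abs_le_iff by linarith
  qed
  have bh: "0 \<le> b * h\<^sup>2" using b0 h0 by simp
  \<comment> \<open>As \<open>D\<close> is at least \<open>7/8\<close>, the correction
    \<open>20 b h^2\<close> contributes at least \<open>17.5 b h^2\<close>, which covers the loss of
    \<open>2 b h^2\<close> in \<open>e1\<close> and leaves \<open>15 b h^2\<close>.\<close>
  have f1: "D * (1 + h * (\<beta>' - \<omega>') + 20 * b * h\<^sup>2) - A \<ge> 15 * (b * h\<^sup>2)"
  proof -
    have "7/8 * (20 * b * h\<^sup>2) \<le> D * (20 * b * h\<^sup>2)" using AD bh by (intro mult_right_mono) auto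
    then show ?thesis using e1 bh by (simp add: distrib_left)
  qed
  have f2: "A * (1 - h * (\<beta>' - \<omega>') + 20 * b * h\<^sup>2) - D \<ge> 15 * (b * h\<^sup>2)"
  proof -
    have "7/8 * (20 * b * h\<^sup>2) \<le> A * (20 * b * h\<^sup>2)" using AD bh by (intro mult_right_mono) auto
    then show ?thesis using e2 bh by (simp add: distrib_left)
  qed
  have g1: "A * (D * (1 + h * (\<beta>' - \<omega>') + 20 * b * h\<^sup>2) - A) \<ge> 12 * (b * h\<^sup>2)"
  proof -
    have "7/8 * (15 * (b * h\<^sup>2)) \<le> A * (D * (1 + h * (\<beta>' - \<omega>') + 20 * b * h\<^sup>2) - A)"
      using AD f1 bh by (intro mult_mono) auto
    then show ?thesis using bh by linarith
  qed
  have g2: "D * (A * (1 - h * (\<beta>' - \<omega>') + 20 * b * h\<^sup>2) - D) - h\<^sup>2 * (\<gamma> * \<gamma>) \<ge> 11 * (b * h\<^sup>2)"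
  proof -
    have "7/8 * (15 * (b * h\<^sup>2)) \<le> D * (A * (1 - h * (\<beta>' - \<omega>') + 20 * b * h\<^sup>2) - D)"
      using AD f2 bh by (intro mult_mono) auto
    moreover have "h\<^sup>2 * (\<gamma> * \<gamma>) \<le> h\<^sup>2 * (B * B)" using hm2[OF m[OF bd(3) bd(3)]] by (simp add: abs_le_iff)
    moreover have "h\<^sup>2 * (B * B) \<le> b * h\<^sup>2" 
    proof -
      have "b * h\<^sup>2 = h\<^sup>2 * (B * B) + B * h\<^sup>2" by (simp add: b_def power2_eq_square algebra_simps)
      then show ?thesis using B h0 by simp
    qed
    ultimately show ?thesis using bh by linarith
  qed
  have g3: "\<bar>2 * A * h * (\<gamma> - D * \<gamma>') * Z\<bar> \<le> 3 * (b * h\<^sup>2) * ((X + Y) / 2)"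
  proof -
    have "h * (\<gamma> - D * \<gamma>') = h * (\<gamma> - \<gamma>') + h\<^sup>2 * (\<beta> * \<gamma>')"
      by (simp add: D_def power2_eq_square algebra_simps)
    then have "\<bar>h * (\<gamma> - D * \<gamma>')\<bar> \<le> B * h\<^sup>2 + h\<^sup>2 * (B * B)"
      using hm[OF lip(3)] hm2[OF m[OF bd(2) bd(6)]] by linarith
    also have "\<dots> = b * h\<^sup>2" by (simp add: b_def power2_eq_square algebra_simps)
    finally have "\<bar>h * (\<gamma> - D * \<gamma>')\<bar> \<le> b * h\<^sup>2" .
    then have "\<bar>2 * A\<bar> * \<bar>h * (\<gamma> - D * \<gamma>')\<bar> * \<bar>Z\<bar> \<le> 3 * (b * h\<^sup>2) * ((X + Y) / 2)"
      using AD Z by (intro mult_mono) (auto simp: bh)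
    then show ?thesis by (simp add: abs_mult mult.assoc)
  qed
  \<comment> \<open>The difference of the two sides is a quadratic form in \<open>a\<close> and
    \<open>c\<close>. Its diagonal coefficients are at least \<open>12 b h^2\<close> and
    \<open>11 b h^2\<close>, whereas the mixed term takes at most \<open>3/2 b h^2\<close> from
    each.\<close>
  have "A * D * (X + Y + h * ((\<beta>' - \<omega>') * (X - Y) - 2 * \<gamma>' * Z) + 20 * b * h\<^sup>2 * (X + Y)) -
      (A\<^sup>2 * X - 2 * A * (h * \<gamma>) * Z + (h * \<gamma>)\<^sup>2 * Y + D\<^sup>2 * Y) =
    X * (A * (D * (1 + h * (\<beta>' - \<omega>') + 20 * b * h\<^sup>2) - A)) +
    Y * (D * (A * (1 - h * (\<beta>' - \<omega>') + 20 * b * h\<^sup>2) - D) - h\<^sup>2 * (\<gamma> * \<gamma>)) + 2 * A * h * (\<gamma> - D * \<gamma>') * Z"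
    by (simp add: power2_eq_square algebra_simps)
  moreover have "X * (12 * (b * h\<^sup>2)) \<le> X * (A * (D * (1 + h * (\<beta>' - \<omega>') + 20 * b * h\<^sup>2) - A))"
    by (rule mult_left_mono[OF g1 XY(1)])
  moreover have "Y * (11 * (b * h\<^sup>2)) \<le> Y * (D * (A * (1 - h * (\<beta>' - \<omega>') + 20 * b * h\<^sup>2) - D) - h\<^sup>2 * (\<gamma> * \<gamma>))"
    by (rule mult_left_mono[OF g2 XY(2)])
  moreover have "3 * (b * h\<^sup>2) * ((X + Y) / 2) = X * (3/2 * (b * h\<^sup>2)) + Y * (3/2 * (b * h\<^sup>2))"
    by (simp add: algebra_simps)
  moreover have "0 \<le> X * (b * h\<^sup>2)" "0 \<le> Y * (b * h\<^sup>2)" using XY bh by simp_all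
  ultimately have "A\<^sup>2 * X - 2 * A * (h * \<gamma>) * Z + (h * \<gamma>)\<^sup>2 * Y + D\<^sup>2 * Y \<le>
     A * D * (X + Y + h * ((\<beta>' - \<omega>') * (X - Y) - 2 * \<gamma>' * Z) + 20 * b * h\<^sup>2 * (X + Y))"
    using g3 unfolding abs_le_iff by (simp add: mult.assoc mult.left_commute[of X] mult.left_commute[of Y])
  moreover have "(norm (A *\<^sub>R a - (h * \<gamma>) *\<^sub>R c))\<^sup>2 = A\<^sup>2 * X - 2 * A * (h * \<gamma>) * Z + (h * \<gamma>)\<^sup>2 * Y"
    unfolding X_def Y_def Z_def power2_norm_eq_inner inner_diff_left inner_diff_right inner_scaleR_left inner_scaleR_right inner_commute[of c a]
    by (simp add: power2_eq_square algebra_simps)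
  moreover have "(norm (D *\<^sub>R c))\<^sup>2 = D\<^sup>2 * Y" by (simp add: Y_def power_mult_distrib)
  ultimately show ?thesis by (simp add: A_def D_def X_def Y_def Z_def b_def)
qed

text \<open>The fundamental theorem is paired with the increment itself, and half of the squared
  increment is absorbed on the left. The bound is phrased with nonnegative integrals because
  \<open>pull_diff\<close> applies Tonelli's theorem to it.\<close>

lemma unit_interval_increment_le:
  fixes f :: "real \<Rightarrow> complex"
  assumes d: "\<And>t. (f has_vector_derivative f' t) (at t)" and c: "continuous_on UNIV f'"
  shows "ennreal ((norm (f 1 - f 0))\<^sup>2) \<le> (\<integral>\<^sup>+t. ennreal (indicator {0..1} t * (norm (f' t))\<^sup>2) \<partial>lborel)"
proof -
  let ?\<Delta> = "f 1 - f 0"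
  have c': "continuous_on {0..1} f'" using c continuous_on_subset by blast
  have ftc: "has_bochner_integral lborel (\<lambda>x. indicator {0..1} x *\<^sub>R f' x) ?\<Delta>"
    by (rule has_bochner_integral_FTC_Icc[OF _ has_vector_derivative_at_within[OF d] c']) simp
  have i1: "integrable lborel (\<lambda>x. indicator {0..1} x *\<^sub>R (norm (f' x))\<^sup>2)"
    by (intro borel_integrable_compact continuous_intros c') auto
  have i0: "integrable lborel (\<lambda>x::real. indicator {0..1} x *\<^sub>R (1::real))"
    by (rule borel_integrable_compact) auto
  have "(norm ?\<Delta>)\<^sup>2 = (\<integral>x. (indicator {0..1} x *\<^sub>R f' x) \<bullet> ?\<Delta> \<partial>lborel)"
    using has_bochner_integral_integral_eq[OF has_bochner_integral_inner_left[of ?\<Delta>, OF ftc]]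
    by (simp only: power2_norm_eq_inner)
  also have "\<dots> \<le> (\<integral>x. 1/2 * (indicator {0..1} x *\<^sub>R (norm (f' x))\<^sup>2) + 1/2 * (norm ?\<Delta>)\<^sup>2 * (indicator {0..1} x *\<^sub>R 1) \<partial>lborel)"
  proof (rule integral_mono)
    show "integrable lborel (\<lambda>x. (indicator {0..1} x *\<^sub>R f' x) \<bullet> ?\<Delta>)"
      using ftc by (intro integrable_inner_left) (auto simp: has_bochner_integral_iff)
    show "integrable lborel (\<lambda>x. 1/2 * (indicator {0..1} x *\<^sub>R (norm (f' x))\<^sup>2) + 1/2 * (norm ?\<Delta>)\<^sup>2 * (indicator {0..1} x *\<^sub>R 1))"
      using i1 i0 by (intro Bochner_Integration.integrable_add integrable_mult_right) auto
    show "(indicator {0..1} x *\<^sub>R f' x) \<bullet> ?\<Delta> \<le> 1/2 * (indicator {0..1} x *\<^sub>R (norm (f' x))\<^sup>2) + 1/2 * (norm ?\<Delta>)\<^sup>2 * (indicator {0..1} x *\<^sub>R 1)" for x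
    proof -
      have "f' x \<bullet> ?\<Delta> \<le> norm (f' x) * norm ?\<Delta>" by (rule norm_cauchy_schwarz)
      then have "f' x \<bullet> ?\<Delta> \<le> 1/2 * (norm (f' x))\<^sup>2 + 1/2 * (norm ?\<Delta>)\<^sup>2"
        using sum_squares_bound[of "norm (f' x)" "norm ?\<Delta>"] by linarith
      then show ?thesis by (cases "x \<in> {0..1}") auto
    qed
  qed
  also have "\<dots> = 1/2 * (\<integral>x. indicator {0..1} x *\<^sub>R (norm (f' x))\<^sup>2 \<partial>lborel) + 1/2 * (norm ?\<Delta>)\<^sup>2 * (\<integral>x. indicator {0..1} (x::real) *\<^sub>R 1 \<partial>lborel)"
    using i0 i1 by simp
  also have "(\<integral>x. indicator {0..1} (x::real) *\<^sub>R (1::real) \<partial>lborel) = 1" by simp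
  finally have "(norm ?\<Delta>)\<^sup>2 \<le> (\<integral>x. indicator {0..1} x * (norm (f' x))\<^sup>2 \<partial>lborel)" by simp
  moreover have "(\<integral>\<^sup>+t. ennreal (indicator {0..1} t * (norm (f' t))\<^sup>2) \<partial>lborel) = ennreal (\<integral>x. indicator {0..1} x * (norm (f' x))\<^sup>2 \<partial>lborel)"
    using i1 by (intro nn_integral_eq_integral) auto
  ultimately show ?thesis by (simp add: ennreal_leI)
qed

text \<open>The last assumption, properness of \<open>p \<mapsto> p - hX(p)\<close> for \<open>X = (w, b)\<close>, replaces the boundary condition
  \<open>X \<cdot> \<nu> \<le> 0\<close>.\<close>

locale inward_field =
  fixes \<Omega> :: "plane set" and w w' :: "real \<Rightarrow> real" and b bx by' :: "plane \<Rightarrow> real" and h0 B :: real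
  assumes open_\<Omega>: "open \<Omega>" and h0: "0 < h0" "h0 \<le> 1" "8 * B * h0 \<le> 1" and B: "0 \<le> B"
    and w_deriv: "\<And>x. (w has_real_derivative w' x) (at x)" and w'_cont: "continuous_on UNIV w'"
    and b_C1: "C1_on \<Omega> b bx by'"
    and bounds: "\<And>x. \<bar>w x\<bar> \<le> B" "\<And>x. \<bar>w' x\<bar> \<le> B" "\<And>p. p \<in> \<Omega> \<Longrightarrow> \<bar>b p\<bar> \<le> B" "\<And>p. p \<in> \<Omega> \<Longrightarrow> \<bar>bx p\<bar> \<le> B" "\<And>p. p \<in> \<Omega> \<Longrightarrow> \<bar>by' p\<bar> \<le> B"
    and lip: "\<And>p h. p \<in> \<Omega> \<Longrightarrow> 0 < h \<Longrightarrow> h \<le> h0 \<Longrightarrow> p - h *\<^sub>R (w (fst p), b p) \<in> \<Omega> \<Longrightarrow>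
        \<bar>w' (fst p) - w' (fst p - h * w (fst p))\<bar> \<le> B * h \<and> \<bar>bx p - bx (p - h *\<^sub>R (w (fst p), b p))\<bar> \<le> B * h \<and>
        \<bar>by' p - by' (p - h *\<^sub>R (w (fst p), b p))\<bar> \<le> B * h"
    and inj: "\<And>h. 0 < h \<Longrightarrow> h \<le> h0 \<Longrightarrow> inj_on (\<lambda>p. p - h *\<^sub>R (w (fst p), b p)) {p \<in> \<Omega>. p - h *\<^sub>R (w (fst p), b p) \<in> \<Omega>}"
    and cpt: "\<And>h K. 0 < h \<Longrightarrow> h \<le> h0 \<Longrightarrow> compact K \<Longrightarrow> K \<subseteq> \<Omega> \<Longrightarrow> compact {p \<in> \<Omega>. p - h *\<^sub>R (w (fst p), b p) \<in> K}"
begin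

abbreviation "M \<equiv> lebesgue_on \<Omega>"

section \<open>Pullback along the backward step\<close>

definition S :: "real \<Rightarrow> plane \<Rightarrow> plane" where "S h p = p - h *\<^sub>R (w (fst p), b p)"
definition dom :: "real \<Rightarrow> plane set" where "dom h = {p \<in> \<Omega>. S h p \<in> \<Omega>}"
text \<open>The derivative of \<open>S h\<close> is triangular, as \<open>w\<close> depends on the
  first coordinate alone; its determinant is the product of the diagonal entries.\<close>

definition J :: "real \<Rightarrow> plane \<Rightarrow> real" where "J h p = (1 - h * w' (fst p)) * (1 - h * by' p)"

lemma h_small: "0 < h \<Longrightarrow> h \<le> h0 \<Longrightarrow> 8 * B * h \<le> 1"
  using mult_left_mono[of h h0 "8 * B"] B h0(3) by simp

lemma S_deriv:
  assumes "p \<in> \<Omega>"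
  shows "(S h has_derivative (\<lambda>k. ((1 - h * w' (fst p)) * fst k, - (h * bx p) * fst k + (1 - h * by' p) * snd k))) (at p)"
proof -
  have "((\<lambda>p. w (fst p)) has_derivative (\<lambda>k. fst k * w' (fst p))) (at p)"
    using has_derivative_compose[OF has_derivative_fst[OF has_derivative_ident] has_field_derivative_imp_has_derivative[OF w_deriv]]
    by (simp add: mult.commute)
  moreover have "(b has_derivative (\<lambda>k. fst k * bx p + snd k * by' p)) (at p)"
    using b_C1 assms unfolding C1_on_def by blast
  ultimately have "((\<lambda>p. p - h *\<^sub>R (w (fst p), b p)) has_derivative (\<lambda>k. k - h *\<^sub>R (fst k * w' (fst p), fst k * bx p + snd k * by' p))) (at p)"
    by (intro derivative_intros)
  then show ?thesis unfolding S_def[abs_def]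
    by (rule has_derivative_eq_rhs) (auto simp: fun_eq_iff algebra_simps)
qed

lemma S_continuous: "continuous_on \<Omega> (S h)"
  by (meson S_deriv continuous_at_imp_continuous_on has_derivative_continuous)

lemma dom_open: "open (dom h)"
proof -
  have "dom h = \<Omega> \<inter> S h -` \<Omega>" by (auto simp: dom_def)
  then show ?thesis using continuous_open_preimage[OF S_continuous open_\<Omega> open_\<Omega>] by simp
qed

lemma hbound: 
  assumes "0 < h" "h \<le> h0" "\<bar>x\<bar> \<le> B" shows "7/8 \<le> 1 - h * x" "1 - h * x \<le> 9/8"
proof -
  have "\<bar>h * x\<bar> \<le> h * B" using assms by (simp add: abs_mult mult_left_mono)
  moreover have "8 * (h * B) \<le> 1" using h_small[OF assms(1,2)] by (simp add: mult_ac)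
  ultimately have "\<bar>h * x\<bar> \<le> 1/8" by linarith
  then show "7/8 \<le> 1 - h * x" "1 - h * x \<le> 9/8" by (auto simp: abs_le_iff)
qed

lemma J_ge: 
  assumes "0 < h" "h \<le> h0" "p \<in> \<Omega>" shows "1/4 \<le> J h p"
proof -
  have "7/8 \<le> 1 - h * w' (fst p)" "7/8 \<le> 1 - h * by' p"
    using hbound(1)[OF assms(1,2) bounds(2)] hbound(1)[OF assms(1,2) bounds(5)[OF assms(3)]] by auto
  then have "7/8 * (7/8) \<le> J h p" unfolding J_def by (intro mult_mono) linarith+
  then show ?thesis by simp
qed

lemma pull_integral_le:
  assumes h: "0 < h" "h \<le> h0" and F: "integrable M F" "\<And>p. p \<in> \<Omega> \<Longrightarrow> 0 \<le> F p"
  shows "integrable M (\<lambda>p. if p \<in> dom h then J h p * F (S h p) else 0)"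
    "(\<integral>p. (if p \<in> dom h then J h p * F (S h p) else 0) \<partial>M) \<le> (\<integral>p. F p \<partial>M)"
proof -
  have sub: "dom h \<subseteq> \<Omega>" by (auto simp: dom_def)
  have d: "(S h has_derivative (\<lambda>k. ((1 - h * w' (fst p)) * fst k, - (h * bx p) * fst k + (1 - h * by' p) * snd k))) (at p)" if "p \<in> dom h" for p
    using S_deriv that sub by blast
  have i: "inj_on (S h) (dom h)" using inj[OF h] by (simp add: S_def[abs_def] dom_def)
  have Jd: "J h p = \<bar>fst ((\<lambda>k. ((1 - h * w' (fst p)) * fst k, - (h * bx p) * fst k + (1 - h * by' p) * snd k)) (1,0)) *
     snd ((\<lambda>k. ((1 - h * w' (fst p)) * fst k, - (h * bx p) * fst k + (1 - h * by' p) * snd k)) (0,1)) -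
     fst ((\<lambda>k. ((1 - h * w' (fst p)) * fst k, - (h * bx p) * fst k + (1 - h * by' p) * snd k)) (0,1)) *
     snd ((\<lambda>k. ((1 - h * w' (fst p)) * fst k, - (h * bx p) * fst k + (1 - h * by' p) * snd k)) (1,0))\<bar>" if "p \<in> dom h" for p
    using J_ge[OF h, of p] that sub by (auto simp: J_def)
  have img: "S h p \<in> \<Omega>" if "p \<in> dom h" for p using that by (simp add: dom_def)
  note c = change_of_variables_le[OF open_\<Omega> dom_open sub d i img F Jd]
  show "integrable M (\<lambda>p. if p \<in> dom h then J h p * F (S h p) else 0)" by (rule c(1))
  show "(\<integral>p. (if p \<in> dom h then J h p * F (S h p) else 0) \<partial>M) \<le> (\<integral>p. F p \<partial>M)" by (rule c(2))
qed

definition pull :: "real \<Rightarrow> (plane \<Rightarrow> complex) \<Rightarrow> plane \<Rightarrow> complex" where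
  "pull h f p = (if p \<in> dom h then f (S h p) else 0)"
definition pullx :: "real \<Rightarrow> (plane \<Rightarrow> complex) \<Rightarrow> (plane \<Rightarrow> complex) \<Rightarrow> plane \<Rightarrow> complex" where
  "pullx h fx fy p = (if p \<in> dom h then (1 - h * w' (fst p)) *\<^sub>R fx (S h p) - (h * bx p) *\<^sub>R fy (S h p) else 0)"
definition pully :: "real \<Rightarrow> (plane \<Rightarrow> complex) \<Rightarrow> plane \<Rightarrow> complex" where
  "pully h fy p = (if p \<in> dom h then (1 - h * by' p) *\<^sub>R fy (S h p) else 0)"

text \<open>Properness, the assumption \<open>cpt\<close>, makes the preimage \<open>L\<close> of
  the support compact inside \<Omega>. On \<Omega> the case distinction in \<open>pull\<close> is
  harmless: where the step ends outside \<Omega>, it also misses the support of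
  \<open>f\<close>.\<close>

lemma pull_C1c:
  assumes h: "0 < h" "h \<le> h0" and f: "C1c \<Omega> f fx fy"
  shows "C1c \<Omega> (pull h f) (pullx h fx fy) (pully h fy)"
proof -
  note C1 = C1c_C1[OF f]
  from C1cE[OF f] obtain K where K: "compact K" "K \<subseteq> \<Omega>" "\<And>p. p \<notin> K \<Longrightarrow> f p = 0" "\<And>p. p \<notin> K \<Longrightarrow> fx p = 0" "\<And>p. p \<notin> K \<Longrightarrow> fy p = 0"
    by metis
  define L where "L = {p \<in> \<Omega>. S h p \<in> K}"
  have L: "compact L" "L \<subseteq> \<Omega>" using cpt[OF h K(1,2)] by (auto simp: L_def S_def)
  have out: "pull h f p = 0" "pullx h fx fy p = 0" "pully h fy p = 0" if "p \<notin> L" for p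
    using that K(3-5)[of "S h p"] by (auto simp: L_def dom_def pull_def pullx_def pully_def)
  have eq\<Omega>: "pull h f p = f (S h p)" "pullx h fx fy p = (1 - h * w' (fst p)) *\<^sub>R fx (S h p) - (h * bx p) *\<^sub>R fy (S h p)"
    "pully h fy p = (1 - h * by' p) *\<^sub>R fy (S h p)" if "p \<in> \<Omega>" for p
  proof -
    have "S h p \<notin> \<Omega> \<Longrightarrow> S h p \<notin> K" using K(2) by blast
    then show "pull h f p = f (S h p)" "pullx h fx fy p = (1 - h * w' (fst p)) *\<^sub>R fx (S h p) - (h * bx p) *\<^sub>R fy (S h p)"
      "pully h fy p = (1 - h * by' p) *\<^sub>R fy (S h p)"
      using that K(3-5)[of "S h p"] by (simp_all add: dom_def pull_def pullx_def pully_def)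
  qed
  have cc: "continuous_on \<Omega> (\<lambda>p. g (S h p))" if "continuous_on UNIV g" for g :: "plane \<Rightarrow> complex"
    using continuous_on_compose2[OF that S_continuous] by simp
  have cb: "continuous_on \<Omega> bx" "continuous_on \<Omega> by'" using b_C1 by (auto simp: C1_on_def)
  have cw: "continuous_on \<Omega> (\<lambda>p. w' (fst p))"
    by (intro continuous_on_compose2[OF w'_cont] continuous_intros) auto
  have "C1 (pull h f) (pullx h fx fy) (pully h fy)"
  proof (rule C1I)
    show "(pull h f has_derivative (\<lambda>k. fst k *\<^sub>R pullx h fx fy p + snd k *\<^sub>R pully h fy p)) (at p)" for p
    proof (cases "p \<in> \<Omega>")
      case True
      have "((\<lambda>p. f (S h p)) has_derivative (\<lambda>k. ((1 - h * w' (fst p)) * fst k) *\<^sub>R fx (S h p) + (- (h * bx p) * fst k + (1 - h * by' p) * snd k) *\<^sub>R fy (S h p))) (at p)"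
        using has_derivative_compose[OF S_deriv[OF True] C1_deriv[OF C1]] by simp
      then have "((\<lambda>p. f (S h p)) has_derivative (\<lambda>k. fst k *\<^sub>R pullx h fx fy p + snd k *\<^sub>R pully h fy p)) (at p)"
        by (rule has_derivative_eq_rhs) (simp add: fun_eq_iff eq\<Omega>[OF True] algebra_simps)
      then show ?thesis
        by (rule has_derivative_transform_within_open[OF _ open_\<Omega> True]) (simp add: eq\<Omega>)
    next
      case False
      then have p: "p \<in> - L" using L by auto
      have "(pull h f has_derivative (\<lambda>k. 0)) (at p)"
        by (rule has_derivative_transform_within_open[OF has_derivative_const _ p])
          (use out compact_imp_closed[OF L(1)] in auto)
      then show ?thesis using out p by simp
    qed
    have "continuous_on \<Omega> (pullx h fx fy)"
      by (rule continuous_on_cong[THEN iffD2, OF refl eq\<Omega>(2)])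
        (auto intro!: continuous_intros cc cb cw C1_contx[OF C1] C1_conty[OF C1])
    then show "continuous_on UNIV (pullx h fx fy)"
      by (rule continuous_on_extend_zero[OF _ open_\<Omega> L out(2)])
    have "continuous_on \<Omega> (pully h fy)"
      by (rule continuous_on_cong[THEN iffD2, OF refl eq\<Omega>(3)])
        (auto intro!: continuous_intros cc cb cw C1_contx[OF C1] C1_conty[OF C1])
    then show "continuous_on UNIV (pully h fy)"
      by (rule continuous_on_extend_zero[OF _ open_\<Omega> L out(3)])
  qed
  then show ?thesis by (rule C1cI[OF _ L out])
qed

end

context inward_field
begin

section \<open>First variation of the Dirichlet energy\<close>

definition energy :: "(plane \<Rightarrow> complex) \<Rightarrow> (plane \<Rightarrow> complex) \<Rightarrow> real" where
  "energy fx fy = (nrm M fx)\<^sup>2 + (nrm M fy)\<^sup>2"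

text \<open>The coefficient of \<open>h\<close> in \<open>rellich_pointwise\<close>: the density of
  the first variation of the Dirichlet integral when a function is composed with
  \<open>S h\<close>.\<close>

definition stress :: "(plane \<Rightarrow> complex) \<Rightarrow> (plane \<Rightarrow> complex) \<Rightarrow> plane \<Rightarrow> real" where
  "stress fx fy x = (by' x - w' (fst x)) * ((norm (fx x))\<^sup>2 - (norm (fy x))\<^sup>2) - 2 * bx x * (fx x \<bullet> fy x)"

lemma energy_nonneg: "0 \<le> energy fx fy" by (simp add: energy_def)

lemma w_cont: "continuous_on UNIV w"
  by (rule continuous_at_imp_continuous_on) (blast intro: DERIV_isCont w_deriv)

lemma field_measurable:
  "(\<lambda>p. w (fst p)) \<in> borel_measurable M" "(\<lambda>p. w' (fst p)) \<in> borel_measurable M" "b \<in> borel_measurable M"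
  "bx \<in> borel_measurable M" "by' \<in> borel_measurable M" "(\<lambda>x. by' x - w' (fst x)) \<in> borel_measurable M"
proof -
  have "continuous_on UNIV w" by (rule w_cont)
  then have "continuous_on UNIV (\<lambda>p::plane. w (fst p))" by (intro continuous_on_compose2[OF w_cont] continuous_intros) auto
  then show "(\<lambda>p. w (fst p)) \<in> borel_measurable M" by (rule continuous_measurable_lebesgue_on)
  have "continuous_on UNIV (\<lambda>p::plane. w' (fst p))" by (intro continuous_on_compose2[OF w'_cont] continuous_intros) auto
  then show 1: "(\<lambda>p. w' (fst p)) \<in> borel_measurable M" by (rule continuous_measurable_lebesgue_on)
  show "b \<in> borel_measurable M" "bx \<in> borel_measurable M" and 2: "by' \<in> borel_measurable M"
    by (rule C1_on_measurable[OF b_C1 open_\<Omega>])+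
  show "(\<lambda>x. by' x - w' (fst x)) \<in> borel_measurable M" using 1 2 by (intro borel_measurable_diff)
qed

lemma by_w_bound: "x \<in> space M \<Longrightarrow> \<bar>by' x - w' (fst x)\<bar> \<le> 2 * B"
  using bounds(2)[of "fst x"] bounds(5)[of x] by simp

lemma stress_terms:
  assumes "sqint M fx" "sqint M fy"
  shows "integrable M (\<lambda>x. (by' x - w' (fst x)) * (fx x \<bullet> fx x))" "integrable M (\<lambda>x. (by' x - w' (fst x)) * (fy x \<bullet> fy x))"
    "integrable M (\<lambda>x. bx x * (fx x \<bullet> fy x))"
  using assms field_measurable by_w_bound bounds(4) by (auto intro!: sqint_inner_bounded)

lemma stress_eq: "stress fx fy x = (by' x - w' (fst x)) * (fx x \<bullet> fx x) - (by' x - w' (fst x)) * (fy x \<bullet> fy x) - 2 * (bx x * (fx x \<bullet> fy x))"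
  by (simp add: stress_def power2_norm_eq_inner right_diff_distrib)

lemma stress_integrable: "sqint M fx \<Longrightarrow> sqint M fy \<Longrightarrow> integrable M (stress fx fy)"
  using stress_terms[of fx fy] unfolding stress_eq[abs_def] by (intro Bochner_Integration.integrable_diff integrable_mult_right) auto

lemma stress_bound:
  assumes "x \<in> \<Omega>"
  shows "\<bar>stress fx fy x\<bar> \<le> 3 * B * ((norm (fx x))\<^sup>2 + (norm (fy x))\<^sup>2)"
proof -
  let ?X = "(norm (fx x))\<^sup>2" and ?Y = "(norm (fy x))\<^sup>2"
  have "\<bar>(by' x - w' (fst x)) * (?X - ?Y)\<bar> \<le> 2 * B * (?X + ?Y)"
    using by_w_bound[of x] assms unfolding abs_mult by (intro mult_mono) (auto simp: abs_le_iff)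
  moreover have "\<bar>2 * bx x * (fx x \<bullet> fy x)\<bar> \<le> B * (?X + ?Y)"
  proof -
    have "\<bar>fx x \<bullet> fy x\<bar> \<le> norm (fx x) * norm (fy x)" by (rule Cauchy_Schwarz_ineq2)
    then have "2 * \<bar>fx x \<bullet> fy x\<bar> \<le> ?X + ?Y" using sum_squares_bound[of "norm (fx x)" "norm (fy x)"] by linarith
    then have "\<bar>bx x\<bar> * (2 * \<bar>fx x \<bullet> fy x\<bar>) \<le> B * (?X + ?Y)" using bounds(4)[OF assms] B by (intro mult_mono) auto
    then show ?thesis by (simp add: abs_mult mult_ac)
  qed
  ultimately show ?thesis unfolding stress_def using abs_triangle_ineq4[of "(by' x - w' (fst x)) * (?X - ?Y)" "2 * bx x * (fx x \<bullet> fy x)"]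
    by (simp add: algebra_simps)
qed

lemma stress_tendsto:
  assumes "L2lim M F P" "L2lim M G Q"
  shows "(\<lambda>n. \<integral>x. stress (F n) (G n) x \<partial>M) \<longlonglongrightarrow> (\<integral>x. stress P Q x \<partial>M)"
proof -
  have s: "sqint M (F n)" "sqint M P" "sqint M (G n)" "sqint M Q" for n using assms by (auto simp: L2lim_def)
  have B2: "0 \<le> 2 * B" using B by simp
  have eq: "(\<integral>x. stress fx fy x \<partial>M) = ip M (\<lambda>x. (by' x - w' (fst x)) *\<^sub>R fx x) fx - ip M (\<lambda>x. (by' x - w' (fst x)) *\<^sub>R fy x) fy - 2 * ip M (\<lambda>x. bx x *\<^sub>R fx x) fy"
    if "sqint M fx" "sqint M fy" for fx fy
    using stress_terms[OF that] by (simp add: stress_eq ip_def)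
  show ?thesis
    unfolding eq[OF s(1,3)] eq[OF s(2,4)]
    using field_measurable by_w_bound bounds(4) B B2
    by (intro tendsto_intros L2lim_ip L2lim_scale[where B="2*B"] L2lim_scale[where B=B] assms) auto
qed

text \<open>\<open>rellich_pointwise\<close> bounds the energy density at \<open>x\<close> by the
  Jacobian times a function \<open>F\<close> at \<open>S h x\<close>, so that change of variables
  applies. The condition \<open>8 * B * h \<le> 1\<close> keeps \<open>F\<close> nonnegative, as is
  required because the image may be smaller than \<Omega>.\<close>

lemma pull_energy:
  assumes h: "0 < h" "h \<le> h0" and f: "C1c \<Omega> f fx fy"
  shows "energy (pullx h fx fy) (pully h fy) \<le> energy fx fy + h * (\<integral>x. stress fx fy x \<partial>M) + 20 * (B + B\<^sup>2) * h\<^sup>2 * energy fx fy"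
proof -
  have \<Omega>l: "\<Omega> \<in> sets lebesgue" using open_\<Omega> by auto
  note s = H10_jet_sqint[OF C1c_in_H10[OF open_\<Omega> f]] and sv = H10_jet_sqint[OF C1c_in_H10[OF open_\<Omega> pull_C1c[OF h f]]]
  define F where "F x = (norm (fx x))\<^sup>2 + (norm (fy x))\<^sup>2 + h * stress fx fy x + 20 * (B + B\<^sup>2) * h\<^sup>2 * ((norm (fx x))\<^sup>2 + (norm (fy x))\<^sup>2)" for x
  have i: "integrable M (\<lambda>x. (norm (fx x))\<^sup>2)" "integrable M (\<lambda>x. (norm (fy x))\<^sup>2)" "integrable M (stress fx fy)"
    using s stress_integrable by (auto simp: sqint_def)
  have Fi: "integrable M F" unfolding F_def[abs_def] using i by (intro Bochner_Integration.integrable_add integrable_mult_right) auto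
  have F0: "0 \<le> F x" if x: "x \<in> \<Omega>" for x
  proof -
    let ?e = "(norm (fx x))\<^sup>2 + (norm (fy x))\<^sup>2"
    have "\<bar>h * stress fx fy x\<bar> = h * \<bar>stress fx fy x\<bar>" using h by (simp add: abs_mult)
    also have "\<dots> \<le> h * (3 * B * ?e)" using h by (intro mult_left_mono stress_bound[OF x]) auto
    also have "\<dots> = 3 * (B * h) * ?e" by simp
    also have "\<dots> \<le> 1 * ?e" using h_small[OF h] B h by (intro mult_right_mono) auto
    finally have "- ?e \<le> h * stress fx fy x" unfolding abs_le_iff by simp
    moreover have "0 \<le> 20 * (B + B\<^sup>2) * h\<^sup>2 * ?e" using B by simp
    ultimately show ?thesis unfolding F_def by linarith
  qed
  have pt: "(norm (pullx h fx fy x))\<^sup>2 + (norm (pully h fy x))\<^sup>2 \<le> (if x \<in> dom h then J h x * F (S h x) else 0)" for x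
  proof (cases "x \<in> dom h")
    case True
    then have x: "x \<in> \<Omega>" "S h x \<in> \<Omega>" by (auto simp: dom_def)
    have l: "\<bar>w' (fst x) - w' (fst (S h x))\<bar> \<le> B * h" "\<bar>bx x - bx (S h x)\<bar> \<le> B * h" "\<bar>by' x - by' (S h x)\<bar> \<le> B * h"
      using lip[OF x(1) h x(2)[unfolded S_def]] by (auto simp: S_def)
    show ?thesis
      using rellich_pointwise[OF h(1) h_small[OF h] B bounds(2) bounds(5)[OF x(1)] bounds(4)[OF x(1)] bounds(2) bounds(5)[OF x(2)] bounds(4)[OF x(2)] l(1) l(3) l(2), of "fx (S h x)" "fy (S h x)"] True
      by (simp add: pullx_def pully_def J_def F_def stress_def)
  qed (simp add: pullx_def pully_def)
  have "energy (pullx h fx fy) (pully h fy) = (\<integral>x. (norm (pullx h fx fy x))\<^sup>2 + (norm (pully h fy x))\<^sup>2 \<partial>M)"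
    using sv by (simp add: energy_def nrm_sq sqint_def)
  also have "\<dots> \<le> (\<integral>x. (if x \<in> dom h then J h x * F (S h x) else 0) \<partial>M)"
    using sv pull_integral_le(1)[OF h Fi F0] pt by (intro integral_mono) (auto simp: sqint_def)
  also have "\<dots> \<le> (\<integral>x. F x \<partial>M)" by (rule pull_integral_le(2)[OF h Fi F0])
  also have "\<dots> = energy fx fy + h * (\<integral>x. stress fx fy x \<partial>M) + 20 * (B + B\<^sup>2) * h\<^sup>2 * energy fx fy"
    unfolding F_def energy_def nrm_sq using i by simp
  finally show ?thesis .
qed

text \<open>A crude bound uniform in \<open>h\<close>; the square root \<open>3\<close> of the
  factor is what \<open>weak_solution_pull\<close> uses.\<close>

lemma pull_energy_le:
  assumes h: "0 < h" "h \<le> h0" and f: "C1c \<Omega> f fx fy"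
  shows "energy (pullx h fx fy) (pully h fy) \<le> 9 * energy fx fy"
proof -
  note s = H10_jet_sqint[OF C1c_in_H10[OF open_\<Omega> f]]
  have i: "integrable M (\<lambda>x. (norm (fx x))\<^sup>2)" "integrable M (\<lambda>x. (norm (fy x))\<^sup>2)" "integrable M (stress fx fy)"
    using s stress_integrable by (auto simp: sqint_def)
  have "(\<integral>x. stress fx fy x \<partial>M) \<le> (\<integral>x. 3 * B * ((norm (fx x))\<^sup>2 + (norm (fy x))\<^sup>2) \<partial>M)"
    using i stress_bound by (intro integral_mono) (auto simp: abs_le_iff)
  also have "\<dots> = 3 * B * energy fx fy" using i by (simp add: energy_def nrm_sq)
  finally have "h * (\<integral>x. stress fx fy x \<partial>M) \<le> h * (3 * B * energy fx fy)" using h by (intro mult_left_mono) auto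
  also have "\<dots> = 3 * (B * h) * energy fx fy" by simp
  also have "\<dots> \<le> 1 * energy fx fy" using h_small[OF h] energy_nonneg B h by (intro mult_right_mono) auto
  finally have 1: "h * (\<integral>x. stress fx fy x \<partial>M) \<le> energy fx fy" by simp
  have "20 * (B + B\<^sup>2) * h\<^sup>2 = 20 * (B * h) * h + 20 * (B * h) * (B * h)" by (simp add: power2_eq_square algebra_simps)
  also have "\<dots> \<le> 20 * (1/8) * 1 + 20 * (1/8) * (1/8)"
    using h_small[OF h] B h h0 by (intro add_mono mult_mono) auto
  also have "\<dots> \<le> 7" by simp
  finally have "20 * (B + B\<^sup>2) * h\<^sup>2 * energy fx fy \<le> 7 * energy fx fy" using energy_nonneg by (intro mult_right_mono) auto
  then show ?thesis using pull_energy[OF h f] 1 by linarith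
qed

lemma norm_field: "p \<in> \<Omega> \<Longrightarrow> norm (w (fst p), b p) \<le> 2 * B"
  using norm_Pair_le[of "w (fst p)" "b p"] bounds(1)[of "fst p"] bounds(3)[of p] by simp

lemma pull_eq: 
  assumes "C1c \<Omega> f fx fy" "p \<in> \<Omega>" shows "pull h f p = f (S h p)"
proof -
  from C1cE[OF assms(1)] obtain K where K: "K \<subseteq> \<Omega>" "\<And>p. p \<notin> K \<Longrightarrow> f p = 0" by metis
  have "S h p \<notin> \<Omega> \<Longrightarrow> f (S h p) = 0" using K by blast
  then show ?thesis using assms(2) by (auto simp: pull_def dom_def)
qed

lemma field_quotient_bound:
  fixes x y :: complex
  assumes p: "p \<in> \<Omega>"
  shows "(norm (w (fst p) *\<^sub>R x + b p *\<^sub>R y))\<^sup>2 \<le> 2 * B\<^sup>2 * ((norm x)\<^sup>2 + (norm y)\<^sup>2)"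
proof -
  have "norm (w (fst p) *\<^sub>R x + b p *\<^sub>R y) \<le> \<bar>w (fst p)\<bar> * norm x + \<bar>b p\<bar> * norm y"
    using norm_triangle_ineq[of "w (fst p) *\<^sub>R x" "b p *\<^sub>R y"] by simp
  also have "\<dots> \<le> B * norm x + B * norm y" using bounds(1) bounds(3)[OF p] by (intro add_mono mult_right_mono) auto
  finally have "(norm (w (fst p) *\<^sub>R x + b p *\<^sub>R y))\<^sup>2 \<le> (B * norm x + B * norm y)\<^sup>2" by (intro power_mono) auto
  also have "\<dots> = B\<^sup>2 * (norm x + norm y)\<^sup>2" by (simp add: power2_eq_square algebra_simps)
  also have "\<dots> \<le> B\<^sup>2 * (2 * ((norm x)\<^sup>2 + (norm y)\<^sup>2))"
    using sum_squares_bound[of "norm x" "norm y"] by (intro mult_left_mono) (auto simp: power2_eq_square algebra_simps)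
  finally show ?thesis by (simp only: mult_ac)
qed

text \<open>Along the segment of points \<open>S (t * h) p\<close> the increment of \<open>f\<close>
  is controlled by its gradient. After Tonelli each slice is a backward step of length
  \<open>t * h\<close>, and the change of variables costs at most the factor \<open>4\<close> from
  \<open>J_ge\<close>. The segment may leave \<Omega>, where \<open>f\<close> and its gradient
  vanish.\<close>

lemma pull_diff:
  assumes h: "0 < h" "h \<le> h0" and f: "C1c \<Omega> f fx fy"
  shows "(nrm M (\<lambda>p. pull h f p - f p))\<^sup>2 \<le> 8 * B\<^sup>2 * h\<^sup>2 * energy fx fy"
proof -
  note C1 = C1c_C1[OF f]
  note s = H10_jet_sqint[OF C1c_in_H10[OF open_\<Omega> f]] and sv = H10_jet_sqint[OF C1c_in_H10[OF open_\<Omega> pull_C1c[OF h f]]]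
  from C1cE[OF f] obtain K where K: "compact K" "K \<subseteq> \<Omega>" "\<And>p. p \<notin> K \<Longrightarrow> f p = 0" "\<And>p. p \<notin> K \<Longrightarrow> fx p = 0" "\<And>p. p \<notin> K \<Longrightarrow> fy p = 0"
    by metis
  have \<Omega>l: "\<Omega> \<in> sets lebesgue" "\<Omega> \<in> sets borel" using open_\<Omega> by auto
  define e where "e p = (norm (fx p))\<^sup>2 + (norm (fy p))\<^sup>2" for p
  have e0: "0 \<le> e p" for p by (simp add: e_def)
  have ec: "continuous_on UNIV e" unfolding e_def by (intro continuous_intros C1_contx[OF C1] C1_conty[OF C1])
  have ei: "integrable M e" unfolding e_def[abs_def] using s by (intro Bochner_Integration.integrable_add) (auto simp: sqint_def)
  have eI: "(\<integral>p. e p \<partial>M) = energy fx fy" unfolding e_def energy_def nrm_sq using s by (simp add: sqint_def)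
  define c where "c = 2 * B\<^sup>2 * h\<^sup>2"
  have c0: "0 \<le> c" by (simp add: c_def)
  \<comment> \<open>The indicator of \<Omega> is built in because \<open>S\<close> is continuous in
    \<open>p\<close> only there; with it \<open>G\<close> is a Borel function on the whole
    product.\<close>
  define G where "G = (\<lambda>(p::plane, t::real). indicator (\<Omega> \<times> UNIV) (p, t) *\<^sub>R (indicator {0..1} t * e (S (t * h) p)))"
  have Gm: "G \<in> borel_measurable (lborel \<Otimes>\<^sub>M lborel)"
  proof -
    have cS: "continuous_on (\<Omega> \<times> UNIV) (\<lambda>(p, t). S (t * h) p)"
    proof -
      show ?thesis unfolding S_def split_def
        by (intro continuous_intros continuous_on_compose2[OF w_cont] continuous_on_compose2[OF C1_on_continuous[OF b_C1]]) auto
    qed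
    have a: "(\<lambda>z. indicator (\<Omega> \<times> UNIV) z *\<^sub>R e ((\<lambda>(p, t). S (t * h) p) z)) \<in> borel_measurable borel"
      using \<Omega>l by (intro borel_measurable_continuous_on_indicator continuous_on_compose2[OF ec cS]) (auto simp: borel_open open_Times open_\<Omega>)
    have b: "(\<lambda>z::plane \<times> real. indicator {0..1} (snd z) :: real) \<in> borel_measurable borel"
      by (intro borel_measurable_indicator' ) (auto intro!: borel_closed closed_Collect_le continuous_intros simp: vimage_def Collect_conj_eq)
    have "(\<lambda>z. indicator {0..1} (snd z) * (indicator (\<Omega> \<times> UNIV) z *\<^sub>R e ((\<lambda>(p, t). S (t * h) p) z))) = G"
      by (auto simp: G_def fun_eq_iff indicator_def)
    with borel_measurable_times[OF b a] have "G \<in> borel_measurable borel" by simp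
    then show ?thesis unfolding lborel_prod by simp
  qed
  have toM: "(\<integral>\<^sup>+p. F p \<partial>M) = (\<integral>\<^sup>+p. F p * indicator \<Omega> p \<partial>lborel)" for F
    using \<Omega>l by (simp add: nn_integral_restrict_space nn_integral_completion)
  have "(\<integral>\<^sup>+p. ennreal ((norm (pull h f p - f p))\<^sup>2) \<partial>M) \<le> (\<integral>\<^sup>+p. (\<integral>\<^sup>+t. ennreal (c * G (p, t)) \<partial>lborel) \<partial>M)"
  proof (rule nn_integral_mono)
    fix p assume "p \<in> space M"
    then have p: "p \<in> \<Omega>" by simp
    let ?f' = "\<lambda>t. - (h *\<^sub>R (w (fst p) *\<^sub>R fx (S (t * h) p) + b p *\<^sub>R fy (S (t * h) p)))"
    have d: "((\<lambda>t. f (S (t * h) p)) has_vector_derivative ?f' t) (at t)" for t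
    proof -
      have "((\<lambda>t. S (t * h) p) has_derivative (\<lambda>k. - ((k * h) *\<^sub>R (w (fst p), b p)))) (at t)"
        unfolding S_def by (auto intro!: derivative_eq_intros simp: algebra_simps)
      from has_derivative_compose[OF this C1_deriv[OF C1]] show ?thesis
        unfolding has_vector_derivative_def by (rule has_derivative_eq_rhs) (simp add: fun_eq_iff algebra_simps)
    qed
    have S0: "S 0 p = p" by (simp add: S_def zero_prod_def[symmetric])
    have cS: "continuous_on UNIV (\<lambda>t. S (t * h) p)" unfolding S_def by (intro continuous_intros)
    have "continuous_on UNIV ?f'"
      by (intro continuous_intros continuous_on_compose2[OF C1_contx[OF C1] cS] continuous_on_compose2[OF C1_conty[OF C1] cS]) auto
    from unit_interval_increment_le[OF d this]
    have "ennreal ((norm (f (S h p) - f p))\<^sup>2) \<le> (\<integral>\<^sup>+t. ennreal (indicator {0..1} t * (norm (?f' t))\<^sup>2) \<partial>lborel)"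
      using S0 by simp
    also have "\<dots> \<le> (\<integral>\<^sup>+t. ennreal (c * G (p, t)) \<partial>lborel)"
    proof (intro nn_integral_mono ennreal_leI)
      fix t :: real
      have "(norm (?f' t))\<^sup>2 = h\<^sup>2 * (norm (w (fst p) *\<^sub>R fx (S (t * h) p) + b p *\<^sub>R fy (S (t * h) p)))\<^sup>2"
        by (simp only: norm_minus_cancel norm_scaleR power_mult_distrib power2_abs)
      also have "\<dots> \<le> h\<^sup>2 * (2 * B\<^sup>2 * e (S (t * h) p))"
        unfolding e_def by (intro mult_left_mono field_quotient_bound p) auto
      finally have "(norm (?f' t))\<^sup>2 \<le> c * e (S (t * h) p)" by (simp add: c_def mult_ac)
      then show "indicator {0..1} t * (norm (?f' t))\<^sup>2 \<le> c * G (p, t)"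
        using p by (auto simp: G_def indicator_def)
    qed
    finally show "ennreal ((norm (pull h f p - f p))\<^sup>2) \<le> (\<integral>\<^sup>+t. ennreal (c * G (p, t)) \<partial>lborel)"
      by (simp add: pull_eq[OF f p])
  qed
  also have "\<dots> = (\<integral>\<^sup>+p. (\<integral>\<^sup>+t. ennreal (c * G (p, t)) \<partial>lborel) \<partial>lborel)"
    unfolding toM by (rule nn_integral_cong) (auto simp: G_def indicator_def)
  also have "\<dots> = (\<integral>\<^sup>+t. (\<integral>\<^sup>+p. ennreal (c * G (p, t)) \<partial>lborel) \<partial>lborel)"
    by (rule lborel_pair.Fubini'[symmetric]) (use Gm in measurable)
  also have "\<dots> \<le> (\<integral>\<^sup>+t. ennreal (4 * c * energy fx fy) * indicator {0..1::real} t \<partial>lborel)"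
  proof (rule nn_integral_mono)
    fix t :: real
    show "(\<integral>\<^sup>+p. ennreal (c * G (p, t)) \<partial>lborel) \<le> ennreal (4 * c * energy fx fy) * indicator {0..1} t"
    proof (cases "t \<in> {0..1}")
      case False
      then show ?thesis by (simp add: G_def)
    next
      case True
      have "(\<integral>\<^sup>+p. ennreal (c * G (p, t)) \<partial>lborel) = (\<integral>\<^sup>+p. ennreal (c * e (S (t * h) p)) \<partial>M)"
        unfolding toM by (rule nn_integral_cong) (use True in \<open>auto simp: G_def indicator_def\<close>)
      also have "\<dots> \<le> ennreal (4 * c * energy fx fy)"
      proof (cases "t = 0")
        case True
        have "(\<integral>\<^sup>+p. ennreal (c * e (S (t * h) p)) \<partial>M) = ennreal (c * energy fx fy)"
          unfolding eI[symmetric] using True ei e0 c0 by (simp add: S_def zero_prod_def[symmetric] nn_integral_eq_integral)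
        also have "\<dots> \<le> ennreal (4 * c * energy fx fy)" using c0 energy_nonneg[of fx fy] by (intro ennreal_leI) (simp add: mult_right_mono)
        finally show ?thesis .
      next
        case False
        then have th: "0 < t * h" "t * h \<le> h0" using True h mult_mono[of t 1 h h0] by auto
        note pi = pull_integral_le[OF th ei e0]
        have "(\<integral>\<^sup>+p. ennreal (c * e (S (t * h) p)) \<partial>M) \<le> (\<integral>\<^sup>+p. ennreal (4 * c * (if p \<in> dom (t * h) then J (t * h) p * e (S (t * h) p) else 0)) \<partial>M)"
        proof (intro nn_integral_mono ennreal_leI)
          fix p assume "p \<in> space M"
          then have p: "p \<in> \<Omega>" by simp
          show "c * e (S (t * h) p) \<le> 4 * c * (if p \<in> dom (t * h) then J (t * h) p * e (S (t * h) p) else 0)"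
          proof (cases "p \<in> dom (t * h)")
            case True
            have "1 * (c * e (S (t * h) p)) \<le> (4 * J (t * h) p) * (c * e (S (t * h) p))"
              using J_ge[OF th p] c0 e0 by (intro mult_right_mono) auto
            then show ?thesis using True by (simp add: mult_ac)
          next
            case False
            then have "S (t * h) p \<notin> K" using p K(2) by (auto simp: dom_def)
            then show ?thesis using False K by (simp add: e_def)
          qed
        qed
        also have "\<dots> = ennreal (\<integral>p. 4 * c * (if p \<in> dom (t * h) then J (t * h) p * e (S (t * h) p) else 0) \<partial>M)"
        proof (rule nn_integral_eq_integral)
          show "integrable M (\<lambda>p. 4 * c * (if p \<in> dom (t * h) then J (t * h) p * e (S (t * h) p) else 0))"
            by (rule integrable_mult_right) (rule pi(1))
          show "AE p in M. 0 \<le> 4 * c * (if p \<in> dom (t * h) then J (t * h) p * e (S (t * h) p) else 0)"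
          proof (intro AE_I2)
            fix p assume "p \<in> space M"
            then have "1/4 \<le> J (t * h) p" using J_ge[OF th] by simp
            then show "0 \<le> 4 * c * (if p \<in> dom (t * h) then J (t * h) p * e (S (t * h) p) else 0)"
              using c0 e0[of "S (t * h) p"] by simp
          qed
        qed
        also have "\<dots> \<le> ennreal (4 * c * energy fx fy)"
          using pi(2) c0 unfolding eI by (intro ennreal_leI) (simp add: mult_left_mono)
        finally show ?thesis .
      qed
      finally show ?thesis using True by simp
    qed
  qed
  also have "\<dots> = ennreal (4 * c * energy fx fy)"
    by (subst nn_integral_cmult_indicator) auto
  finally have "(\<integral>\<^sup>+p. ennreal ((norm (pull h f p - f p))\<^sup>2) \<partial>M) \<le> ennreal (4 * c * energy fx fy)" .
  moreover have "(\<integral>\<^sup>+p. ennreal ((norm (pull h f p - f p))\<^sup>2) \<partial>M) = ennreal ((nrm M (\<lambda>p. pull h f p - f p))\<^sup>2)"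
    unfolding nrm_sq using sqint_diff[OF sv(1) s(1)] by (intro nn_integral_eq_integral) (auto simp: sqint_def)
  ultimately show ?thesis using c0 energy_nonneg[of fx fy] by (simp add: c_def)
qed

end

context inward_field
begin

section \<open>The limit of small steps\<close>

definition flow :: "(plane \<Rightarrow> complex) \<Rightarrow> (plane \<Rightarrow> complex) \<Rightarrow> plane \<Rightarrow> complex" where
  "flow fx fy p = w (fst p) *\<^sub>R fx p + b p *\<^sub>R fy p"

lemma flow_sqint: "sqint M fx \<Longrightarrow> sqint M fy \<Longrightarrow> sqint M (flow fx fy)"
  unfolding flow_def[abs_def] using field_measurable bounds(1,3)
  by (intro sqint_add sqint_scale[where B=B]) auto

lemma flow_L2lim: "L2lim M F P \<Longrightarrow> L2lim M G Q \<Longrightarrow> L2lim M (\<lambda>n. flow (F n) (G n)) (flow P Q)"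
  unfolding flow_def[abs_def] using field_measurable bounds(1,3) B
  by (intro L2lim_add L2lim_scale[where B=B]) auto

lemma C1c_sqint:
  fixes f :: "plane \<Rightarrow> complex"
  assumes "C1c \<Omega> f fx fy"
  shows "sqint M f" "sqint M fx" "sqint M fy"
  using H10_jet_sqint[OF C1c_in_H10[OF open_\<Omega> assms]] by auto

lemma pull_sqint:
  assumes "0 < h" "h \<le> h0" "C1c \<Omega> f fx fy"
  shows "sqint M (pull h f)" "sqint M (pullx h fx fy)" "sqint M (pully h fy)"
  using C1c_sqint[OF pull_C1c[OF assms]] by auto

text \<open>Dominated convergence: \<open>f\<close> is Lipschitz and the field has norm at most
  \<open>2 * B\<close>, so the quotients are bounded; as all steps are at most \<open>1\<close>,
  they vanish in \<Omega> outside the compact set \<open>K'\<close>.\<close>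

lemma difference_quotient_tendsto:
  assumes f: "C1c \<Omega> f fx fy" and h: "\<And>k. 0 < h k" "\<And>k. h k \<le> h0" "h \<longlonglongrightarrow> 0"
  shows "L2lim M (\<lambda>k p. (1 / h k) *\<^sub>R (pull (h k) f p - f p)) (\<lambda>p. - flow fx fy p)"
proof -
  note C1 = C1c_C1[OF f]
  note s = C1c_sqint[OF f]
  from C1c_lipschitz[OF f] obtain L where L: "0 \<le> L" "\<And>p q. norm (f p - f q) \<le> L * norm (p - q)" by metis
  from C1cE[OF f] obtain K where K: "compact K" "K \<subseteq> \<Omega>" "\<And>p. p \<notin> K \<Longrightarrow> f p = 0" "\<And>p. p \<notin> K \<Longrightarrow> fx p = 0" "\<And>p. p \<notin> K \<Longrightarrow> fy p = 0"
    by metis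
  define K' where "K' = {x + y |x y. x \<in> K \<and> y \<in> cball 0 (2 * B)}"
  have K': "compact K'" unfolding K'_def by (intro compact_sums K compact_cball)
  have \<Omega>l: "\<Omega> \<in> sets lebesgue" using open_\<Omega> by auto
  define Q where "Q k p = (1 / h k) *\<^sub>R (pull (h k) f p - f p)" for k p
  have sQ: "sqint M (Q k)" for k
    unfolding Q_def[abs_def] using pull_sqint(1)[OF h(1,2) f] s by (intro sqint_scaleR sqint_diff)
  have sF: "sqint M (\<lambda>p. - flow fx fy p)"
    using sqint_scaleR[OF flow_sqint[OF s(2,3)], of "-1"] by simp
  have Qb: "norm (Q k p) \<le> 2 * B * L" if p: "p \<in> \<Omega>" for k p
  proof -
    have "norm (f (S (h k) p) - f p) \<le> L * norm (S (h k) p - p)" by (rule L)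
    also have "S (h k) p - p = - (h k *\<^sub>R (w (fst p), b p))" by (simp only: S_def diff_diff_eq2 diff_add_cancel) simp
    also have "L * norm (- (h k *\<^sub>R (w (fst p), b p))) = h k * (L * norm (w (fst p), b p))"
      using h(1)[of k] by (simp only: norm_minus_cancel norm_scaleR) simp
    also have "\<dots> \<le> h k * (L * (2 * B))" using h(1)[of k] L norm_field[OF p] by (intro mult_left_mono) auto
    finally have "norm (f (S (h k) p) - f p) \<le> h k * (2 * B * L)" by (simp add: mult_ac)
    then show ?thesis using h(1)[of k] by (simp add: Q_def pull_eq[OF f p] divide_simps mult_ac)
  qed
  have tend: "(\<lambda>k. Q k p) \<longlonglongrightarrow> - flow fx fy p" if p: "p \<in> \<Omega>" for p
  proof -
    have "filterlim h (at 0) sequentially"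
      using h by (auto simp: filterlim_at intro!: always_eventually) (metis less_irrefl)
    from filterlim_compose[OF C1_diff_quotient[OF C1, where p=p and b="- (w (fst p), b p)"] this]
    have "(\<lambda>k. (f (p + h k *\<^sub>R - (w (fst p), b p)) - f p) /\<^sub>R h k) \<longlonglongrightarrow> fst (- (w (fst p), b p)) *\<^sub>R fx p + snd (- (w (fst p), b p)) *\<^sub>R fy p" .
    moreover have "(f (p + h k *\<^sub>R - (w (fst p), b p)) - f p) /\<^sub>R h k = Q k p" for k
      unfolding Q_def pull_eq[OF f p] S_def scaleR_minus_right by (simp only: diff_conv_add_uminus inverse_eq_divide)
    moreover have "fst (- (w (fst p), b p)) *\<^sub>R fx p + snd (- (w (fst p), b p)) *\<^sub>R fy p = - flow fx fy p"
      by (simp add: flow_def)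
    ultimately show ?thesis by simp
  qed
  have out: "Q k p = 0" "flow fx fy p = 0" if p: "p \<in> \<Omega>" "p \<notin> K'" for k p
  proof -
    have "p + 0 \<in> K'" if "p \<in> K" unfolding K'_def using B that by (intro CollectI exI[of _ p] exI[of _ 0]) auto
    then have "p \<notin> K" using p(2) by auto
    moreover have "S (h k) p \<notin> K"
    proof
      assume a: "S (h k) p \<in> K"
      have "norm (h k *\<^sub>R (w (fst p), b p)) = h k * norm (w (fst p), b p)" using h(1)[of k] by (simp only: norm_scaleR abs_of_pos)
      also have "\<dots> \<le> 1 * (2 * B)" using h(1,2)[of k] h0 norm_field[OF p(1)] by (intro mult_mono) auto
      finally have "h k *\<^sub>R (w (fst p), b p) \<in> cball 0 (2 * B)" by simp
      then have "S (h k) p + h k *\<^sub>R (w (fst p), b p) \<in> K'" unfolding K'_def using a by blast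
      then show False using p(2) by (simp add: S_def)
    qed
    ultimately show "Q k p = 0" "flow fx fy p = 0" using K(3-5) by (auto simp: Q_def pull_eq[OF f p(1)] flow_def)
  qed
  have "(\<lambda>k. (nrm M (\<lambda>p. Q k p - - flow fx fy p))\<^sup>2) \<longlonglongrightarrow> (\<integral>p. 0 \<partial>M)"
    unfolding nrm_sq
  proof (rule integral_dominated_convergence[where w="\<lambda>p. indicator K' p *\<^sub>R (4 * B * L)\<^sup>2"])
    show "(\<lambda>p. 0) \<in> borel_measurable M" by simp
    show "(\<lambda>p. (norm (Q k p - - flow fx fy p))\<^sup>2) \<in> borel_measurable M" for k
      using sqint_diff[OF sQ sF] by (auto simp: sqint_def)
    have "integrable lebesgue (\<lambda>p. indicator K' p *\<^sub>R (4 * B * L)\<^sup>2)"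
      using lmeasurable_compact[OF K'] by (intro integrable_scaleR_left integrable_real_indicator) (auto simp: fmeasurable_def)
    from integrable_mult_indicator[OF \<Omega>l this] show "integrable M (\<lambda>p. indicator K' p *\<^sub>R (4 * B * L)\<^sup>2)"
      by (rule integrable_restrict_space[THEN iffD2, rotated]) (use \<Omega>l in simp)
    show "AE p in M. (\<lambda>k. (norm (Q k p - - flow fx fy p))\<^sup>2) \<longlonglongrightarrow> 0"
    proof (rule AE_I2)
      fix p assume "p \<in> space M"
      then have p: "p \<in> \<Omega>" by simp
      have "(\<lambda>k. (norm (Q k p - - flow fx fy p))\<^sup>2) \<longlonglongrightarrow> (norm (- flow fx fy p - - flow fx fy p))\<^sup>2"
        by (intro tendsto_intros tend p)
      then show "(\<lambda>k. (norm (Q k p - - flow fx fy p))\<^sup>2) \<longlonglongrightarrow> 0" by simp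
    qed
    show "AE p in M. norm ((norm (Q k p - - flow fx fy p))\<^sup>2) \<le> indicator K' p *\<^sub>R (4 * B * L)\<^sup>2" for k
    proof (rule AE_I2)
      fix p assume "p \<in> space M"
      then have p: "p \<in> \<Omega>" by simp
      show "norm ((norm (Q k p - - flow fx fy p))\<^sup>2) \<le> indicator K' p *\<^sub>R (4 * B * L)\<^sup>2"
      proof (cases "p \<in> K'")
        case True
        have "norm (- flow fx fy p) \<le> 2 * B * L"
          by (rule Lim_norm_ubound[OF _ tend[OF p]]) (use Qb[OF p] in auto)
        then have "norm (Q k p - - flow fx fy p) \<le> 4 * B * L"
          using norm_triangle_ineq4[of "Q k p" "- flow fx fy p"] Qb[OF p, of k] by linarith
        then have "(norm (Q k p - - flow fx fy p))\<^sup>2 \<le> (4 * B * L)\<^sup>2" by (rule power_mono) simp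
        then show ?thesis using True by simp
      qed (use out[OF p] in simp)
    qed
  qed
  then have "(\<lambda>k. sqrt ((nrm M (\<lambda>p. Q k p - - flow fx fy p))\<^sup>2)) \<longlonglongrightarrow> sqrt 0" by (intro tendsto_real_sqrt) simp
  then have "(\<lambda>k. nrm M (\<lambda>p. Q k p - - flow fx fy p)) \<longlonglongrightarrow> 0" by simp
  then show ?thesis using sQ sF unfolding L2lim_def Q_def by blast
qed

text \<open>The weak equation is tested with \<open>pull h f - f\<close>. Replacing
  \<open>(p, q)\<close> by \<open>(fx, fy)\<close> costs the last term, in which \<open>4\<close> is
  \<open>3 + 1\<close> from the norms of the two gradients; what remains is a pairing of
  \<open>(fx, fy)\<close> with an increment, at most half of the gain of energy.\<close>

lemma weak_solution_pull:
  assumes u: "weak_solution \<Omega> u p q g" and h: "0 < h" "h \<le> h0" and f: "C1c \<Omega> f fx fy"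
  shows "ip M g (\<lambda>x. pull h f x - f x) \<le> 1/2 * (h * (\<integral>x. stress fx fy x \<partial>M) + 20 * (B + B\<^sup>2) * h\<^sup>2 * energy fx fy)
    + (nrm M (\<lambda>x. p x - fx x) + nrm M (\<lambda>x. q x - fy x)) * (4 * sqrt (energy fx fy))"
proof -
  note s = C1c_sqint[OF f] and sv = pull_sqint[OF h f]
  have jf: "jet f fx fy \<in> H10 \<Omega>" and jv: "jet (pull h f) (pullx h fx fy) (pully h fy) \<in> H10 \<Omega>"
    using C1c_in_H10[OF open_\<Omega>] f pull_C1c[OF h f] by auto
  have sg: "sqint M g" and ju: "jet u p q \<in> H10 \<Omega>" using u by (auto simp: weak_solution_def)
  have sp: "sqint M p" "sqint M q" using H10_jet_sqint[OF ju] by auto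
  let ?vx = "pullx h fx fy" and ?vy = "pully h fy" and ?r = "sqrt (energy fx fy)"
  have weak: "ip M p vx + ip M q vy = ip M g v" if "jet v vx vy \<in> H10 \<Omega>" for v vx vy
    using u that by (auto simp: weak_solution_def)
  have 1: "ip M g (\<lambda>x. pull h f x - f x) = ip M p (\<lambda>x. ?vx x - fx x) + ip M q (\<lambda>x. ?vy x - fy x)"
    using weak[OF jf] weak[OF jv] s sv sg sp by (simp add: ip_diff_right)
  have part: "ip M P (\<lambda>x. v x - F x) \<le> 1/2 * ((nrm M v)\<^sup>2 - (nrm M F)\<^sup>2) + nrm M (\<lambda>x. P x - F x) * (4 * ?r)"
    if "sqint M P" "sqint M v" "sqint M F" "nrm M v \<le> 3 * ?r" "nrm M F \<le> ?r" for P v F :: "plane \<Rightarrow> complex"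
  proof -
    have "ip M P (\<lambda>x. v x - F x) = ip M (\<lambda>x. P x - F x) (\<lambda>x. v x - F x) + ip M F (\<lambda>x. v x - F x)"
      using that by (simp add: ip_diff_left sqint_diff)
    moreover have "ip M F (\<lambda>x. v x - F x) \<le> 1/2 * ((nrm M v)\<^sup>2 - (nrm M F)\<^sup>2)"
      using nrm_diff_sq[OF that(2,3)] zero_le_power2[of "nrm M (\<lambda>x. v x - F x)"] that
      by (simp add: ip_diff_right nrm_sq_ip[of M F] ip_commute[of M v F])
    moreover have "ip M (\<lambda>x. P x - F x) (\<lambda>x. v x - F x) \<le> nrm M (\<lambda>x. P x - F x) * nrm M (\<lambda>x. v x - F x)"
      using ip_bound[OF sqint_diff[OF that(1,3)] sqint_diff[OF that(2,3)]] by simp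
    moreover have "nrm M (\<lambda>x. v x - F x) \<le> 4 * ?r"
      using nrm_triangle[OF that(2) sqint_scaleR[OF that(3), of "-1"]] that(4,5) by (simp add: nrm_scaleR[of M "-1" F, simplified])
    then have "nrm M (\<lambda>x. P x - F x) * nrm M (\<lambda>x. v x - F x) \<le> nrm M (\<lambda>x. P x - F x) * (4 * ?r)"
      by (intro mult_left_mono) auto
    ultimately show ?thesis by linarith
  qed
  have small: "nrm M F \<le> c * ?r" if "(nrm M F)\<^sup>2 \<le> c\<^sup>2 * energy fx fy" "0 \<le> c" for F :: "plane \<Rightarrow> complex" and c
  proof -
    have "nrm M F \<le> sqrt (c\<^sup>2 * energy fx fy)" using that(1) by (rule real_le_rsqrt)
    then show ?thesis using that(2) by (simp add: real_sqrt_mult)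
  qed
  have e9: "(nrm M ?vx)\<^sup>2 \<le> 3\<^sup>2 * energy fx fy" "(nrm M ?vy)\<^sup>2 \<le> 3\<^sup>2 * energy fx fy"
    "(nrm M fx)\<^sup>2 \<le> 1\<^sup>2 * energy fx fy" "(nrm M fy)\<^sup>2 \<le> 1\<^sup>2 * energy fx fy"
    using pull_energy_le[OF h f, unfolded energy_def] zero_le_power2[of "nrm M ?vx"] zero_le_power2[of "nrm M ?vy"]
      zero_le_power2[of "nrm M fx"] zero_le_power2[of "nrm M fy"]
    unfolding energy_def power_one mult_1 power2_eq_square[of "3::real"] by linarith+
  have n: "nrm M ?vx \<le> 3 * ?r" "nrm M ?vy \<le> 3 * ?r" "nrm M fx \<le> ?r" "nrm M fy \<le> ?r"
    using small[OF e9(1)] small[OF e9(2)] small[OF e9(3)] small[OF e9(4)] by auto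
  have "ip M g (\<lambda>x. pull h f x - f x) \<le> 1/2 * (energy ?vx ?vy - energy fx fy) + (nrm M (\<lambda>x. p x - fx x) + nrm M (\<lambda>x. q x - fy x)) * (4 * ?r)"
    using part[OF sp(1) sv(2) s(2) n(1,3)] part[OF sp(2) sv(3) s(3) n(2,4)] unfolding 1 energy_def distrib_right by argo
  moreover have "1/2 * (energy ?vx ?vy - energy fx fy) \<le> 1/2 * (h * (\<integral>x. stress fx fy x \<partial>M) + 20 * (B + B\<^sup>2) * h\<^sup>2 * energy fx fy)"
    using pull_energy[OF h f] by (intro mult_left_mono) simp_all
  ultimately show ?thesis by (meson add_right_mono order_trans)
qed

lemma pull_diff_linear:
  assumes "C1c \<Omega> f fx fy" "C1c \<Omega> g gx gy"
  shows "C1c \<Omega> (\<lambda>x. f x - g x) (\<lambda>x. fx x - gx x) (\<lambda>x. fy x - gy x)"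
    "pull h (\<lambda>x. f x - g x) = (\<lambda>x. pull h f x - pull h g x)"
  using C1c_add[OF assms(1) C1c_bounded_linear[OF bounded_linear_minus[OF bounded_linear_ident] assms(2)]]
  by (auto simp: pull_def fun_eq_iff)

text \<open>The error term of \<open>weak_solution_pull\<close> has no factor \<open>h\<close> and
  must disappear before the division by \<open>h\<close>. Hence two indices: for fixed
  \<open>h\<close> and \<open>\<phi> m\<close>, exchanging \<open>\<phi> m\<close> for
  \<open>\<phi> n\<close> costs by \<open>pull_diff\<close> only a multiple of
  \<open>h * (\<epsilon> n + \<epsilon> m)\<close>, and \<open>n\<close> goes to infinity first.
  Then \<open>h\<close> tends to \<open>0\<close> in the difference quotient of the fixed
  \<open>\<phi> m\<close>, and \<open>m\<close> goes to infinity last.\<close>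

theorem rellich:
  assumes u: "weak_solution \<Omega> u p q g"
  shows "- ip M g (flow p q) \<le> 1/2 * (\<integral>x. stress p q x \<partial>M)"
proof -
  have sg: "sqint M g" and ju: "jet u p q \<in> H10 \<Omega>" using u by (auto simp: weak_solution_def)
  from H10E[OF ju] obtain \<phi> where \<phi>: "\<And>n. \<phi> n \<in> test_functions \<Omega>" and
    l: "L2lim M (\<lambda>n. dx (\<phi> n)) p" "L2lim M (\<lambda>n. dy (\<phi> n)) q" by metis
  define \<phi>x where "\<phi>x n = dx (\<phi> n)" for n
  define \<phi>y where "\<phi>y n = dy (\<phi> n)" for n
  have C: "C1c \<Omega> (\<phi> n) (\<phi>x n) (\<phi>y n)" for n unfolding \<phi>x_def \<phi>y_def by (rule tjet_C1c[OF \<phi>])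
  note s = C1c_sqint[OF C] and l = l[folded \<phi>x_def \<phi>y_def]
  have sp: "sqint M p" "sqint M q" using l by (auto simp: L2lim_def)
  define \<epsilon> where "\<epsilon> n = nrm M (\<lambda>x. p x - \<phi>x n x) + nrm M (\<lambda>x. q x - \<phi>y n x)" for n
  have \<epsilon>0: "\<epsilon> \<longlonglongrightarrow> 0"
    unfolding \<epsilon>_def[abs_def] using l tendsto_add[of _ 0 _ _ 0] by (auto simp: L2lim_def nrm_minus_commute[of M p] nrm_minus_commute[of M q])
  have El: "(\<lambda>n. energy (\<phi>x n) (\<phi>y n)) \<longlonglongrightarrow> energy p q"
    unfolding energy_def nrm_sq_ip by (intro tendsto_intros L2lim_ip l)
  note Sl = stress_tendsto[OF l]
  have step: "ip M g (\<lambda>x. pull h (\<phi> m) x - \<phi> m x) \<le>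
      1/2 * (h * (\<integral>x. stress p q x \<partial>M) + 20 * (B + B\<^sup>2) * h\<^sup>2 * energy p q) + nrm M g * (3 * B * h * \<epsilon> m)"
    if h: "0 < h" "h \<le> h0" for h m
  proof -
    have "ip M g (\<lambda>x. pull h (\<phi> m) x - \<phi> m x) \<le>
      1/2 * (h * (\<integral>x. stress (\<phi>x n) (\<phi>y n) x \<partial>M) + 20 * (B + B\<^sup>2) * h\<^sup>2 * energy (\<phi>x n) (\<phi>y n)) + \<epsilon> n * (4 * sqrt (energy (\<phi>x n) (\<phi>y n)))
        + nrm M g * (3 * B * h * (\<epsilon> n + \<epsilon> m))" for n
    proof -
      let ?d = "\<lambda>k x. pull h (\<phi> k) x - \<phi> k x"
      have sd: "sqint M (?d k)" for k using pull_sqint(1)[OF h C] s by (intro sqint_diff)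
      let ?D = "\<lambda>x. pull h (\<lambda>x. \<phi> m x - \<phi> n x) x - (\<phi> m x - \<phi> n x)"
      have D: "?D = (\<lambda>x. ?d m x - ?d n x)" using pull_diff_linear(2)[OF C C, of h m n] by (simp add: fun_eq_iff)
      have Cd: "C1c \<Omega> (\<lambda>x. \<phi> m x - \<phi> n x) (\<lambda>x. \<phi>x m x - \<phi>x n x) (\<lambda>x. \<phi>y m x - \<phi>y n x)" by (rule pull_diff_linear(1)[OF C C])
      have a: "nrm M (\<lambda>x. \<phi>x m x - \<phi>x n x) + nrm M (\<lambda>x. \<phi>y m x - \<phi>y n x) \<le> \<epsilon> n + \<epsilon> m"
        using nrm_triangle_diff[OF s(2) sp(1) s(2), of m n] nrm_triangle_diff[OF s(3) sp(2) s(3), of m n]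
        by (simp add: \<epsilon>_def nrm_minus_commute[of M "\<phi>x m" p] nrm_minus_commute[of M "\<phi>y m" q])
      have "energy (\<lambda>x. \<phi>x m x - \<phi>x n x) (\<lambda>x. \<phi>y m x - \<phi>y n x) \<le> (nrm M (\<lambda>x. \<phi>x m x - \<phi>x n x) + nrm M (\<lambda>x. \<phi>y m x - \<phi>y n x))\<^sup>2"
        by (simp add: energy_def power2_sum)
      also have "\<dots> \<le> (\<epsilon> n + \<epsilon> m)\<^sup>2" by (rule power_mono[OF a]) simp
      finally have E: "energy (\<lambda>x. \<phi>x m x - \<phi>x n x) (\<lambda>x. \<phi>y m x - \<phi>y n x) \<le> (\<epsilon> n + \<epsilon> m)\<^sup>2" .
      have "(nrm M ?D)\<^sup>2 \<le> 8 * B\<^sup>2 * h\<^sup>2 * energy (\<lambda>x. \<phi>x m x - \<phi>x n x) (\<lambda>x. \<phi>y m x - \<phi>y n x)"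
        by (rule pull_diff[OF h Cd])
      also have "\<dots> \<le> 9 * B\<^sup>2 * h\<^sup>2 * (\<epsilon> n + \<epsilon> m)\<^sup>2" using E energy_nonneg by (intro mult_mono) auto
      also have "\<dots> = (3 * B * h * (\<epsilon> n + \<epsilon> m))\<^sup>2" by (simp add: power_mult_distrib)
      finally have "nrm M ?D \<le> 3 * B * h * (\<epsilon> n + \<epsilon> m)"
        by (rule power2_le_imp_le) (use B h in \<open>simp add: \<epsilon>_def\<close>)
      then have "nrm M g * nrm M ?D \<le> nrm M g * (3 * B * h * (\<epsilon> n + \<epsilon> m))" by (intro mult_left_mono) auto
      moreover have "ip M g ?D \<le> nrm M g * nrm M ?D" using ip_bound[OF sg sqint_diff[OF sd[of m] sd[of n]]] unfolding D by simp
      moreover have "ip M g ?D = ip M g (?d m) - ip M g (?d n)" unfolding D by (rule ip_diff_right[OF sd sd sg])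
      moreover note weak_solution_pull[OF u h C, of n, folded \<epsilon>_def]
      ultimately show ?thesis by linarith
    qed
    moreover have "(\<lambda>n. 1/2 * (h * (\<integral>x. stress (\<phi>x n) (\<phi>y n) x \<partial>M) + 20 * (B + B\<^sup>2) * h\<^sup>2 * energy (\<phi>x n) (\<phi>y n)) + \<epsilon> n * (4 * sqrt (energy (\<phi>x n) (\<phi>y n)))
        + nrm M g * (3 * B * h * (\<epsilon> n + \<epsilon> m))) \<longlonglongrightarrow> 
        1/2 * (h * (\<integral>x. stress p q x \<partial>M) + 20 * (B + B\<^sup>2) * h\<^sup>2 * energy p q) + 0 * (4 * sqrt (energy p q)) + nrm M g * (3 * B * h * (0 + \<epsilon> m))"
      by (intro tendsto_intros Sl El \<epsilon>0)
    ultimately have "ip M g (\<lambda>x. pull h (\<phi> m) x - \<phi> m x) \<le> 1/2 * (h * (\<integral>x. stress p q x \<partial>M) + 20 * (B + B\<^sup>2) * h\<^sup>2 * energy p q) + 0 * (4 * sqrt (energy p q)) + nrm M g * (3 * B * h * (0 + \<epsilon> m))"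
      by (intro LIMSEQ_le_const[where X="\<lambda>n. 1/2 * (h * (\<integral>x. stress (\<phi>x n) (\<phi>y n) x \<partial>M) + 20 * (B + B\<^sup>2) * h\<^sup>2 * energy (\<phi>x n) (\<phi>y n)) + \<epsilon> n * (4 * sqrt (energy (\<phi>x n) (\<phi>y n)))
        + nrm M g * (3 * B * h * (\<epsilon> n + \<epsilon> m))"]) blast+
    then show ?thesis by simp
  qed
  define h where "h k = h0 * inverse (real (Suc k))" for k
  have h: "0 < h k" "h k \<le> h0" "h \<longlonglongrightarrow> 0" for k
  proof -
    show "0 < h k" using h0 by (simp add: h_def)
    have "inverse (real (Suc k)) \<le> 1" by (simp add: inverse_le_1_iff)
    then show "h k \<le> h0" using h0 by (simp add: h_def mult_left_le)
    show "h \<longlonglongrightarrow> 0" unfolding h_def[abs_def] using tendsto_mult[OF tendsto_const LIMSEQ_inverse_real_of_nat, of h0] by simp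
  qed
  have main: "- ip M g (flow (\<phi>x m) (\<phi>y m)) \<le> 1/2 * (\<integral>x. stress p q x \<partial>M) + nrm M g * (3 * B * \<epsilon> m)" for m
  proof -
    have "ip M g (\<lambda>x. (1 / h k) *\<^sub>R (pull (h k) (\<phi> m) x - \<phi> m x)) \<le>
      1/2 * ((\<integral>x. stress p q x \<partial>M) + 20 * (B + B\<^sup>2) * h k * energy p q) + nrm M g * (3 * B * \<epsilon> m)" for k
    proof -
      have "(1 / h k) * ip M g (\<lambda>x. pull (h k) (\<phi> m) x - \<phi> m x) \<le> (1 / h k) * (1/2 * (h k * (\<integral>x. stress p q x \<partial>M) + 20 * (B + B\<^sup>2) * (h k)\<^sup>2 * energy p q) + nrm M g * (3 * B * h k * \<epsilon> m))"
        using h(1)[of k] by (intro mult_left_mono step h) auto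
      also have "\<dots> = 1/2 * ((\<integral>x. stress p q x \<partial>M) + 20 * (B + B\<^sup>2) * h k * energy p q) + nrm M g * (3 * B * \<epsilon> m)"
        using h(1)[of k] by (simp add: power2_eq_square distrib_left)
      finally show ?thesis by (simp add: ip_scaleR_right)
    qed
    moreover have "(\<lambda>k. 1/2 * ((\<integral>x. stress p q x \<partial>M) + 20 * (B + B\<^sup>2) * h k * energy p q) + nrm M g * (3 * B * \<epsilon> m)) \<longlonglongrightarrow>
       1/2 * ((\<integral>x. stress p q x \<partial>M) + 20 * (B + B\<^sup>2) * 0 * energy p q) + nrm M g * (3 * B * \<epsilon> m)"
      by (intro tendsto_intros h)
    moreover have "(\<lambda>k. ip M g (\<lambda>x. (1 / h k) *\<^sub>R (pull (h k) (\<phi> m) x - \<phi> m x))) \<longlonglongrightarrow> ip M g (\<lambda>x. - flow (\<phi>x m) (\<phi>y m) x)"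
      by (intro L2lim_ip L2lim_const sg difference_quotient_tendsto C h)
    ultimately have "ip M g (\<lambda>x. - flow (\<phi>x m) (\<phi>y m) x) \<le> 1/2 * ((\<integral>x. stress p q x \<partial>M) + 20 * (B + B\<^sup>2) * 0 * energy p q) + nrm M g * (3 * B * \<epsilon> m)"
      by (auto intro: LIMSEQ_le)
    then show ?thesis using ip_scaleR_right[of M g "-1" "flow (\<phi>x m) (\<phi>y m)"] by simp
  qed
  have "(\<lambda>m. - ip M g (flow (\<phi>x m) (\<phi>y m))) \<longlonglongrightarrow> - ip M g (flow p q)"
    by (intro tendsto_intros L2lim_ip L2lim_const sg flow_L2lim l)
  moreover have "(\<lambda>m. 1/2 * (\<integral>x. stress p q x \<partial>M) + nrm M g * (3 * B * \<epsilon> m)) \<longlonglongrightarrow> 1/2 * (\<integral>x. stress p q x \<partial>M) + nrm M g * (3 * B * 0)"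
    by (intro tendsto_intros \<epsilon>0)
  ultimately have "- ip M g (flow p q) \<le> 1/2 * (\<integral>x. stress p q x \<partial>M) + nrm M g * (3 * B * 0)"
    by (rule LIMSEQ_le) (use main in blast)
  then show ?thesis by simp
qed

end

section \<open>The vector field\<close>

text \<open>A cutoff with Lipschitz derivative suffices. Its square shape bounds the squared
  derivative by a multiple of the cutoff itself, which allows mixed terms to be absorbed even at the
  edge of the support.\<close>

definition bump_sq :: "real \<Rightarrow> real \<Rightarrow> real" where "bump_sq l s = (max 0 (l\<^sup>2 - s\<^sup>2))\<^sup>2"
definition bump_sq' :: "real \<Rightarrow> real \<Rightarrow> real" where "bump_sq' l s = - (4 * s * max 0 (l\<^sup>2 - s\<^sup>2))"

lemma has_real_derivative_max_sq: "((\<lambda>t::real. (max 0 t)\<^sup>2) has_real_derivative 2 * max 0 t) (at t)"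
proof -
  consider "t < 0" | "0 < t" | "t = 0" by linarith
  then show ?thesis
  proof cases
    case 1
    have "((\<lambda>t::real. 0) has_real_derivative 2 * max 0 t) (at t)" using 1 by simp
    then show ?thesis by (rule DERIV_cong_ev[THEN iffD1, OF refl _ refl, rotated])
      (use 1 in \<open>auto intro!: eventually_mono[OF eventually_nhds_in_open[of "{..<0}"]]\<close>)
  next
    case 2
    have "((\<lambda>t::real. t\<^sup>2) has_real_derivative 2 * max 0 t) (at t)" using 2 by (auto intro!: derivative_eq_intros)
    then show ?thesis by (rule DERIV_cong_ev[THEN iffD1, OF refl _ refl, rotated])
      (use 2 in \<open>auto intro!: eventually_mono[OF eventually_nhds_in_open[of "{0<..}"]]\<close>)
  next
    case 3
    have "((\<lambda>h::real. (max 0 h)\<^sup>2 / h) \<longlongrightarrow> 0) (at 0)"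
    proof (rule Lim_null_comparison)
      show "\<forall>\<^sub>F h in at 0. norm ((max 0 h)\<^sup>2 / h) \<le> \<bar>h\<bar>"
        by (intro always_eventually allI) (auto simp: max_def power2_eq_square)
      show "((\<lambda>h::real. \<bar>h\<bar>) \<longlongrightarrow> 0) (at 0)" by (rule tendsto_rabs_zero) (rule tendsto_ident_at)
    qed
    then show ?thesis using 3 by (simp add: DERIV_def)
  qed
qed

lemma bump_sq_deriv: "(bump_sq l has_real_derivative bump_sq' l s) (at s)"
proof -
  have "((\<lambda>s. l\<^sup>2 - s\<^sup>2) has_real_derivative - (2 * s)) (at s)" by (auto intro!: derivative_eq_intros)
  from DERIV_chain2[OF has_real_derivative_max_sq this] show ?thesis
    unfolding bump_sq_def[abs_def] bump_sq'_def by (simp add: mult_ac)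
qed

lemma bump_sq'_cont: "continuous_on A (bump_sq' l)"
  unfolding bump_sq'_def[abs_def] by (intro continuous_intros)

lemma sq_le_of_abs_le: "l \<le> \<bar>s\<bar> \<Longrightarrow> 0 \<le> l \<Longrightarrow> l\<^sup>2 \<le> s\<^sup>2" for l s :: real
  by (metis abs_le_square_iff abs_of_nonneg)

lemma bump_sq_zero: 
  assumes "0 < l" "l \<le> \<bar>s\<bar>" shows "bump_sq l s = 0" "bump_sq' l s = 0"
  using sq_le_of_abs_le[OF assms(2)] assms(1) by (auto simp: bump_sq_def bump_sq'_def)

lemma bump_sq_bounds:
  assumes l: "0 < l"
  shows "0 \<le> bump_sq l s" "bump_sq l s \<le> l^4" "\<bar>bump_sq' l s\<bar> \<le> 4 * l^3" "(bump_sq' l s)\<^sup>2 \<le> 16 * l\<^sup>2 * bump_sq l s"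
proof -
  have m: "0 \<le> max 0 (l\<^sup>2 - s\<^sup>2)" "max 0 (l\<^sup>2 - s\<^sup>2) \<le> l\<^sup>2" using l by auto
  show "0 \<le> bump_sq l s" by (simp add: bump_sq_def)
  have "(max 0 (l\<^sup>2 - s\<^sup>2))\<^sup>2 \<le> (l\<^sup>2)\<^sup>2" by (rule power_mono[OF m(2,1)])
  then show "bump_sq l s \<le> l^4" by (simp add: bump_sq_def)
  show "\<bar>bump_sq' l s\<bar> \<le> 4 * l^3"
  proof (cases "l \<le> \<bar>s\<bar>")
    case True then show ?thesis using bump_sq_zero[OF l True] l by simp
  next
    case False
    have "\<bar>bump_sq' l s\<bar> = 4 * (\<bar>s\<bar> * max 0 (l\<^sup>2 - s\<^sup>2))" by (simp add: bump_sq'_def abs_mult)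
    also have "\<dots> \<le> 4 * (l * l\<^sup>2)" using False m by (intro mult_left_mono mult_mono) auto
    finally show ?thesis by (simp add: power3_eq_cube power2_eq_square)
  qed
  show "(bump_sq' l s)\<^sup>2 \<le> 16 * l\<^sup>2 * bump_sq l s"
  proof (cases "l \<le> \<bar>s\<bar>")
    case True then show ?thesis using bump_sq_zero[OF l True] l by simp
  next
    case False
    then have "s\<^sup>2 \<le> l\<^sup>2" using l by (intro abs_le_square_iff[THEN iffD1]) auto
    then have "16 * s\<^sup>2 * bump_sq l s \<le> 16 * l\<^sup>2 * bump_sq l s" by (intro mult_right_mono) (auto simp: bump_sq_def)
    then show ?thesis by (simp add: bump_sq'_def bump_sq_def power_mult_distrib)
  qed
qed

lemma bump_sq_lip:
  assumes l: "0 < l"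
  shows "\<bar>bump_sq l s - bump_sq l t\<bar> \<le> 4 * l^3 * \<bar>s - t\<bar>"
    "\<bar>t\<bar> < 2 * l \<Longrightarrow> \<bar>s\<bar> < 2 * l \<Longrightarrow> \<bar>bump_sq' l s - bump_sq' l t\<bar> \<le> 36 * l\<^sup>2 * \<bar>s - t\<bar>"
proof -
  have "norm (bump_sq l s - bump_sq l t) \<le> 4 * l^3 * norm (s - t)"
    by (rule field_differentiable_bound[of UNIV "bump_sq l" "bump_sq' l"])
      (use bump_sq_bounds(3)[OF l] bump_sq_deriv in auto)
  then show "\<bar>bump_sq l s - bump_sq l t\<bar> \<le> 4 * l^3 * \<bar>s - t\<bar>" by simp
  assume ts: "\<bar>t\<bar> < 2 * l" "\<bar>s\<bar> < 2 * l"
  let ?m = "\<lambda>s. max 0 (l\<^sup>2 - s\<^sup>2)"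
  have "\<bar>s * ?m s - t * ?m t\<bar> = \<bar>(s - t) * ?m s + t * (?m s - ?m t)\<bar>" by (simp add: algebra_simps)
  also have "\<dots> \<le> \<bar>(s - t) * ?m s\<bar> + \<bar>t * (?m s - ?m t)\<bar>" by (rule abs_triangle_ineq)
  also have "\<dots> \<le> \<bar>s - t\<bar> * l\<^sup>2 + (2 * l) * (4 * l * \<bar>s - t\<bar>)"
  proof (rule add_mono)
    show "\<bar>(s - t) * ?m s\<bar> \<le> \<bar>s - t\<bar> * l\<^sup>2" unfolding abs_mult by (intro mult_left_mono) auto
    have "\<bar>?m s - ?m t\<bar> \<le> \<bar>s\<^sup>2 - t\<^sup>2\<bar>" by auto
    also have "s\<^sup>2 - t\<^sup>2 = (s + t) * (s - t)" by (simp add: power2_eq_square algebra_simps)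
    also have "\<bar>(s + t) * (s - t)\<bar> \<le> (4 * l) * \<bar>s - t\<bar>" unfolding abs_mult using ts by (intro mult_right_mono) auto
    finally show "\<bar>t * (?m s - ?m t)\<bar> \<le> (2 * l) * (4 * l * \<bar>s - t\<bar>)" unfolding abs_mult using ts l by (intro mult_mono) auto
  qed
  also have "\<dots> = 9 * l\<^sup>2 * \<bar>s - t\<bar>" by (simp add: power2_eq_square)
  finally have a: "\<bar>s * ?m s - t * ?m t\<bar> \<le> 9 * l\<^sup>2 * \<bar>s - t\<bar>" .
  have eq: "bump_sq' l s - bump_sq' l t = - 4 * (s * ?m s - t * ?m t)" by (simp add: bump_sq'_def)
  show "\<bar>bump_sq' l s - bump_sq' l t\<bar> \<le> 36 * l\<^sup>2 * \<bar>s - t\<bar>"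
    using mult_left_mono[OF a, of 4] unfolding eq abs_mult by simp
qed

lemma outward_normal_norm: 
  assumes "outward_normal \<Omega> p \<nu>" shows "norm \<nu> = 1"
proof -
  from assms obtain T \<phi> m where ep: "local_epigraph \<Omega> p T \<phi>" and T2: "T \<nu> = (1 / sqrt (1 + m\<^sup>2)) *\<^sub>R (m, -1)"
    unfolding outward_normal_def by blast
  from ep have T1: "orthogonal_transformation T" unfolding local_epigraph_def by (rule conjunct1)
  note T = T1 T2
  have "norm (m, -1::real) = sqrt (1 + m\<^sup>2)" by (simp add: norm_Pair add.commute)
  moreover have "0 < sqrt (1 + m\<^sup>2)" by (simp add: add_pos_nonneg)
  ultimately have "norm (T \<nu>) = 1" unfolding T(2) norm_scaleR by simp
  then show ?thesis using T(1) by (simp add: orthogonal_transformation_norm)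
qed

lemma first_exit:
  fixes q d :: "'a::real_normed_vector"
  assumes \<Omega>: "open \<Omega>" and q: "q \<in> \<Omega>" "q + h *\<^sub>R d \<notin> \<Omega>" and h: "0 < h"
  obtains s where "0 < s" "s \<le> h" "q + s *\<^sub>R d \<notin> \<Omega>" "\<And>t. 0 \<le> t \<Longrightarrow> t < s \<Longrightarrow> q + t *\<^sub>R d \<in> \<Omega>"
proof -
  let ?T = "{0..h} \<inter> (\<lambda>t. q + t *\<^sub>R d) -` (- \<Omega>)"
  have "compact ?T"
    by (rule compact_Int_closed[OF compact_Icc]) (intro closed_vimage continuous_intros, use \<Omega> in auto)
  moreover have "h \<in> ?T" using q h by simp
  then have "?T \<noteq> {}" by blast
  ultimately obtain s where s: "s \<in> ?T" "\<And>t. t \<in> ?T \<Longrightarrow> s \<le> t" using compact_attains_inf[of ?T] by blast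
  have "s \<noteq> 0" using s(1) q by auto
  then have "0 < s" using s(1) by auto
  moreover have "q + t *\<^sub>R d \<in> \<Omega>" if "0 \<le> t" "t < s" for t
    using s(2)[of t] that s(1) by force
  ultimately show ?thesis using that s(1) by auto
qed

text \<open>\<open>\<alpha>\<close> stands for the locally constant function with value \<open>a\<^sub>k\<close> on \<open>\<Omega>\<^sub>k\<close>. Boundary points \<open>p\<close> near which
  \<open>\<alpha>\<close> is constant with a value different from the second coordinate of \<open>p\<close> lie in \<open>\<Gamma>\<^sub>F\<close>, hence the assumption \<open>steep\<close>.\<close>

locale strip_field =
  fixes \<Omega> :: "plane set" and \<alpha> :: "plane \<Rightarrow> real" and x0 l C D d0 :: real
    and w w' :: "real \<Rightarrow> real" and \<eta> B0 :: real
  assumes open_dom: "open \<Omega>" and lipschitz_dom: "lipschitz_boundary \<Omega>" and regular_dom: "locally_convex_or_C11 \<Omega>"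
    and horizontal: "\<And>p \<nu>. outward_normal \<Omega> p \<nu> \<Longrightarrow> fst p * fst \<nu> \<le> 0"
    and l: "0 < l" "2 * l < \<bar>x0\<bar>" and C: "0 < C" and D: "0 \<le> D" and d0: "0 < d0"
    and alpha_bound: "\<And>p. p \<in> \<Omega> \<Longrightarrow> \<bar>fst p - x0\<bar> < 2 * l \<Longrightarrow> \<bar>snd p - \<alpha> p\<bar> \<le> D"
    and alpha_const: "\<And>p q. p \<in> \<Omega> \<Longrightarrow> q \<in> \<Omega> \<Longrightarrow> \<bar>fst p - x0\<bar> < 2 * l \<Longrightarrow> \<bar>fst q - x0\<bar> < 2 * l \<Longrightarrow> dist p q < d0 \<Longrightarrow> \<alpha> p = \<alpha> q"
    and steep: "\<And>p \<nu> r a. outward_normal \<Omega> p \<nu> \<Longrightarrow> \<bar>fst p - x0\<bar> < 2 * l \<Longrightarrow> 0 < r \<Longrightarrow>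
       (\<And>z. z \<in> \<Omega> \<Longrightarrow> dist z p < r \<Longrightarrow> \<alpha> z = a) \<Longrightarrow> snd p \<noteq> a \<Longrightarrow> fst p * fst \<nu> \<le> - C"
    and w_deriv: "\<And>x. (w has_real_derivative w' x) (at x)" and w'_cont: "continuous_on UNIV w'" and w_zero: "w 0 = 0"
    and w'_bounds: "\<And>x. 0 < w' x" "\<And>x. w' x \<le> B0" and w_bound: "\<And>x. \<bar>w x\<bar> \<le> B0"
    and w'_lip: "\<And>x y. \<bar>w' x - w' y\<bar> \<le> B0 * \<bar>x - y\<bar>"
    and \<eta>: "0 < \<eta>" and \<eta>_small: "\<And>x. \<bar>x - x0\<bar> < l \<Longrightarrow> \<eta> * l^4 * D * (\<bar>x0\<bar> + 2 * l) \<le> C * \<bar>w x\<bar>"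
begin

section \<open>The second component of the field and its bounds\<close>

definition b :: "plane \<Rightarrow> real" where "b p = \<eta> * bump_sq l (fst p - x0) * (snd p - \<alpha> p)"
definition bx :: "plane \<Rightarrow> real" where "bx p = \<eta> * bump_sq' l (fst p - x0) * (snd p - \<alpha> p)"
definition by' :: "plane \<Rightarrow> real" where "by' p = \<eta> * bump_sq l (fst p - x0)"

text \<open>One constant for all bounds of \<open>inward_field\<close>. In order, the summands serve
  \<open>w\<close> and \<open>w'\<close>, the variation of \<open>w'\<close> along a step, the size
  of \<open>b\<close>, \<open>bx\<close> and \<open>by'\<close>, and the variation of
  \<open>bx\<close> and of \<open>by'\<close> along a step.\<close>

definition B :: real where
  "B = B0 + B0 * B0 + \<eta> * l^4 * D + \<eta> * (4 * l^3) * D + \<eta> * l^4 + \<eta> * (36 * l\<^sup>2 * B0 * D + 4 * l^3 * (\<eta> * l^4 * D)) + \<eta> * (4 * l^3) * B0"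

text \<open>The three entries of the minimum keep the Jacobian factors near \<open>1\<close>, the
  step inside the wider strip of half width \<open>2 * l\<close>, and its two ends in the same piece
  of \<Omega>.\<close>

definition h0 :: real where "h0 = min 1 (min l d0) / (8 * (B + 1))"

lemma B0: "0 \<le> B0" using w_bound[of 0] by simp

lemma B_ge: "B0 \<le> B" "B0 * B0 \<le> B" "\<eta> * l^4 * D \<le> B" "\<eta> * (4 * l^3) * D \<le> B" "\<eta> * l^4 \<le> B"
  "\<eta> * (36 * l\<^sup>2 * B0 * D + 4 * l^3 * (\<eta> * l^4 * D)) \<le> B" "\<eta> * (4 * l^3) * B0 \<le> B" "0 \<le> B"
proof -
  have "0 \<le> B0 * B0" "0 \<le> \<eta> * l^4 * D" "0 \<le> \<eta> * (4 * l^3) * D" "0 \<le> \<eta> * l^4"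
  "0 \<le> \<eta> * (36 * l\<^sup>2 * B0 * D + 4 * l^3 * (\<eta> * l^4 * D))" "0 \<le> \<eta> * (4 * l^3) * B0" using B0 \<eta> l D by simp_all
  then show "B0 \<le> B" "B0 * B0 \<le> B" "\<eta> * l^4 * D \<le> B" "\<eta> * (4 * l^3) * D \<le> B" "\<eta> * l^4 \<le> B"
  "\<eta> * (36 * l\<^sup>2 * B0 * D + 4 * l^3 * (\<eta> * l^4 * D)) \<le> B" "\<eta> * (4 * l^3) * B0 \<le> B" "0 \<le> B"
    unfolding B_def using B0 by linarith+
qed

lemma h0_bounds: "0 < h0" "h0 \<le> 1" "8 * B * h0 \<le> 1" "8 * B * h0 \<le> l" "8 * B * h0 \<le> d0"
proof -
  have B: "0 < 8 * (B + 1)" using B_ge(8) by simp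
  let ?m = "min 1 (min l d0)"
  have m: "0 < ?m" using l d0 by simp
  show pos: "0 < h0" unfolding h0_def by (rule divide_pos_pos[OF m B])
  have e: "8 * (B + 1) * h0 = ?m" unfolding h0_def using B by simp
  have "8 * B * h0 \<le> 8 * (B + 1) * h0" using pos by (intro mult_right_mono) auto
  then show "8 * B * h0 \<le> 1" "8 * B * h0 \<le> l" "8 * B * h0 \<le> d0" unfolding e by simp_all
  have "1 * h0 \<le> 8 * (B + 1) * h0" using pos B_ge(8) by (intro mult_right_mono) auto
  then show "h0 \<le> 1" unfolding e by simp
qed

lemma h_bounds: assumes "0 < h" "h \<le> h0" shows "8 * B * h \<le> 1" "8 * B * h \<le> l" "8 * B * h \<le> d0"
  using mult_left_mono[OF assms(2), of "8 * B"] B_ge(8) h0_bounds by auto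

text \<open>By the mean value theorem and positivity of \<open>w'\<close>, \<open>w\<close> has the
  sign of its argument; so the sign condition on \<open>x\<close> times the normal transfers to
  \<open>w\<close>. The upper bound on \<open>\<kappa>\<close> prevents a short step from crossing
  the axis \<open>x = 0\<close>.\<close>

lemma w_factor: obtains \<kappa> where "0 < \<kappa>" "\<kappa> \<le> B0" "w x = x * \<kappa>"
proof -
  consider "x = 0" | "0 < x" | "x < 0" by linarith
  then show ?thesis
  proof cases
    case 1 then show ?thesis using that[of "w' 0"] w_zero w'_bounds by auto
  next
    case 2
    from MVT2[OF 2, of w w'] w_deriv obtain z where "w x - w 0 = (x - 0) * w' z" by blast
    then show ?thesis using that[of "w' z"] w_zero w'_bounds by auto
  next
    case 3
    from MVT2[OF 3, of w w'] w_deriv obtain z where "w 0 - w x = (0 - x) * w' z" by blast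
    then show ?thesis using that[of "w' z"] w_zero w'_bounds by auto
  qed
qed

lemma w_cont: "continuous_on UNIV w"
  by (rule continuous_at_imp_continuous_on) (blast intro: DERIV_isCont w_deriv)

lemma b_bound': "p \<in> \<Omega> \<Longrightarrow> \<bar>b p\<bar> \<le> \<eta> * bump_sq l (fst p - x0) * D"
proof (cases "\<bar>fst p - x0\<bar> < 2 * l")
  case True
  assume "p \<in> \<Omega>"
  then show ?thesis using alpha_bound[of p] True \<eta> bump_sq_bounds(1)[OF l(1)] by (simp add: b_def abs_mult mult_left_mono)
qed (use bump_sq_zero[OF l(1), of "fst p - x0"] l in \<open>simp add: b_def\<close>)

lemma b_bound:
  assumes "p \<in> \<Omega>"
  shows "\<bar>b p\<bar> \<le> \<eta> * l^4 * D"
proof -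
  have "\<eta> * bump_sq l (fst p - x0) * D \<le> \<eta> * l^4 * D"
    using \<eta> D bump_sq_bounds(2)[OF l(1)] by (intro mult_right_mono mult_left_mono) auto
  then show ?thesis using b_bound'[OF assms] by simp
qed

lemma bx_bound:
  assumes "p \<in> \<Omega>"
  shows "\<bar>bx p\<bar> \<le> \<eta> * (4 * l^3) * D"
proof (cases "\<bar>fst p - x0\<bar> < 2 * l")
  case True
  then show ?thesis using alpha_bound[OF assms] \<eta> bump_sq_bounds(3)[OF l(1)] l by (simp add: bx_def abs_mult mult_mono)
qed (use bump_sq_zero[OF l(1), of "fst p - x0"] l \<eta> D in \<open>simp add: bx_def\<close>)

text \<open>Prepares the absorption of the mixed term \<open>bx (u_x, u_y)\<close>: for
  \<open>u_y\<close> only the coefficient \<open>by'\<close> is available, which vanishes at the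
  edge of the cutoff.\<close>

lemma bx_sq_bound:
  assumes "p \<in> \<Omega>"
  shows "(bx p)\<^sup>2 \<le> 16 * \<eta> * l\<^sup>2 * D\<^sup>2 * by' p"
proof (cases "\<bar>fst p - x0\<bar> < 2 * l")
  case True
  have "(bump_sq' l (fst p - x0))\<^sup>2 * (snd p - \<alpha> p)\<^sup>2 \<le> (16 * l\<^sup>2 * bump_sq l (fst p - x0)) * D\<^sup>2"
    using alpha_bound[OF assms True] bump_sq_bounds[OF l(1)] D
    by (intro mult_mono) (auto intro!: abs_le_square_iff[THEN iffD1])
  from mult_left_mono[OF this, of "\<eta>\<^sup>2"] show ?thesis
    by (simp add: bx_def by'_def power_mult_distrib mult_ac power2_eq_square)
qed (use bump_sq_zero[OF l(1), of "fst p - x0"] l \<eta> D in \<open>simp add: bx_def by'_def\<close>)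

lemma by_bound: "0 \<le> by' p" "by' p \<le> \<eta> * l^4"
  using \<eta> bump_sq_bounds(1,2)[OF l(1)] by (auto simp: by'_def intro!: mult_left_mono)

lemma alpha_local:
  assumes "p \<in> \<Omega>" "\<bar>fst p - x0\<bar> < 2 * l"
  obtains U where "open U" "p \<in> U" "U \<subseteq> \<Omega>" "\<And>q. q \<in> U \<Longrightarrow> \<alpha> q = \<alpha> p"
proof
  let ?U = "\<Omega> \<inter> {q. \<bar>fst q - x0\<bar> < 2 * l} \<inter> ball p d0"
  show "open ?U" using open_dom by (intro open_Int open_Collect_less continuous_intros) auto
  show "p \<in> ?U" "?U \<subseteq> \<Omega>" using assms d0 by auto
  show "\<alpha> q = \<alpha> p" if "q \<in> ?U" for q using that assms by (intro alpha_const) (auto simp: dist_commute)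
qed

lemma bump_fst_deriv: "((\<lambda>p::plane. bump_sq l (fst p - x0)) has_derivative (\<lambda>h. fst h * bump_sq' l (fst p - x0))) (at p)"
proof -
  have "((\<lambda>p::plane. fst p - x0) has_derivative fst) (at p)" by (auto intro!: derivative_eq_intros)
  from has_derivative_compose[OF this has_field_derivative_imp_has_derivative[OF bump_sq_deriv]] show ?thesis
    by (simp add: mult.commute)
qed

lemma bump_fst_cont: "continuous_on A (\<lambda>p::plane. bump_sq' l (fst p - x0))" "continuous_on A (\<lambda>p::plane. bump_sq l (fst p - x0))"
proof -
  show "continuous_on A (\<lambda>p::plane. bump_sq' l (fst p - x0))"
    by (rule continuous_on_compose2[OF bump_sq'_cont[of UNIV]]) (auto intro!: continuous_intros)
  show "continuous_on A (\<lambda>p::plane. bump_sq l (fst p - x0))"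
    unfolding bump_sq_def by (intro continuous_intros)
qed

text \<open>Two overlapping open regions cover \<Omega>. At distance below \<open>2 * l\<close> from
  the line \<open>x = x0\<close>, \<open>\<alpha>\<close> is locally constant and \<open>b\<close>
  an explicit C^1 expression; at distance above \<open>l\<close> the cutoff vanishes and
  \<open>\<alpha>\<close> may be anything.\<close>

lemma b_C1: "C1_on \<Omega> b bx by'"
  unfolding C1_on_def
proof (intro conjI ballI)
  fix p assume p: "p \<in> \<Omega>"
  show "(b has_derivative (\<lambda>h. fst h * bx p + snd h * by' p)) (at p)"
  proof (cases "\<bar>fst p - x0\<bar> < 2 * l")
    case True
    from alpha_local[OF p True] obtain U where U: "open U" "p \<in> U" "\<And>q. q \<in> U \<Longrightarrow> \<alpha> q = \<alpha> p" by metis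
    have "((\<lambda>q. \<eta> * bump_sq l (fst q - x0) * (snd q - \<alpha> p)) has_derivative (\<lambda>h. fst h * bx p + snd h * by' p)) (at p)"
      by (rule derivative_eq_intros bump_fst_deriv refl)+ (simp add: bx_def by'_def fun_eq_iff algebra_simps)
    then show ?thesis
      by (rule has_derivative_transform_within_open[OF _ U(1,2)]) (simp add: b_def U(3))
  next
    case False
    let ?U = "{q::plane. l < \<bar>fst q - x0\<bar>}"
    have U: "open ?U" "p \<in> ?U" using False l by (auto intro!: open_Collect_less continuous_intros)
    have "((\<lambda>q. 0) has_derivative (\<lambda>h. fst h * bx p + snd h * by' p)) (at p)"
      using bump_sq_zero[OF l(1), of "fst p - x0"] False l by (simp add: bx_def by'_def)
    then show ?thesis
      by (rule has_derivative_transform_within_open[OF _ U]) (use bump_sq_zero[OF l(1)] in \<open>auto simp: b_def\<close>)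
  qed
next
  show "continuous_on \<Omega> by'" unfolding by'_def[abs_def] by (intro continuous_intros bump_fst_cont)
  have "isCont bx p" if p: "p \<in> \<Omega>" for p
  proof (cases "\<bar>fst p - x0\<bar> < 2 * l")
    case True
    from alpha_local[OF p True] obtain U where U: "open U" "p \<in> U" "\<And>q. q \<in> U \<Longrightarrow> \<alpha> q = \<alpha> p" by metis
    have "continuous_on U (\<lambda>q. \<eta> * bump_sq' l (fst q - x0) * (snd q - \<alpha> p))" by (intro continuous_intros bump_fst_cont)
    then have "continuous_on U bx" by (rule continuous_on_cong[THEN iffD1, OF refl, rotated]) (simp add: bx_def U(3))
    then show ?thesis using U continuous_on_eq_continuous_at by blast
  next
    case False
    let ?U = "{q::plane. l < \<bar>fst q - x0\<bar>}"
    have U: "open ?U" "p \<in> ?U" using False l by (auto intro!: open_Collect_less continuous_intros)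
    have "continuous_on ?U bx"
      by (rule continuous_on_cong[THEN iffD1, OF refl _ continuous_on_const[of _ 0]]) (use bump_sq_zero[OF l(1)] in \<open>auto simp: bx_def\<close>)
    then show ?thesis using U continuous_on_eq_continuous_at by blast
  qed
  then show "continuous_on \<Omega> bx" by (simp add: continuous_at_imp_continuous_on)
qed

lemma displacement:
  assumes p: "p \<in> \<Omega>" and h: "0 < h" "h \<le> h0"
  shows "norm (h *\<^sub>R (w (fst p), b p)) \<le> 2 * B * h" "\<bar>h * w (fst p)\<bar> \<le> h * B0" "\<bar>h * b p\<bar> \<le> h * (\<eta> * l^4 * D)"
proof -
  show 1: "\<bar>h * w (fst p)\<bar> \<le> h * B0" "\<bar>h * b p\<bar> \<le> h * (\<eta> * l^4 * D)"
    using h w_bound b_bound[OF p] by (auto simp: abs_mult intro!: mult_left_mono)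
  have "norm (h *\<^sub>R (w (fst p), b p)) \<le> \<bar>h * w (fst p)\<bar> + \<bar>h * b p\<bar>"
    using norm_Pair_le[of "h * w (fst p)" "h * b p"] by simp
  moreover have "h * B0 \<le> h * B" "h * (\<eta> * l^4 * D) \<le> h * B" using h B_ge by (auto intro!: mult_left_mono)
  ultimately show "norm (h *\<^sub>R (w (fst p), b p)) \<le> 2 * B * h" using 1 by (simp add: mult_ac)
qed

text \<open>The length of a step is at most \<open>2 * B * h\<close>, which is below both the
  separation \<open>d0\<close> of the pieces and the margin \<open>l\<close> between the two
  strips.\<close>

lemma same_alpha:
  assumes p: "p \<in> \<Omega>" and h: "0 < h" "h \<le> h0" and q: "q = p - h *\<^sub>R (w (fst p), b p)" "q \<in> \<Omega>"
    and strip: "\<bar>fst p - x0\<bar> < l \<or> \<bar>fst q - x0\<bar> < l"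
  shows "\<alpha> p = \<alpha> q" "\<bar>fst p - x0\<bar> < 2 * l" "\<bar>fst q - x0\<bar> < 2 * l"
proof -
  have "\<bar>fst p - fst q\<bar> \<le> h * B0" using displacement(2)[OF p h] by (simp add: q)
  moreover have "h * B0 \<le> h * B" using B_ge h by (intro mult_left_mono) auto
  moreover have hB: "8 * (h * B) \<le> l" "8 * (h * B) \<le> d0" using h_bounds[OF h] by (simp_all add: mult_ac)
  ultimately show s: "\<bar>fst p - x0\<bar> < 2 * l" "\<bar>fst q - x0\<bar> < 2 * l" using strip l by linarith+
  have "dist p q \<le> 2 * B * h" using displacement(1)[OF p h] by (simp add: q dist_norm)
  moreover have "2 * B * h < d0" using hB d0 by (simp add: mult_ac)
  ultimately show "\<alpha> p = \<alpha> q" using p q(2) s by (intro alpha_const) auto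
qed

text \<open>The first coordinate moves by at most \<open>h * B0\<close>, so Lipschitz bounds give a
  factor \<open>h\<close>. For \<open>bx\<close> this needs the same value of
  \<open>\<alpha>\<close> at both ends, which \<open>same_alpha\<close> supplies where the cutoff is
  active.\<close>

lemma field_lip:
  assumes p: "p \<in> \<Omega>" and h: "0 < h" "h \<le> h0" and q: "q = p - h *\<^sub>R (w (fst p), b p)" "q \<in> \<Omega>"
  shows "\<bar>w' (fst p) - w' (fst q)\<bar> \<le> B * h" "\<bar>bx p - bx q\<bar> \<le> B * h" "\<bar>by' p - by' q\<bar> \<le> B * h"
proof -
  have dx: "\<bar>fst p - fst q\<bar> \<le> h * B0" and dy: "\<bar>snd p - snd q\<bar> \<le> h * (\<eta> * l^4 * D)"
    using displacement(2,3)[OF p h] by (simp_all add: q)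
  have "\<bar>w' (fst p) - w' (fst q)\<bar> \<le> B0 * (h * B0)"
    using w'_lip[of "fst p" "fst q"] mult_left_mono[OF dx B0] by linarith
  also have "\<dots> = h * (B0 * B0)" by simp
  also have "\<dots> \<le> h * B" using h B_ge by (intro mult_left_mono) auto
  finally show "\<bar>w' (fst p) - w' (fst q)\<bar> \<le> B * h" by (simp add: mult.commute)
  have "\<bar>by' p - by' q\<bar> = \<eta> * \<bar>bump_sq l (fst p - x0) - bump_sq l (fst q - x0)\<bar>"
    using \<eta> by (simp add: by'_def abs_mult flip: right_diff_distrib)
  also have "\<dots> \<le> \<eta> * (4 * l^3 * \<bar>(fst p - x0) - (fst q - x0)\<bar>)" using \<eta> by (intro mult_left_mono bump_sq_lip(1)[OF l(1)]) auto
  also have "\<dots> \<le> \<eta> * (4 * l^3 * (h * B0))" using \<eta> l dx by (intro mult_left_mono) auto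
  also have "\<dots> = h * (\<eta> * (4 * l^3) * B0)" by simp
  also have "\<dots> \<le> h * B" using h B_ge by (intro mult_left_mono) auto
  finally show "\<bar>by' p - by' q\<bar> \<le> B * h" by (simp add: mult.commute)
  show "\<bar>bx p - bx q\<bar> \<le> B * h"
  proof (cases "\<bar>fst p - x0\<bar> < l \<or> \<bar>fst q - x0\<bar> < l")
    case False
    then have "bx p = 0" "bx q = 0" using bump_sq_zero[OF l(1), of "fst p - x0"] bump_sq_zero[OF l(1), of "fst q - x0"] by (auto simp: bx_def)
    then show ?thesis using B_ge(8) h by simp
  next
    case True
    note s = same_alpha[OF p h q True]
    let ?c = "\<lambda>p. bump_sq' l (fst p - x0)"
    have "bx p - bx q = \<eta> * ((?c p - ?c q) * (snd p - \<alpha> p) + ?c q * (snd p - snd q))"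
      by (simp add: bx_def s(1) algebra_simps)
    also have "\<bar>\<dots>\<bar> \<le> \<eta> * (\<bar>?c p - ?c q\<bar> * \<bar>snd p - \<alpha> p\<bar> + \<bar>?c q\<bar> * \<bar>snd p - snd q\<bar>)"
      using \<eta> abs_triangle_ineq[of "(?c p - ?c q) * (snd p - \<alpha> p)" "?c q * (snd p - snd q)"] by (simp add: abs_mult mult_left_mono)
    also have "\<dots> \<le> \<eta> * ((36 * l\<^sup>2 * (h * B0)) * D + (4 * l^3) * (h * (\<eta> * l^4 * D)))"
    proof (intro mult_left_mono add_mono mult_mono)
      have "\<bar>?c p - ?c q\<bar> \<le> 36 * l\<^sup>2 * \<bar>(fst p - x0) - (fst q - x0)\<bar>" using s by (intro bump_sq_lip(2)[OF l(1)]) auto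
      also have "\<dots> \<le> 36 * l\<^sup>2 * (h * B0)" using dx by (intro mult_left_mono) auto
      finally show "\<bar>?c p - ?c q\<bar> \<le> 36 * l\<^sup>2 * (h * B0)" .
    qed (use alpha_bound[OF p s(2)] bump_sq_bounds(3)[OF l(1)] dy \<eta> l h B0 in auto)
    also have "\<dots> = h * (\<eta> * (36 * l\<^sup>2 * B0 * D + 4 * l^3 * (\<eta> * l^4 * D)))" by (simp add: algebra_simps)
    also have "\<dots> \<le> h * B" using h B_ge by (intro mult_left_mono) auto
    finally show ?thesis by (simp add: mult.commute)
  qed
qed

text \<open>The triangular structure reduces injectivity to one dimension twice: first the
  contraction \<open>h * w\<close> on the first coordinate, then, for equal first coordinates, the
  affine dependence of \<open>b\<close> on the second.\<close>

lemma field_inj: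
  assumes h: "0 < h" "h \<le> h0"
  shows "inj_on (\<lambda>p. p - h *\<^sub>R (w (fst p), b p)) {p \<in> \<Omega>. p - h *\<^sub>R (w (fst p), b p) \<in> \<Omega>}"
proof (rule inj_onI, safe)
  fix x y x' y' :: real
  let ?p = "(x, y)" and ?p' = "(x', y')"
  assume p: "?p \<in> \<Omega>" "?p' \<in> \<Omega>" and q: "?p - h *\<^sub>R (w (fst ?p), b ?p) \<in> \<Omega>" "?p' - h *\<^sub>R (w (fst ?p'), b ?p') \<in> \<Omega>"
    and eq: "?p - h *\<^sub>R (w (fst ?p), b ?p) = ?p' - h *\<^sub>R (w (fst ?p'), b ?p')"
  have e: "x - h * w x = x' - h * w x'" "y - h * b ?p = y' - h * b ?p'" using eq by simp_all
  have hB: "8 * (h * B) \<le> 1" using h_bounds(1)[OF h] by (simp add: mult_ac)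
  have "\<bar>w x - w x'\<bar> \<le> B0 * \<bar>x - x'\<bar>"
  proof -
    have "norm (w x - w x') \<le> B0 * norm (x - x')"
      by (rule field_differentiable_bound[of UNIV w w']) (use w_deriv w'_bounds in \<open>auto simp: abs_of_pos\<close>)
    then show ?thesis by simp
  qed
  then have "h * \<bar>w x - w x'\<bar> \<le> h * (B0 * \<bar>x - x'\<bar>)" using h by (intro mult_left_mono) auto
  also have "\<dots> \<le> h * (B * \<bar>x - x'\<bar>)" using h B_ge by (intro mult_left_mono mult_right_mono) auto
  also have "\<dots> = (h * B) * \<bar>x - x'\<bar>" by simp
  also have "\<dots> \<le> 1/8 * \<bar>x - x'\<bar>" using hB by (intro mult_right_mono) auto
  finally have "\<bar>h * w x - h * w x'\<bar> \<le> 1/8 * \<bar>x - x'\<bar>" using h by (simp add: abs_mult flip: right_diff_distrib)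
  then show x: "x = x'" using e(1) by (simp add: abs_if split: if_splits)
  show "y = y'"
  proof (cases "\<bar>x - x0\<bar> < l")
    case False
    then show ?thesis using e(2) bump_sq_zero[OF l(1), of "x - x0"] x by (simp add: b_def)
  next
    case True
    \<comment> \<open>The two points are not known to be close, but each shares its value of
      \<open>\<alpha>\<close> with the common image.\<close>
    have "\<alpha> ?p = \<alpha> (?p - h *\<^sub>R (w (fst ?p), b ?p))" "\<alpha> ?p' = \<alpha> (?p' - h *\<^sub>R (w (fst ?p'), b ?p'))"
      using same_alpha(1)[OF p(1) h refl q(1)] same_alpha(1)[OF p(2) h refl q(2)] True x by auto
    then have a: "\<alpha> ?p = \<alpha> ?p'" using eq by simp
    let ?k = "h * (\<eta> * bump_sq l (x - x0))"
    have "(1 - ?k) * (y - y') = 0" using e(2) x a by (simp add: b_def algebra_simps)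
    moreover have "?k \<le> h * B"
      using h by_bound(2)[of ?p] B_ge(5) by (intro mult_left_mono) (auto simp: by'_def)
    ultimately show ?thesis using hB by auto
  qed
qed

end

context strip_field
begin

text \<open>At a boundary point \<open>\<alpha>\<close> carries no information, so the value of
  \<open>b\<close> there is read off from a sequence in \<Omega>. Points of \<Omega> within
  \<open>d0 / 2\<close> of \<open>p\<close> are within \<open>d0\<close> of each other, hence
  \<open>\<alpha>\<close> is constant among them. Outside the support of the cutoff the limit is
  \<open>0\<close>.\<close>

lemma limit_direction:
  assumes x: "\<And>n. x n \<in> \<Omega>" "x \<longlonglongrightarrow> p" and d: "(\<lambda>n. b (x n)) \<longlonglongrightarrow> \<beta>"
  shows "\<beta> = 0 \<or> (\<exists>a r. \<bar>fst p - x0\<bar> < l \<and> 0 < r \<and> 8 * B * h0 \<le> 2 * r \<and> (\<forall>z\<in>\<Omega>. dist z p < r \<longrightarrow> \<bar>fst z - x0\<bar> < 2 * l \<and> \<alpha> z = a) \<and> \<beta> = by' p * (snd p - a))"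
proof (cases "\<bar>fst p - x0\<bar> < l")
  case True
  define r where "r = min (d0 / 2) l"
  have r: "0 < r" "r \<le> d0 / 2" "r \<le> l" using d0 l by (auto simp: r_def)
  have hr: "8 * B * h0 \<le> 2 * r" using h0_bounds(4,5) l by (simp add: r_def)
  have strip: "\<bar>fst z - x0\<bar> < 2 * l" if "dist z p < r" for z
    using True dist_fst_le[of z p] that r by (simp add: dist_real_def)
  have ev: "\<forall>\<^sub>F n in sequentially. dist (x n) p < r" using x(2) r(1) by (simp add: tendsto_iff)
  then obtain N where N: "dist (x N) p < r" by (auto simp: eventually_sequentially)
  define a where "a = \<alpha> (x N)"
  have a: "\<alpha> z = a" if "z \<in> \<Omega>" "dist z p < r" for z
    unfolding a_def
  proof (rule alpha_const[OF that(1) x(1) strip[OF that(2)] strip[OF N]])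
    have "dist z (x N) \<le> dist z p + dist (x N) p" by (rule dist_triangle2)
    then show "dist z (x N) < d0" using that(2) N r by linarith
  qed
  have "(\<lambda>n. \<eta> * bump_sq l (fst (x n) - x0) * (snd (x n) - a)) \<longlonglongrightarrow> \<eta> * bump_sq l (fst p - x0) * (snd p - a)"
    unfolding bump_sq_def by (intro tendsto_intros x)
  moreover have "\<forall>\<^sub>F n in sequentially. \<eta> * bump_sq l (fst (x n) - x0) * (snd (x n) - a) = b (x n)"
    using ev by eventually_elim (simp add: b_def a[OF x(1)])
  ultimately have "(\<lambda>n. b (x n)) \<longlonglongrightarrow> \<eta> * bump_sq l (fst p - x0) * (snd p - a)"
    by (rule Lim_transform_eventually)
  then have "\<beta> = by' p * (snd p - a)" using LIMSEQ_unique[OF d] by (simp add: by'_def)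
  then show ?thesis using True r(1) hr strip a by blast
next
  case False
  have "(\<lambda>n. b (x n)) \<longlonglongrightarrow> 0"
  proof (rule Lim_null_comparison)
    show "\<forall>\<^sub>F n in sequentially. norm (b (x n)) \<le> \<eta> * bump_sq l (fst (x n) - x0) * D"
      using b_bound'[OF x(1)] by (intro always_eventually) auto
    have "(\<lambda>n. \<eta> * bump_sq l (fst (x n) - x0) * D) \<longlonglongrightarrow> \<eta> * bump_sq l (fst p - x0) * D"
      unfolding bump_sq_def by (intro tendsto_intros x)
    then show "(\<lambda>n. \<eta> * bump_sq l (fst (x n) - x0) * D) \<longlonglongrightarrow> 0"
      using bump_sq_zero[OF l(1), of "fst p - x0"] False by simp
  qed
  then show ?thesis using LIMSEQ_unique[OF d] by simp
qed

lemma horizontal_sign: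
  assumes n: "outward_normal \<Omega> z \<nu>" and s: "0 < fst z * t"
  shows "t * fst \<nu> \<le> 0"
  using horizontal[OF n] s by (auto simp: zero_less_mult_iff mult_le_0_iff)

text \<open>Otherwise the segment from \<open>q\<close> to \<open>p\<close>, whose direction is the limit of \<open>X\<close> at \<open>p\<close>, would leave \<open>\<Omega>\<close>.\<close>

lemma limit_in_domain:
  assumes h: "0 < h" "h \<le> h0" and x: "\<And>n. x n \<in> \<Omega>" "x \<longlonglongrightarrow> p" and q: "q \<in> \<Omega>"
    and y: "(\<lambda>n. x n - h *\<^sub>R (w (fst (x n)), b (x n))) \<longlonglongrightarrow> q"
  shows "p \<in> \<Omega>"
proof (rule ccontr)
  assume p: "p \<notin> \<Omega>"
  define d where "d = (1 / h) *\<^sub>R (p - q)"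
  have pq: "p = q + h *\<^sub>R d" using h by (simp add: d_def)
  have lim: "(\<lambda>n. (w (fst (x n)), b (x n))) \<longlonglongrightarrow> d"
  proof -
    have "(\<lambda>n. (1 / h) *\<^sub>R (x n - (x n - h *\<^sub>R (w (fst (x n)), b (x n))))) \<longlonglongrightarrow> d"
      unfolding d_def by (intro tendsto_intros x y)
    moreover have "(1 / h) *\<^sub>R (z - (z - h *\<^sub>R v)) = v" for z v :: "plane"
    proof -
      have "z - (z - h *\<^sub>R v) = h *\<^sub>R v" by simp
      then show ?thesis using h by (simp only: scaleR_scaleR) simp
    qed
    ultimately show ?thesis by (simp only:)
  qed
  have db: "(\<lambda>n. b (x n)) \<longlonglongrightarrow> snd d" using tendsto_snd[OF lim] by simp
  have "(\<lambda>n. w (fst (x n))) \<longlonglongrightarrow> w (fst p)"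
    using w_cont x(2) by (intro isCont_tendsto_compose[of _ w] tendsto_intros) (auto simp: continuous_on_eq_continuous_at)
  moreover have "(\<lambda>n. w (fst (x n))) \<longlonglongrightarrow> fst d" using tendsto_fst[OF lim] by simp
  ultimately have dw: "fst d = w (fst p)" using LIMSEQ_unique by blast
  have dbound: "\<bar>snd d\<bar> \<le> \<eta> * l^4 * D"
    by (rule tendsto_upperbound[OF tendsto_rabs[OF db]]) (use b_bound[OF x(1)] in auto)
  have dnorm: "norm d \<le> 2 * B"
  proof -
    have "norm d \<le> \<bar>fst d\<bar> + \<bar>snd d\<bar>" using norm_Pair_le[of "fst d" "snd d"] by simp
    then show ?thesis using dbound w_bound[of "fst p"] B_ge(1,3) unfolding dw by linarith
  qed
  obtain \<kappa> where \<kappa>: "0 < \<kappa>" "\<kappa> \<le> B0" "w (fst p) = fst p * \<kappa>" by (rule w_factor)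
  have hB: "8 * (h * B) \<le> 1" using h_bounds(1)[OF h] by (simp add: mult_ac)
  have d_ne: "d \<noteq> 0" using p q pq by auto
  \<comment> \<open>On the axis both components of the limit field vanish, because the axis lies
    outside the support of the cutoff; but \<open>d\<close> is not zero.\<close>
  have p0: "fst p \<noteq> 0"
  proof
    assume a: "fst p = 0"
    then have "fst d = 0" using dw w_zero by simp
    moreover have "snd d = 0" using limit_direction[OF x db] a l by auto
    ultimately show False using d_ne by (simp add: prod_eq_iff)
  qed
  \<comment> \<open>The segment may leave \<Omega> before it reaches \<open>p\<close>. The sign
    conditions must therefore be checked at the first exit point \<open>e\<close>, although the
    direction \<open>d\<close> is that of the field at \<open>p\<close>.\<close>
  from first_exit[OF open_dom q _ h(1), of d] p pq obtain s where s: "0 < s" "s \<le> h" "q + s *\<^sub>R d \<notin> \<Omega>"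
    and path: "\<And>t. 0 \<le> t \<Longrightarrow> t < s \<Longrightarrow> q + t *\<^sub>R d \<in> \<Omega>" by metis
  define e where "e = q + s *\<^sub>R d"
  have e: "e = p - (h - s) *\<^sub>R d" by (simp add: e_def pq algebra_simps)
  have path': "e + t *\<^sub>R d \<in> \<Omega>" if "- s \<le> t" "t < 0" for t
    using path[of "s + t"] that by (simp add: e_def scaleR_add_left algebra_simps)
  have small: "0 \<le> (h - s) * c" "(h - s) * c < 1" if "0 \<le> c" "c \<le> B" for c
  proof -
    show "0 \<le> (h - s) * c" using s that by simp
    have "(h - s) * c \<le> h * B" using s that h by (intro mult_mono) auto
    then show "(h - s) * c < 1" using hB by simp
  qed
  have pos: "0 < fst e * fst p"
  proof -
    have "fst e = fst p * (1 - (h - s) * \<kappa>)" by (simp add: e dw \<kappa>(3) algebra_simps)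
    then have "fst e * fst p = (fst p)\<^sup>2 * (1 - (h - s) * \<kappa>)" by (simp add: power2_eq_square)
    moreover have "(h - s) * \<kappa> < 1" using small(2)[of \<kappa>] \<kappa> B_ge(1) by linarith
    ultimately show ?thesis using p0 by simp
  qed
  have "\<exists>V. open V \<and> e \<in> V \<and> (\<forall>z \<nu>. z \<in> V \<longrightarrow> outward_normal \<Omega> z \<nu> \<longrightarrow> d \<bullet> \<nu> \<le> 0)"
  proof (cases "snd d = 0")
    case True
    let ?V = "{z::plane. 0 < fst z * fst p}"
    have "d \<bullet> \<nu> \<le> 0" if "z \<in> ?V" "outward_normal \<Omega> z \<nu>" for z \<nu>
    proof -
      have "fst p * fst \<nu> \<le> 0" using horizontal_sign[OF that(2)] that(1) by simp
      moreover have "d \<bullet> \<nu> = \<kappa> * (fst p * fst \<nu>)" by (simp add: inner_prod_def True dw \<kappa>(3))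
      ultimately show ?thesis using \<kappa> by (simp add: mult_le_0_iff)
    qed
    moreover have "open ?V" by (intro open_Collect_less continuous_intros)
    ultimately show ?thesis using pos by blast
  next
    case False
    with limit_direction[OF x db] obtain a r where str: "\<bar>fst p - x0\<bar> < l" and r: "0 < r" "8 * B * h0 \<le> 2 * r"
      and loc: "\<And>z. z \<in> \<Omega> \<Longrightarrow> dist z p < r \<Longrightarrow> \<bar>fst z - x0\<bar> < 2 * l \<and> \<alpha> z = a" and \<beta>: "snd d = by' p * (snd p - a)" by blast
    have pa: "snd p \<noteq> a" using False \<beta> by auto
    \<comment> \<open>Going back from \<open>p\<close> to \<open>e\<close> multiplies both the first
      coordinate and the height above \<open>a\<close> by positive factors, so their signs persist,
      and with them the hypotheses of \<open>steep\<close>, throughout this neighbourhood of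
      \<open>e\<close>.\<close>
    let ?V = "{z::plane. 0 < fst z * fst p} \<inter> {z. 0 < (snd z - a) * (snd p - a)} \<inter> {z. \<bar>fst z - x0\<bar> < 2 * l} \<inter> ball p r"
    have hB': "8 * (B * h) \<le> 8 * (B * h0)" using mult_left_mono[OF h(2) B_ge(8)] by simp
    have disp: "norm ((h - s) *\<^sub>R d) \<le> 2 * (B * h)"
    proof -
      have "norm ((h - s) *\<^sub>R d) = (h - s) * norm d" using s by simp
      also have "\<dots> \<le> h * (2 * B)" using s h dnorm by (intro mult_mono) auto
      finally show ?thesis by (simp add: mult_ac)
    qed
    have "open ?V" by (intro open_Int open_Collect_less continuous_intros open_ball)
    moreover have "e \<in> ?V"
    proof -
      have "dist p e \<le> 2 * (B * h)" using disp by (simp add: e dist_norm)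
      then have "dist p e < r" using hB' r by simp
      moreover have "0 < (snd e - a) * (snd p - a)"
      proof -
        have "snd e - a = (snd p - a) * (1 - (h - s) * by' p)" by (simp add: e \<beta> algebra_simps)
        then have "(snd e - a) * (snd p - a) = (snd p - a)\<^sup>2 * (1 - (h - s) * by' p)" by (simp add: power2_eq_square)
        moreover have "(h - s) * by' p < 1" using by_bound[of p] B_ge(5) by (intro small(2)) auto
        ultimately show ?thesis using pa by simp
      qed
      moreover have "\<bar>fst e - x0\<bar> < 2 * l"
      proof -
        have "\<bar>fst e - fst p\<bar> \<le> 2 * (B * h)" using norm_fst_le[of "fst ((h - s) *\<^sub>R d)" "snd ((h - s) *\<^sub>R d)"] disp unfolding prod.collapse by (simp add: e)
        moreover have "8 * (B * h) \<le> l" using h_bounds(2)[OF h] by (simp add: mult_ac)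
        ultimately show ?thesis using str l by linarith
      qed
      ultimately show ?thesis using pos by simp
    qed
    moreover have "d \<bullet> \<nu> \<le> 0" if z: "z \<in> ?V" and n: "outward_normal \<Omega> z \<nu>" for z \<nu>
    proof -
      have za: "snd z \<noteq> a" and zx: "\<bar>fst z - x0\<bar> < 2 * l" and zr: "dist z p < r" and zp: "0 < fst z * fst p"
        using z by (auto simp: dist_commute)
      have near: "\<alpha> z' = a" if "z' \<in> \<Omega>" "dist z' z < r - dist z p" for z'
      proof -
        have "dist z' p < r" using dist_triangle[of z' p z] that(2) by linarith
        then show ?thesis using loc[OF that(1)] by blast
      qed
      have st: "fst z * fst \<nu> \<le> - C"
        using zr za by (intro steep[OF n zx, where r="r - dist z p" and a=a] near) auto
      \<comment> \<open>\<open>X\<close> bounds the first coordinate in the strip, so steepness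
        gives the first component of the normal at least \<open>C / X\<close> in modulus. This is
        what \<open>\<eta>_small\<close> is tuned to: the contribution of \<open>w\<close> then
        dominates that of \<open>b\<close>.\<close>
      define X where "X = \<bar>x0\<bar> + 2 * l"
      have X: "0 < X" "\<bar>fst z\<bar> \<le> X" using l zx by (auto simp: X_def)
      have "C \<le> \<bar>fst z\<bar> * \<bar>fst \<nu>\<bar>" using st by (simp flip: abs_mult)
      also have "\<dots> \<le> X * \<bar>fst \<nu>\<bar>" using X by (intro mult_right_mono) auto
      finally have C\<nu>: "C \<le> X * \<bar>fst \<nu>\<bar>" .
      have "fst p * fst \<nu> \<le> 0" using horizontal_sign[OF n] zp by simp
      then have "w (fst p) * fst \<nu> \<le> 0" using \<kappa> mult_nonneg_nonpos[of \<kappa> "fst p * fst \<nu>"] by (simp add: mult_ac)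
      then have wn: "w (fst p) * fst \<nu> = - (\<bar>w (fst p)\<bar> * \<bar>fst \<nu>\<bar>)" by (simp add: abs_of_nonpos flip: abs_mult)
      have "\<bar>snd \<nu>\<bar> \<le> 1" using norm_snd_le[of "snd \<nu>" "fst \<nu>"] outward_normal_norm[OF n] by simp
      then have "\<bar>snd d\<bar> * \<bar>snd \<nu>\<bar> \<le> (\<eta> * l^4 * D) * 1" using dbound \<eta> D by (intro mult_mono) auto
      then have "X * (snd d * snd \<nu>) \<le> X * (\<eta> * l^4 * D)"
        using X by (intro mult_left_mono) (auto simp flip: abs_mult)
      also have "\<dots> \<le> C * \<bar>w (fst p)\<bar>" using \<eta>_small[OF str] by (simp add: X_def mult_ac)
      also have "\<dots> \<le> X * \<bar>fst \<nu>\<bar> * \<bar>w (fst p)\<bar>" by (rule mult_right_mono[OF C\<nu>]) simp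
      finally have "X * (snd d * snd \<nu>) \<le> X * \<bar>fst \<nu>\<bar> * \<bar>w (fst p)\<bar>" .
      moreover have "X * (d \<bullet> \<nu>) = X * (snd d * snd \<nu>) - X * \<bar>fst \<nu>\<bar> * \<bar>w (fst p)\<bar>"
        unfolding inner_prod_def dw inner_real_def wn by (simp add: algebra_simps)
      ultimately have "X * (d \<bullet> \<nu>) \<le> 0" by simp
      then show ?thesis using X by (simp add: mult_le_0_iff)
    qed
    ultimately show ?thesis by blast
  qed
  then obtain V where V: "open V" "e \<in> V" "\<And>z \<nu>. z \<in> V \<Longrightarrow> outward_normal \<Omega> z \<nu> \<Longrightarrow> d \<bullet> \<nu> \<le> 0" by blast
  show False
    by (rule no_exit[OF open_dom lipschitz_dom regular_dom _ s(1) path' V]) (use s(3) e_def in auto)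
qed

text \<open>Boundedness comes from the bound on the length of a step. For closedness only one thing
  can fail, that a limit of preimages sits on the boundary, and \<open>limit_in_domain\<close>
  excludes it.\<close>

lemma field_cpt:
  assumes h: "0 < h" "h \<le> h0" and K: "compact K" "K \<subseteq> \<Omega>"
  shows "compact {p \<in> \<Omega>. p - h *\<^sub>R (w (fst p), b p) \<in> K}" (is "compact ?L")
  unfolding compact_eq_bounded_closed
proof
  obtain R where R: "\<And>p. p \<in> K \<Longrightarrow> norm p \<le> R" using compact_imp_bounded[OF K(1)] by (auto simp: bounded_iff)
  show "bounded ?L"
    unfolding bounded_iff
  proof (intro exI ballI)
    fix p assume "p \<in> ?L"
    then have p: "p \<in> \<Omega>" "p - h *\<^sub>R (w (fst p), b p) \<in> K" by auto
    have "norm p = norm ((p - h *\<^sub>R (w (fst p), b p)) + h *\<^sub>R (w (fst p), b p))" by (simp only: diff_add_cancel)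
    also have "\<dots> \<le> norm (p - h *\<^sub>R (w (fst p), b p)) + norm (h *\<^sub>R (w (fst p), b p))" by (rule norm_triangle_ineq)
    also have "\<dots> \<le> R + 2 * B * h" by (rule add_mono[OF R[OF p(2)] displacement(1)[OF p(1) h]])
    finally show "norm p \<le> R + 2 * B * h" .
  qed
  show "closed ?L"
    unfolding closed_sequential_limits
  proof (intro allI impI, elim conjE)
    fix x p assume x: "\<forall>n. x n \<in> ?L" "x \<longlonglongrightarrow> p"
    define y where "y n = x n - h *\<^sub>R (w (fst (x n)), b (x n))" for n
    have xy: "x n \<in> \<Omega>" "y n \<in> K" for n using x(1) by (auto simp: y_def)
    from K(1) xy(2) obtain q r where q: "q \<in> K" "strict_mono (r :: nat \<Rightarrow> nat)" "(y \<circ> r) \<longlonglongrightarrow> q"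
      unfolding compact_def by metis
    have xr: "(\<lambda>n. x (r n)) \<longlonglongrightarrow> p" using LIMSEQ_subseq_LIMSEQ[OF x(2) q(2)] by (simp add: comp_def)
    have yr: "(\<lambda>n. x (r n) - h *\<^sub>R (w (fst (x (r n))), b (x (r n)))) \<longlonglongrightarrow> q" using q(3) by (simp add: comp_def y_def)
    have p: "p \<in> \<Omega>" using limit_in_domain[OF h xy(1) xr _ yr] q(1) K(2) by blast
    have "isCont b p" using C1_on_continuous[OF b_C1] open_dom p by (simp add: continuous_on_eq_continuous_at)
    then have "(\<lambda>n. b (x (r n))) \<longlonglongrightarrow> b p" using xr by (rule isCont_tendsto_compose)
    moreover have "(\<lambda>n. w (fst (x (r n)))) \<longlonglongrightarrow> w (fst p)"
      using w_cont xr by (intro isCont_tendsto_compose[of _ w] tendsto_intros) (auto simp: continuous_on_eq_continuous_at)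
    ultimately have "(\<lambda>n. x (r n) - h *\<^sub>R (w (fst (x (r n))), b (x (r n)))) \<longlonglongrightarrow> p - h *\<^sub>R (w (fst p), b p)"
      using xr by (intro tendsto_intros)
    then have "p - h *\<^sub>R (w (fst p), b p) = q" using yr LIMSEQ_unique by blast
    then show "p \<in> ?L" using p q(1) by simp
  qed
qed

sublocale inward_field \<Omega> w w' b bx by' h0 B
proof (unfold_locales)
  show "open \<Omega>" by (rule open_dom)
  show "C1_on \<Omega> b bx by'" by (rule b_C1)
  show "\<bar>w x\<bar> \<le> B" "\<bar>w' x\<bar> \<le> B" for x using w_bound[of x] w'_bounds[of x] B_ge(1) by (auto simp: abs_of_pos)
  show "\<bar>b p\<bar> \<le> B" "\<bar>bx p\<bar> \<le> B" "\<bar>by' p\<bar> \<le> B" if "p \<in> \<Omega>" for p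
    using b_bound[OF that] bx_bound[OF that] by_bound[of p] B_ge by auto
  show "\<bar>w' (fst p) - w' (fst p - h * w (fst p))\<bar> \<le> B * h \<and> \<bar>bx p - bx (p - h *\<^sub>R (w (fst p), b p))\<bar> \<le> B * h \<and>
        \<bar>by' p - by' (p - h *\<^sub>R (w (fst p), b p))\<bar> \<le> B * h"
    if "p \<in> \<Omega>" "0 < h" "h \<le> h0" "p - h *\<^sub>R (w (fst p), b p) \<in> \<Omega>" for p h
    using field_lip[OF that(1-3) refl that(4)] by simp
qed (use h0_bounds B_ge w_deriv w'_cont field_inj field_cpt in auto)

end

section \<open>Multipliers\<close>

lemma C1_on_fst:
  assumes "\<And>x. (k has_real_derivative k' x) (at x)" "continuous_on UNIV k'"
  shows "C1_on \<Omega> (\<lambda>p. k (fst p)) (\<lambda>p. k' (fst p)) (\<lambda>_. 0)"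
proof -
  have "((\<lambda>p::plane. k (fst p)) has_derivative (\<lambda>h. fst h * k' (fst p) + snd h * 0)) (at p)" for p
    using has_derivative_compose[OF has_derivative_fst[OF has_derivative_ident] has_field_derivative_imp_has_derivative[OF assms(1)]]
    by (simp add: mult.commute)
  moreover have "continuous_on \<Omega> (\<lambda>p::plane. k' (fst p))"
    by (intro continuous_on_compose2[OF assms(2)] continuous_intros) auto
  ultimately show ?thesis by (auto simp: C1_on_def)
qed

lemma helmholtz_ip:
  assumes "sqint M f" "sqint M u" "sqint M v"
  shows "ip M (\<lambda>x. f x + Complex E \<epsilon> * u x) v = ip M f v + E * ip M u v + \<epsilon> * ip M (\<lambda>x. \<i> * u x) v"
proof -
  have eq: "(\<lambda>x. f x + Complex E \<epsilon> * u x) = (\<lambda>x. (f x + E *\<^sub>R u x) + \<epsilon> *\<^sub>R (\<i> * u x))"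
    by (auto simp: fun_eq_iff complex_eq_iff)
  have s: "sqint M (\<lambda>x. E *\<^sub>R u x)" "sqint M (\<lambda>x. \<epsilon> *\<^sub>R (\<i> * u x))" "sqint M (\<lambda>x. \<i> * u x)" using assms sqint_cmult sqint_scaleR[OF sqint_cmult] by auto
  show ?thesis unfolding eq using assms s by (simp add: ip_add_left sqint_add ip_scaleR_left)
qed

text \<open>Testing with \<open>u\<close> expresses the Dirichlet energy through \<open>E\<close>,
  testing with \<i> u isolates \<open>\<epsilon>\<close> times the squared norm of \<open>u\<close>.
  The geometric mean of the two estimates is what Cauchy-Schwarz requires for the term with
  \<open>\<epsilon>\<close>; the factor \<open>sqrt (1 + E)\<close> is the origin of
  \<open>E^(1/2)\<close> in the theorem.\<close>

lemma energy_absorption: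
  assumes u: "weak_solution \<Omega> u p q (\<lambda>x. f x + Complex E \<epsilon> * u x)" and f: "sqint (lebesgue_on \<Omega>) f" and E: "0 < E" and \<epsilon>: "0 < \<epsilon>" "\<epsilon> \<le> 1"
    and S: "\<bar>ip (lebesgue_on \<Omega>) f u\<bar> \<le> S" "\<bar>ip (lebesgue_on \<Omega>) f (\<lambda>x. \<i> * u x)\<bar> \<le> S"
  shows "\<epsilon> * nrm (lebesgue_on \<Omega>) u * sqrt ((nrm (lebesgue_on \<Omega>) p)\<^sup>2 + (nrm (lebesgue_on \<Omega>) q)\<^sup>2) \<le> sqrt (1 + E) * S"
proof -
  let ?M = "lebesgue_on \<Omega>"
  have U: "jet u p q \<in> H10 \<Omega>" and weak: "\<And>v vx vy. jet v vx vy \<in> H10 \<Omega> \<Longrightarrow> ip ?M p vx + ip ?M q vy = ip ?M (\<lambda>x. f x + Complex E \<epsilon> * u x) v"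
    using u by (auto simp: weak_solution_def)
  note s = H10_jet_sqint[OF U] and si = sqint_cmult[OF H10_jet_sqint(1)[OF U], of \<i>]
  have orth: "ip ?M F (\<lambda>x. \<i> * F x) = 0" "ip ?M (\<lambda>x. \<i> * F x) F = 0" for F :: "plane \<Rightarrow> complex" by (simp_all add: ip_def inner_complex_def mult.commute)
  have same: "ip ?M (\<lambda>x. \<i> * u x) (\<lambda>x. \<i> * u x) = ip ?M u u" by (simp add: ip_def inner_complex_def add.commute)
  have 1: "(nrm ?M p)\<^sup>2 + (nrm ?M q)\<^sup>2 = ip ?M f u + E * (nrm ?M u)\<^sup>2"
    using weak[OF U] helmholtz_ip[OF f s(1) s(1)] by (simp add: nrm_sq_ip orth)
  have 2: "\<epsilon> * (nrm ?M u)\<^sup>2 = - ip ?M f (\<lambda>x. \<i> * u x)"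
    using weak[OF H10_cmult[OF U, of \<i>]] helmholtz_ip[OF f s(1) si] by (simp add: orth same nrm_sq_ip)
  have S0: "0 \<le> S" using S(1) by linarith
  have 3: "\<epsilon> * (nrm ?M u)\<^sup>2 \<le> S" using 2 S by linarith
  have "\<epsilon> * ((nrm ?M p)\<^sup>2 + (nrm ?M q)\<^sup>2) = \<epsilon> * ip ?M f u + E * (\<epsilon> * (nrm ?M u)\<^sup>2)" by (simp add: 1 distrib_left)
  also have "\<dots> \<le> 1 * S + E * S"
  proof (rule add_mono)
    have "\<epsilon> * ip ?M f u \<le> \<epsilon> * S" using S(1) \<epsilon> by (intro mult_left_mono) auto
    also have "\<dots> \<le> 1 * S" using \<epsilon> S0 by (intro mult_right_mono) auto
    finally show "\<epsilon> * ip ?M f u \<le> 1 * S" .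
    show "E * (\<epsilon> * (nrm ?M u)\<^sup>2) \<le> E * S" using 3 E by (intro mult_left_mono) auto
  qed
  finally have 4: "\<epsilon> * ((nrm ?M p)\<^sup>2 + (nrm ?M q)\<^sup>2) \<le> (1 + E) * S" by (simp add: distrib_right)
  have "(\<epsilon> * nrm ?M u * sqrt ((nrm ?M p)\<^sup>2 + (nrm ?M q)\<^sup>2))\<^sup>2 = (\<epsilon> * (nrm ?M u)\<^sup>2) * (\<epsilon> * ((nrm ?M p)\<^sup>2 + (nrm ?M q)\<^sup>2))"
    by (simp add: power_mult_distrib power2_eq_square)
  also have "\<dots> \<le> S * ((1 + E) * S)" by (rule mult_mono[OF 3 4]) (use \<epsilon> S0 in auto)
  also have "\<dots> = (sqrt (1 + E) * S)\<^sup>2" using E by (simp add: power_mult_distrib power2_eq_square)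
  finally show ?thesis by (rule power2_le_imp_le) (use E S0 in simp)
qed

text \<open>The bookkeeping for \<open>multiplier_inequality\<close>: \<open>y1\<close>,
  \<open>y2\<close>, \<open>y3\<close> are integrals with weight \<open>by'\<close> and
  \<open>a1\<close>, \<open>a2\<close>, \<open>a3\<close> those with weight \<open>w'\<close>, for
  \<open>u_x\<close>, \<open>u_y\<close>, \<open>u\<close> in turn. Half of the identity for
  \<open>w' u\<close> is added because it removes both \<open>w' |u_y|^2\<close> and
  \<open>E w' |u|^2\<close>, the terms without a sign of their own.\<close>

lemma multiplier_arith:
  fixes a1 a2 a3 :: real
  assumes "- (F + E * U + Z) \<le> 1/2 * (y1 - a1 - y2 + a2 - 2 * m)" "E * (2 * U) = - (E * a3) - E * y3" "2 * g1 = - g2" "a1 + s + a2 = Fw + E * a3"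
  shows "a1 + y2 / 2 - y1 / 2 + m + E * y3 / 2 + s / 2 + 2 * g1 + g2 \<le> F + Fw / 2 + Z"
  using assms by argo

context inward_field
begin

text \<open>The two terms with \<open>G\<close> form the \<open>x\<close>-derivative of
  \<open>G |u|^2\<close> and integrate to zero; they redistribute the density so that a pointwise
  lower bound becomes possible.\<close>

definition multiplier_form where
  "multiplier_form E w'' G G' u p q x = w' (fst x) * (p x \<bullet> p x) + by' x * (q x \<bullet> q x) / 2 - by' x * (p x \<bullet> p x) / 2 + bx x * (p x \<bullet> q x)
     + E * (by' x * (u x \<bullet> u x)) / 2 + w'' (fst x) * (u x \<bullet> p x) / 2 + 2 * (G (fst x) * (u x \<bullet> p x)) + G' (fst x) * (u x \<bullet> u x)"
  for u p q :: "plane \<Rightarrow> complex" and w'' G G' :: "real \<Rightarrow> real"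

text \<open>Combines \<open>rellich\<close>, the weak equation tested with \<open>w' u\<close>, and
  integration by parts of \<open>u\<close> against \<open>flow p q\<close> and against
  \<open>G u_x\<close>. In the second of these the term with \<open>\<epsilon>\<close> drops out, as
  \<i> u is pointwise orthogonal to real multiples of \<open>u\<close>.\<close>

lemma multiplier_inequality:
  fixes w'' G G' :: "real \<Rightarrow> real"
  assumes u: "weak_solution \<Omega> u p q (\<lambda>x. f x + Complex E \<epsilon> * u x)" and f: "sqint M f"
    and w'': "\<And>x. (w' has_real_derivative w'' x) (at x)" "continuous_on UNIV w''" "\<And>x. \<bar>w'' x\<bar> \<le> B1"
    and G: "\<And>x. (G has_real_derivative G' x) (at x)" "continuous_on UNIV G'" "\<And>x. \<bar>G x\<bar> \<le> B1" "\<And>x. \<bar>G' x\<bar> \<le> B1"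
  shows "integrable M (multiplier_form E w'' G G' u p q)" (is "integrable M ?Q")
    and "(\<integral>x. multiplier_form E w'' G G' u p q x \<partial>M) \<le> ip M f (flow p q) + ip M f (\<lambda>x. w' (fst x) *\<^sub>R u x) / 2 + \<epsilon> * ip M (\<lambda>x. \<i> * u x) (flow p q)"
proof -
  have B1: "0 \<le> B1" using w''(3)[of 0] by simp
  define K where "K = B + B1"
  have K: "0 \<le> K" "B \<le> K" "B1 \<le> K" using B B1 by (auto simp: K_def)
  have U: "jet u p q \<in> H10 \<Omega>" and weak: "\<And>v vx vy. jet v vx vy \<in> H10 \<Omega> \<Longrightarrow> ip M p vx + ip M q vy = ip M (\<lambda>x. f x + Complex E \<epsilon> * u x) v"
    using u by (auto simp: weak_solution_def)
  note s = H10_jet_sqint[OF U]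
  define I where "I c F H = (\<integral>x. c x * (F x \<bullet> H x) \<partial>M)" for c :: "plane \<Rightarrow> real" and F H :: "plane \<Rightarrow> complex"
  have ms: "(\<lambda>x. k (fst x)) \<in> borel_measurable M" if "continuous_on UNIV k" for k :: "real \<Rightarrow> real"
    by (rule continuous_measurable_lebesgue_on) (intro continuous_on_compose2[OF that] continuous_intros, auto)
  have cG: "continuous_on UNIV G" by (rule continuous_at_imp_continuous_on) (blast intro: DERIV_isCont G(1))
  have bnd: "\<bar>w (fst x)\<bar> \<le> K" "\<bar>w' (fst x)\<bar> \<le> K" "\<bar>w'' (fst x)\<bar> \<le> K" "\<bar>G (fst x)\<bar> \<le> K" "\<bar>G' (fst x)\<bar> \<le> K" for x :: "plane"
    using bounds(1)[of "fst x"] bounds(2)[of "fst x"] w''(3)[of "fst x"] G(3)[of "fst x"] G(4)[of "fst x"] K by linarith+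
  have bndb: "\<bar>b x\<bar> \<le> K" "\<bar>bx x\<bar> \<le> K" "\<bar>by' x\<bar> \<le> K" if "x \<in> \<Omega>" for x
    using bounds(3-5)[OF that] K by linarith+
  have int: "integrable M (\<lambda>x. c x * (F x \<bullet> H x))" if "sqint M F" "sqint M H" "c \<in> borel_measurable M" "\<And>x. x \<in> \<Omega> \<Longrightarrow> \<bar>c x\<bar> \<le> K"
    for c :: "plane \<Rightarrow> real" and F H :: "plane \<Rightarrow> complex"
    by (rule sqint_inner_bounded[OF that(1-3)]) (use that(4) in simp)
  note m = field_measurable ms[OF w''(2)] ms[OF cG] ms[OF G(2)]
  note i = int[OF s(2) s(2) m(2) bnd(2)] int[OF s(3) s(3) m(2) bnd(2)] int[OF s(1) s(1) m(2) bnd(2)]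
    int[OF s(2) s(2) m(5) bndb(3)] int[OF s(3) s(3) m(5) bndb(3)] int[OF s(1) s(1) m(5) bndb(3)]
    int[OF s(2) s(3) m(4) bndb(2)] int[OF s(1) s(2) m(7) bnd(3)] int[OF s(1) s(2) m(8) bnd(4)] int[OF s(1) s(1) m(9) bnd(5)]
  show "integrable M ?Q" unfolding multiplier_form_def[abs_def]
    by (intro Bochner_Integration.integrable_add Bochner_Integration.integrable_diff Bochner_Integration.integrable_divide_zero integrable_mult_right i)
  have Qi: "(\<integral>x. ?Q x \<partial>M) = I (\<lambda>x. w' (fst x)) p p + I by' q q / 2 - I by' p p / 2 + I bx p q + E * I by' u u / 2
     + I (\<lambda>x. w'' (fst x)) u p / 2 + 2 * I (\<lambda>x. G (fst x)) u p + I (\<lambda>x. G' (fst x)) u u"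
    unfolding multiplier_form_def I_def using i by simp
  have st: "(\<integral>x. stress p q x \<partial>M) = I by' p p - I (\<lambda>x. w' (fst x)) p p - I by' q q + I (\<lambda>x. w' (fst x)) q q - 2 * I bx p q"
  proof -
    have "(\<integral>x. stress p q x \<partial>M) = (\<integral>x. by' x * (p x \<bullet> p x) - w' (fst x) * (p x \<bullet> p x) - by' x * (q x \<bullet> q x) + w' (fst x) * (q x \<bullet> q x) - 2 * (bx x * (p x \<bullet> q x)) \<partial>M)"
      by (intro Bochner_Integration.integral_cong refl) (simp add: stress_eq algebra_simps)
    then show ?thesis unfolding I_def using i by simp
  qed
  have sF: "sqint M (flow p q)" using flow_sqint[OF s(2,3)] .
  have F1: "2 * ip M u (flow p q) = - I (\<lambda>x. w' (fst x)) u u - I by' u u"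
  proof -
    have "ip M u (flow p q) = I (\<lambda>x. w (fst x)) p u + I b q u"
    proof -
      have "ip M u (flow p q) = (\<integral>x. w (fst x) * (p x \<bullet> u x) + b x * (q x \<bullet> u x) \<partial>M)"
        unfolding ip_def by (intro Bochner_Integration.integral_cong refl) (simp add: flow_def inner_add_right inner_commute)
      then show ?thesis unfolding I_def using int[OF s(2) s(1) m(1) bnd(1)] int[OF s(3) s(1) m(3) bndb(1)] by simp
    qed
    moreover have "2 * I (\<lambda>x. w (fst x)) p u = - I (\<lambda>x. w' (fst x)) u u"
      using H10_ibp(1)[OF U U open_\<Omega> C1_on_fst[OF w_deriv w'_cont], of K] bnd K by (simp add: I_def inner_commute[of "u _" "p _"])
    moreover have "2 * I b q u = - I by' u u"
      using H10_ibp(2)[OF U U open_\<Omega> b_C1 bndb K(1)] by (simp add: I_def inner_commute[of "u _" "q _"])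
    ultimately show ?thesis by linarith
  qed
  have F2: "2 * I (\<lambda>x. G (fst x)) u p = - I (\<lambda>x. G' (fst x)) u u"
    using H10_ibp(1)[OF U U open_\<Omega> C1_on_fst[OF G(1,2)], of K] bnd K by (simp add: I_def inner_commute[of "p _" "u _"])
  have F3: "I (\<lambda>x. w' (fst x)) p p + I (\<lambda>x. w'' (fst x)) u p + I (\<lambda>x. w' (fst x)) q q = ip M f (\<lambda>x. w' (fst x) *\<^sub>R u x) + E * I (\<lambda>x. w' (fst x)) u u"
  proof -
    have J: "jet (\<lambda>x. w' (fst x) *\<^sub>R u x) (\<lambda>x. w' (fst x) *\<^sub>R p x + w'' (fst x) *\<^sub>R u x) (\<lambda>x. w' (fst x) *\<^sub>R q x + 0 *\<^sub>R u x) \<in> H10 \<Omega>"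
      by (rule H10_mult[OF U open_\<Omega> C1_on_fst[OF w''(1,2)], of K]) (use bnd K in auto)
    note sv = H10_jet_sqint[OF J]
    have "ip M p (\<lambda>x. w' (fst x) *\<^sub>R p x + w'' (fst x) *\<^sub>R u x) = I (\<lambda>x. w' (fst x)) p p + I (\<lambda>x. w'' (fst x)) u p"
      unfolding ip_def I_def using i(1,8) by (simp add: inner_add_right inner_commute[of "p _" "u _"])
    moreover have "ip M q (\<lambda>x. w' (fst x) *\<^sub>R q x + 0 *\<^sub>R u x) = I (\<lambda>x. w' (fst x)) q q"
      unfolding ip_def I_def by simp
    moreover have "ip M u (\<lambda>x. w' (fst x) *\<^sub>R u x) = I (\<lambda>x. w' (fst x)) u u"
      unfolding ip_def I_def by simp
    moreover have "ip M (\<lambda>x. \<i> * u x) (\<lambda>x. w' (fst x) *\<^sub>R u x) = 0"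
      unfolding ip_def by (simp add: inner_complex_def mult.commute)
    ultimately show ?thesis using weak[OF J] helmholtz_ip[OF f s(1) sv(1), of E \<epsilon>] by simp
  qed
  have "- ip M (\<lambda>x. f x + Complex E \<epsilon> * u x) (flow p q) \<le> 1/2 * (\<integral>x. stress p q x \<partial>M)" by (rule rellich[OF u])
  moreover have "E * (2 * ip M u (flow p q)) = - (E * I (\<lambda>x. w' (fst x)) u u) - E * I by' u u" unfolding F1 by (simp add: algebra_simps)
  ultimately show "(\<integral>x. ?Q x \<partial>M) \<le> ip M f (flow p q) + ip M f (\<lambda>x. w' (fst x) *\<^sub>R u x) / 2 + \<epsilon> * ip M (\<lambda>x. \<i> * u x) (flow p q)"
    unfolding Qi st helmholtz_ip[OF f s(1) sF] by (rule multiplier_arith[OF _ _ F2 F3])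
qed

end

section \<open>Pointwise positivity of the quadratic form\<close>

lemma young: "x * y \<le> A * x\<^sup>2 + y\<^sup>2 / (4 * A)" if "0 < A" for x y A :: real
proof -
  have "0 \<le> (2 * A * x - y)\<^sup>2 / (4 * A)" using that by simp
  also have "\<dots> = A * x\<^sup>2 + y\<^sup>2 / (4 * A) - x * y" using that by (simp add: power2_eq_square field_simps)
  finally show ?thesis by simp
qed

text \<open>Here \<open>R e = w'\<close>, and \<open>- k s e\<close> is the multiplier \<open>G\<close>. The mixed term \<open>up\<close> is split by Young's inequality with the share
  \<open>1 - \<mu>\<close> of \<open>w' |u\<^sub>x|\<^sup>2\<close>, which costs \<open>\<theta>\<close> of the coefficient \<open>k (2 + \<delta>)\<close> and leaves \<open>m0\<close>.\<close>

lemma form_lower_bound: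
  fixes \<delta> c s R e k \<mu> \<theta> m0 \<beta> \<gamma> X E a b v up pq :: real
  assumes \<delta>: "0 < \<delta>" and R: "R = c + s\<^sup>2" "0 < c" and e: "0 < e" and k: "k = (3 + \<delta>) / 4" and \<mu>: "\<mu> < 1"
    and \<theta>: "(2 + \<delta>)\<^sup>2 = 4 * (1 - \<mu>) * \<theta>" "k * (2 + \<delta>) = \<theta> + m0"
    and \<beta>: "0 \<le> \<beta>" "\<gamma>\<^sup>2 \<le> X * \<beta>" and X: "0 \<le> X"
    and up: "\<bar>up\<bar> \<le> v * a" and pq: "\<bar>pq\<bar> \<le> a * b" and nonneg: "0 \<le> a" "0 \<le> b" "0 \<le> v"
    and A1: "\<beta> / 2 + X \<le> \<mu> / 2 * (R * e)"
    and A2: "k * (3 + \<delta>) * (c / R) * e \<le> m0 / 2 * e + E * \<beta> / 2"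
  shows "\<mu> / 2 * ((R * e) * a\<^sup>2) + \<beta> * b\<^sup>2 / 4 + m0 / 2 * (e * v\<^sup>2) \<le>
    (R * e) * a\<^sup>2 + \<beta> * b\<^sup>2 / 2 - \<beta> * a\<^sup>2 / 2 + \<gamma> * pq + E * (\<beta> * v\<^sup>2) / 2 + (- ((1 + \<delta>) * s * e)) * up / 2
     + 2 * ((- (k * s * e)) * up) + e * (k * (2 + \<delta>) - k * (3 + \<delta>) * (c / R)) * v\<^sup>2"
proof -
  have R0: "0 < R" using R by (simp add: add_pos_nonneg)
  have \<theta>0: "0 \<le> \<theta>"
  proof -
    have "0 \<le> 4 * (1 - \<mu>) * \<theta>" unfolding \<theta>(1)[symmetric] by simp
    then show ?thesis using \<mu> by (simp add: zero_le_mult_iff)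
  qed
  have T1: "(2 + \<delta>) * s * up \<le> (1 - \<mu>) * R * a\<^sup>2 + \<theta> * (1 - c / R) * v\<^sup>2"
  proof -
    have "(2 + \<delta>) * s * up \<le> \<bar>(2 + \<delta>) * s\<bar> * \<bar>up\<bar>" by (metis abs_ge_self abs_mult)
    also have "\<dots> \<le> \<bar>(2 + \<delta>) * s\<bar> * (v * a)" using up by (intro mult_left_mono) auto
    also have "\<dots> = a * (\<bar>(2 + \<delta>) * s\<bar> * v)" by simp
    also have "\<dots> \<le> ((1 - \<mu>) * R) * a\<^sup>2 + (\<bar>(2 + \<delta>) * s\<bar> * v)\<^sup>2 / (4 * ((1 - \<mu>) * R))"
      using \<mu> R0 by (intro young) simp
    also have "(\<bar>(2 + \<delta>) * s\<bar> * v)\<^sup>2 / (4 * ((1 - \<mu>) * R)) = \<theta> * (s\<^sup>2 / R) * v\<^sup>2"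
    proof -
      have "4 * n * \<theta> * s\<^sup>2 * v\<^sup>2 / (4 * (n * R)) = \<theta> * (s\<^sup>2 / R) * v\<^sup>2" if "n \<noteq> 0" for n
        using that by simp
      from this[of "1 - \<mu>"] \<mu> show ?thesis by (simp add: power_mult_distrib \<theta>(1) del: right_diff_distrib_numeral)
    qed
    also have "s\<^sup>2 / R = 1 - c / R" using R0 by (simp add: R(1) field_simps)
    finally show ?thesis .
  qed
  \<comment> \<open>Because \<open>\<gamma>^2\<close> is at most \<open>X * \<beta>\<close>, the
    arithmetic-geometric inequality splits the mixed term and uses only a quarter of
    \<open>\<beta> * b^2\<close>.\<close>
  have T2: "- (\<gamma> * pq) \<le> X * a\<^sup>2 + \<beta> * b\<^sup>2 / 4"
  proof -
    have "\<bar>\<gamma> * pq\<bar> \<le> \<bar>\<gamma>\<bar> * (a * b)" using pq by (simp add: abs_mult mult_left_mono)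
    also have "\<dots> \<le> X * a\<^sup>2 + \<beta> * b\<^sup>2 / 4"
    proof (rule power2_le_imp_le)
      have "(\<bar>\<gamma>\<bar> * (a * b))\<^sup>2 = \<gamma>\<^sup>2 * (a\<^sup>2 * b\<^sup>2)" by (simp add: power_mult_distrib)
      also have "\<dots> \<le> (X * \<beta>) * (a\<^sup>2 * b\<^sup>2)" using \<beta> by (intro mult_right_mono) auto
      also have "\<dots> = 4 * (X * a\<^sup>2) * (\<beta> * b\<^sup>2 / 4)" by simp
      also have "\<dots> \<le> (X * a\<^sup>2 + \<beta> * b\<^sup>2 / 4)\<^sup>2"
      proof -
        have "4 * m * n \<le> (m + n)\<^sup>2" for m n :: real
          using zero_le_power2[of "m - n"] by (simp add: power2_sum power2_diff)
        then show ?thesis .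
      qed
      finally show "(\<bar>\<gamma>\<bar> * (a * b))\<^sup>2 \<le> (X * a\<^sup>2 + \<beta> * b\<^sup>2 / 4)\<^sup>2" .
    qed (use X \<beta> in simp)
    finally show ?thesis by linarith
  qed
  have T3: "(\<beta> / 2 + X) * a\<^sup>2 \<le> \<mu> / 2 * (R * e) * a\<^sup>2" using A1 by (rule mult_right_mono) simp
  have T4: "k * (3 + \<delta>) * (c / R) * e * v\<^sup>2 \<le> (m0 / 2 * e + E * \<beta> / 2) * v\<^sup>2" using A2 by (rule mult_right_mono) simp
  have T5: "e * ((2 + \<delta>) * s * up) \<le> e * ((1 - \<mu>) * R * a\<^sup>2 + \<theta> * (1 - c / R) * v\<^sup>2)" using T1 e by (intro mult_left_mono) auto
  have T6: "0 \<le> \<theta> * (c / R) * e * v\<^sup>2" using \<theta>0 R0 R(2) e by simp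
  have k2: "2 * k = (3 + \<delta>) / 2" using k by simp
  have "(- ((1 + \<delta>) * s * e)) * up / 2 + 2 * ((- (k * s * e)) * up) = - (((1 + \<delta>) / 2 + 2 * k) * (s * e * up))"
    by (simp add: field_simps)
  \<comment> \<open>The two sources of mixed terms, \<open>w''\<close> and the multiplier
    \<open>G\<close>, add up to this coefficient, whose square appears in the assumption on
    \<open>\<theta>\<close>.\<close>
  also have "(1 + \<delta>) / 2 + 2 * k = 2 + \<delta>" unfolding k2 by argo
  finally have c1: "(- ((1 + \<delta>) * s * e)) * up / 2 + 2 * ((- (k * s * e)) * up) = - (e * ((2 + \<delta>) * s * up))" by simp
  have c2: "e * (k * (2 + \<delta>) - k * (3 + \<delta>) * (c / R)) * v\<^sup>2 = \<theta> * e * v\<^sup>2 + m0 * e * v\<^sup>2 - k * (3 + \<delta>) * (c / R) * e * v\<^sup>2"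
    unfolding \<theta>(2) by (simp add: algebra_simps)
  have c3: "e * ((1 - \<mu>) * R * a\<^sup>2 + \<theta> * (1 - c / R) * v\<^sup>2) = R * e * a\<^sup>2 - \<mu> * (R * e * a\<^sup>2) + \<theta> * e * v\<^sup>2 - \<theta> * (c / R) * e * v\<^sup>2"
    by (simp add: algebra_simps)
  have c4: "(\<beta> / 2 + X) * a\<^sup>2 = \<beta> * a\<^sup>2 / 2 + X * a\<^sup>2" "(m0 / 2 * e + E * \<beta> / 2) * v\<^sup>2 = m0 * e * v\<^sup>2 / 2 + E * (\<beta> * v\<^sup>2) / 2"
    "\<mu> / 2 * (R * e) * a\<^sup>2 = \<mu> * (R * e * a\<^sup>2) / 2" "\<mu> / 2 * (R * e * a\<^sup>2) = \<mu> * (R * e * a\<^sup>2) / 2" "m0 / 2 * (e * v\<^sup>2) = m0 * e * v\<^sup>2 / 2"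
    by (simp_all add: algebra_simps)
  have "A1 / 2 + B / 4 + C1 / 2 \<le> P + B / 2 - D / 2 + G + H / 2 + S + S' + L"
    if "S + S' = - T" "L = U + C1 - V" "T \<le> P - A1 + U - W" "0 \<le> W" "- G \<le> Y + B / 4" "D / 2 + Y \<le> A1 / 2" "V \<le> C1 / 2 + H / 2" for A1 B C1 P D G H S S' L T U V W Y :: real
    using that by linarith
  from this[OF c1 c2 T5[unfolded c3] T6 T2 T3[unfolded c4] T4[unfolded c4]] show ?thesis unfolding c4 .
qed

section \<open>Powers of \<open>c + (x - x0)^2\<close>\<close>

definition decay :: "real \<Rightarrow> real \<Rightarrow> real \<Rightarrow> real \<Rightarrow> real" where
  "decay c x0 a x = (c + (x - x0)\<^sup>2) powr a"

lemma decay_deriv: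
  assumes "0 < c"
  shows "(decay c x0 a has_real_derivative 2 * a * (x - x0) * decay c x0 (a - 1) x) (at x)"
proof -
  have p: "0 < c + (x - x0)\<^sup>2" using assms by (simp add: add_pos_nonneg)
  have "((\<lambda>x. c + (x - x0)\<^sup>2) has_real_derivative 2 * (x - x0)) (at x)" by (auto intro!: derivative_eq_intros)
  from DERIV_chain2[OF has_real_derivative_powr[OF p] this] show ?thesis
    by (simp add: decay_def[abs_def] mult_ac)
qed

lemma decay_cont: "0 < c \<Longrightarrow> continuous_on A (decay c x0 a)"
  by (rule continuous_at_imp_continuous_on) (blast intro: DERIV_isCont decay_deriv)

lemma decay_pos: "0 < c \<Longrightarrow> 0 < decay c x0 a x"
proof -
  assume "0 < c"
  then have "0 < c + (x - x0)\<^sup>2" by (simp add: add_pos_nonneg)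
  then show ?thesis by (simp add: decay_def)
qed

lemma decay_mult: 
  assumes "0 < c" shows "decay c x0 (a + 1) x = (c + (x - x0)\<^sup>2) * decay c x0 a x"
proof -
  have "0 < c + (x - x0)\<^sup>2" using assms by (simp add: add_pos_nonneg)
  then show ?thesis by (simp add: decay_def powr_add)
qed

lemma decay_mono:
  assumes "0 < c" "\<bar>x - x0\<bar> \<le> r" "a \<le> 0"
  shows "(c + r\<^sup>2) powr a \<le> decay c x0 a x"
proof -
  have "(x - x0)\<^sup>2 \<le> r\<^sup>2" using assms(2) by (intro abs_le_square_iff[THEN iffD1]) auto
  moreover have "0 < c + (x - x0)\<^sup>2" using assms by (simp add: add_pos_nonneg)
  ultimately show ?thesis unfolding decay_def using assms(3) by (intro powr_mono2') auto
qed

lemma decay_le: 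
  assumes "0 < c" "a \<le> 0" shows "decay c x0 a x \<le> c powr a"
  unfolding decay_def using assms by (intro powr_mono2') auto

text \<open>Arithmetic-geometric mean: \<open>2 * \<bar>x - x0\<bar> * sqrt c\<close> is at most
  \<open>c + (x - x0)^2\<close>.\<close>

lemma decay_lin_bound:
  assumes "0 < c" shows "\<bar>x - x0\<bar> * decay c x0 (a - 1) x \<le> decay c x0 a x / sqrt c"
proof -
  let ?R = "c + (x - x0)\<^sup>2"
  have "0 \<le> (\<bar>x - x0\<bar> - sqrt c)\<^sup>2" by simp
  also have "\<dots> = ?R - 2 * (\<bar>x - x0\<bar> * sqrt c)" using assms by (simp add: power2_diff)
  finally have "\<bar>x - x0\<bar> * sqrt c \<le> ?R" using assms by (smt (verit) mult_nonneg_nonneg real_sqrt_ge_zero abs_ge_zero)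
  then have "\<bar>x - x0\<bar> * sqrt c * decay c x0 (a - 1) x \<le> ?R * decay c x0 (a - 1) x"
    using decay_pos[OF assms] by (intro mult_right_mono) (auto intro: less_imp_le)
  also have "\<dots> = decay c x0 a x" using decay_mult[OF assms, of x0 "a - 1" x] by simp
  finally show ?thesis using assms by (simp add: pos_le_divide_eq mult_ac)
qed

text \<open>\<open>c_small\<close> makes the bad part of the potential small at distance at least
  \<open>l / 2\<close> from \<open>x0\<close>; its right side is \<open>m0\<close> times
  \<open>l^2\<close>. \<open>\<eta>_small'\<close> makes all losses caused by \<open>b\<close>
  smaller than the reserved share of \<open>w'\<close> on the strip; the last factor on its right
  side is the value of \<open>w'\<close> at distance \<open>l\<close>. Both constants are spelled
  out since \<open>m0\<close> and \<open>\<mu>\<close> are defined only inside.\<close>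

locale decay_field = strip_field \<Omega> \<alpha> x0 l C D d0 w w' \<eta> B0
  for \<Omega> \<alpha> x0 l C D d0 w w' \<eta> B0 +
  fixes c \<delta> :: real
  assumes c: "0 < c" and \<delta>: "0 < \<delta>" and w'_eq: "w' = decay c x0 (- ((1 + \<delta>) / 2))"
    and c_small: "2 * c * (3 + \<delta>)\<^sup>2 \<le> (2 + \<delta>) * (3 + \<delta>) / (4 * (5 + 2 * \<delta>)) * l\<^sup>2"
    and \<eta>_small': "\<eta> * (l^4 / 2 + 16 * l\<^sup>2 * D\<^sup>2) \<le> 1 / (6 + 2 * \<delta>) / 2 * (c + l\<^sup>2) powr (- ((1 + \<delta>) / 2))"
begin

text \<open>If all of \<open>w' |u_x|^2\<close> is spent on the mixed term, Young's inequality
  leaves far from \<open>x0\<close> the coefficient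
  \<open>k (2 + \<delta>) - (2 k + (1 + \<delta>)/2)^2 / 4\<close> for \<open>e |u|^2\<close>. This
  \<open>k\<close> maximises it; the maximum is \<open>(2 + \<delta>) / 4\<close>.\<close>

definition k :: real where "k = (3 + \<delta>) / 4"
text \<open>The reserved share of \<open>w' |u_x|^2\<close>. The coefficient that remains for
  \<open>e |u|^2\<close> is positive exactly when the share is below
  \<open>1 / (3 + \<delta>)\<close>; half of this is taken, and \<open>\<theta>\<close> and
  \<open>m0\<close> then follow from the first two equations of \<open>constants\<close>.\<close>

definition \<mu> :: real where "\<mu> = 1 / (6 + 2 * \<delta>)"
definition m0 :: real where "m0 = (2 + \<delta>) * (3 + \<delta>) / (4 * (5 + 2 * \<delta>))"
definition \<theta> :: real where "\<theta> = (2 + \<delta>)\<^sup>2 * (3 + \<delta>) / (2 * (5 + 2 * \<delta>))"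
definition e :: "real \<Rightarrow> real" where "e = decay c x0 (- ((3 + \<delta>) / 2))"
definition R :: "real \<Rightarrow> real" where "R x = c + (x - x0)\<^sup>2"
definition w'' :: "real \<Rightarrow> real" where "w'' x = - ((1 + \<delta>) * (x - x0) * e x)"
definition G :: "real \<Rightarrow> real" where "G x = - (k * (x - x0) * e x)"
definition G' :: "real \<Rightarrow> real" where "G' x = e x * (k * (2 + \<delta>) - k * (3 + \<delta>) * (c / R x))"

lemma constants: "(2 + \<delta>)\<^sup>2 = 4 * (1 - \<mu>) * \<theta>" "k * (2 + \<delta>) = \<theta> + m0" "0 < \<mu>" "\<mu> < 1" "0 < m0" "0 < k"
proof -
  have gen: "1 - 1 / (6 + 2 * \<delta>) = s / (2 * t)" "4 * (s / (2 * t)) * (r * t / (2 * s)) = r" if "s = 5 + 2 * \<delta>" "t = 3 + \<delta>" for r s t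
  proof -
    have st: "0 < s" "0 < t" "6 + 2 * \<delta> = 2 * t" "s = 2 * t - 1" using that \<delta> by auto
    show "1 - 1 / (6 + 2 * \<delta>) = s / (2 * t)" unfolding st(3) using st(2) unfolding st(4) by (simp add: diff_divide_distrib)
    show "4 * (s / (2 * t)) * (r * t / (2 * s)) = r" using st(1,2) by simp
  qed
  show "(2 + \<delta>)\<^sup>2 = 4 * (1 - \<mu>) * \<theta>"
    unfolding \<mu>_def \<theta>_def gen(1)[OF refl refl] gen(2)[OF refl refl] ..
  have "k * (2 + \<delta>) = (2 + \<delta>) * (3 + \<delta>) * (5 + 2 * \<delta>) / (4 * (5 + 2 * \<delta>))"
  proof -
    have "(3 + \<delta>) / 4 * (2 + \<delta>) = (2 + \<delta>) * (3 + \<delta>) * s / (4 * s)" if "s \<noteq> 0" for s using that by simp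
    moreover have "5 + 2 * \<delta> \<noteq> 0" using \<delta> by simp
    ultimately show ?thesis unfolding k_def by blast
  qed
  also have "(2 + \<delta>) * (3 + \<delta>) * (5 + 2 * \<delta>) = 2 * ((2 + \<delta>)\<^sup>2 * (3 + \<delta>)) + (2 + \<delta>) * (3 + \<delta>)"
    by (simp add: power2_eq_square algebra_simps)
  also have "\<dots> / (4 * (5 + 2 * \<delta>)) = \<theta> + m0"
  proof -
    have "(2 * r + t) / (4 * s) = r / (2 * s) + t / (4 * s)" for r s t :: real by (simp add: add_divide_distrib)
    then show ?thesis unfolding \<theta>_def m0_def .
  qed
  finally show "k * (2 + \<delta>) = \<theta> + m0" .
  show "0 < \<mu>" "\<mu> < 1" "0 < m0" "0 < k" using \<delta> by (auto simp: \<mu>_def m0_def k_def)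
qed

lemma exponents: "- ((3 + \<delta>) / 2) + 1 = - ((1 + \<delta>) / 2)" "- ((1 + \<delta>) / 2) - 1 = - ((3 + \<delta>) / 2)"
  by argo+

lemma R_pos: "0 < R x" "c \<le> R x" using c by (auto simp: R_def add_pos_nonneg)
lemma e_pos: "0 < e x" unfolding e_def by (rule decay_pos[OF c])
lemma w'_Re: "w' x = R x * e x"
  unfolding w'_eq e_def R_def decay_mult[OF c, symmetric] exponents ..

lemma e_le: "e x \<le> c powr (- ((3 + \<delta>) / 2))"
  unfolding e_def using \<delta> by (intro decay_le c) auto

lemma w''_deriv: "(w' has_real_derivative w'' x) (at x)"
proof -
  have "2 * (- ((1 + \<delta>) / 2)) * (x - x0) * decay c x0 (- ((1 + \<delta>) / 2) - 1) x = w'' x"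
    unfolding exponents w''_def e_def by simp
  then show ?thesis using decay_deriv[OF c, of x0 "- ((1 + \<delta>) / 2)" x] unfolding w'_eq by simp
qed

lemma e_cont: "continuous_on UNIV e" unfolding e_def by (rule decay_cont[OF c])

lemma w''_cont: "continuous_on UNIV w''"
  unfolding w''_def[abs_def] by (intro continuous_intros e_cont)

lemma R_ne: "R x \<noteq> 0" using R_pos[of x] by simp

lemma G_deriv: "(G has_real_derivative G' x) (at x)"
proof -
  define e' where "e' = decay c x0 (- ((3 + \<delta>) / 2) - 1) x"
  have ee: "e x = R x * e'" unfolding e_def e'_def R_def decay_mult[OF c, symmetric] by simp
  have "(e has_real_derivative 2 * (- ((3 + \<delta>) / 2)) * (x - x0) * e') (at x)"
    unfolding e_def e'_def by (rule decay_deriv[OF c])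
  then have "(G has_real_derivative - (k * e x + k * (x - x0) * (2 * (- ((3 + \<delta>) / 2)) * (x - x0) * e'))) (at x)"
    unfolding G_def[abs_def] by (auto intro!: derivative_eq_intros)
  moreover have "- (k * e x + k * (x - x0) * (2 * (- ((3 + \<delta>) / 2)) * (x - x0) * e')) = G' x"
  proof -
    have "- (k * e x + k * (x - x0) * (2 * (- ((3 + \<delta>) / 2)) * (x - x0) * e')) = - (k * e x) + k * (3 + \<delta>) * ((x - x0)\<^sup>2 * e')"
    proof -
      have "- (k * a + k * s * (2 * (- (d / 2)) * s * t)) = - (k * a) + k * d * (s\<^sup>2 * t)" for a s d t
        by (simp add: power2_eq_square)
      then show ?thesis .
    qed
    also have "(x - x0)\<^sup>2 * e' = e x - c / R x * e x" 
    proof -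
      have "(x - x0)\<^sup>2 = R x - c" by (simp add: R_def)
      then show ?thesis using R_ne[of x] by (simp add: ee left_diff_distrib)
    qed
    also have "- (k * e x) + k * (3 + \<delta>) * (e x - c / R x * e x) = G' x" by (simp add: G'_def algebra_simps add_divide_distrib)
    finally show ?thesis .
  qed
  ultimately show ?thesis by simp
qed

lemma G'_cont: "continuous_on UNIV G'"
  unfolding G'_def[abs_def] using R_ne by (intro continuous_intros e_cont) (auto simp: R_def intro!: continuous_intros)

definition B1 :: real where "B1 = (1 + \<delta> + k) * (B0 / sqrt c) + (k * (2 + \<delta>) + k * (3 + \<delta>)) * (B0 / c)"

lemma multiplier_bounds: "\<bar>w'' x\<bar> \<le> B1" "\<bar>G x\<bar> \<le> B1" "\<bar>G' x\<bar> \<le> B1"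
proof -
  have s: "\<bar>x - x0\<bar> * e x \<le> B0 / sqrt c"
  proof -
    have "\<bar>x - x0\<bar> * e x \<le> w' x / sqrt c"
      using decay_lin_bound[OF c, of x x0 "- ((1 + \<delta>) / 2)"] unfolding exponents by (simp add: e_def w'_eq)
    also have "\<dots> \<le> B0 / sqrt c" using w'_bounds(2) c by (intro divide_right_mono) auto
    finally show ?thesis .
  qed
  have e: "e x \<le> B0 / c"
  proof -
    have "c * e x \<le> R x * e x" using R_pos(2) e_pos by (intro mult_right_mono) (auto intro: less_imp_le)
    also have "\<dots> \<le> B0" using w'_bounds(2)[of x] by (simp add: w'_Re)
    finally show ?thesis using c by (simp add: pos_le_divide_eq mult.commute)
  qed
  have B1: "B1 = (1 + \<delta>) * (B0 / sqrt c) + k * (B0 / sqrt c) + (k * (2 + \<delta>) + k * (3 + \<delta>)) * (B0 / c)"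
    unfolding B1_def by (simp only: distrib_right)
  have p: "0 \<le> B0 / sqrt c" "0 \<le> B0 / c" "0 < e x" "0 < k" using B0 c e_pos constants by auto
  have q: "0 \<le> (1 + \<delta>) * (B0 / sqrt c)" "0 \<le> k * (B0 / sqrt c)" "0 \<le> (k * (2 + \<delta>) + k * (3 + \<delta>)) * (B0 / c)"
    using p \<delta> by (intro mult_nonneg_nonneg add_nonneg_nonneg; linarith)+
  have "\<bar>w'' x\<bar> = (1 + \<delta>) * (\<bar>x - x0\<bar> * e x)" using \<delta> p by (simp add: w''_def abs_mult)
  also have "\<dots> \<le> (1 + \<delta>) * (B0 / sqrt c)" using s \<delta> by (intro mult_left_mono) auto
  finally show "\<bar>w'' x\<bar> \<le> B1" using q unfolding B1 by linarith
  have "\<bar>G x\<bar> = k * (\<bar>x - x0\<bar> * e x)" using p by (simp add: G_def abs_mult)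
  also have "\<dots> \<le> k * (B0 / sqrt c)" using s p by (intro mult_left_mono) auto
  finally show "\<bar>G x\<bar> \<le> B1" using q unfolding B1 by linarith
  have cR: "0 \<le> c / R x" "c / R x \<le> 1" using R_pos[of x] c by (auto simp: divide_le_eq)
  have "\<bar>k * (2 + \<delta>) - k * (3 + \<delta>) * (c / R x)\<bar> \<le> k * (2 + \<delta>) + k * (3 + \<delta>)"
  proof -
    have a: "0 \<le> k * (3 + \<delta>) * (c / R x)" "0 \<le> k * (2 + \<delta>)" using p \<delta> cR by (intro mult_nonneg_nonneg; linarith)+
    have b: "k * (3 + \<delta>) * (c / R x) \<le> k * (3 + \<delta>) * 1" using p \<delta> cR by (intro mult_left_mono) auto
    show ?thesis using a b by (simp only: abs_le_iff) linarith
  qed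
  then have "\<bar>G' x\<bar> \<le> (B0 / c) * (k * (2 + \<delta>) + k * (3 + \<delta>))"
    unfolding G'_def abs_mult using e p by (intro mult_mono) auto
  then show "\<bar>G' x\<bar> \<le> B1" using q unfolding B1 mult.commute[of "B0 / c"] by linarith
qed

text \<open>At distance at most \<open>l / 2\<close> from \<open>x0\<close> the cutoff is at least
  \<open>9/16 * l^4\<close>. With this bound \<open>E1 * by' / 2\<close> reaches the largest
  possible value of the bad part of the potential.\<close>

definition E1 :: real where "E1 = 32 * (k * (3 + \<delta>) * c powr (- ((3 + \<delta>) / 2))) / (9 * \<eta> * l^4)"
definition c1 :: real where "c1 = min (\<mu> / 2) (min (1/4) (m0 / 2))"

lemma c1: "0 < c1" "c1 \<le> \<mu> / 2" "c1 \<le> 1/4" "c1 \<le> m0 / 2" using constants by (auto simp: c1_def)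
lemma E1_pos: "0 < E1" using \<eta> l c \<delta> constants by (auto simp: E1_def)

text \<open>At distance at least \<open>l / 2\<close> from \<open>x0\<close>, \<open>R\<close> is at
  least \<open>l^2 / 4\<close> and the smallness of \<open>c\<close> suffices; closer to
  \<open>x0\<close> the cutoff is bounded below and a large \<open>E\<close> does the work.\<close>

lemma absorb_potential:
  assumes E: "E1 \<le> E"
  shows "k * (3 + \<delta>) * (c / R (fst p)) * e (fst p) \<le> m0 / 2 * e (fst p) + E * by' p / 2"
proof -
  let ?s = "fst p - x0"
  have k3: "0 < k * (3 + \<delta>)" using constants \<delta> by simp
  have by0: "0 \<le> E * by' p / 2" using E E1_pos by_bound(1)[of p] by simp
  show ?thesis
  proof (cases "l / 2 \<le> \<bar>?s\<bar>")
    case True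
    then have "(l/2)\<^sup>2 \<le> ?s\<^sup>2" using l by (intro sq_le_of_abs_le) auto
    then have "l\<^sup>2 \<le> 4 * R (fst p)" using c by (simp add: R_def power_divide)
    moreover have "k * (3 + \<delta>) * c * 8 \<le> m0 * l\<^sup>2"
    proof -
      have "k * (3 + \<delta>) * c * 8 = 2 * c * (3 + \<delta>)\<^sup>2" 
      proof -
        have "t / 4 * t * c * 8 = 2 * c * (t * t)" for t by simp
        then show ?thesis by (simp only: k_def power2_eq_square)
      qed
      then show ?thesis using c_small unfolding m0_def by (simp only:)
    qed
    moreover have "m0 * l\<^sup>2 \<le> m0 * (4 * R (fst p))" using calculation(1) constants by (intro mult_left_mono) auto
    ultimately have "k * (3 + \<delta>) * c \<le> m0 / 2 * R (fst p)" by linarith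
    then have "k * (3 + \<delta>) * (c / R (fst p)) \<le> m0 / 2" using R_pos[of "fst p"] by (simp add: pos_divide_le_eq)
    then have "k * (3 + \<delta>) * (c / R (fst p)) * e (fst p) \<le> m0 / 2 * e (fst p)"
      using e_pos by (intro mult_right_mono) (auto intro: less_imp_le)
    then show ?thesis using by0 by linarith
  next
    case False
    have "?s\<^sup>2 \<le> (l/2)\<^sup>2" using False l by (intro abs_le_square_iff[THEN iffD1]) auto
    then have "3/4 * l\<^sup>2 \<le> l\<^sup>2 - ?s\<^sup>2" by (simp add: power_divide)
    then have m: "3/4 * l\<^sup>2 \<le> max 0 (l\<^sup>2 - ?s\<^sup>2)" by linarith
    have "(3/4 * l\<^sup>2)\<^sup>2 \<le> bump_sq l ?s" unfolding bump_sq_def by (rule power_mono[OF m]) simp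
    also have "(3/4 * l\<^sup>2)\<^sup>2 = 9/16 * l^4" by (simp add: power_mult_distrib power_divide)
    finally have \<beta>: "9/16 * (\<eta> * l^4) \<le> by' p" using \<eta> by (simp add: by'_def)
    let ?ec = "c powr (- ((3 + \<delta>) / 2))"
    have "c / R (fst p) * e (fst p) \<le> 1 * ?ec"
      using R_pos[of "fst p"] c e_le[of "fst p"] e_pos[of "fst p"] by (intro mult_mono) (auto simp: divide_le_eq)
    then have "k * (3 + \<delta>) * (c / R (fst p) * e (fst p)) \<le> k * (3 + \<delta>) * ?ec" using k3 by (intro mult_left_mono) auto
    also have "\<dots> = E1 * (9/16 * (\<eta> * l^4)) / 2" using \<eta> l by (simp add: E1_def)
    also have "\<dots> \<le> E * by' p / 2"
      by (intro divide_right_mono mult_mono E \<beta>) (use E E1_pos \<eta> l in auto)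
    finally show ?thesis using e_pos[of "fst p"] constants by (simp add: mult.assoc add_increasing)
  qed
qed

text \<open>Applies \<open>form_lower_bound\<close> at each point; the smallness conditions on
  \<open>\<eta>\<close> and \<open>c\<close> enter through its assumptions \<open>A1\<close> and
  \<open>A2\<close>.\<close>

lemma form_bound:
  assumes x: "x \<in> \<Omega>" and E: "E1 \<le> E"
  shows "c1 * (w' (fst x) * (norm (p x))\<^sup>2 + by' x * (norm (q x))\<^sup>2 + e (fst x) * (norm (u x))\<^sup>2) \<le> multiplier_form E w'' G G' u p q x"
proof -
  let ?s = "fst x - x0" and ?e = "e (fst x)" and ?R = "R (fst x)"
  \<comment> \<open>Cut off to the strip because \<open>A1\<close> compares \<open>X\<close> with
    \<open>w'\<close>, which decays at infinity; outside the strip \<open>bx\<close> and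
    \<open>by'\<close> vanish anyway.\<close>
  define X where "X = (if \<bar>?s\<bar> < l then 16 * \<eta> * l\<^sup>2 * D\<^sup>2 else 0)"
  have X0: "0 \<le> X" using \<eta> by (simp add: X_def)
  have X1: "(bx x)\<^sup>2 \<le> X * by' x"
    using bx_sq_bound[OF x] bump_sq_zero[OF l(1), of ?s] by (cases "\<bar>?s\<bar> < l") (auto simp: X_def bx_def)
  have A1: "by' x / 2 + X \<le> \<mu> / 2 * (?R * ?e)"
  proof (cases "\<bar>?s\<bar> < l")
    case False
    then show ?thesis using bump_sq_zero[OF l(1), of ?s] constants R_pos[of "fst x"] e_pos[of "fst x"] by (simp add: X_def by'_def)
  next
    case True
    have "by' x / 2 + X \<le> \<eta> * (l^4 / 2 + 16 * l\<^sup>2 * D\<^sup>2)" using by_bound(2)[of x] True by (simp add: X_def algebra_simps)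
    also have "\<dots> \<le> \<mu> / 2 * (c + l\<^sup>2) powr (- ((1 + \<delta>) / 2))" using \<eta>_small' by (simp add: \<mu>_def)
    also have "\<dots> \<le> \<mu> / 2 * w' (fst x)"
      unfolding w'_eq using constants True \<delta> c by (intro mult_left_mono decay_mono) auto
    finally show ?thesis by (simp add: w'_Re)
  qed
  have "\<mu> / 2 * ((?R * ?e) * (norm (p x))\<^sup>2) + by' x * (norm (q x))\<^sup>2 / 4 + m0 / 2 * (?e * (norm (u x))\<^sup>2) \<le>
    (?R * ?e) * (norm (p x))\<^sup>2 + by' x * (norm (q x))\<^sup>2 / 2 - by' x * (norm (p x))\<^sup>2 / 2 + bx x * (p x \<bullet> q x) + E * (by' x * (norm (u x))\<^sup>2) / 2 + (- ((1 + \<delta>) * ?s * ?e)) * (u x \<bullet> p x) / 2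
     + 2 * ((- (k * ?s * ?e)) * (u x \<bullet> p x)) + ?e * (k * (2 + \<delta>) - k * (3 + \<delta>) * (c / ?R)) * (norm (u x))\<^sup>2"
    by (rule form_lower_bound[OF \<delta> R_def c e_pos k_def constants(4,1,2) by_bound(1) X1 X0 Cauchy_Schwarz_ineq2 Cauchy_Schwarz_ineq2 norm_ge_zero norm_ge_zero norm_ge_zero A1 absorb_potential[OF E]])
  moreover have "c1 * (w' (fst x) * (norm (p x))\<^sup>2 + by' x * (norm (q x))\<^sup>2 + e (fst x) * (norm (u x))\<^sup>2) \<le> \<mu> / 2 * ((?R * ?e) * (norm (p x))\<^sup>2) + by' x * (norm (q x))\<^sup>2 / 4 + m0 / 2 * (?e * (norm (u x))\<^sup>2)"
  proof -
    have "c1 * (w' (fst x) * (norm (p x))\<^sup>2) \<le> \<mu> / 2 * ((?R * ?e) * (norm (p x))\<^sup>2)"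
      unfolding w'_Re using c1 R_pos[of "fst x"] e_pos[of "fst x"] by (intro mult_right_mono) auto
    moreover have "c1 * (by' x * (norm (q x))\<^sup>2) \<le> 1/4 * (by' x * (norm (q x))\<^sup>2)"
      using c1 by_bound(1)[of x] by (intro mult_right_mono) auto
    moreover have "c1 * (e (fst x) * (norm (u x))\<^sup>2) \<le> m0 / 2 * (?e * (norm (u x))\<^sup>2)"
      using c1 e_pos[of "fst x"] by (intro mult_right_mono) auto
    ultimately show ?thesis by (simp add: distrib_left)
  qed
  ultimately show ?thesis unfolding multiplier_form_def power2_norm_eq_inner w'_Re w''_def G_def G'_def by linarith
qed

end

context decay_field
begin

section \<open>The a priori estimate for solutions\<close>

definition C2 :: "real \<Rightarrow> real" where
  "C2 A = A * B0\<^sup>2 / (2 * c1 * c) + A * c powr (- ((3 + \<delta>) / 2)) * (\<eta> * l^4 * D\<^sup>2) / (2 * c1) + A * B0\<^sup>2 / (2 * c1)"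

lemma C2_nonneg: "0 \<le> A \<Longrightarrow> 0 \<le> C2 A"
  using c1 c \<eta> by (simp add: C2_def)

text \<open>The quadratic form controls \<open>u_y\<close> only with the weight \<open>by'\<close>,
  so the term \<open>b u_y\<close> on the right side can be absorbed only if \<open>b^2\<close> is
  dominated by \<open>by'\<close>.\<close>

lemma b_sq_bound: 
  assumes "p \<in> \<Omega>" shows "(b p)\<^sup>2 \<le> (\<eta> * l^4 * D\<^sup>2) * by' p"
proof -
  let ?\<chi> = "bump_sq l (fst p - x0)"
  have "(b p)\<^sup>2 \<le> (\<eta> * ?\<chi> * D)\<^sup>2" using b_bound'[OF assms] by (intro abs_le_square_iff[THEN iffD1]) auto
  also have "\<dots> = (\<eta> * D\<^sup>2 * by' p) * ?\<chi>" by (simp add: by'_def power2_eq_square)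
  also have "\<dots> \<le> (\<eta> * D\<^sup>2 * by' p) * l^4" using bump_sq_bounds(2)[OF l(1)] by_bound(1)[of p] \<eta> by (intro mult_left_mono) auto
  finally show ?thesis by (simp add: mult_ac)
qed

text \<open>\<open>t\<close> stands for the value of the weight at \<open>x\<close>. Three
  applications of Young's inequality let half of the coercive form absorb the right side; the term
  with \<open>p\<close> uses that \<open>w'\<close> is \<open>R\<close> times \<open>e\<close> with
  \<open>R\<close> at least \<open>c\<close>, so that \<open>t^2 / w'\<close> stays bounded.\<close>

lemma rhs_bound:
  fixes u p q F :: complex
  assumes x: "x \<in> \<Omega>" and t: "0 \<le> t" "t\<^sup>2 \<le> A * e (fst x)" and A: "0 \<le> A"
  shows "(t *\<^sub>R F) \<bullet> (w (fst x) *\<^sub>R p + b x *\<^sub>R q) + (t *\<^sub>R F) \<bullet> (w' (fst x) *\<^sub>R u) / 2 \<le>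
    c1 / 2 * (w' (fst x) * (norm p)\<^sup>2 + by' x * (norm q)\<^sup>2 + e (fst x) * (norm u)\<^sup>2) + C2 A * (norm F)\<^sup>2"
proof -
  let ?T = "t * norm F" and ?e = "e (fst x)" and ?w' = "w' (fst x)" and ?ec = "c powr (- ((3 + \<delta>) / 2))"
  have e0: "0 < ?e" and w'0: "0 < ?w'" using e_pos w'_bounds(1) by auto
  have cs: "(t *\<^sub>R F) \<bullet> (r *\<^sub>R z) \<le> norm z * (\<bar>r\<bar> * ?T)" for r and z :: complex
    using norm_cauchy_schwarz[of "t *\<^sub>R F" "r *\<^sub>R z"] t by (simp add: mult_ac)
  have TT: "?T\<^sup>2 \<le> A * ?e * (norm F)\<^sup>2" using t(2) by (simp add: power_mult_distrib mult_right_mono)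
  have 1: "(t *\<^sub>R F) \<bullet> (w (fst x) *\<^sub>R p) \<le> c1 / 2 * (?w' * (norm p)\<^sup>2) + A * B0\<^sup>2 / (2 * c1 * c) * (norm F)\<^sup>2"
  proof -
    have "(t *\<^sub>R F) \<bullet> (w (fst x) *\<^sub>R p) \<le> norm p * (\<bar>w (fst x)\<bar> * ?T)" by (rule cs)
    also have "\<dots> \<le> norm p * (B0 * ?T)" using w_bound t by (intro mult_left_mono mult_right_mono) auto
    also have "\<dots> \<le> (c1 / 2 * ?w') * (norm p)\<^sup>2 + (B0 * ?T)\<^sup>2 / (4 * (c1 / 2 * ?w'))" using c1 w'0 by (intro young) auto
    also have "(B0 * ?T)\<^sup>2 / (4 * (c1 / 2 * ?w')) \<le> (B0\<^sup>2 * (A * ?e * (norm F)\<^sup>2)) / (4 * (c1 / 2 * ?w'))"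
      using TT c1 w'0 by (intro divide_right_mono) (auto simp: power_mult_distrib intro!: mult_left_mono)
    also have "\<dots> = A * B0\<^sup>2 / (2 * c1 * R (fst x)) * (norm F)\<^sup>2"
      using e0 by (simp add: w'_Re mult_ac)
    also have "\<dots> \<le> A * B0\<^sup>2 / (2 * c1 * c) * (norm F)\<^sup>2"
      using c1 c R_pos[of "fst x"] A by (intro mult_right_mono divide_left_mono mult_left_mono mult_pos_pos) auto
    finally show ?thesis by (simp add: mult.assoc)
  qed
  have 2: "(t *\<^sub>R F) \<bullet> (b x *\<^sub>R q) \<le> c1 / 2 * (by' x * (norm q)\<^sup>2) + A * ?ec * (\<eta> * l^4 * D\<^sup>2) / (2 * c1) * (norm F)\<^sup>2"
  proof (cases "by' x = 0")
    case True
    then have "b x = 0" using b_sq_bound[OF x] by simp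
    then show ?thesis using True A \<eta> c1 by simp
  next
    case False
    then have by0: "0 < by' x" using by_bound(1)[of x] by simp
    have "(t *\<^sub>R F) \<bullet> (b x *\<^sub>R q) \<le> norm q * (\<bar>b x\<bar> * ?T)" by (rule cs)
    also have "\<dots> \<le> (c1 / 2 * by' x) * (norm q)\<^sup>2 + (\<bar>b x\<bar> * ?T)\<^sup>2 / (4 * (c1 / 2 * by' x))" using c1 by0 by (intro young) auto
    also have "(\<bar>b x\<bar> * ?T)\<^sup>2 / (4 * (c1 / 2 * by' x)) \<le> (((\<eta> * l^4 * D\<^sup>2) * by' x) * (A * ?ec * (norm F)\<^sup>2)) / (4 * (c1 / 2 * by' x))"
    proof -
      have "A * ?e * (norm F)\<^sup>2 \<le> A * ?ec * (norm F)\<^sup>2" using A e_le by (intro mult_right_mono mult_left_mono) auto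
      then have "(\<bar>b x\<bar> * ?T)\<^sup>2 \<le> ((\<eta> * l^4 * D\<^sup>2) * by' x) * (A * ?ec * (norm F)\<^sup>2)"
        unfolding power_mult_distrib[of "\<bar>b x\<bar>"] power2_abs using TT b_sq_bound[OF x] \<eta> by0 by (intro mult_mono) auto
      then show ?thesis using c1 by0 by (intro divide_right_mono) auto
    qed
    also have "\<dots> = A * ?ec * (\<eta> * l^4 * D\<^sup>2) / (2 * c1) * (norm F)\<^sup>2" using by0 by simp
    finally show ?thesis by (simp add: mult.assoc)
  qed
  have 3: "(t *\<^sub>R F) \<bullet> (?w' *\<^sub>R u) / 2 \<le> c1 / 2 * (?e * (norm u)\<^sup>2) + A * B0\<^sup>2 / (2 * c1) * (norm F)\<^sup>2"
  proof -
    have "(t *\<^sub>R F) \<bullet> (?w' *\<^sub>R u) \<le> norm u * (\<bar>?w'\<bar> * ?T)" by (rule cs)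
    also have "\<dots> \<le> norm u * (B0 * ?T)" using w'0 w'_bounds(2)[of "fst x"] t by (intro mult_left_mono mult_right_mono) auto
    also have "\<dots> \<le> (c1 * ?e) * (norm u)\<^sup>2 + (B0 * ?T)\<^sup>2 / (4 * (c1 * ?e))" using c1 e0 by (intro young) auto
    also have "(B0 * ?T)\<^sup>2 / (4 * (c1 * ?e)) \<le> (B0\<^sup>2 * (A * ?e * (norm F)\<^sup>2)) / (4 * (c1 * ?e))"
      using TT c1 e0 by (intro divide_right_mono) (auto simp: power_mult_distrib intro!: mult_left_mono)
    also have "\<dots> = A * B0\<^sup>2 / (4 * c1) * (norm F)\<^sup>2" using e0 by simp
    finally have "(t *\<^sub>R F) \<bullet> (?w' *\<^sub>R u) \<le> c1 * (?e * (norm u)\<^sup>2) + A * B0\<^sup>2 / (4 * c1) * (norm F)\<^sup>2" by (simp only: mult.assoc)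
    moreover have "A * B0\<^sup>2 / (4 * c1) * (norm F)\<^sup>2 \<le> 2 * (A * B0\<^sup>2 / (2 * c1) * (norm F)\<^sup>2)"
    proof -
      have "0 \<le> A * B0\<^sup>2 / c1 * (norm F)\<^sup>2" using A c1 by simp
      then show ?thesis by simp
    qed
    ultimately show ?thesis by linarith
  qed
  have "C2 A * (norm F)\<^sup>2 = A * B0\<^sup>2 / (2 * c1 * c) * (norm F)\<^sup>2 + A * ?ec * (\<eta> * l^4 * D\<^sup>2) / (2 * c1) * (norm F)\<^sup>2 + A * B0\<^sup>2 / (2 * c1) * (norm F)\<^sup>2"
    by (simp only: C2_def distrib_right)
  then show ?thesis using 1 2 3 unfolding inner_add_right distrib_left by linarith
qed

text \<open>The term with \<open>\<epsilon>\<close> is bounded by \<open>sqrt (1 + E)\<close> times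
  the norms of \<open>F\<close> and of the weighted solution. The latter norm, squared, is at most
  \<open>A\<close> times the coercive integral, so it can be absorbed on the left; the price is the
  square of \<open>sqrt (1 + E)\<close>.\<close>

lemma weighted_bound:
  assumes u: "weak_solution \<Omega> u p q (\<lambda>x. wt (fst x) *\<^sub>R F x + Complex E \<epsilon> * u x)" and F: "sqint M F"
    and wt: "continuous_on UNIV wt" "\<And>x. 0 \<le> wt x" "\<And>x. wt x \<le> 1" "\<And>x. (wt x)\<^sup>2 \<le> A * e x" and A: "0 < A"
    and E: "E1 \<le> E" and \<epsilon>: "0 < \<epsilon>" "\<epsilon> \<le> 1"
  shows "(nrm M (\<lambda>x. wt (fst x) *\<^sub>R u x))\<^sup>2 \<le> (4 * A / c1) * (C2 A + 2 * B\<^sup>2 * A / c1) * (1 + E) * (nrm M F)\<^sup>2"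
proof -
  have E0: "0 < E" using E E1_pos by linarith
  have U: "jet u p q \<in> H10 \<Omega>" using u by (simp add: weak_solution_def)
  note s = H10_jet_sqint[OF U]
  have wtm: "(\<lambda>x. wt (fst x)) \<in> borel_measurable M"
    by (rule continuous_measurable_lebesgue_on) (intro continuous_on_compose2[OF wt(1)] continuous_intros, auto)
  have wtb: "\<bar>wt (fst x)\<bar> \<le> 1" for x :: "plane" using wt(2,3)[of "fst x"] by simp
  have sf: "sqint M (\<lambda>x. wt (fst x) *\<^sub>R F x)" and sT: "sqint M (\<lambda>x. wt (fst x) *\<^sub>R u x)"
    using sqint_scale[OF F wtm wtb] sqint_scale[OF s(1) wtm wtb] by auto
  have em: "(\<lambda>x. e (fst x)) \<in> borel_measurable M"
    by (rule continuous_measurable_lebesgue_on) (intro continuous_on_compose2[OF e_cont] continuous_intros, auto)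
  have eb: "\<bar>e (fst x)\<bar> \<le> c powr (- ((3 + \<delta>) / 2))" for x :: "plane" using e_le[of "fst x"] e_pos[of "fst x"] by simp
  define N where "N x = w' (fst x) * (norm (p x))\<^sup>2 + by' x * (norm (q x))\<^sup>2 + e (fst x) * (norm (u x))\<^sup>2" for x
  have i: "integrable M (\<lambda>x. w' (fst x) * (norm (p x))\<^sup>2)" "integrable M (\<lambda>x. by' x * (norm (q x))\<^sup>2)" "integrable M (\<lambda>x. e (fst x) * (norm (u x))\<^sup>2)"
    unfolding power2_norm_eq_inner using s field_measurable em bounds(2,5) eb by (auto intro!: sqint_inner_bounded)
  have Ni: "integrable M N" unfolding N_def[abs_def] by (intro Bochner_Integration.integrable_add i)
  define V where "V = (\<integral>x. e (fst x) * (norm (u x))\<^sup>2 \<partial>M)"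
  have VN: "V \<le> (\<integral>x. N x \<partial>M)"
    unfolding V_def N_def
  proof (intro integral_mono Bochner_Integration.integrable_add i)
    show "e (fst x) * (norm (u x))\<^sup>2 \<le> w' (fst x) * (norm (p x))\<^sup>2 + by' x * (norm (q x))\<^sup>2 + e (fst x) * (norm (u x))\<^sup>2" for x
      using by_bound(1)[of x] less_imp_le[OF w'_bounds(1)[of "fst x"]] by simp
  qed
  let ?T = "nrm M (\<lambda>x. wt (fst x) *\<^sub>R u x)"
  have TV: "?T\<^sup>2 \<le> A * V"
  proof -
    have "?T\<^sup>2 \<le> (\<integral>x. A * (e (fst x) * (norm (u x))\<^sup>2) \<partial>M)"
      unfolding nrm_sq
    proof (intro integral_mono)
      show "(norm (wt (fst x) *\<^sub>R u x))\<^sup>2 \<le> A * (e (fst x) * (norm (u x))\<^sup>2)" for x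
        using mult_right_mono[OF wt(4)[of "fst x"], of "(norm (u x))\<^sup>2"] by (simp add: power_mult_distrib mult.assoc)
    qed (use sT i in \<open>auto simp: sqint_def\<close>)
    then show ?thesis by (simp add: V_def)
  qed
  have S: "\<bar>ip M (\<lambda>x. wt (fst x) *\<^sub>R F x) u\<bar> \<le> nrm M F * ?T" "\<bar>ip M (\<lambda>x. wt (fst x) *\<^sub>R F x) (\<lambda>x. \<i> * u x)\<bar> \<le> nrm M F * ?T"
  proof -
    have "ip M (\<lambda>x. wt (fst x) *\<^sub>R F x) u = ip M F (\<lambda>x. wt (fst x) *\<^sub>R u x)" by (simp add: ip_def)
    then show "\<bar>ip M (\<lambda>x. wt (fst x) *\<^sub>R F x) u\<bar> \<le> nrm M F * ?T" using ip_bound[OF F sT] by simp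
    have "ip M (\<lambda>x. wt (fst x) *\<^sub>R F x) (\<lambda>x. \<i> * u x) = ip M F (\<lambda>x. \<i> * (wt (fst x) *\<^sub>R u x))" by (simp add: ip_def)
    moreover have "nrm M (\<lambda>x. \<i> * (wt (fst x) *\<^sub>R u x)) = ?T" by (simp add: nrm_def norm_mult)
    ultimately show "\<bar>ip M (\<lambda>x. wt (fst x) *\<^sub>R F x) (\<lambda>x. \<i> * u x)\<bar> \<le> nrm M F * ?T" using ip_bound[OF F sqint_cmult[OF sT, of \<i>]] by simp
  qed
  have flowb: "nrm M (flow p q) \<le> sqrt 2 * B * sqrt ((nrm M p)\<^sup>2 + (nrm M q)\<^sup>2)"
  proof (rule power2_le_imp_le)
    have "(nrm M (flow p q))\<^sup>2 \<le> (\<integral>x. 2 * B\<^sup>2 * ((norm (p x))\<^sup>2 + (norm (q x))\<^sup>2) \<partial>M)"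
      unfolding nrm_sq flow_def using flow_sqint[OF s(2,3)] s field_quotient_bound
      by (intro integral_mono) (auto simp: sqint_def flow_def[abs_def])
    also have "\<dots> = 2 * B\<^sup>2 * ((nrm M p)\<^sup>2 + (nrm M q)\<^sup>2)" using s by (simp add: sqint_def nrm_sq)
    also have "\<dots> = (sqrt 2 * B * sqrt ((nrm M p)\<^sup>2 + (nrm M q)\<^sup>2))\<^sup>2" by (simp add: power_mult_distrib)
    finally show "(nrm M (flow p q))\<^sup>2 \<le> (sqrt 2 * B * sqrt ((nrm M p)\<^sup>2 + (nrm M q)\<^sup>2))\<^sup>2" .
  qed (use B_ge in simp)
  have eps: "\<epsilon> * ip M (\<lambda>x. \<i> * u x) (flow p q) \<le> sqrt 2 * B * sqrt (1 + E) * nrm M F * ?T"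
  proof -
    have "ip M (\<lambda>x. \<i> * u x) (flow p q) \<le> nrm M (\<lambda>x. \<i> * u x) * nrm M (flow p q)"
      using ip_bound[OF sqint_cmult[OF s(1)] flow_sqint[OF s(2,3)], of \<i>] by simp
    also have "nrm M (\<lambda>x. \<i> * u x) = nrm M u" by (simp add: nrm_def norm_mult)
    also have "nrm M u * nrm M (flow p q) \<le> nrm M u * (sqrt 2 * B * sqrt ((nrm M p)\<^sup>2 + (nrm M q)\<^sup>2))"
      by (rule mult_left_mono[OF flowb]) simp
    finally have "\<epsilon> * ip M (\<lambda>x. \<i> * u x) (flow p q) \<le> \<epsilon> * (nrm M u * (sqrt 2 * B * sqrt ((nrm M p)\<^sup>2 + (nrm M q)\<^sup>2)))"
      using \<epsilon> by (intro mult_left_mono) auto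
    also have "\<dots> = sqrt 2 * B * (\<epsilon> * nrm M u * sqrt ((nrm M p)\<^sup>2 + (nrm M q)\<^sup>2))" by simp
    also have "\<dots> \<le> sqrt 2 * B * (sqrt (1 + E) * (nrm M F * ?T))"
      using B_ge by (intro mult_left_mono energy_absorption[OF u sf E0 \<epsilon> S]) auto
    finally show ?thesis by (simp add: mult.assoc)
  qed
  note mi = multiplier_inequality[OF u sf w''_deriv w''_cont multiplier_bounds(1) G_deriv G'_cont multiplier_bounds(2,3)]
  have "c1 * (\<integral>x. N x \<partial>M) = (\<integral>x. c1 * N x \<partial>M)" by simp
  also have "\<dots> \<le> (\<integral>x. multiplier_form E w'' G G' u p q x \<partial>M)"
    by (rule integral_mono[OF integrable_mult_right[OF Ni] mi(1)]) (use form_bound[OF _ E] in \<open>simp add: N_def\<close>)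
  also have "\<dots> \<le> ip M (\<lambda>x. wt (fst x) *\<^sub>R F x) (flow p q) + ip M (\<lambda>x. wt (fst x) *\<^sub>R F x) (\<lambda>x. w' (fst x) *\<^sub>R u x) / 2 + \<epsilon> * ip M (\<lambda>x. \<i> * u x) (flow p q)"
    by (rule mi(2))
  finally have main: "c1 * (\<integral>x. N x \<partial>M) \<le> ip M (\<lambda>x. wt (fst x) *\<^sub>R F x) (flow p q) + ip M (\<lambda>x. wt (fst x) *\<^sub>R F x) (\<lambda>x. w' (fst x) *\<^sub>R u x) / 2 + \<epsilon> * ip M (\<lambda>x. \<i> * u x) (flow p q)" .
  have sw: "sqint M (\<lambda>x. w' (fst x) *\<^sub>R u x)" using sqint_scale[OF s(1) field_measurable(2)] bounds(2) by auto
  have ii: "integrable M (\<lambda>x. (wt (fst x) *\<^sub>R F x) \<bullet> flow p q x)" "integrable M (\<lambda>x. (wt (fst x) *\<^sub>R F x) \<bullet> (w' (fst x) *\<^sub>R u x) / 2)"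
    using sqint_inner[OF sf flow_sqint[OF s(2,3)]] sqint_inner[OF sf sw] by auto
  have "ip M (\<lambda>x. wt (fst x) *\<^sub>R F x) (flow p q) + ip M (\<lambda>x. wt (fst x) *\<^sub>R F x) (\<lambda>x. w' (fst x) *\<^sub>R u x) / 2
      = (\<integral>x. (wt (fst x) *\<^sub>R F x) \<bullet> flow p q x + (wt (fst x) *\<^sub>R F x) \<bullet> (w' (fst x) *\<^sub>R u x) / 2 \<partial>M)"
    using Bochner_Integration.integral_add[OF ii] by (simp add: ip_def)
  also have "\<dots> \<le> (\<integral>x. c1 / 2 * N x + C2 A * (norm (F x))\<^sup>2 \<partial>M)"
  proof (rule integral_mono)
    show "integrable M (\<lambda>x. (wt (fst x) *\<^sub>R F x) \<bullet> flow p q x + (wt (fst x) *\<^sub>R F x) \<bullet> (w' (fst x) *\<^sub>R u x) / 2)"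
      by (rule Bochner_Integration.integrable_add[OF ii])
    show "integrable M (\<lambda>x. c1 / 2 * N x + C2 A * (norm (F x))\<^sup>2)"
      using Ni F by (intro Bochner_Integration.integrable_add integrable_mult_right) (auto simp: sqint_def)
    show "(wt (fst x) *\<^sub>R F x) \<bullet> flow p q x + (wt (fst x) *\<^sub>R F x) \<bullet> (w' (fst x) *\<^sub>R u x) / 2 \<le> c1 / 2 * N x + C2 A * (norm (F x))\<^sup>2"
      if "x \<in> space M" for x
      using rhs_bound[OF _ wt(2,4) less_imp_le[OF A], of x "F x" "p x" "q x" "u x"] that unfolding N_def flow_def by simp
  qed
  also have "\<dots> = c1 / 2 * (\<integral>x. N x \<partial>M) + C2 A * (nrm M F)\<^sup>2"
    using Ni F by (simp add: nrm_sq sqint_def)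
  finally have "c1 / 2 * (\<integral>x. N x \<partial>M) \<le> C2 A * (nrm M F)\<^sup>2 + sqrt 2 * B * sqrt (1 + E) * nrm M F * ?T"
    using main eps by linarith
  moreover have "c1 / 2 * V \<le> c1 / 2 * (\<integral>x. N x \<partial>M)" using VN c1 by (intro mult_left_mono) auto
  moreover have "c1 / (2 * A) * ?T\<^sup>2 \<le> c1 / (2 * A) * (A * V)" using TV c1 A by (intro mult_left_mono) auto
  moreover have "c1 / (2 * A) * (A * V) = c1 / 2 * V" using A by simp
  \<comment> \<open>The left side holds \<open>c1 / (2 * A)\<close> times the square of
    \<open>?T\<close>; Young's inequality is weighted to consume exactly half of it.\<close>
  moreover have "?T * (sqrt 2 * B * sqrt (1 + E) * nrm M F) \<le> c1 / (4 * A) * ?T\<^sup>2 + (sqrt 2 * B * sqrt (1 + E) * nrm M F)\<^sup>2 / (4 * (c1 / (4 * A)))"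
    using c1 A by (intro young) auto
  moreover have "?T * (sqrt 2 * B * sqrt (1 + E) * nrm M F) = sqrt 2 * B * sqrt (1 + E) * nrm M F * ?T" by simp
  moreover have "(sqrt 2 * B * sqrt (1 + E) * nrm M F)\<^sup>2 / (4 * (c1 / (4 * A))) = 2 * B\<^sup>2 * A / c1 * (1 + E) * (nrm M F)\<^sup>2"
    using E0 by (simp add: power_mult_distrib)
  moreover have "c1 / (2 * A) * ?T\<^sup>2 = c1 / (4 * A) * ?T\<^sup>2 + c1 / (4 * A) * ?T\<^sup>2" using A by (simp add: field_simps)
  ultimately have "c1 / (4 * A) * ?T\<^sup>2 \<le> C2 A * (nrm M F)\<^sup>2 + 2 * B\<^sup>2 * A / c1 * (1 + E) * (nrm M F)\<^sup>2" by linarith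
  also have "\<dots> \<le> C2 A * (1 + E) * (nrm M F)\<^sup>2 + 2 * B\<^sup>2 * A / c1 * (1 + E) * (nrm M F)\<^sup>2"
    using C2_nonneg[of A] A E0 by (intro add_right_mono mult_right_mono) (auto simp: mult_le_cancel_left1)
  also have "\<dots> = (C2 A + 2 * B\<^sup>2 * A / c1) * (1 + E) * (nrm M F)\<^sup>2" by (simp add: distrib_right)
  finally have "4 * A / c1 * (c1 / (4 * A) * ?T\<^sup>2) \<le> 4 * A / c1 * ((C2 A + 2 * B\<^sup>2 * A / c1) * (1 + E) * (nrm M F)\<^sup>2)"
    using A c1 by (intro mult_left_mono) auto
  moreover have "4 * A / c1 * (c1 / (4 * A) * ?T\<^sup>2) = ?T\<^sup>2" using A c1 by simp
  ultimately show ?thesis by (simp only: mult.assoc)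
qed

end

section \<open>The resolvent estimate\<close>

text \<open>The density is dominated by a multiple of \<open>(1 + s)^(-1-\<delta>)\<close> with
  \<open>s = x - x0\<close>, whose primitive \<open>g\<close> stays between
  \<open>- (K / \<delta>)\<close> and \<open>0\<close>. Here \<open>0 < \<delta>\<close> is what
  makes \<open>w\<close> bounded.\<close>

lemma decay_primitive_increment:
  assumes c: "0 < c" and \<delta>: "0 < \<delta>" and V: "\<And>x. (V has_real_derivative decay c x0 (- ((1 + \<delta>) / 2)) x) (at x)" and x: "x0 \<le> x"
  shows "V x - V x0 \<le> (min c 1 / 2) powr (- ((1 + \<delta>) / 2)) / \<delta>"
proof -
  \<comment> \<open>From \<open>(1 + s)^2 \<le> 2 * (1 + s^2)\<close> it follows that
    \<open>\<kappa> * (1 + s)^2\<close> is at most \<open>c + s^2\<close>.\<close>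
  define \<kappa> where "\<kappa> = min c 1 / 2"
  have \<kappa>: "0 < \<kappa>" using c by (simp add: \<kappa>_def)
  define K where "K = \<kappa> powr (- ((1 + \<delta>) / 2))"
  have K: "0 < K" using \<kappa> by (simp add: K_def)
  define g where "g x = - (K / \<delta>) * (1 + (x - x0)) powr (- \<delta>)" for x
  have "g x0 - V x0 \<le> g x - V x"
  proof (rule DERIV_nonneg_imp_nondecreasing[OF x])
    fix t assume t: "x0 \<le> t" "t \<le> x"
    let ?s = "1 + (t - x0)"
    have s: "0 < ?s" using t by simp
    have "(g has_real_derivative K * ?s powr (- \<delta> - 1)) (at t)"
    proof -
      have "((\<lambda>x. 1 + (x - x0)) has_real_derivative 1) (at t)" by (auto intro!: derivative_eq_intros)
      from DERIV_cmult[OF DERIV_chain2[OF has_real_derivative_powr[OF s, of "- \<delta>"] this], of "- (K / \<delta>)"] show ?thesis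
        using \<delta> by (simp add: g_def[abs_def])
    qed
    from DERIV_diff[OF this V] have "((\<lambda>x. g x - V x) has_real_derivative K * ?s powr (- \<delta> - 1) - decay c x0 (- ((1 + \<delta>) / 2)) t) (at t)" .
    moreover have "decay c x0 (- ((1 + \<delta>) / 2)) t \<le> K * ?s powr (- \<delta> - 1)"
    proof -
      have "\<kappa> * ?s\<^sup>2 \<le> \<kappa> * (2 * (1 + (t - x0)\<^sup>2))"
        using \<kappa> zero_le_power2[of "1 - (t - x0)"] by (intro mult_left_mono) (auto simp: power2_sum power2_diff)
      also have "\<dots> = min c 1 + min c 1 * (t - x0)\<^sup>2" by (simp add: \<kappa>_def algebra_simps)
      also have "\<dots> \<le> c + 1 * (t - x0)\<^sup>2" by (intro add_mono mult_right_mono) auto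
      finally have le: "\<kappa> * ?s\<^sup>2 \<le> c + (t - x0)\<^sup>2" by simp
      have "decay c x0 (- ((1 + \<delta>) / 2)) t \<le> (\<kappa> * ?s\<^sup>2) powr (- ((1 + \<delta>) / 2))"
        unfolding decay_def using \<delta> \<kappa> s by (intro powr_mono2' le) auto
      also have "\<dots> = K * (?s\<^sup>2) powr (- ((1 + \<delta>) / 2))" using \<kappa> by (simp add: powr_mult K_def)
      also have "(?s\<^sup>2) powr (- ((1 + \<delta>) / 2)) = ?s powr (- \<delta> - 1)"
      proof -
        have "?s\<^sup>2 = ?s powr 2" using s by simp
        then have "(?s\<^sup>2) powr (- ((1 + \<delta>) / 2)) = ?s powr (2 * (- ((1 + \<delta>) / 2)))" by (simp only: powr_powr)
        also have "2 * (- ((1 + \<delta>) / 2)) = - \<delta> - 1" by argo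
        finally show ?thesis .
      qed
      finally show ?thesis .
    qed
    ultimately show "\<exists>y. ((\<lambda>x. g x - V x) has_real_derivative y) (at t) \<and> 0 \<le> y" by (intro exI conjI) auto
  qed
  moreover have "g x \<le> 0" using K \<delta> by (simp add: g_def)
  moreover have "g x0 = - (K / \<delta>)" by (simp add: g_def)
  ultimately show ?thesis by (simp add: K_def \<kappa>_def)
qed

lemma decay_primitive_exists:
  assumes c: "0 < c" and \<delta>: "0 < \<delta>"
  obtains w B where "\<And>x. (w has_real_derivative decay c x0 (- ((1 + \<delta>) / 2)) x) (at x)" "w 0 = 0" "\<And>x. \<bar>w x\<bar> \<le> B"
    "\<And>x. decay c x0 (- ((1 + \<delta>) / 2)) x \<le> B"
    "\<And>x y. \<bar>decay c x0 (- ((1 + \<delta>) / 2)) x - decay c x0 (- ((1 + \<delta>) / 2)) y\<bar> \<le> B * \<bar>x - y\<bar>"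
proof -
  let ?a = "- ((1 + \<delta>) / 2)"
  let ?f = "decay c x0 ?a"
  have "isCont ?f x" for x using decay_cont[OF c, of UNIV x0 ?a] by (simp add: continuous_on_eq_continuous_at)
  then obtain V where V: "\<And>x. (V has_vector_derivative ?f x) (at x)"
    using einterval_antiderivative[of "-\<infinity>" "\<infinity>" ?f] by auto
  then have V: "\<And>x. (V has_real_derivative ?f x) (at x)" by (simp add: has_real_derivative_iff_has_vector_derivative)
  define L where "L = (min c 1 / 2) powr ?a / \<delta>"
  have L0: "0 \<le> L" using \<delta> by (simp add: L_def)
  have mono: "V x \<le> V y" if "x \<le> y" for x y
    by (rule DERIV_nonneg_imp_nondecreasing[OF that]) (use V decay_pos[OF c] in \<open>blast intro: less_imp_le\<close>)
  have bound: "\<bar>V x - V x0\<bar> \<le> L" for x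
  proof (cases "x0 \<le> x")
    case True
    then show ?thesis using decay_primitive_increment[OF c \<delta> V True] mono[OF True] by (simp add: L_def)
  next
    case False
    \<comment> \<open>The left half line is reduced to the right one by reflection about
      \<open>x0\<close>, under which the density is symmetric.\<close>
    have d: "((\<lambda>x. - V (2 * x0 - x)) has_real_derivative ?f x) (at x)" for x
    proof -
      have "((\<lambda>x. 2 * x0 - x) has_real_derivative -1) (at x)" by (auto intro!: derivative_eq_intros)
      from DERIV_minus[OF DERIV_chain2[OF V this]] have "((\<lambda>x. - V (2 * x0 - x)) has_real_derivative ?f (2 * x0 - x)) (at x)" by simp
      moreover have "?f (2 * x0 - x) = ?f x" by (simp add: decay_def power2_commute)
      ultimately show ?thesis by simp
    qed
    show ?thesis using decay_primitive_increment[OF c \<delta> d, of "2 * x0 - x"] mono[of x x0] False by (simp add: L_def)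
  qed
  define B where "B = 2 * L + c powr ?a + (1 + \<delta>) * (c powr ?a / sqrt c)"
  have p: "0 \<le> c powr ?a" "0 \<le> (1 + \<delta>) * (c powr ?a / sqrt c)" using c \<delta> by simp_all
  show ?thesis
  proof (rule that[of "\<lambda>x. V x - V 0" B])
    show "((\<lambda>x. V x - V 0) has_real_derivative ?f x) (at x)" for x
      using DERIV_diff[OF V DERIV_const[of "V 0"]] by simp
    show "\<bar>V x - V 0\<bar> \<le> B" for x using bound[of x] bound[of 0] p unfolding B_def by linarith
    show "?f x \<le> B" for x 
    proof -
      have "?f x \<le> c powr ?a" using \<delta> by (intro decay_le c) auto
      then show ?thesis using p L0 unfolding B_def by linarith
    qed
    show "\<bar>?f x - ?f y\<bar> \<le> B * \<bar>x - y\<bar>" for x y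
    proof -
      have "norm (?f x - ?f y) \<le> (1 + \<delta>) * (c powr ?a / sqrt c) * norm (x - y)"
      proof (rule field_differentiable_bound[of UNIV ?f "\<lambda>x. 2 * ?a * (x - x0) * decay c x0 (?a - 1) x"])
        show "(?f has_field_derivative 2 * ?a * (z - x0) * decay c x0 (?a - 1) z) (at z within UNIV)" for z
          using decay_deriv[OF c, of x0 ?a z] by simp
        show "norm (2 * ?a * (z - x0) * decay c x0 (?a - 1) z) \<le> (1 + \<delta>) * (c powr ?a / sqrt c)" for z
        proof -
          have a2: "2 * ?a = - (1 + \<delta>)" by argo
          have "norm (2 * ?a * (z - x0) * decay c x0 (?a - 1) z) = (1 + \<delta>) * (\<bar>z - x0\<bar> * decay c x0 (?a - 1) z)"
            unfolding a2 using \<delta> decay_pos[OF c, of x0 "?a - 1" z] by (simp add: abs_mult del: minus_add_distrib)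
          also have "\<dots> \<le> (1 + \<delta>) * (decay c x0 ?a z / sqrt c)" using \<delta> by (intro mult_left_mono decay_lin_bound c) auto
          also have "\<dots> \<le> (1 + \<delta>) * (c powr ?a / sqrt c)" using \<delta> c by (intro mult_left_mono divide_right_mono decay_le) auto
          finally show ?thesis .
        qed
      qed auto
      moreover have "(1 + \<delta>) * (c powr ?a / sqrt c) \<le> B" using p L0 unfolding B_def by linarith
      then have "(1 + \<delta>) * (c powr ?a / sqrt c) * norm (x - y) \<le> B * norm (x - y)" by (rule mult_right_mono) simp
      ultimately show ?thesis by simp
    qed
  qed simp
qed

section \<open>Construction of the field from the hypotheses\<close>

lemma finite_lower_bound:
  fixes P :: "'a \<Rightarrow> real \<Rightarrow> bool"
  assumes "finite A" "\<And>i. i \<in> A \<Longrightarrow> \<exists>d>0. P i d" "\<And>i d d'. P i d \<Longrightarrow> d' \<le> d \<Longrightarrow> P i d'"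
  shows "\<exists>d>0. \<forall>i\<in>A. P i d"
proof -
  from assms(2) obtain d where d: "\<And>i. i \<in> A \<Longrightarrow> 0 < d i \<and> P i (d i)" by metis
  let ?d = "Min (insert 1 (d ` A))"
  have "0 < ?d" using assms(1) d by (subst Min_gr_iff) auto
  moreover have "P i ?d" if "i \<in> A" for i
    using assms(3)[of i "d i" ?d] d[OF that] that assms(1) by simp
  ultimately show ?thesis by blast
qed

lemma small_scale:
  fixes P Q X Y :: real
  assumes "0 \<le> P" "0 \<le> Q" "0 < X" "0 < Y"
  shows "\<exists>\<eta>>0. \<eta> * P \<le> X \<and> \<eta> * Q \<le> Y"
proof -
  define \<eta> where "\<eta> = min X Y / (P + Q + 1)"
  have \<eta>: "0 < \<eta>" using assms by (simp add: \<eta>_def add_nonneg_pos)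
  have e: "\<eta> * (P + Q + 1) = min X Y" using assms by (simp add: \<eta>_def add_nonneg_pos less_imp_neq[symmetric])
  have "\<eta> * P \<le> \<eta> * (P + Q + 1)" "\<eta> * Q \<le> \<eta> * (P + Q + 1)" using \<eta> assms by (auto intro!: mult_left_mono)
  then show ?thesis using \<eta> e by (intro exI[of _ \<eta>]) auto
qed

text \<open>The order of the choices matters: \<open>x0\<close> and \<open>l\<close> from the
  interval, \<open>c\<close> from \<open>l\<close>, \<open>w\<close> from \<open>c\<close>, a lower
  bound of \<open>\<bar>w\<bar>\<close> near \<open>x0\<close> from \<open>w\<close>, and
  \<open>\<eta>\<close> last of all, because it is measured against the preceding ones.\<close>

lemma decay_field_exists:
  fixes \<Omega> \<Gamma> :: "plane set" and I :: "real set" and \<Omega>' :: "nat \<Rightarrow> plane set" and a :: "nat \<Rightarrow> real"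
  assumes \<Omega>: "open \<Omega>" "lipschitz_boundary \<Omega>" "locally_convex_or_C11 \<Omega>"
    and horizontal: "\<And>p \<nu>. outward_normal \<Omega> p \<nu> \<Longrightarrow> fst p * fst \<nu> \<le> 0"
    and I: "open I" "I \<noteq> {}" and C: "0 < C"
    and \<Gamma>: "\<And>p \<nu>. p \<in> \<Gamma> \<Longrightarrow> outward_normal \<Omega> p \<nu> \<Longrightarrow> fst p * fst \<nu> \<le> - C"
    and cover: "\<Omega> \<inter> (I \<times> UNIV) = (\<Union>k\<in>{1..K}. \<Omega>' k)"
    and pieces: "\<And>k. k \<in> {1..K} \<Longrightarrow> open (\<Omega>' k) \<and> bounded (\<Omega>' k)"
    and disj: "\<And>j k. j \<in> {1..K} \<Longrightarrow> k \<in> {1..K} \<Longrightarrow> j \<noteq> k \<Longrightarrow> closure (\<Omega>' j) \<inter> closure (\<Omega>' k) = {}"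
    and flat: "\<And>k. k \<in> {1..K} \<Longrightarrow> (frontier \<Omega> \<inter> frontier (\<Omega>' k) \<inter> (I \<times> UNIV)) - \<Gamma> \<subseteq> I \<times> {a k}"
    and \<delta>: "0 < \<delta>"
  shows "\<exists>\<alpha> x0 l D d0 w w' \<eta> B c. decay_field \<Omega> \<alpha> x0 l C D d0 w w' \<eta> B c \<delta>"
proof -
  obtain x0 r where x0: "x0 \<noteq> 0" "0 < r" "ball x0 r \<subseteq> I"
  proof -
    obtain y where y: "y \<in> I" using I by blast
    obtain s where s: "0 < s" "ball y s \<subseteq> I" using I(1) y by (meson openE)
    define x where "x = (if y = 0 then s / 2 else y)"
    have "x \<in> I" using s y by (auto simp: x_def dist_real_def)
    moreover have "x \<noteq> 0" using s by (auto simp: x_def)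
    ultimately show ?thesis using I(1) that by (meson openE)
  qed
  \<comment> \<open>The wider strip of half width \<open>2 * l\<close> must lie over
    \<open>I\<close> and stay away from \<open>x = 0\<close>.\<close>
  define l where "l = min r \<bar>x0\<bar> / 4"
  have l: "0 < l" "2 * l < \<bar>x0\<bar>" using x0 by (auto simp: l_def)
  have strip: "fst p \<in> I" if "\<bar>fst p - x0\<bar> < 2 * l" for p :: "plane"
    using x0(2) that by (intro subsetD[OF x0(3)]) (auto simp: l_def dist_real_def abs_minus_commute)
  \<comment> \<open>Disjoint closures make the piece containing a given point unique; away from the
    pieces the value is arbitrary.\<close>
  define \<alpha> where "\<alpha> p = a (SOME k. k \<in> {1..K} \<and> p \<in> \<Omega>' k)" for p
  have uniq: "j = k" if "j \<in> {1..K}" "k \<in> {1..K}" "p \<in> \<Omega>' j" "p \<in> \<Omega>' k" for j k p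
    using disj[OF that(1,2)] that(3,4) closure_subset[of "\<Omega>' j"] closure_subset[of "\<Omega>' k"] by blast
  have \<alpha>: "\<alpha> p = a k" if "k \<in> {1..K}" "p \<in> \<Omega>' k" for p k
  proof -
    have "(SOME j. j \<in> {1..K} \<and> p \<in> \<Omega>' j) = k" by (rule some_equality) (use that uniq in blast)+
    then show ?thesis by (simp add: \<alpha>_def)
  qed
  have piece: "\<exists>k\<in>{1..K}. p \<in> \<Omega>' k" if "p \<in> \<Omega>" "\<bar>fst p - x0\<bar> < 2 * l" for p
  proof -
    have "p \<in> \<Omega> \<inter> (I \<times> UNIV)" using that strip[OF that(2)] by (simp add: mem_Times_iff)
    then show ?thesis using cover by blast
  qed
  have "bounded (\<Union>k\<in>{1..K}. \<Omega>' k)" using pieces by (intro bounded_UN) auto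
  then obtain R where R: "\<And>p k. k \<in> {1..K} \<Longrightarrow> p \<in> \<Omega>' k \<Longrightarrow> norm p \<le> R" unfolding bounded_iff by blast
  define D where "D = \<bar>R\<bar> + (\<Sum>k\<in>{1..K}. \<bar>a k\<bar>)"
  have D: "0 \<le> D" by (simp add: D_def sum_nonneg)
  have Db: "\<bar>snd p - a k\<bar> \<le> D" if "k \<in> {1..K}" "p \<in> \<Omega>' k" for p k
  proof -
    have "\<bar>snd p\<bar> \<le> norm p" using norm_snd_le[of "snd p" "fst p"] by simp
    moreover have "\<bar>a k\<bar> \<le> (\<Sum>k\<in>{1..K}. \<bar>a k\<bar>)" using that by (intro member_le_sum) auto
    ultimately show ?thesis using R[OF that] by (simp add: D_def)
  qed
  have "\<exists>d>0. \<forall>jk\<in>{1..K} \<times> {1..K}. fst jk \<noteq> snd jk \<longrightarrow> (\<forall>p\<in>\<Omega>' (fst jk). \<forall>q\<in>\<Omega>' (snd jk). d \<le> dist p q)"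
  proof (rule finite_lower_bound)
    show "\<exists>d>0. fst jk \<noteq> snd jk \<longrightarrow> (\<forall>p\<in>\<Omega>' (fst jk). \<forall>q\<in>\<Omega>' (snd jk). d \<le> dist p q)" if "jk \<in> {1..K} \<times> {1..K}" for jk
    proof (cases "fst jk = snd jk")
      case True
      then show ?thesis by (intro exI[of _ 1]) simp
    next
      case False
      have "fst jk \<in> {1..K}" "snd jk \<in> {1..K}" using that by auto
      then have "compact (closure (\<Omega>' (fst jk)))" "closure (\<Omega>' (fst jk)) \<inter> closure (\<Omega>' (snd jk)) = {}"
        using pieces disj False by (auto simp: compact_closure)
      then obtain d where "0 < d" "\<And>x y. x \<in> closure (\<Omega>' (fst jk)) \<Longrightarrow> y \<in> closure (\<Omega>' (snd jk)) \<Longrightarrow> d \<le> dist x y"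
        using separate_compact_closed[of "closure (\<Omega>' (fst jk))" "closure (\<Omega>' (snd jk))"] by auto
      then show ?thesis using closure_subset by blast
    qed
  qed (auto intro: order_trans)
  then obtain d0 where d0: "0 < d0" and sep: "\<And>j k p q. j \<in> {1..K} \<Longrightarrow> k \<in> {1..K} \<Longrightarrow> j \<noteq> k \<Longrightarrow> p \<in> \<Omega>' j \<Longrightarrow> q \<in> \<Omega>' k \<Longrightarrow> d0 \<le> dist p q"
    by auto
  \<comment> \<open>Chosen to turn \<open>c_small\<close> into an equality.\<close>
  define c where "c = (2 + \<delta>) * (3 + \<delta>) / (4 * (5 + 2 * \<delta>)) * l\<^sup>2 / (2 * (3 + \<delta>)\<^sup>2)"
  have c: "0 < c" using \<delta> l by (simp add: c_def)
  obtain w B where w: "\<And>x. (w has_real_derivative decay c x0 (- ((1 + \<delta>) / 2)) x) (at x)" "w 0 = 0" "\<And>x. \<bar>w x\<bar> \<le> B"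
    "\<And>x. decay c x0 (- ((1 + \<delta>) / 2)) x \<le> B"
    "\<And>x y. \<bar>decay c x0 (- ((1 + \<delta>) / 2)) x - decay c x0 (- ((1 + \<delta>) / 2)) y\<bar> \<le> B * \<bar>x - y\<bar>"
    using decay_primitive_exists[OF c \<delta>] by metis
  have wmono: "w x < w y" if "x < y" for x y
    by (rule DERIV_pos_imp_increasing[OF that]) (use w(1) decay_pos[OF c] in blast)
  \<comment> \<open>\<open>w\<close> is strictly increasing with \<open>w 0 = 0\<close>, and the
    strip lies on one side of \<open>0\<close>, so the end of the strip nearer to \<open>0\<close>
    provides the bound.\<close>
  obtain m where m: "0 < m" "\<And>x. \<bar>x - x0\<bar> < l \<Longrightarrow> m \<le> \<bar>w x\<bar>"
  proof (cases "0 < x0")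
    case True
    have "w 0 < w (x0 - l)" using l True by (intro wmono) auto
    moreover have "w (x0 - l) < w x" if "\<bar>x - x0\<bar> < l" for x using that by (intro wmono) auto
    ultimately show ?thesis using that[of "w (x0 - l)"] w(2) by fastforce
  next
    case False
    have "w (x0 + l) < w 0" using l False by (intro wmono) auto
    moreover have "w x < w (x0 + l)" if "\<bar>x - x0\<bar> < l" for x using that by (intro wmono) auto
    ultimately show ?thesis using that[of "- w (x0 + l)"] w(2) by fastforce
  qed
  have "\<exists>\<eta>>0. \<eta> * (l^4 * D * (\<bar>x0\<bar> + 2 * l)) \<le> C * m \<and>
      \<eta> * (l^4 / 2 + 16 * l\<^sup>2 * D\<^sup>2) \<le> 1 / (6 + 2 * \<delta>) / 2 * (c + l\<^sup>2) powr (- ((1 + \<delta>) / 2))"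
    using D l \<delta> c C m(1) by (intro small_scale) (auto simp: add_pos_pos less_imp_neq[symmetric])
  then obtain \<eta> where \<eta>: "0 < \<eta>" "\<eta> * (l^4 * D * (\<bar>x0\<bar> + 2 * l)) \<le> C * m"
      "\<eta> * (l^4 / 2 + 16 * l\<^sup>2 * D\<^sup>2) \<le> 1 / (6 + 2 * \<delta>) / 2 * (c + l\<^sup>2) powr (- ((1 + \<delta>) / 2))" by blast
  have "decay_field \<Omega> \<alpha> x0 l C D d0 w (decay c x0 (- ((1 + \<delta>) / 2))) \<eta> B c \<delta>"
  proof (unfold_locales)
    show "fst p * fst \<nu> \<le> 0" if "outward_normal \<Omega> p \<nu>" for p \<nu> by (rule horizontal[OF that])
    show "\<bar>snd p - \<alpha> p\<bar> \<le> D" if "p \<in> \<Omega>" "\<bar>fst p - x0\<bar> < 2 * l" for p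
    proof -
      have "\<exists>k\<in>{1..K}. p \<in> \<Omega>' k" by (rule piece[OF that])
      then obtain k where "k \<in> {1..K}" "p \<in> \<Omega>' k" by blast
      then show ?thesis using Db \<alpha> by simp
    qed
    show "\<alpha> p = \<alpha> q" if "p \<in> \<Omega>" "q \<in> \<Omega>" "\<bar>fst p - x0\<bar> < 2 * l" "\<bar>fst q - x0\<bar> < 2 * l" "dist p q < d0" for p q
    proof -
      have "\<exists>j\<in>{1..K}. p \<in> \<Omega>' j" "\<exists>k\<in>{1..K}. q \<in> \<Omega>' k" using piece that by blast+
      then obtain j k where jk: "j \<in> {1..K}" "p \<in> \<Omega>' j" "k \<in> {1..K}" "q \<in> \<Omega>' k" by blast
      then have "j = k" using sep[OF jk(1,3) _ jk(2,4)] \<open>dist p q < d0\<close> by force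
      then show ?thesis using \<alpha> jk by simp
    qed
    show "fst p * fst \<nu> \<le> - C"
      if n: "outward_normal \<Omega> p \<nu>" and s: "\<bar>fst p - x0\<bar> < 2 * l" and \<rho>: "0 < \<rho>" and loc: "\<And>z. z \<in> \<Omega> \<Longrightarrow> dist z p < \<rho> \<Longrightarrow> \<alpha> z = a'" and ne: "snd p \<noteq> a'"
      for p \<nu> \<rho> a'
    proof -
      have pf: "p \<in> frontier \<Omega>" using n by (simp add: outward_normal_def)
      then have pc: "p \<in> closure \<Omega>" "p \<notin> \<Omega>" using \<Omega>(1) by (auto simp: frontier_def interior_open)
      have pI: "p \<in> I \<times> UNIV" using strip[OF s] by (simp add: mem_Times_iff)
      \<comment> \<open>There are finitely many pieces, so \<open>p\<close> is in the closure of one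
        of them, and on its frontier as it is outside \<Omega>. Nearby points of that piece identify
        \<open>a'\<close> with \<open>a k\<close>; thus \<open>p\<close> is off the flat line and
        belongs to \<open>\<Gamma>\<close>.\<close>
      have "p \<in> closure (\<Omega> \<inter> (I \<times> UNIV))"
        using open_Int_closure_subset[of "I \<times> UNIV" \<Omega>] pI pc(1) I(1) by (auto simp: open_Times Int_commute)
      moreover have "closure (\<Union>k\<in>{1..K}. \<Omega>' k) \<subseteq> (\<Union>k\<in>{1..K}. closure (\<Omega>' k))"
        by (intro closure_minimal closed_UN UN_mono closure_subset) auto
      ultimately have "p \<in> (\<Union>k\<in>{1..K}. closure (\<Omega>' k))" unfolding cover by blast
      then obtain k where k: "k \<in> {1..K}" "p \<in> closure (\<Omega>' k)" by blast
      have sub: "\<Omega>' k \<subseteq> \<Omega>" using cover k(1) by blast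
      then have "p \<in> frontier (\<Omega>' k)" using k pc(2) pieces[OF k(1)] by (auto simp: frontier_def interior_open)
      obtain z where z: "z \<in> \<Omega>' k" "dist z p < \<rho>" using k(2) \<rho> by (auto simp: closure_approachable)
      then have "a' = a k" using loc[of z] sub \<alpha>[OF k(1) z(1)] by auto
      then have "p \<notin> I \<times> {a k}" using ne by (auto simp: mem_Times_iff)
      then have "p \<in> \<Gamma>" using flat[OF k(1)] pf pI \<open>p \<in> frontier (\<Omega>' k)\<close> by blast
      then show ?thesis using \<Gamma> n by blast
    qed
    show "\<eta> * l ^ 4 * D * (\<bar>x0\<bar> + 2 * l) \<le> C * \<bar>w x\<bar>" if "\<bar>x - x0\<bar> < l" for x
    proof -
      have "C * m \<le> C * \<bar>w x\<bar>" using m(2)[OF that] C by (intro mult_left_mono) auto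
      then show ?thesis using \<eta>(2) by (simp add: mult.assoc)
    qed
    show "2 * c * (3 + \<delta>)\<^sup>2 \<le> (2 + \<delta>) * (3 + \<delta>) / (4 * (5 + 2 * \<delta>)) * l\<^sup>2"
    proof -
      have "2 * (y / (2 * t)) * t = y" if "t \<noteq> 0" for y t :: real using that by simp
      from this[of "(3 + \<delta>)\<^sup>2"] \<delta> show ?thesis unfolding c_def by simp
    qed
  qed (use \<Omega> l C D d0 w \<eta> c \<delta> decay_cont[OF c] decay_pos[OF c] in auto)
  then show ?thesis by blast
qed

text \<open>\<open>L2_operator_norm\<close> is infinite unless the operator is defined on all of
  L^2, so solvability is a part of the claim and comes from \<open>helmholtz_solvable\<close>. The
  bound is proved for every related pair, which makes it independent of how the solution was
  obtained.\<close>

theorem weighted_resolvent_norm_le: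
  assumes "decay_field \<Omega> \<alpha> x0 l C D d0 w w' \<eta> B0 c \<delta>"
  shows "\<exists>E\<^sub>0>0. \<exists>C>0. \<forall>E\<ge>E\<^sub>0. \<forall>\<epsilon>\<in>{0<..1}.
           L2_operator_norm (lebesgue_on \<Omega>)
             (weighted_resolvent \<Omega> (\<lambda>(x, y). (1 + \<bar>x\<bar>) powr (- ((3 + \<delta>) / 2))) (Complex E \<epsilon>))
           \<le> ennreal (C * E powr (1/2))"
proof -
  interpret decay_field \<Omega> \<alpha> x0 l C D d0 w w' \<eta> B0 c \<delta> by fact
  let ?g = "(3 + \<delta>) / 2"
  define wt where "wt x = (1 + \<bar>x\<bar>) powr (- ?g)" for x :: real
  have wt_cont: "continuous_on UNIV wt" unfolding wt_def by (intro continuous_intros) (auto simp: add_nonneg_eq_0_iff)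
  have wt0: "0 \<le> wt x" for x by (simp add: wt_def)
  have wt1: "wt x \<le> 1" for x
  proof -
    have "wt x \<le> 1 powr (- ?g)" unfolding wt_def using \<delta> by (intro powr_mono2') auto
    then show ?thesis by simp
  qed
  \<comment> \<open>Since \<open>c + (x - x0)^2\<close> is at most
    \<open>(c + 2 + 2 * x0^2) * (1 + \<bar>x\<bar>)^2\<close>, raising to the power
    \<open>- ?g\<close> compares the squared weight with \<open>e\<close>.\<close>
  define A where "A = (c + 2 + 2 * x0\<^sup>2) powr ?g"
  have c2: "0 < c + 2 + 2 * x0\<^sup>2" using c by (simp add: add_pos_nonneg)
  have A: "0 < A" using c2 by (simp add: A_def)
  have wt2: "(wt x)\<^sup>2 \<le> A * e x" for x
  proof -
    let ?s = "1 + \<bar>x\<bar>"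
    have s: "0 < ?s" by simp
    have "(x - x0)\<^sup>2 \<le> 2 * x\<^sup>2 + 2 * x0\<^sup>2" using zero_le_power2[of "x + x0"] by (simp add: power2_sum power2_diff)
    have "0 \<le> c * x\<^sup>2" "0 \<le> x0\<^sup>2 * x\<^sup>2" using c by simp_all
    then have "c + (x - x0)\<^sup>2 \<le> (c + 2 + 2 * x0\<^sup>2) + (c + 2 + 2 * x0\<^sup>2) * x\<^sup>2"
    proof -
      have "(c + 2 + 2 * x0\<^sup>2) * x\<^sup>2 = c * x\<^sup>2 + 2 * x\<^sup>2 + 2 * (x0\<^sup>2 * x\<^sup>2)" by (simp only: distrib_right mult.assoc)
      then show ?thesis using \<open>(x - x0)\<^sup>2 \<le> 2 * x\<^sup>2 + 2 * x0\<^sup>2\<close> \<open>0 \<le> c * x\<^sup>2\<close> \<open>0 \<le> x0\<^sup>2 * x\<^sup>2\<close> by linarith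
    qed
    also have "\<dots> = (c + 2 + 2 * x0\<^sup>2) * (1 + x\<^sup>2)" by (simp add: distrib_left)
    also have "\<dots> \<le> (c + 2 + 2 * x0\<^sup>2) * ?s\<^sup>2" using c2 by (intro mult_left_mono) (auto simp: power2_sum)
    finally have "((c + 2 + 2 * x0\<^sup>2) * ?s\<^sup>2) powr (- ?g) \<le> e x"
      unfolding e_def decay_def using \<delta> c by (intro powr_mono2') (auto simp: add_pos_nonneg)
    then have "A * ((c + 2 + 2 * x0\<^sup>2) * ?s\<^sup>2) powr (- ?g) \<le> A * e x" using A by (intro mult_left_mono) auto
    also have "A * ((c + 2 + 2 * x0\<^sup>2) * ?s\<^sup>2) powr (- ?g) = (?s\<^sup>2) powr (- ?g)"
    proof -
      have "A * (c + 2 + 2 * x0\<^sup>2) powr (- ?g) = 1" using c2 unfolding A_def by (simp flip: powr_add)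
      then show ?thesis using c2 by (simp add: powr_mult mult.assoc[symmetric])
    qed
    also have "(?s\<^sup>2) powr (- ?g) = (wt x)\<^sup>2"
      unfolding wt_def power2_eq_square by (rule powr_mult)
    finally show ?thesis .
  qed
  have wtm: "(\<lambda>x. wt (fst x)) \<in> borel_measurable M"
    by (rule continuous_measurable_lebesgue_on) (intro continuous_on_compose2[OF wt_cont] continuous_intros, auto)
  have wtb: "\<bar>wt (fst x)\<bar> \<le> 1" for x :: "plane" using wt0 wt1 by simp
  have scale: "sqint M (\<lambda>x. wt (fst x) *\<^sub>R f x)" if "sqint M f" for f :: "plane \<Rightarrow> complex"
    using sqint_scale[OF that wtm wtb] by simp
  have weight: "(\<lambda>(x, y). (1 + \<bar>x\<bar>) powr (- ((3 + \<delta>) / 2))) = (\<lambda>x. wt (fst x))" by (auto simp: wt_def fun_eq_iff)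
  let ?T = "\<lambda>E \<epsilon>. weighted_resolvent \<Omega> (\<lambda>x. wt (fst x)) (Complex E \<epsilon>)"
  have T_iff: "(f, g) \<in> ?T E \<epsilon> \<longleftrightarrow> sqint M f \<and> (\<exists>u h. (u, h) \<in> minus_dirichlet_laplacian \<Omega> \<and> sqint M u \<and> (\<forall>x. wt (fst x) *\<^sub>R f x = h x - Complex E \<epsilon> * u x) \<and> g = (\<lambda>x. wt (fst x) *\<^sub>R u x))" (is "?l \<longleftrightarrow> ?r") for f g E \<epsilon>
  proof
    assume ?l
    then obtain h u where 1: "(f, h) \<in> multiplication_operator M (\<lambda>x. wt (fst x))" "(h, u) \<in> resolvent (minus_dirichlet_laplacian \<Omega>) (Complex E \<epsilon>)"
        "(u, g) \<in> multiplication_operator M (\<lambda>x. wt (fst x))"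
      unfolding weighted_resolvent_def by blast
    from 1(2) obtain k where k: "h = (\<lambda>x. k x - Complex E \<epsilon> * u x)" "(u, k) \<in> minus_dirichlet_laplacian \<Omega>"
      unfolding resolvent_def by blast
    have 2: "sqint M f" "sqint M u" "h = (\<lambda>x. wt (fst x) *\<^sub>R f x)" "g = (\<lambda>x. wt (fst x) *\<^sub>R u x)"
      using 1(1,3) unfolding multiplication_operator_def by (simp_all add: L2_sqint scaleR_conv_of_real)
    have "wt (fst x) *\<^sub>R f x = k x - Complex E \<epsilon> * u x" for x using fun_cong[OF k(1), of x] unfolding 2(3) .
    then show ?r using 2 k(2) by blast
  next
    assume ?r
    then obtain u k where k: "sqint M f" "(u, k) \<in> minus_dirichlet_laplacian \<Omega>" "sqint M u" "\<And>x. wt (fst x) *\<^sub>R f x = k x - Complex E \<epsilon> * u x"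
        "g = (\<lambda>x. wt (fst x) *\<^sub>R u x)" by blast
    define h where "h = (\<lambda>x. wt (fst x) *\<^sub>R f x)"
    have "h = (\<lambda>x. k x - Complex E \<epsilon> * u x)" unfolding h_def by (rule ext) (rule k(4))
    then have "(h, u) \<in> resolvent (minus_dirichlet_laplacian \<Omega>) (Complex E \<epsilon>)" unfolding resolvent_def using k(2) by blast
    moreover have "(f, h) \<in> multiplication_operator M (\<lambda>x. wt (fst x))" "(u, g) \<in> multiplication_operator M (\<lambda>x. wt (fst x))"
      unfolding multiplication_operator_def using k(1,3) scale[OF k(1)] scale[OF k(3)] by (simp_all add: L2_sqint h_def k(5) scaleR_conv_of_real)
    ultimately show ?l unfolding weighted_resolvent_def by blast
  qed
  define Kc where "Kc = (4 * A / c1) * (C2 A + 2 * B\<^sup>2 * A / c1)"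
  have Kc: "0 \<le> Kc" using A c1 C2_nonneg[of A] by (simp add: Kc_def)
  have total: "\<exists>g\<in>L2 M. (f, g) \<in> ?T E \<epsilon>" if f: "f \<in> L2 M" and E: "0 < E" and \<epsilon>: "0 < \<epsilon>" for f E \<epsilon>
  proof -
    have sf: "sqint M f" using f by (simp add: L2_sqint)
    obtain u p q where u: "weak_solution \<Omega> u p q (\<lambda>x. wt (fst x) *\<^sub>R f x + Complex E \<epsilon> * u x)"
      using helmholtz_solvable[OF open_dom E \<epsilon> scale[OF sf]] by blast
    then have su: "sqint M u" using H10_jet_sqint(1) by (auto simp: weak_solution_def)
    have "(f, \<lambda>x. wt (fst x) *\<^sub>R u x) \<in> ?T E \<epsilon>"
      unfolding T_iff using sf su weak_dirichlet_laplacian[OF open_dom u] by fastforce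
    then show ?thesis using scale[OF su] by (auto simp: L2_sqint)
  qed
  have bound: "nrm M g \<le> sqrt (2 * Kc) * E powr (1/2)"
    if fg: "(f, g) \<in> ?T E \<epsilon>" and f1: "nrm M f \<le> 1" and E: "max 1 E1 \<le> E" and \<epsilon>: "0 < \<epsilon>" "\<epsilon> \<le> 1" for f g E \<epsilon>
  proof -
    obtain u h where h: "(u, h) \<in> minus_dirichlet_laplacian \<Omega>" "sqint M u" "\<And>x. wt (fst x) *\<^sub>R f x = h x - Complex E \<epsilon> * u x"
      and g: "g = (\<lambda>x. wt (fst x) *\<^sub>R u x)" and sf: "sqint M f" using fg unfolding T_iff by blast
    have heq: "h = (\<lambda>x. wt (fst x) *\<^sub>R f x + Complex E \<epsilon> * u x)" using h(3) by (simp add: fun_eq_iff)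
    obtain p q where u: "weak_solution \<Omega> u p q (\<lambda>x. wt (fst x) *\<^sub>R f x + Complex E \<epsilon> * u x)"
      using dirichlet_laplacian_weak[OF open_dom h(1)] unfolding heq by blast
    have E': "E1 \<le> E" "1 \<le> E" using E by auto
    have "(nrm M g)\<^sup>2 \<le> Kc * (1 + E) * (nrm M f)\<^sup>2"
      unfolding g Kc_def by (rule weighted_bound[OF u sf wt_cont wt0 wt1 wt2 A E'(1) \<epsilon>])
    \<comment> \<open>The threshold is \<open>max 1 E1\<close> so that \<open>1 + E\<close> may be
      replaced by \<open>2 * E\<close>.\<close>
    also have "\<dots> \<le> Kc * (2 * E) * 1\<^sup>2"
      using Kc E' f1 by (intro mult_mono mult_left_mono power_mono) auto
    finally have "(nrm M g)\<^sup>2 \<le> 2 * Kc * E" by simp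
    then have "nrm M g \<le> sqrt (2 * Kc * E)" by (rule real_le_rsqrt)
    also have "\<dots> = sqrt (2 * Kc) * E powr (1/2)" using E' by (simp add: real_sqrt_mult powr_half_sqrt)
    finally show ?thesis .
  qed
  show ?thesis
    unfolding weight
  proof (intro exI conjI allI ballI impI)
    show "0 < max 1 E1" by simp
    \<comment> \<open>The constant has to be strictly positive, whereas \<open>Kc\<close> has only
      been shown to be nonnegative.\<close>
    show "0 < sqrt (2 * Kc) + 1" using Kc by (simp add: add_nonneg_pos)
    fix E \<epsilon> :: real assume E: "max 1 E1 \<le> E" and \<epsilon>: "\<epsilon> \<in> {0<..1}"
    have "L2_operator_norm M (?T E \<epsilon>) = (SUP (f, g) \<in> {(f, g) \<in> ?T E \<epsilon>. f \<in> L2 M \<and> L2_norm M f \<le> 1}. ennreal (L2_norm M g))"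
      unfolding L2_operator_norm_def using total[of _ E \<epsilon>] E \<epsilon> by simp
    also have "\<dots> \<le> ennreal ((sqrt (2 * Kc) + 1) * E powr (1/2))"
    proof (rule SUP_least, clarify)
      fix f g assume fg: "(f, g) \<in> ?T E \<epsilon>" "L2_norm M f \<le> 1"
      have "nrm M g \<le> sqrt (2 * Kc) * E powr (1/2)" using fg E \<epsilon> by (intro bound[OF fg(1)]) (auto simp: L2_norm_nrm)
      also have "\<dots> \<le> (sqrt (2 * Kc) + 1) * E powr (1/2)" by (intro mult_right_mono) auto
      finally show "ennreal (L2_norm M g) \<le> ennreal ((sqrt (2 * Kc) + 1) * E powr (1/2))"
        by (simp add: L2_norm_nrm ennreal_leI)
    qed
    finally show "L2_operator_norm M (?T E \<epsilon>) \<le> ennreal ((sqrt (2 * Kc) + 1) * E powr (1/2))" .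
  qed
qed

theorem theorem3:
  fixes \<Omega> \<Gamma>\<^sub>F :: "(real \<times> real) set"
    and I :: "real set"
    and C\<^sub>I \<delta> :: real
    and K :: nat
    and \<Omega>' :: "nat \<Rightarrow> (real \<times> real) set"
    and a :: "nat \<Rightarrow> real"
  assumes "open \<Omega>"
    and "emeasure lborel \<Omega> = \<infinity>"
    and "lipschitz_boundary \<Omega>"
    and "locally_convex_or_C11 \<Omega>"
    and "\<And>p \<nu>. outward_normal \<Omega> p \<nu> \<Longrightarrow> fst p * fst \<nu> \<le> 0"
    and "open I" and "is_interval I" and "I \<noteq> {}"
    and "C\<^sub>I > 0"
    and "\<Gamma>\<^sub>F \<subseteq> frontier \<Omega> \<inter> (I \<times> UNIV)"
    and "\<And>p \<nu>. p \<in> \<Gamma>\<^sub>F \<Longrightarrow> outward_normal \<Omega> p \<nu> \<Longrightarrow> fst p * fst \<nu> \<le> - C\<^sub>I"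
    and "\<Omega> \<inter> (I \<times> UNIV) = (\<Union>k\<in>{1..K}. \<Omega>' k)"
    and "\<And>k. k \<in> {1..K} \<Longrightarrow> open (\<Omega>' k) \<and> bounded (\<Omega>' k)"
    and "\<And>j k. j \<in> {1..K} \<Longrightarrow> k \<in> {1..K} \<Longrightarrow> j \<noteq> k \<Longrightarrow> closure (\<Omega>' j) \<inter> closure (\<Omega>' k) = {}"
    and "\<And>k. k \<in> {1..K} \<Longrightarrow>
           (frontier \<Omega> \<inter> frontier (\<Omega>' k) \<inter> (I \<times> UNIV)) - \<Gamma>\<^sub>F \<subseteq> I \<times> {a k}"
    and "\<delta> > 0"
  shows "\<exists>E\<^sub>0>0. \<exists>C>0. \<forall>E\<ge>E\<^sub>0. \<forall>\<epsilon>\<in>{0<..1}.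
           L2_operator_norm (lebesgue_on \<Omega>)
             (weighted_resolvent \<Omega> (\<lambda>(x, y). (1 + \<bar>x\<bar>) powr (- ((3 + \<delta>) / 2))) (Complex E \<epsilon>))
           \<le> ennreal (C * E powr (1/2))"
proof -
  obtain \<alpha> x0 l D d0 w w' \<eta> B c where "decay_field \<Omega> \<alpha> x0 l C\<^sub>I D d0 w w' \<eta> B c \<delta>"
    using decay_field_exists[OF assms(1,3-6,8,9,11-16)] by blast
  then show ?thesis by (rule weighted_resolvent_norm_le)
qed

end
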